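(* For every fixed integer $h$, the Directed Steiner Tree problem can be solved in time $O^*(3^{hk+o(hk)})$ on directed graphs whose underlying undirected graph excludes the complete graph $K_h$ as a minor.
   Context: Directed Steiner Tree (DST): the input is a directed graph $D=(V,A)$, a root $r\in V$, a set $T\subseteq V\setminus\{r\}$ of terminals and an integer $k$; the question is whether there is a set $S\subseteq V\setminus(T\cup\{r\})$ with $|S|\le k$ such that the induced digraph $D[S\cup T\cup\{r\}]$ contains a directed path from $r$ to every $t\in T$. The parameter is $k$. The notation $O^*(\cdot)$ suppresses factors polynomial in the input size. A digraph excludes a graph as a minor if its underlying undirected graph does. *)

theory Defs
  imports
    "Graph_Theory.Graph_Theory"
    "HOL-Library.Log_Nat"
    "HOL-Library.Landau_Symbols"
    "HOL-Computational_Algebra.Polynomial"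
begin

section \<open>Minors\<close>

text \<open>
  Undirected graphs are symmetric digraphs. A minor of \<open>G\<close> is given by its branch sets: pairwise
  disjoint sets of vertices, each inducing a connected (in particular nonempty) subgraph, with an
  edge of \<open>G\<close> between the branch sets of any two adjacent vertices of \<open>H\<close>.
\<close>

definition minor_of :: "('b, 'c) pre_digraph \<Rightarrow> ('a, 'd) pre_digraph \<Rightarrow> bool" where
  "minor_of H G \<longleftrightarrow>
     (\<exists>X :: 'b \<Rightarrow> 'a set.
        (\<forall>i \<in> verts H. X i \<subseteq> verts G \<and> connected (G \<restriction> X i)) \<and>
        (\<forall>i \<in> verts H. \<forall>j \<in> verts H. i \<noteq> j \<longrightarrow> X i \<inter> X j = {}) \<and>
        (\<forall>(i, j) \<in> arcs_ends H. \<exists>u \<in> X i. \<exists>v \<in> X j. (u, v) \<in> arcs_ends G))"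

definition complete_graph :: "nat \<Rightarrow> nat pair_pre_digraph" where
  "complete_graph h = \<lparr> pverts = {0..<h}, parcs = {(i, j). i < h \<and> j < h \<and> i \<noteq> j} \<rparr>"

lemma complete_digraph_complete_graph: "complete_digraph h (with_proj (complete_graph h))"
  by (auto simp: complete_digraph_pair_def complete_graph_def)

text \<open>
  The underlying undirected graph of a digraph is its symmetric closure. Loops, if there are any,
  are immaterial for \<^const>\<open>minor_of\<close> when \<open>H\<close> is loop-free.
\<close>

definition excludes_minor :: "('a, 'd) pre_digraph \<Rightarrow> ('b, 'c) pre_digraph \<Rightarrow> bool" where
  "excludes_minor D H \<longleftrightarrow> \<not> minor_of H (with_proj (mk_symmetric D))"


section \<open>Directed Steiner Tree\<close>

record 'a dst_instance =
  dgraph :: "'a pair_pre_digraph"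
  root :: 'a
  terminals :: "'a set"
  budget :: nat

definition dst_wf :: "'a dst_instance \<Rightarrow> bool" where
  "dst_wf I \<longleftrightarrow> pair_fin_digraph (dgraph I) \<and> root I \<in> pverts (dgraph I) \<and>
     terminals I \<subseteq> pverts (dgraph I) - {root I}"

definition dst_yes :: "'a dst_instance \<Rightarrow> bool" where
  "dst_yes I \<longleftrightarrow>
     (\<exists>S. S \<subseteq> pverts (dgraph I) - (terminals I \<union> {root I}) \<and> card S \<le> budget I \<and>
        (\<forall>t \<in> terminals I. \<exists>p.
           pre_digraph.apath (with_proj (dgraph I) \<restriction> (S \<union> terminals I \<union> {root I})) (root I) p t))"


section \<open>Random access machines with logarithmic cost\<close>

text \<open>
  Structured programs for a random access machine. A state consists of registers, which a program
  can only address by constants, and of a memory that is accessed indirectly. All cells hold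
  natural numbers; \<open>Sub\<close> is truncated subtraction.
\<close>

type_synonym state = "(nat \<Rightarrow> nat) \<times> (nat \<Rightarrow> nat)"

datatype com =
    Skip
  | Const nat nat     \<comment> \<open>\<open>R[x] := c\<close>\<close>
  | Add nat nat nat   \<comment> \<open>\<open>R[x] := R[y] + R[z]\<close>\<close>
  | Sub nat nat nat   \<comment> \<open>\<open>R[x] := R[y] - R[z]\<close>\<close>
  | Load nat nat      \<comment> \<open>\<open>R[x] := M[R[y]]\<close>\<close>
  | Store nat nat     \<comment> \<open>\<open>M[R[x]] := R[y]\<close>\<close>
  | Seq com com
  | If_nz nat com com
  | While_nz nat com

text \<open>
  The binary length of a number, with length \<open>0\<close> for the number \<open>0\<close>. Every step is charged
  one unit plus the lengths of the numbers and of the memory addresses it handles.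
\<close>

abbreviation bits :: "nat \<Rightarrow> nat" where
  "bits \<equiv> floorlog 2"

inductive exec :: "com \<Rightarrow> state \<Rightarrow> nat \<Rightarrow> state \<Rightarrow> bool" where
  Skip: "exec Skip s 1 s"
| Const: "exec (Const x c) (R, M) (1 + bits c) (R(x := c), M)"
| Add: "exec (Add x y z) (R, M) (1 + bits (R y) + bits (R z)) (R(x := R y + R z), M)"
| Sub: "exec (Sub x y z) (R, M) (1 + bits (R y) + bits (R z)) (R(x := R y - R z), M)"
| Load: "exec (Load x y) (R, M) (1 + bits (R y) + bits (M (R y))) (R(x := M (R y)), M)"
| Store: "exec (Store x y) (R, M) (1 + bits (R x) + bits (R y)) (R, M(R x := R y))"
| Seq: "exec c1 s1 t1 s2 \<Longrightarrow> exec c2 s2 t2 s3 \<Longrightarrow> exec (Seq c1 c2) s1 (t1 + t2) s3"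
| If_True: "R x \<noteq> 0 \<Longrightarrow> exec c1 (R, M) t s \<Longrightarrow>
    exec (If_nz x c1 c2) (R, M) (1 + bits (R x) + t) s"
| If_False: "R x = 0 \<Longrightarrow> exec c2 (R, M) t s \<Longrightarrow>
    exec (If_nz x c1 c2) (R, M) (1 + bits (R x) + t) s"
| While_False: "R x = 0 \<Longrightarrow> exec (While_nz x c) (R, M) (1 + bits (R x)) (R, M)"
| While_True: "R x \<noteq> 0 \<Longrightarrow> exec c (R, M) t1 s2 \<Longrightarrow> exec (While_nz x c) s2 t2 s3 \<Longrightarrow>
    exec (While_nz x c) (R, M) (1 + bits (R x) + t1 + t2) s3"

lemma exec_deterministic:
  "exec c s t1 s1 \<Longrightarrow> exec c s t2 s2 \<Longrightarrow> t1 = t2 \<and> s1 = s2"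
proof (induction arbitrary: t2 s2 rule: exec.induct)
  case (Skip s)
  then show ?case by cases simp
next
  case (Const x c R M)
  then show ?case by cases simp
next
  case (Add x y z R M)
  then show ?case by cases simp
next
  case (Sub x y z R M)
  then show ?case by cases simp
next
  case (Load x y R M)
  then show ?case by cases simp
next
  case (Store x y R M)
  then show ?case by cases simp
next
  case (Seq c1 s1 t1 s2' c2 t2' s3)
  from Seq.prems show ?case
  proof cases
    case step: (Seq u1 s u2)
    have "t1 = u1 \<and> s2' = s" by (rule Seq.IH(1)) (rule step)
    moreover have "t2' = u2 \<and> s3 = s2"
      by (rule Seq.IH(2)) (use step calculation in simp)
    ultimately show ?thesis using step by simp
  qed
next
  case (If_True R x c1 M t s c2)
  from If_True.prems show ?case
  proof cases
    case step: (If_True u)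
    from If_True.IH[OF step(3)] step show ?thesis by simp
  next
    case If_False
    with If_True.hyps show ?thesis by simp
  qed
next
  case (If_False R x c2 M t s c1)
  from If_False.prems show ?case
  proof cases
    case If_True
    with If_False.hyps show ?thesis by simp
  next
    case step: (If_False u)
    from If_False.IH[OF step(3)] step show ?thesis by simp
  qed
next
  case (While_False R x c M)
  from While_False.prems show ?case
  proof cases
    case While_False
    then show ?thesis by simp
  next
    case While_True
    with While_False.hyps show ?thesis by simp
  qed
next
  case (While_True R x c M t1 s2' t2' s3)
  from While_True.prems show ?case
  proof cases
    case While_False
    with While_True.hyps show ?thesis by simp
  next
    case step: (While_True u1 s u2)
    have "t1 = u1 \<and> s2' = s" by (rule While_True.IH(1)) (rule step)
    moreover have "t2' = u2 \<and> s3 = s2"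
      by (rule While_True.IH(2)) (use step calculation in simp)
    ultimately show ?thesis using step by simp
  qed
qed

text \<open>Inputs are written into the memory from address \<open>0\<close> on; everything else is \<open>0\<close>.\<close>

definition init_state :: "nat list \<Rightarrow> state" where
  "init_state xs = ((\<lambda>_. 0), (\<lambda>a. if a < length xs then xs ! a else 0))"

definition word_size :: "nat list \<Rightarrow> nat" where
  "word_size xs = (\<Sum>x\<leftarrow>xs. 1 + bits x)"

definition accepts_in :: "com \<Rightarrow> nat list \<Rightarrow> nat \<Rightarrow> bool" where
  "accepts_in P xs t \<longleftrightarrow> (\<exists>R M. exec P (init_state xs) t (R, M) \<and> R 0 \<noteq> 0)"

definition rejects_in :: "com \<Rightarrow> nat list \<Rightarrow> nat \<Rightarrow> bool" where
  "rejects_in P xs t \<longleftrightarrow> (\<exists>R M. exec P (init_state xs) t (R, M) \<and> R 0 = 0)"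

text \<open>
  As an input, an instance has vertex set \<open>{0..<n}\<close> and is given by \<open>n\<close>, the root, the budget
  in binary, the characteristic vector of the terminals and the adjacency matrix, row by row.
\<close>

definition dst_input :: "nat dst_instance \<Rightarrow> bool" where
  "dst_input I \<longleftrightarrow> dst_wf I \<and> (\<exists>n. pverts (dgraph I) = {0..<n})"

definition dst_encode :: "nat dst_instance \<Rightarrow> nat list" where
  "dst_encode I = (let n = card (pverts (dgraph I)) in
     [n, root I, budget I] @
     map (\<lambda>v. of_bool (v \<in> terminals I)) [0..<n] @
     concat (map (\<lambda>u. map (\<lambda>v. of_bool ((u, v) \<in> parcs (dgraph I))) [0..<n]) [0..<n]))"

definition dst_size :: "nat dst_instance \<Rightarrow> nat" where
  "dst_size I = word_size (dst_encode I)"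

text \<open>
  \<open>P\<close> solves Directed Steiner Tree on the inputs in \<open>\<C>\<close> in time \<open>O\<^sup>*(f(k))\<close>, where
  \<open>k\<close> is the budget: the running time is at most \<open>f(k)\<close> times a polynomial in the input size.
\<close>

definition solves_dst :: "com \<Rightarrow> nat dst_instance set \<Rightarrow> (nat \<Rightarrow> real) \<Rightarrow> bool" where
  "solves_dst P \<C> f \<longleftrightarrow>
     (\<exists>p :: nat poly. \<forall>I \<in> \<C>. dst_input I \<longrightarrow>
        (\<exists>t. real t \<le> f (budget I) * real (poly p (dst_size I)) \<and>
             (if dst_yes I then accepts_in P (dst_encode I) t
              else rejects_in P (dst_encode I) t)))"

end

theory Submission
  imports Defs "HOL-Library.Nat_Bijection"
begin

text \<open>
  Let \<open>d = h - 2\<close>. Every solution contains an in-neighbour of each source component of \<open>D[T \<union> {r}]\<close>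
  without \<open>r\<close>, and together with the chosen vertices it suffices to reach these components. A
  nonterminal is high if it precedes more than \<open>d\<close> of the components that no chosen vertex
  precedes. If no such component had between \<open>1\<close> and \<open>d 2\<^sup>d\<close> high in-neighbours although there are
  high vertices, then contracting every high vertex into a suitable component would yield a dense
  graph, hence a \<open>K\<^sub>h\<close> minor. So one can branch on a component with few high in-neighbours: either
  one of them is chosen, or all are forbidden, and the component becomes low. Since a vertex that is
  not high precedes at most \<open>d\<close> components, a partial solution with \<open>j\<close> chosen vertices and \<open>l\<close> low
  components is pruned unless \<open>l \<le> d (k - j)\<close>. Without high vertices, the Dreyfus--Wagner dynamic
  program for the \<open>j + l\<close> targets needs \<open>3\<^sup>j\<^sup>+\<^sup>l\<close> steps.

  With \<open>x = 2 / h\<close> and \<open>c = d 2\<^sup>d\<close>, the weight \<open>(x / c)\<^sup>j (1 - x)\<^sup>l\<close> does not increase in total when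
  branching, and \<open>3\<^sup>h\<^sup>k\<close> times the weight dominates \<open>3\<^sup>j\<^sup>+\<^sup>l\<close> as long as \<open>l \<le> d (k - j)\<close>. Therefore the
  whole search takes \<open>3\<^sup>h\<^sup>k\<close> steps up to a polynomial factor, even without the \<open>o(hk)\<close> in the exponent.
\<close>


section \<open>Clique minors of dense graphs\<close>

text \<open>How the constants fit together: a high vertex precedes at least
  \<open>d + 1 = h - 1\<close> components, and a clique on that many components together with the
  vertex is \<open>K_h\<close>; this fixes \<open>d = h - 2\<close>. If nothing is chosen, a leaf of
  the search costs at most \<open>3 ^ ((h - 2) * k)\<close>, which leaves a factor
  \<open>9 ^ k\<close> for the search tree. Each low component loses a factor \<open>1 - x\<close>
  of the weight, and \<open>(1 + 2 / d) ^ d \<le> exp 2 \<le> 9\<close> shows that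
  \<open>x = 2 / h\<close> stays within this slack.

  The other obstacle is the machine. It has no multiplication, no bit operations and no recursion,
  and it charges for the length of every number. So the search runs on an explicit stack, disjoint
  pairs of target sets are listed instead of being recognised, and all this is written in a small
  structured language whose compiled cost is derived once: a polynomial in a bound \<open>W\<close>
  on the lengths of stored numbers, times one factor for each nested loop over the exponentially
  long range. Stored values are cut off at a cap, so that the bound on lengths holds by
  construction.\<close>

definition conn :: "('a \<times> 'a) set \<Rightarrow> 'a set \<Rightarrow> bool" where
  "conn E S \<longleftrightarrow> S \<noteq> {} \<and> (\<forall>x\<in>S. \<forall>y\<in>S. (x, y) \<in> (E \<inter> S \<times> S)\<^sup>*)"

definition clique_minor :: "nat \<Rightarrow> 'a set \<Rightarrow> ('a \<times> 'a) set \<Rightarrow> bool" where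
  "clique_minor h V E \<longleftrightarrow> (\<exists>X :: nat \<Rightarrow> 'a set.
     (\<forall>i<h. X i \<subseteq> V \<and> conn E (X i)) \<and>
     (\<forall>i<h. \<forall>j<h. i \<noteq> j \<longrightarrow> X i \<inter> X j = {} \<and> (\<exists>u\<in>X i. \<exists>v\<in>X j. (u, v) \<in> E)))"

lemma conn_singleton [simp]: "conn E {v}"
  by (simp add: conn_def)

text \<open>A walk in \<open>H\<close> lifts edge by edge: inside the current set one moves freely,
  and each edge of \<open>H\<close> supplies a crossing to the next set.\<close>

lemma conn_Union:
  assumes Y: "\<And>i. i \<in> J \<Longrightarrow> conn E (Y i)"
    and H: "\<And>i j. i \<in> J \<Longrightarrow> j \<in> J \<Longrightarrow> i \<noteq> j \<Longrightarrow> (i, j) \<in> H \<Longrightarrow> \<exists>u\<in>Y i. \<exists>v\<in>Y j. (u, v) \<in> E"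
    and J: "conn H J"
  shows "conn E (\<Union>i\<in>J. Y i)"
proof -
  let ?S = "\<Union>i\<in>J. Y i"
  have mono: "(x, y) \<in> (E \<inter> ?S \<times> ?S)\<^sup>*" if "i \<in> J" "x \<in> Y i" "y \<in> Y i" for i x y
  proof -
    have "(x, y) \<in> (E \<inter> Y i \<times> Y i)\<^sup>*" using Y[OF that(1)] that by (auto simp: conn_def)
    then show ?thesis by (rule rtrancl_mono[THEN subsetD, rotated]) (use that in auto)
  qed
  \<comment> \<open>Reaching all of \<open>Y j\<close>, not just one vertex, lets the next crossing
    start wherever its edge happens to leave \<open>Y j\<close>.\<close>
  have reach: "\<forall>y\<in>Y j. (x, y) \<in> (E \<inter> ?S \<times> ?S)\<^sup>*"
    if "(i, j) \<in> (H \<inter> J \<times> J)\<^sup>*" "i \<in> J" "x \<in> Y i" for i j x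
    using that(1)
  proof (induction rule: rtrancl_induct)
    case base
    then show ?case using mono that by blast
  next
    case (step j j')
    show ?case
    proof (cases "j = j'")
      case False
      then obtain u v where uv: "u \<in> Y j" "v \<in> Y j'" "(u, v) \<in> E" using H[of j j'] step by auto
      show ?thesis
      proof
        fix y assume "y \<in> Y j'"
        have "(x, u) \<in> (E \<inter> ?S \<times> ?S)\<^sup>*" using step uv by auto
        also have "(u, v) \<in> E \<inter> ?S \<times> ?S" using uv step by auto
        also have "(v, y) \<in> (E \<inter> ?S \<times> ?S)\<^sup>*" using mono \<open>y \<in> Y j'\<close> uv step by blast
        finally show "(x, y) \<in> (E \<inter> ?S \<times> ?S)\<^sup>*" .
      qed
    qed (use step in auto)
  qed
  have "?S \<noteq> {}" using Y J by (fastforce simp: conn_def)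
  moreover have "(x, y) \<in> (E \<inter> ?S \<times> ?S)\<^sup>*" if "x \<in> ?S" "y \<in> ?S" for x y
  proof -
    from that obtain i j where "i \<in> J" "x \<in> Y i" "j \<in> J" "y \<in> Y j" by auto
    then show ?thesis using reach[of i j x] J by (auto simp: conn_def)
  qed
  ultimately show ?thesis by (simp add: conn_def)
qed

text \<open>Transitivity of the minor relation: a branch set of the clique is the union of the sets
  \<open>Y a\<close> over a branch set in \<open>I\<close>. Contraction, passage to supergraphs and
  the merging of whole components are instances.\<close>

lemma clique_minor_model:
  assumes Y: "\<And>i. i \<in> I \<Longrightarrow> Y i \<subseteq> V" "\<And>i. i \<in> I \<Longrightarrow> conn E (Y i)"
    and disj: "\<And>i j. i \<in> I \<Longrightarrow> j \<in> I \<Longrightarrow> i \<noteq> j \<Longrightarrow> Y i \<inter> Y j = {}"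
    and H: "\<And>i j. i \<in> I \<Longrightarrow> j \<in> I \<Longrightarrow> i \<noteq> j \<Longrightarrow> (i, j) \<in> H \<Longrightarrow> \<exists>u\<in>Y i. \<exists>v\<in>Y j. (u, v) \<in> E"
    and minor: "clique_minor h I H"
  shows "clique_minor h V E"
proof -
  obtain X where "\<forall>i<h. X i \<subseteq> I \<and> conn H (X i)"
    "\<forall>i<h. \<forall>j<h. i \<noteq> j \<longrightarrow> X i \<inter> X j = {} \<and> (\<exists>u\<in>X i. \<exists>v\<in>X j. (u, v) \<in> H)"
    using minor unfolding clique_minor_def by blast
  note X = this[rule_format]
  let ?Z = "\<lambda>i. \<Union>a\<in>X i. Y a"
  have 1: "?Z i \<subseteq> V \<and> conn E (?Z i)" if "i < h" for i
  proof
    show "?Z i \<subseteq> V" using X(1)[OF that] Y by blast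
    show "conn E (?Z i)"
    proof (rule conn_Union)
      show "conn H (X i)" using X(1)[OF that] by simp
      show "conn E (Y j)" if "j \<in> X i" for j using X(1)[OF \<open>i < h\<close>] Y that by blast
      show "\<exists>u\<in>Y a. \<exists>v\<in>Y b. (u, v) \<in> E" if "a \<in> X i" "b \<in> X i" "a \<noteq> b" "(a, b) \<in> H" for a b
        using X(1)[OF \<open>i < h\<close>] H that by blast
    qed
  qed
  have 2: "?Z i \<inter> ?Z j = {} \<and> (\<exists>u\<in>?Z i. \<exists>v\<in>?Z j. (u, v) \<in> E)" if "i < h" "j < h" "i \<noteq> j" for i j
  proof
    have "Y a \<inter> Y b = {}" if "a \<in> X i" "b \<in> X j" for a b
      using that X(1)[OF \<open>i < h\<close>] X(1)[OF \<open>j < h\<close>] X(2)[OF \<open>i < h\<close> \<open>j < h\<close> \<open>i \<noteq> j\<close>]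
      by (intro disj) blast+
    then show "?Z i \<inter> ?Z j = {}" by blast
    note Xij = X(2)[OF \<open>i < h\<close> \<open>j < h\<close> \<open>i \<noteq> j\<close>]
    then obtain a b where ab: "a \<in> X i" "b \<in> X j" "(a, b) \<in> H" by blast
    then have "a \<noteq> b" "a \<in> I" "b \<in> I" using X(1)[OF \<open>i < h\<close>] X(1)[OF \<open>j < h\<close>] Xij by auto
    then show "\<exists>u\<in>?Z i. \<exists>v\<in>?Z j. (u, v) \<in> E" using H[of a b] ab by blast
  qed
  show ?thesis unfolding clique_minor_def using 1 2 by (intro exI[of _ ?Z]) simp
qed

lemma clique_minor_mono:
  assumes "clique_minor h V' E'" "V' \<subseteq> V" "E' \<subseteq> E"
  shows "clique_minor h V E"
  by (rule clique_minor_model[where Y = "\<lambda>i. {i}", OF _ _ _ _ assms(1)]) (use assms in auto)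

text \<open>The model has \<open>{u, v}\<close> for \<open>u\<close> and singletons elsewhere.
  \<open>E'\<close> is bounded only from above, so that one may keep just some of the edges that the
  contraction creates.\<close>

lemma clique_minor_contract:
  assumes uv: "(u, v) \<in> E" "(v, u) \<in> E" "u \<in> V" "v \<in> V" "u \<noteq> v"
    and minor: "clique_minor h (V - {v}) E'"
    and E': "\<And>x y. (x, y) \<in> E' \<Longrightarrow> (x, y) \<in> E \<or> x = u \<and> (v, y) \<in> E \<or> y = u \<and> (x, v) \<in> E"
  shows "clique_minor h V E"
proof (rule clique_minor_model[where Y = "\<lambda>i. if i = u then {u, v} else {i}", OF _ _ _ _ minor])
  have "conn E {u, v}" unfolding conn_def using uv by (auto intro: r_into_rtrancl)
  then show "conn E (if i = u then {u, v} else {i})" for i by simp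
qed (use assms in \<open>auto dest!: E'\<close>)

text \<open>The apex \<open>v\<close> is a branch set of its own, with number
  \<open>h\<close>.\<close>

lemma clique_minor_cone:
  assumes "clique_minor h N E" "v \<notin> N" "\<And>u. u \<in> N \<Longrightarrow> (u, v) \<in> E \<and> (v, u) \<in> E"
  shows "clique_minor (Suc h) (insert v N) E"
proof -
  obtain X where "\<forall>i<h. X i \<subseteq> N \<and> conn E (X i)"
    "\<forall>i<h. \<forall>j<h. i \<noteq> j \<longrightarrow> X i \<inter> X j = {} \<and> (\<exists>u\<in>X i. \<exists>v\<in>X j. (u, v) \<in> E)"
    using assms(1) unfolding clique_minor_def by blast
  note X = this[rule_format]
  have ne: "X i \<noteq> {}" if "i < h" for i using X(1)[OF that] by (auto simp: conn_def)
  let ?Z = "X(h := {v})"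
  have "?Z i \<subseteq> insert v N \<and> conn E (?Z i)" if "i < Suc h" for i
    using X(1)[of i] that by (auto simp: less_Suc_eq)
  moreover have "?Z i \<inter> ?Z j = {} \<and> (\<exists>u\<in>?Z i. \<exists>v\<in>?Z j. (u, v) \<in> E)"
    if "i < Suc h" "j < Suc h" "i \<noteq> j" for i j
  proof (cases "i = h \<or> j = h")
    case True
    define l where "l = (if i = h then j else i)"
    have l: "l < h" "i = h \<and> j = l \<or> i = l \<and> j = h"
      using True \<open>i < Suc h\<close> \<open>j < Suc h\<close> \<open>i \<noteq> j\<close> by (auto simp: l_def)
    then obtain u where u: "u \<in> X l" using ne by blast
    have N: "X l \<subseteq> N" using X(1)[OF l(1)] by simp
    then have "v \<notin> X l" "(u, v) \<in> E" "(v, u) \<in> E" using u assms(2,3) by auto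
    then show ?thesis using l u by auto
  next
    case False
    then have "i < h" "j < h" using that by auto
    then show ?thesis using X(2)[OF \<open>i < h\<close> \<open>j < h\<close> \<open>i \<noteq> j\<close>] False by simp
  qed
  ultimately show ?thesis unfolding clique_minor_def by (intro exI[of _ ?Z]) simp
qed

lemma clique_minor_clique:
  assumes "Q \<subseteq> V" "finite Q" "card Q = h" "\<And>u v. u \<in> Q \<Longrightarrow> v \<in> Q \<Longrightarrow> u \<noteq> v \<Longrightarrow> (u, v) \<in> E"
  shows "clique_minor h V E"
proof -
  obtain g where g: "bij_betw g {0..<h} Q" using ex_bij_betw_nat_finite assms(2,3) by blast
  then have "g i \<in> Q" if "i < h" for i using that by (auto simp: bij_betw_def)
  moreover have "g i \<noteq> g j" if "i < h" "j < h" "i \<noteq> j" for i j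
    using g that by (auto simp: bij_betw_def inj_on_def)
  ultimately show ?thesis unfolding clique_minor_def
    using assms by (intro exI[of _ "\<lambda>i. {g i}"]) auto
qed

section \<open>Dense graphs and the clique minors they force\<close>

text \<open>Contracting \<open>v\<close> into \<open>u\<close> destroys the edge \<open>uv\<close>
  and merges the two edges to each common neighbour. Edges are ordered pairs here, whence the
  factors 2.\<close>

lemma card_contract_edge:
  assumes fin: "finite E" and sym: "sym E" and irr: "irrefl E" and uv: "(u, v) \<in> E"
  defines "E' \<equiv> {(x, y) \<in> E. x \<noteq> v \<and> y \<noteq> v} \<union> {u} \<times> (E `` {v} - {u}) \<union> (E `` {v} - {u}) \<times> {u}"
  shows "card E = card E' + 2 + 2 * card (E `` {u} \<inter> E `` {v})"
proof -
  let ?N = "\<lambda>x. E `` {x}"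
  let ?E0 = "{(x, y) \<in> E. x \<noteq> v \<and> y \<noteq> v}"
  \<comment> \<open>The neighbours of \<open>v\<close> that become new neighbours of
    \<open>u\<close>; with these the union that forms \<open>E'\<close> is disjoint.\<close>
  let ?W = "?N v - {u} - ?N u"
  have finN: "finite (?N x)" for x by (rule finite_Image[OF fin])
  have "u \<noteq> v" using irr uv by (auto simp: irrefl_def)
  have vu: "(v, u) \<in> E" using sym uv by (rule symD)
  have sw: "(x, y) \<in> E \<longleftrightarrow> (y, x) \<in> E" for x y using sym by (auto dest: symD)
  have nl: "(x, x) \<notin> E" for x using irr by (auto simp: irrefl_def)
  have "E = ?E0 \<union> {v} \<times> ?N v \<union> ?N v \<times> {v}" using sw by auto
  moreover have "card (?E0 \<union> {v} \<times> ?N v \<union> ?N v \<times> {v}) = card ?E0 + 2 * card (?N v)"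
  proof -
    have "finite ?E0" by (rule finite_subset[OF _ fin]) auto
    then have "card (?E0 \<union> {v} \<times> ?N v \<union> ?N v \<times> {v}) = card (?E0 \<union> {v} \<times> ?N v) + card (?N v \<times> {v})"
      using finN nl by (intro card_Un_disjoint) auto
    also have "card (?E0 \<union> {v} \<times> ?N v) = card ?E0 + card ({v} \<times> ?N v)"
      using finN \<open>finite ?E0\<close> by (intro card_Un_disjoint) auto
    finally show ?thesis by (simp add: card_cartesian_product)
  qed
  moreover have "E' = ?E0 \<union> {u} \<times> ?W \<union> ?W \<times> {u}"
    unfolding E'_def using sw nl \<open>u \<noteq> v\<close> by auto
  moreover have "card (?E0 \<union> {u} \<times> ?W \<union> ?W \<times> {u}) = card ?E0 + 2 * card ?W"
  proof -
    have "finite ?E0" by (rule finite_subset[OF _ fin]) auto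
    then have "card (?E0 \<union> {u} \<times> ?W \<union> ?W \<times> {u}) = card (?E0 \<union> {u} \<times> ?W) + card (?W \<times> {u})"
      using finN nl sw by (intro card_Un_disjoint) auto
    also have "card (?E0 \<union> {u} \<times> ?W) = card ?E0 + card ({u} \<times> ?W)"
      using finN \<open>finite ?E0\<close> by (intro card_Un_disjoint) auto
    finally show ?thesis by (simp add: card_cartesian_product)
  qed
  moreover have "card (?N v) = card ?W + 1 + card (?N u \<inter> ?N v)"
  proof -
    have "?N v = (?W \<union> {u}) \<union> (?N u \<inter> ?N v)" using vu by auto
    also have "card \<dots> = card (?W \<union> {u}) + card (?N u \<inter> ?N v)"
      using finN nl by (intro card_Un_disjoint) auto
    also have "card (?W \<union> {u}) = card ?W + 1" using finN by simp
    finally show ?thesis by simp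
  qed
  ultimately show ?thesis by simp
qed

text \<open>
  An edge with few common neighbours of its ends can be contracted without decreasing the density;
  if there is none, then the neighbourhood of any vertex has large minimum degree.
\<close>

lemma dense_imp_clique_minor:
  assumes "finite V" "V \<noteq> {}" "E \<subseteq> V \<times> V" "sym E" "irrefl E" "2 ^ h * card V \<le> 2 * card E"
  shows "clique_minor (Suc h) V E"
  using assms
proof (induction h arbitrary: V E)
  case 0
  then obtain v where "v \<in> V" by auto
  then show ?case by (intro clique_minor_clique[of "{v}"]) auto
next
  case (Suc h)
  note IHh = Suc.IH
  \<comment> \<open>The inner induction serves the contractions, the outer one the passage to a
    neighbourhood.\<close>
  from Suc.prems show ?case
  proof (induction "card V" arbitrary: V E rule: less_induct)
    case less
    have finE: "finite E" using less.prems by (meson finite_SigmaI finite_subset)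
    have sw: "(x, y) \<in> E \<longleftrightarrow> (y, x) \<in> E" for x y using less.prems by (auto dest: symD)
    have nl: "(x, x) \<notin> E" for x using less.prems by (auto simp: irrefl_def)
    have dens: "2 ^ h * card V \<le> card E" using less.prems by simp
    have "card V > 0" using less.prems by (simp add: card_gt_0_iff)
    then have "card E > 0" using dens by (metis gr0I mult_is_0 not_gr_zero power_not_zero le_zero_eq zero_neq_numeral)
    then obtain v w where vw: "(v, w) \<in> E" by (metis card.empty ex_in_conv less_irrefl surj_pair)
    \<comment> \<open>One vertex less lowers the required number of ordered pairs by
      \<open>2 ^ h\<close>, so an edge whose contraction loses no more than that preserves the
      density.\<close>
    show ?case
    proof (cases "\<exists>u v. (u, v) \<in> E \<and> 2 + 2 * card (E `` {u} \<inter> E `` {v}) \<le> 2 ^ h")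
      case True
      then obtain u v where uv: "(u, v) \<in> E" "2 + 2 * card (E `` {u} \<inter> E `` {v}) \<le> 2 ^ h" by blast
      have ne: "u \<noteq> v" and V: "u \<in> V" "v \<in> V" using uv nl less.prems by auto
      define E' where "E' = {(x, y) \<in> E. x \<noteq> v \<and> y \<noteq> v} \<union> {u} \<times> (E `` {v} - {u}) \<union> (E `` {v} - {u}) \<times> {u}"
      have "card E = card E' + 2 + 2 * card (E `` {u} \<inter> E `` {v})"
        unfolding E'_def by (rule card_contract_edge) (use finE less.prems uv in auto)
      then have "card E \<le> card E' + 2 ^ h" using uv by linarith
      moreover have "card V = Suc (card (V - {v}))" using V less.prems by (metis card_Suc_Diff1)
      ultimately have "2 ^ Suc h * card (V - {v}) \<le> 2 * card E'" using dens by simp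
      moreover have "sym E'" "irrefl E'" unfolding E'_def sym_def irrefl_def using sw nl by auto
      moreover have "E' \<subseteq> (V - {v}) \<times> (V - {v})" unfolding E'_def using less.prems nl V ne by auto
      moreover have "V - {v} \<noteq> {}" using V ne by auto
      ultimately have "clique_minor (Suc (Suc h)) (V - {v}) E'"
        using less.hyps[of "V - {v}" E'] \<open>card V = _\<close> less.prems by auto
      then show ?thesis
        by (rule clique_minor_contract[of u v, rotated 5]) (use uv sw ne V in \<open>auto simp: E'_def\<close>)
    next
      case False
      show ?thesis
      proof (cases h)
        case 0
        have "v \<noteq> w" using vw nl by auto
        then show ?thesis unfolding 0 using vw sw less.prems
          by (intro clique_minor_clique[of "{v, w}"]) auto
      next
        case (Suc h')
        let ?N = "E `` {v}"
        let ?EN = "E \<inter> ?N \<times> ?N"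
        have finN: "finite ?N" by (rule finite_Image[OF finE])
        have deg: "2 ^ h \<le> 2 * card (E `` {u} \<inter> ?N)" if "u \<in> ?N" for u
        proof -
          have "(u, v) \<in> E" using that sw by auto
          then have "\<not> 2 + 2 * card (E `` {u} \<inter> ?N) \<le> 2 ^ h" using False by blast
          then show ?thesis unfolding Suc by simp
        qed
        have "?EN = (SIGMA u:?N. E `` {u} \<inter> ?N)" by auto
        then have "card ?EN = (\<Sum>u\<in>?N. card (E `` {u} \<inter> ?N))"
          using finN by (simp add: card_SigmaI)
        then have "2 * card ?EN = (\<Sum>u\<in>?N. 2 * card (E `` {u} \<inter> ?N))" by (simp add: sum_distrib_left)
        moreover have "(\<Sum>u\<in>?N. 2 * card (E `` {u} \<inter> ?N)) \<ge> (\<Sum>u\<in>?N. 2 ^ h)"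
          by (rule sum_mono) (use deg in auto)
        ultimately have "2 ^ h * card ?N \<le> 2 * card ?EN" by (simp add: mult.commute)
        moreover have "sym ?EN" "irrefl ?EN" using sw nl by (auto simp: sym_def irrefl_def)
        ultimately have "clique_minor (Suc h) ?N ?EN" using IHh[of ?N ?EN] finN vw by auto
        then have "clique_minor (Suc h) ?N E" by (rule clique_minor_mono) auto
        then have "clique_minor (Suc (Suc h)) (insert v ?N) E"
          by (rule clique_minor_cone) (use nl sw in auto)
        then show ?thesis by (rule clique_minor_mono) (use less.prems vw in auto)
      qed
    qed
  qed
qed

section \<open>Neighbourhoods in bipartite graphs without a clique minor\<close>

text \<open>Each chosen vertex rules out fewer than \<open>card N / m\<close> vertices, itself among
  them since \<open>M\<close> is irreflexive. After at most \<open>m\<close> choices some vertex of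
  \<open>N\<close> remains that is adjacent to all of them. The bound with \<open>card N - 1\<close>
  carries the strictness through the sum.\<close>

lemma greedy_clique:
  assumes N: "finite N" "card N \<ge> Suc m"
    and few: "\<And>u. u \<in> N \<Longrightarrow> m * card {w \<in> N. (u, w) \<notin> M} < card N"
    and sym: "sym M" and irr: "irrefl M"
  shows "i \<le> Suc m \<Longrightarrow> \<exists>Q\<subseteq>N. card Q = i \<and> (\<forall>u\<in>Q. \<forall>v\<in>Q. u \<noteq> v \<longrightarrow> (u, v) \<in> M)
    \<and> m * card {w \<in> N. \<exists>u\<in>Q. (u, w) \<notin> M} \<le> i * (card N - 1)"
proof (induction i)
  case 0
  then show ?case by (intro exI[of _ "{}"]) auto
next
  case (Suc i)
  then obtain Q where Q: "Q \<subseteq> N" "card Q = i" "\<forall>u\<in>Q. \<forall>v\<in>Q. u \<noteq> v \<longrightarrow> (u, v) \<in> M"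
    "m * card {w \<in> N. \<exists>u\<in>Q. (u, w) \<notin> M} \<le> i * (card N - 1)" by auto
  have finQ: "finite Q" using Q N finite_subset by blast
  let ?bad = "\<lambda>Q. {w \<in> N. \<exists>u\<in>Q. (u, w) \<notin> M}"
  have "?bad Q \<noteq> N"
  proof (cases "m = 0")
    case True
    then have "Q = {}" using Suc.prems Q finQ by simp
    then show ?thesis using N by auto
  next
    case False
    have "i * (card N - 1) \<le> m * (card N - 1)" using Suc.prems by (intro mult_le_mono1) simp
    then have "m * card (?bad Q) \<le> m * (card N - 1)" using Q(4) by linarith
    then have "card (?bad Q) < card N" using False N by simp
    then show ?thesis by auto
  qed
  then obtain v where v: "v \<in> N" "v \<notin> ?bad Q" by blast
  then have "v \<notin> Q" using irr by (auto simp: irrefl_def)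
  note v = v this
  have "?bad (insert v Q) = ?bad Q \<union> {w \<in> N. (v, w) \<notin> M}" by auto
  then have "card (?bad (insert v Q)) \<le> card (?bad Q) + card {w \<in> N. (v, w) \<notin> M}"
    by (simp add: card_Un_le)
  then have "m * card (?bad (insert v Q)) \<le> m * card (?bad Q) + m * card {w \<in> N. (v, w) \<notin> M}"
    using mult_le_mono2 by (fastforce simp: distrib_left[symmetric])
  also have "\<dots> \<le> i * (card N - 1) + (card N - 1)" using Q few[OF v(1)] by simp
  finally have bad: "m * card (?bad (insert v Q)) \<le> Suc i * (card N - 1)" by simp
  have "(u, v) \<in> M" "(v, u) \<in> M" if "u \<in> Q" for u
    using that v sym by (auto dest: symD)
  then have "\<forall>u\<in>insert v Q. \<forall>w\<in>insert v Q. u \<noteq> w \<longrightarrow> (u, w) \<in> M" using Q(3) by blast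
  moreover have "insert v Q \<subseteq> N" "card (insert v Q) = Suc i" using Q v finQ by auto
  ultimately show ?case using bad by blast
qed

text \<open>
  Each vertex \<open>a\<close> of \<open>A\<close> is contracted into the vertex of \<open>N a\<close> with the largest number of
  non-neighbours in \<open>N a\<close>. Without a large clique in \<open>N a\<close> this number is at least
  \<open>card (N a) div m - 1\<close>, so that the neighbourhoods are paid for by new edges on \<open>B\<close>.
\<close>

lemma sum_card_neighbourhoods_le:
  assumes "finite A" "finite B" "A \<inter> B = {}" "M \<subseteq> B \<times> B" "sym M" "irrefl M"
    and "\<And>a. a \<in> A \<Longrightarrow> N a \<subseteq> B \<and> Suc m \<le> card (N a)"
    and "\<not> clique_minor (Suc (Suc m)) (A \<union> B) (M \<union> (SIGMA a:A. N a) \<union> (SIGMA a:A. N a)\<inverse>)"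
  shows "(\<Sum>a\<in>A. card (N a)) + m * card M \<le> m * (2 ^ m * card B)"
  using assms
proof (induction A arbitrary: M rule: finite_induct)
  case empty
  \<comment> \<open>Nothing is left to contract: \<open>M\<close> alone must be too sparse to force
    the minor.\<close>
  have "\<not> clique_minor (Suc (Suc m)) B M" using empty by simp
  then have "B = {} \<or> \<not> 2 ^ Suc m * card B \<le> 2 * card M"
    using dense_imp_clique_minor[of B M "Suc m"] empty by blast
  then have "card M \<le> 2 ^ m * card B" using empty by auto
  then show ?case by simp
next
  case (insert a A)
  let ?E = "\<lambda>A M. M \<union> (SIGMA a:A. N a) \<union> (SIGMA a:A. N a)\<inverse>"
  have Na: "N a \<subseteq> B" "Suc m \<le> card (N a)" using insert.prems by auto
  have finN: "finite (N a)" using Na insert.prems finite_subset by blast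
  have aB: "a \<notin> B" using insert.prems by auto
  have sw: "(x, y) \<in> M \<longleftrightarrow> (y, x) \<in> M" for x y using insert.prems by (auto dest: symD)
  have nl: "(x, x) \<notin> M" for x using insert.prems by (auto simp: irrefl_def)
  \<comment> \<open>Otherwise the greedy choice finds \<open>m + 1\<close> pairwise adjacent
    vertices in \<open>N a\<close>, which form a clique of size \<open>m + 2\<close> together with
    \<open>a\<close>.\<close>
  have "\<exists>u\<in>N a. card (N a) \<le> m * card {w \<in> N a. (u, w) \<notin> M}"
  proof (rule ccontr)
    assume "\<not> ?thesis"
    then have few: "m * card {w \<in> N a. (u, w) \<notin> M} < card (N a)" if "u \<in> N a" for u
      using that by (meson not_le)
    obtain Q where Q: "Q \<subseteq> N a" "card Q = Suc m" "\<forall>u\<in>Q. \<forall>v\<in>Q. u \<noteq> v \<longrightarrow> (u, v) \<in> M"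
      using greedy_clique[OF finN Na(2) few insert.prems(4,5) order_refl] by blast
    have "clique_minor (Suc (Suc m)) (insert a A \<union> B) (?E (insert a A) M)"
    proof (rule clique_minor_clique[of "insert a Q"])
      show "finite (insert a Q)" using Q finN finite_subset by auto
      moreover have "a \<notin> Q" using Q(1) Na(1) aB by blast
      ultimately show "card (insert a Q) = Suc (Suc m)" using Q(2) by simp
      show "insert a Q \<subseteq> insert a A \<union> B" using Q(1) Na(1) by blast
      show "(u, v) \<in> ?E (insert a A) M" if "u \<in> insert a Q" "v \<in> insert a Q" "u \<noteq> v" for u v
        using that Q(1,3) by blast
    qed
    then show False using insert.prems(7) by blast
  qed
  then obtain u where u: "u \<in> N a" "card (N a) \<le> m * card {w \<in> N a. (u, w) \<notin> M}" by blast
  \<comment> \<open>\<open>u\<close> is one of its own non-neighbours and has to be left out, or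
    \<open>M'\<close> would contain a loop.\<close>
  define W where "W = {w \<in> N a. (u, w) \<notin> M} - {u}"
  have "u \<in> {w \<in> N a. (u, w) \<notin> M}" "finite {w \<in> N a. (u, w) \<notin> M}" using u nl finN by auto
  then have W: "card {w \<in> N a. (u, w) \<notin> M} = Suc (card W)"
    unfolding W_def by (simp only: card_Suc_Diff1)
  have "card W \<noteq> 0"
  proof
    assume "card W = 0"
    then have "card (N a) \<le> m" using u(2) W by simp
    then show False using Na(2) by simp
  qed
  \<comment> \<open>Leaving out \<open>u\<close> costs at most a factor 2, because
    \<open>card (N a) > m\<close> forces \<open>W\<close> to be nonempty; counting ordered pairs in
    \<open>M'\<close> gives this factor back.\<close>
  then have "Suc (card W) \<le> 2 * card W" by simp
  then have "m * Suc (card W) \<le> m * (2 * card W)" by (rule mult_le_mono2)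
  then have cN: "card (N a) \<le> m * (2 * card W)" using u(2) unfolding W by (rule order_trans[rotated])
  define M' where "M' = M \<union> {u} \<times> W \<union> W \<times> {u}"
  have finM: "finite M" using insert.prems by (meson finite_SigmaI finite_subset)
  have finW: "finite W" unfolding W_def using finN by simp
  have "card M' = card M + 2 * card W"
  proof -
    have "card M' = card (M \<union> {u} \<times> W) + card (W \<times> {u})"
      unfolding M'_def using finM finW sw by (intro card_Un_disjoint) (auto simp: W_def)
    also have "card (M \<union> {u} \<times> W) = card M + card ({u} \<times> W)"
      using finM finW by (intro card_Un_disjoint) (auto simp: W_def)
    finally show ?thesis by (simp add: card_cartesian_product)
  qed
  have "\<not> clique_minor (Suc (Suc m)) (A \<union> B) (?E A M')"
  proof
    assume minor: "clique_minor (Suc (Suc m)) (A \<union> B) (?E A M')"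
    have eq: "insert a A \<union> B - {a} = A \<union> B" using aB insert.hyps by auto
    have "clique_minor (Suc (Suc m)) (insert a A \<union> B) (?E (insert a A) M)"
    proof (rule clique_minor_contract[of u a _ _ _ "?E A M'"])
      show "clique_minor (Suc (Suc m)) (insert a A \<union> B - {a}) (?E A M')" using minor eq by simp
      show "(x, y) \<in> ?E (insert a A) M \<or> x = u \<and> (a, y) \<in> ?E (insert a A) M \<or>
          y = u \<and> (x, a) \<in> ?E (insert a A) M" if "(x, y) \<in> ?E A M'" for x y
        using that unfolding M'_def W_def by blast
    qed (use u(1) Na(1) aB in blast)+
    then show False using insert.prems(7) by blast
  qed
  moreover have "M' \<subseteq> B \<times> B" "sym M'" "irrefl M'"
    using insert.prems u Na sw nl by (auto simp: M'_def W_def sym_def irrefl_def)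
  ultimately have "(\<Sum>a\<in>A. card (N a)) + m * card M' \<le> m * (2 ^ m * card B)"
    using insert.prems by (intro insert.IH) simp_all
  moreover have "card (N a) + m * card M \<le> m * card M'"
    using cN \<open>card M' = _\<close> by (simp add: algebra_simps)
  ultimately show ?case using insert.hyps by simp
qed

text \<open>Double counting of the pairs between \<open>A\<close> and \<open>B\<close>: on average a
  vertex of \<open>B\<close> lies in at most \<open>m * 2 ^ m\<close> of the sets
  \<open>N a\<close>. This is the origin of the branching width \<open>d * 2 ^ d\<close>.\<close>

lemma exists_few_neighbours:
  assumes fin: "finite A" "finite B" "A \<inter> B = {}" "B \<noteq> {}"
    and N: "\<And>a. a \<in> A \<Longrightarrow> N a \<subseteq> B \<and> Suc m \<le> card (N a)"
    and free: "\<not> clique_minor (Suc (Suc m)) (A \<union> B) ((SIGMA a:A. N a) \<union> (SIGMA a:A. N a)\<inverse>)"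
  shows "\<exists>b\<in>B. card {a \<in> A. b \<in> N a} \<le> m * 2 ^ m"
proof (rule ccontr)
  assume "\<not> ?thesis"
  then have "m * 2 ^ m < card {a \<in> A. b \<in> N a}" if "b \<in> B" for b using that by auto
  then have "(\<Sum>b\<in>B. m * 2 ^ m) < (\<Sum>b\<in>B. card {a \<in> A. b \<in> N a})"
    using fin by (intro sum_strict_mono) auto
  also have "\<dots> = (\<Sum>a\<in>A. card {b \<in> B. b \<in> N a})"
    using fin by (intro sum_multicount_gen) auto
  also have "\<dots> = (\<Sum>a\<in>A. card (N a))"
    using N by (intro sum.cong refl arg_cong[where f = card]) blast
  also have "\<dots> \<le> m * (2 ^ m * card B)"
    using sum_card_neighbourhoods_le[of A B "{}" N m] assms by simp
  finally show False by (simp add: mult_ac)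
qed


section \<open>Branching and pruning\<close>

locale dst =
  fixes n r :: nat and T :: "nat set" and E :: "(nat \<times> nat) set" and k d :: nat
  assumes root: "r < n" and terms: "T \<subseteq> {..<n} - {r}" and arcs: "E \<subseteq> {..<n} \<times> {..<n}"
begin

text \<open>
  Components are represented by their least vertex, the sources. \<open>dmn w b\<close> says that \<open>w\<close> precedes
  the component of \<open>b\<close>; no chosen vertex precedes those in \<open>und C\<close>.
\<close>

definition "nonterms = {..<n} - T - {r}"
definition "RT = (E \<inter> insert r T \<times> insert r T)\<^sup>*"
definition "sources = {b \<in> T. (r, b) \<notin> RT \<and> (\<forall>t\<in>T. (t, b) \<in> RT \<longrightarrow> (b, t) \<in> RT \<and> b \<le> t)}"
definition "dmn w b \<longleftrightarrow> (\<exists>t\<in>T. (w, t) \<in> E \<and> (t, b) \<in> RT)"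
definition "und C = {b \<in> sources. \<not> (\<exists>w\<in>C. dmn w b)}"
definition "avail C F = nonterms - C - F"
definition "high C F = {w \<in> avail C F. d < card {b \<in> und C. dmn w b}}"
definition "hn C F b = {w \<in> high C F. dmn w b}"
definition "low C F = {b \<in> und C. hn C F b = {}}"
definition "reach S = (E \<inter> (S \<union> T \<union> {r}) \<times> (S \<union> T \<union> {r}))\<^sup>*"

text \<open>
  A solution for the chosen vertices \<open>C\<close> and the forbidden vertices \<open>F\<close>. Requiring that it
  contains no unreachable vertices makes the chosen vertices additional terminals.
\<close>

definition "sol C F \<longleftrightarrow> (\<exists>S. C \<subseteq> S \<and> S \<subseteq> nonterms - F \<and> card S \<le> k \<and> (\<forall>x\<in>S \<union> T. (r, x) \<in> reach S))"

lemma finite_basic [simp]: "finite T" "finite nonterms" "finite sources" "finite (und C)"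
    "finite (avail C F)" "finite (high C F)" "finite (hn C F b)" "finite (low C F)"
proof -
  show "finite T" using terms finite_subset by blast
  then show "finite sources" "finite (und C)" "finite (low C F)"
    by (auto simp: sources_def und_def low_def)
  show "finite nonterms" by (simp add: nonterms_def)
  then show "finite (avail C F)" "finite (high C F)" "finite (hn C F b)"
    by (auto simp: avail_def high_def hn_def)
qed

section \<open>Soundness of branching and pruning, progress of the search\<close>

text \<open>This holds for every set \<open>H\<close>; the choice of \<open>H\<close> matters only
  for the number of branches and for the progress that is made.\<close>

lemma sol_branch:
  "sol C F \<longleftrightarrow> sol C (F \<union> H) \<or> (\<exists>w\<in>H. sol (insert w C) F)"
proof
  assume "sol C F"
  then obtain S where S: "C \<subseteq> S" "S \<subseteq> nonterms - F" "card S \<le> k" "\<forall>x\<in>S \<union> T. (r, x) \<in> reach S"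
    unfolding sol_def by blast
  show "sol C (F \<union> H) \<or> (\<exists>w\<in>H. sol (insert w C) F)"
  proof (cases "S \<inter> H = {}")
    case True
    then have "S \<subseteq> nonterms - (F \<union> H)" using S(2) by blast
    then have "sol C (F \<union> H)" unfolding sol_def using S by (intro exI[of _ S]) simp
    then show ?thesis ..
  next
    case False
    then obtain w where w: "w \<in> S" "w \<in> H" by blast
    then have "sol (insert w C) F" unfolding sol_def using S by (intro exI[of _ S]) simp
    then show ?thesis using w by blast
  qed
next
  assume "sol C (F \<union> H) \<or> (\<exists>w\<in>H. sol (insert w C) F)"
  then obtain C' F' where "sol C' F'" "C \<subseteq> C'" "F \<subseteq> F'" by auto
  then obtain S where S: "C' \<subseteq> S" "S \<subseteq> nonterms - F'" "card S \<le> k" "\<forall>x\<in>S \<union> T. (r, x) \<in> reach S"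
    unfolding sol_def by blast
  then have "C \<subseteq> S" "S \<subseteq> nonterms - F" using \<open>C \<subseteq> C'\<close> \<open>F \<subseteq> F'\<close> by auto
  then show "sol C F" unfolding sol_def using S(3,4) by (intro exI[of _ S]) simp
qed

text \<open>Backwards from \<open>b\<close>, the path stays in \<open>D[T \<union> {r}]\<close>
  until it meets a vertex of \<open>S\<close>, and it must meet one because \<open>r\<close> does
  not reach \<open>b\<close> there. The arc leaving that vertex leads to a terminal above
  \<open>b\<close>.\<close>

lemma dominated_by_solution:
  assumes b: "b \<in> sources" and path: "(r, b) \<in> reach S"
  shows "\<exists>w\<in>S. dmn w b"
proof -
  have bT: "b \<in> T" "(r, b) \<notin> RT" using b by (auto simp: sources_def)
  have "x \<in> insert r T \<and> (x, b) \<in> RT \<or> (\<exists>w\<in>S. dmn w b)" if "(x, b) \<in> reach S" for x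
    using that unfolding reach_def
  proof (induction rule: converse_rtrancl_induct)
    case base
    then show ?case using bT by (simp add: RT_def)
  next
    case (step x y)
    show ?case
    proof (cases "\<exists>w\<in>S. dmn w b")
      case False
      then have y: "y \<in> insert r T" "(y, b) \<in> RT" using step.IH by auto
      then have "y \<in> T" using bT by auto
      show ?thesis
      proof (cases "x \<in> insert r T")
        case True
        then have "(x, b) \<in> RT" using y step.hyps unfolding RT_def
          by (intro converse_rtrancl_into_rtrancl[of x y]) auto
        then show ?thesis using True by blast
      next
        case False
        then have "x \<in> S" "(x, y) \<in> E" using step.hyps by auto
        then show ?thesis using y \<open>y \<in> T\<close> by (auto simp: dmn_def)
      qed
    qed simp
  qed
  from this[OF path] show ?thesis using bT by blast
qed

text \<open>Soundness of pruning. A low component still has to be preceded by some vertex of the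
  solution outside \<open>C\<close>; that vertex is not high, so it serves at most \<open>d\<close>
  components.\<close>

lemma sol_card_low:
  assumes "sol C F"
  shows "card (low C F) \<le> d * (k - card C)" "card C \<le> k"
proof -
  obtain S where S: "C \<subseteq> S" "S \<subseteq> nonterms - F" "card S \<le> k" "\<forall>x\<in>S \<union> T. (r, x) \<in> reach S"
    using assms by (auto simp: sol_def)
  have finS: "finite S" using S by (meson finite_Diff finite_basic(2) finite_subset)
  show "card C \<le> k" using S finS by (meson card_mono le_trans)
  let ?S = "{w \<in> S - C. card {b \<in> und C. dmn w b} \<le> d}"
  have "low C F \<subseteq> (\<Union>w\<in>?S. {b \<in> und C. dmn w b})"
  proof
    fix b assume b: "b \<in> low C F"
    then have "b \<in> sources" "b \<in> und C" by (auto simp: low_def und_def)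
    moreover have "(r, b) \<in> reach S" using S(4) \<open>b \<in> sources\<close> by (auto simp: sources_def)
    ultimately obtain w where w: "w \<in> S" "dmn w b" using dominated_by_solution by blast
    then have "w \<notin> C" using \<open>b \<in> und C\<close> by (auto simp: und_def)
    then have "w \<in> avail C F" using w S by (auto simp: avail_def)
    then have "\<not> d < card {b \<in> und C. dmn w b}" using b w by (auto simp: low_def hn_def high_def)
    then show "b \<in> (\<Union>w\<in>?S. {b \<in> und C. dmn w b})" using w \<open>w \<notin> C\<close> \<open>b \<in> und C\<close> by auto
  qed
  then have "card (low C F) \<le> card (\<Union>w\<in>?S. {b \<in> und C. dmn w b})"
    by (intro card_mono) (use finS in auto)
  also have "\<dots> \<le> (\<Sum>w\<in>?S. card {b \<in> und C. dmn w b})" using finS by (intro card_UN_le) auto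
  also have "\<dots> \<le> (\<Sum>w\<in>?S. d)" by (intro sum_mono) auto
  also have "\<dots> \<le> card (S - C) * d" using finS by (auto intro!: mult_right_mono card_mono)
  also have "\<dots> \<le> (k - card C) * d"
    using S finS by (intro mult_right_mono) (auto simp: card_Diff_subset finite_subset)
  finally show "card (low C F) \<le> d * (k - card C)" by (simp add: mult.commute)
qed

text \<open>Forbidding leaves \<open>und C\<close> alone, so no remaining vertex changes its status:
  \<open>b\<close> loses all its high in-neighbours, and no low component gains one.\<close>

lemma card_low_forbid:
  assumes "b \<in> und C" "hn C F b \<noteq> {}"
  shows "card (low C F) < card (low C (F \<union> hn C F b))"
proof (rule psubset_card_mono)
  have "high C (F \<union> hn C F b) = high C F - hn C F b" by (auto simp: high_def avail_def)
  then show "low C F \<subset> low C (F \<union> hn C F b)" using assms by (auto simp: low_def hn_def)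
qed simp

text \<open>A low component is not preceded by the high vertex \<open>w\<close> and stays
  undominated, while a smaller \<open>und\<close> can only shrink the set of high vertices.\<close>

lemma card_low_choose:
  assumes "w \<in> high C F"
  shows "card (low C F) \<le> card (low (insert w C) F)"
proof (rule card_mono)
  have und: "und (insert w C) \<subseteq> und C" by (auto simp: und_def)
  have high: "high (insert w C) F \<subseteq> high C F"
  proof
    fix z assume z: "z \<in> high (insert w C) F"
    have "card {b \<in> und (insert w C). dmn z b} \<le> card {b \<in> und C. dmn z b}"
      using und by (intro card_mono) auto
    then show "z \<in> high C F" using z by (auto simp: high_def avail_def)
  qed
  show "low C F \<subseteq> low (insert w C) F"
  proof
    fix b assume b: "b \<in> low C F"
    then have "\<not> dmn w b" using assms by (auto simp: low_def hn_def)
    then show "b \<in> low (insert w C) F" using b high by (auto simp: low_def hn_def und_def)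
  qed
qed simp

section \<open>Source components and how they govern reachability\<close>

lemma RT_subset_reach: "RT \<subseteq> reach S"
  unfolding reach_def RT_def by (intro rtrancl_mono) auto

lemma RT_trans: "(x, y) \<in> RT \<Longrightarrow> (y, z) \<in> RT \<Longrightarrow> (x, z) \<in> RT"
  unfolding RT_def by (rule rtrancl_trans)

text \<open>Among the ancestors of \<open>t\<close>, one with the fewest ancestors lies in a source
  component, since each of its ancestors has the same ancestors. The least element of that component
  represents it.\<close>

lemma source_above:
  assumes t: "t \<in> T" "(r, t) \<notin> RT"
  shows "\<exists>b\<in>sources. (b, t) \<in> RT"
proof -
  let ?anc = "\<lambda>t. {s \<in> T. (s, t) \<in> RT}"
  have refl: "(s, s) \<in> RT" for s by (simp add: RT_def)
  have "t \<in> ?anc t" using t refl by simp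
  then obtain s where s: "s \<in> ?anc t" "\<And>s'. s' \<in> ?anc t \<Longrightarrow> card (?anc s) \<le> card (?anc s')"
    using arg_min_natI[of "\<lambda>s. s \<in> ?anc t" t "\<lambda>s. card (?anc s)"]
      arg_min_nat_le[of "\<lambda>s. s \<in> ?anc t" _ "\<lambda>s. card (?anc s)"] by blast
  have below: "(s, s') \<in> RT" if "s' \<in> ?anc s" for s'
  proof -
    have "?anc s' \<subseteq> ?anc s" using that RT_trans by auto
    moreover have "s' \<in> ?anc t" using that s(1) RT_trans by auto
    then have "card (?anc s) \<le> card (?anc s')" by (rule s(2))
    ultimately have "?anc s' = ?anc s" by (intro card_seteq) auto
    then show ?thesis using s(1) refl by auto
  qed
  define b where "b = Min (?anc s)"
  have b: "b \<in> ?anc s" unfolding b_def using s(1) refl by (intro Min_in) auto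
  have "b \<in> sources" unfolding sources_def
  proof (intro CollectI conjI ballI impI)
    show "b \<in> T" using b by simp
    show "(r, b) \<notin> RT" using b s(1) t RT_trans by blast
    fix x assume x: "x \<in> T" "(x, b) \<in> RT"
    then have "x \<in> ?anc s" using b RT_trans by blast
    then show "(b, x) \<in> RT" "b \<le> x" using below b RT_trans by (blast, simp add: b_def)
  qed
  then show ?thesis using b s(1) RT_trans by blast
qed

text \<open>A terminal that \<open>r\<close> does not reach inside \<open>D[T \<union> {r}]\<close>
  lies below a source, and that source is either undominated or preceded by a chosen vertex. Hence
  the dynamic program has to reach only \<open>und C\<close> and \<open>C\<close>.\<close>

lemma reach_terminals:
  assumes "C \<subseteq> S" "\<And>x. x \<in> und C \<union> C \<Longrightarrow> (r, x) \<in> reach S" "t \<in> T"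
  shows "(r, t) \<in> reach S"
proof (cases "(r, t) \<in> RT")
  case True
  then show ?thesis using RT_subset_reach by blast
next
  case False
  then obtain b where b: "b \<in> sources" "(b, t) \<in> RT" using source_above assms by blast
  have "(r, b) \<in> reach S"
  proof (cases "b \<in> und C")
    case False
    then obtain w s where w: "w \<in> C" "s \<in> T" "(w, s) \<in> E" "(s, b) \<in> RT"
      using b by (auto simp: und_def dmn_def)
    have "(r, w) \<in> reach S" using assms w by blast
    moreover have "(w, s) \<in> reach S" unfolding reach_def using w assms(1) by (intro r_into_rtrancl) auto
    moreover have "(s, b) \<in> reach S" using w RT_subset_reach by blast
    ultimately show ?thesis unfolding reach_def by (meson rtrancl_trans)
  qed (use assms in blast)
  then show ?thesis using b RT_subset_reach[of S] unfolding reach_def by (meson rtrancl_trans subsetD)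
qed

lemma sourcesD: "b \<in> sources \<Longrightarrow> t \<in> T \<Longrightarrow> (t, b) \<in> RT \<Longrightarrow> (b, t) \<in> RT \<and> b \<le> t"
  by (simp add: sources_def)

text \<open>Contracting each source component and keeping the high vertices as they are gives a
  bipartite minor of the underlying graph. It inherits the excluded clique, and the double counting
  applies to it with \<open>m = d\<close>.\<close>

lemma few_high_neighbours:
  assumes free: "\<not> clique_minor (d + 2) {..<n} (E \<union> E\<inverse>)" and high: "high C F \<noteq> {}"
  shows "\<exists>b\<in>und C. hn C F b \<noteq> {} \<and> card (hn C F b) \<le> d * 2 ^ d"
proof -
  \<comment> \<open>\<open>?B\<close> is restricted to components with a high in-neighbour, or else
    the double counting might return one that is useless for branching.\<close>
  let ?A = "high C F" and ?B = "{b \<in> und C. hn C F b \<noteq> {}}" and ?N = "\<lambda>w. {b \<in> und C. dmn w b}"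
  have BT: "?B \<subseteq> sources" "sources \<subseteq> T" by (auto simp: und_def sources_def)
  have AN: "?A \<subseteq> nonterms" by (auto simp: high_def avail_def)
  have disj: "T \<inter> nonterms = {}" by (auto simp: nonterms_def)
  have N: "?N a \<subseteq> ?B \<and> Suc d \<le> card (?N a)" if "a \<in> ?A" for a
    using that by (auto simp: hn_def high_def)
  have "?B \<noteq> {}"
  proof -
    obtain a where "a \<in> ?A" using high by blast
    then have Na: "?N a \<subseteq> ?B" "Suc d \<le> card (?N a)" using N by blast+
    then have "card (?N a) \<noteq> 0" by linarith
    then have "?N a \<noteq> {}" by (metis card.empty)
    then show ?thesis using Na(1) by blast
  qed
  let ?H = "(SIGMA a:?A. ?N a) \<union> (SIGMA a:?A. ?N a)\<inverse>"
  have "\<not> clique_minor (Suc (Suc d)) (?A \<union> ?B) ?H"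
  proof
    assume minor: "clique_minor (Suc (Suc d)) (?A \<union> ?B) ?H"
    \<comment> \<open>For a source \<open>i\<close>, the terminals that reach \<open>i\<close> are
      exactly its component, since each of them is reached back.\<close>
    define Y where "Y i = (if i \<in> T then {t \<in> T. (t, i) \<in> RT} else {i})" for i
    have refl: "(s, s) \<in> RT" for s by (simp add: RT_def)
    have "clique_minor (Suc (Suc d)) {..<n} (E \<union> E\<inverse>)"
    proof (rule clique_minor_model[where Y = Y, OF _ _ _ _ minor])
      show "Y i \<subseteq> {..<n}" if "i \<in> ?A \<union> ?B" for i
        using that AN BT terms by (fastforce simp: Y_def nonterms_def)
      show "conn (E \<union> E\<inverse>) (Y i)" if "i \<in> ?A \<union> ?B" for i
      proof (cases "i \<in> T")
        case True
        then have i: "i \<in> sources" using that AN BT disj by blast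
        let ?S = "{t \<in> T. (t, i) \<in> RT}"
        \<comment> \<open>Nothing outside the component reaches it within
          \<open>D[T \<union> {r}]\<close>, not even \<open>r\<close>; so the paths between its
          vertices stay inside.\<close>
        have nr: "x \<in> ?S" if "x \<in> insert r T" "(x, i) \<in> RT" for x
          using that i by (auto simp: sources_def)
        have path: "(x, y) \<in> ((E \<union> E\<inverse>) \<inter> ?S \<times> ?S)\<^sup>*" if "(x, y) \<in> RT" "y \<in> ?S" for x y
          using that(1)[unfolded RT_def]
        proof (induction rule: converse_rtrancl_induct)
          case (step x z)
          have "(z, i) \<in> RT" using step.hyps(2) that(2) RT_trans unfolding RT_def by blast
          moreover from this have "(x, i) \<in> RT" using step.hyps(1) unfolding RT_def
            by (rule converse_rtrancl_into_rtrancl[rotated])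
          ultimately have "x \<in> ?S" "z \<in> ?S" using nr step.hyps(1) by auto
          then show ?case using step by (intro converse_rtrancl_into_rtrancl[of x z]) auto
        qed simp
        have "(x, y) \<in> RT" if "x \<in> ?S" "y \<in> ?S" for x y
          using that sourcesD[OF i, of y] RT_trans[of x i y] by simp
        then have "\<forall>x\<in>?S. \<forall>y\<in>?S. (x, y) \<in> ((E \<union> E\<inverse>) \<inter> ?S \<times> ?S)\<^sup>*" using path by blast
        moreover have "i \<in> ?S" using True refl by simp
        ultimately have "conn (E \<union> E\<inverse>) ?S" unfolding conn_def by blast
        then show ?thesis using True by (simp add: Y_def)
      qed (simp add: Y_def)
      show "Y i \<inter> Y j = {}" if "i \<in> ?A \<union> ?B" "j \<in> ?A \<union> ?B" "i \<noteq> j" for i j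
      proof (cases "i \<in> T \<and> j \<in> T")
        case True
        then have ij: "i \<in> sources" "j \<in> sources" using that AN BT disj by blast+
        show ?thesis
        proof (rule ccontr)
          assume "Y i \<inter> Y j \<noteq> {}"
          then obtain t where t: "t \<in> T" "(t, i) \<in> RT" "(t, j) \<in> RT" using True by (auto simp: Y_def)
          then have "(i, t) \<in> RT" "(j, t) \<in> RT" using sourcesD[OF ij(1)] sourcesD[OF ij(2)] by blast+
          then have "(i, j) \<in> RT" "(j, i) \<in> RT" using t RT_trans by blast+
          then have "i \<le> j" "j \<le> i" using sourcesD[OF ij(1)] sourcesD[OF ij(2)] True by blast+
          then show False using that by simp
        qed
      qed (use that in \<open>auto simp: Y_def\<close>)
      show "\<exists>u\<in>Y i. \<exists>v\<in>Y j. (u, v) \<in> E \<union> E\<inverse>"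
        if "i \<in> ?A \<union> ?B" "j \<in> ?A \<union> ?B" "i \<noteq> j" "(i, j) \<in> ?H" for i j
      proof -
        have edge: "\<exists>v\<in>Y b. (a, v) \<in> E" "Y a = {a}" if "a \<in> ?A" "b \<in> ?N a" for a b
          using that AN disj BT by (auto simp: Y_def dmn_def und_def sources_def)
        then show ?thesis using that(4) by fastforce
      qed
    qed
    then show False using free by simp
  qed
  moreover have "?A \<inter> ?B = {}" using AN BT disj by blast
  ultimately obtain b where "b \<in> ?B" "card {a \<in> ?A. b \<in> ?N a} \<le> d * 2 ^ d"
    using exists_few_neighbours[of ?A ?B ?N d] N \<open>?B \<noteq> {}\<close> by auto
  moreover from this have "{a \<in> ?A. b \<in> ?N a} = hn C F b" by (auto simp: hn_def)
  ultimately show ?thesis by auto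
qed

section \<open>Dreyfus--Wagner derivations\<close>

definition "targets C = und C \<union> C"
text \<open>Terminals, the root and the chosen vertices are free: what remains of the budget pays
  only for further nonterminals.\<close>

definition "cost C F v = (if v \<in> avail C F then 1 else 0 :: nat)"

context
  fixes C F :: "nat set"
  assumes CF: "C \<subseteq> nonterms" "F \<subseteq> nonterms" "C \<inter> F = {}"
begin

text \<open>The recursion over trees rooted at \<open>v\<close>. The cost of \<open>v\<close> itself
  is charged by the arc that enters it, so that a join counts nothing twice. The index bounds the
  height of a derivation and becomes the number of rounds of the program; the disjointness of
  \<open>Y\<close> and \<open>Z\<close> leaves \<open>3 ^ card (targets C)\<close> pairs to be
  joined.\<close>

inductive der :: "nat \<Rightarrow> nat \<Rightarrow> nat set \<Rightarrow> nat \<Rightarrow> bool" where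
  empty: "v \<in> {..<n} - F \<Longrightarrow> der i v {} 0"
| target: "v \<in> {..<n} - F \<Longrightarrow> v \<in> targets C \<Longrightarrow> der i v {v} 0"
| arc: "der i u X c \<Longrightarrow> (v, u) \<in> E \<Longrightarrow> v \<in> {..<n} - F \<Longrightarrow> der (Suc i) v X (c + cost C F u)"
| join: "der i v Y c1 \<Longrightarrow> der i v Z c2 \<Longrightarrow> Y \<inter> Z = {} \<Longrightarrow> der (Suc i) v (Y \<union> Z) (c1 + c2)"

lemma der_usable: "der i v X c \<Longrightarrow> v \<in> {..<n} - F \<and> X \<subseteq> targets C"
  by (induction rule: der.induct) auto

lemma der_Suc: "der i v X c \<Longrightarrow> der (Suc i) v X c"
  by (induction rule: der.induct) (auto intro: der.intros)

lemma der_mono: "i \<le> j \<Longrightarrow> der i v X c \<Longrightarrow> der j v X c"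
  by (induction j rule: dec_induct) (auto intro: der_Suc)

text \<open>No tree has to be extracted: the union of the vertices collected so far is enough, and
  overlaps only make it cheaper. The start \<open>v\<close> is added separately because its cost has
  not been charged yet.\<close>

lemma der_sound:
  "der i v X c \<Longrightarrow> \<exists>S\<subseteq>avail C F. card S \<le> c \<and>
     (\<forall>x\<in>X. (v, x) \<in> (E \<inter> (S \<union> C \<union> T \<union> {r, v}) \<times> (S \<union> C \<union> T \<union> {r, v}))\<^sup>*)"
proof (induction rule: der.induct)
  case (empty v i)
  then show ?case by (intro exI[of _ "{}"]) auto
next
  case (target v i)
  then show ?case by (intro exI[of _ "{}"]) auto
next
  case (arc i u X c v)
  then obtain S where S: "S \<subseteq> avail C F" "card S \<le> c"
    "\<forall>x\<in>X. (u, x) \<in> (E \<inter> (S \<union> C \<union> T \<union> {r, u}) \<times> (S \<union> C \<union> T \<union> {r, u}))\<^sup>*" by auto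
  have u: "u \<in> {..<n} - F" using der_usable[OF arc.hyps(1)] by simp
  let ?S = "S \<union> ({u} \<inter> avail C F)"
  let ?U = "?S \<union> C \<union> T \<union> {r, v}"
  have "u \<in> ?U" using u CF by (auto simp: avail_def nonterms_def)
  have "finite S" using S(1) by (rule finite_subset) simp
  then have "card ?S \<le> c + cost C F u"
    using S(2) by (cases "u \<in> avail C F") (simp_all add: cost_def card_insert_if)
  moreover have "(v, x) \<in> (E \<inter> ?U \<times> ?U)\<^sup>*" if "x \<in> X" for x
  proof -
    have "(u, x) \<in> (E \<inter> ?U \<times> ?U)\<^sup>*"
      using S(3) that \<open>u \<in> ?U\<close> by (elim ballE[of _ _ x] rtrancl_mono[THEN subsetD, rotated]) auto
    moreover have "(v, u) \<in> E \<inter> ?U \<times> ?U" using arc \<open>u \<in> ?U\<close> by auto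
    ultimately show ?thesis by (rule converse_rtrancl_into_rtrancl[rotated])
  qed
  ultimately show ?case using S(1) by (intro exI[of _ ?S]) blast
next
  case (join i v Y c1 Z c2)
  then obtain S1 S2 where S: "S1 \<subseteq> avail C F" "card S1 \<le> c1"
    "\<forall>x\<in>Y. (v, x) \<in> (E \<inter> (S1 \<union> C \<union> T \<union> {r, v}) \<times> (S1 \<union> C \<union> T \<union> {r, v}))\<^sup>*"
    "S2 \<subseteq> avail C F" "card S2 \<le> c2"
    "\<forall>x\<in>Z. (v, x) \<in> (E \<inter> (S2 \<union> C \<union> T \<union> {r, v}) \<times> (S2 \<union> C \<union> T \<union> {r, v}))\<^sup>*" by auto
  let ?S = "S1 \<union> S2"
  let ?U = "?S \<union> C \<union> T \<union> {r, v}"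
  have "card ?S \<le> c1 + c2" using S by (meson add_mono card_Un_le le_trans)
  moreover have "(v, x) \<in> (E \<inter> ?U \<times> ?U)\<^sup>*" if "x \<in> Y \<union> Z" for x
    using that
  proof
    assume "x \<in> Y"
    then show ?thesis using S(3) by (elim ballE[of _ _ x] rtrancl_mono[THEN subsetD, rotated]) auto
  next
    assume "x \<in> Z"
    then show ?thesis using S(6) by (elim ballE[of _ _ x] rtrancl_mono[THEN subsetD, rotated]) auto
  qed
  ultimately show ?case using S(1,4) by (intro exI[of _ ?S]) blast
qed

lemma der_imp_sol:
  assumes "der i r (targets C) c" "c + card C \<le> k"
  shows "sol C F"
proof -
  obtain S where S: "S \<subseteq> avail C F" "card S \<le> c"
     "\<forall>x\<in>targets C. (r, x) \<in> (E \<inter> (S \<union> C \<union> T \<union> {r, r}) \<times> (S \<union> C \<union> T \<union> {r, r}))\<^sup>*"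
    using der_sound[OF assms(1)] by blast
  let ?Q = "S \<union> C"
  \<comment> \<open>Collected vertices that \<open>r\<close> does not reach must be dropped, as
    \<open>sol\<close> admits none; paths from \<open>r\<close> never use them.\<close>
  let ?S = "{x \<in> ?Q. (r, x) \<in> reach ?Q}"
  have C: "(r, x) \<in> reach ?Q" if "x \<in> und C \<union> C" for x
    using S(3) that by (simp add: targets_def reach_def)
  have T: "(r, x) \<in> reach ?Q" if "x \<in> T" for x
    by (rule reach_terminals[of C, OF _ C that]) auto
  have *: "(r, x) \<in> reach ?S" if "(r, x) \<in> reach ?Q" for x
    using that unfolding reach_def[of ?Q]
  proof (induction rule: rtrancl_induct)
    case (step x y)
    have "(r, x) \<in> reach ?Q" "(r, y) \<in> reach ?Q"
      using step.hyps unfolding reach_def by (auto intro: rtrancl_into_rtrancl)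
    then have "(x, y) \<in> E \<inter> (?S \<union> T \<union> {r}) \<times> (?S \<union> T \<union> {r})" using step.hyps by auto
    then show ?case using step.IH unfolding reach_def by (rule rtrancl_into_rtrancl[rotated])
  qed (simp add: reach_def)
  show ?thesis unfolding sol_def
  proof (intro exI[of _ ?S] conjI)
    show "C \<subseteq> ?S" using C by auto
    show "?S \<subseteq> nonterms - F" using S(1) CF by (auto simp: avail_def)
    have "finite ?Q" using S(1) CF by (meson finite_UnI finite_basic finite_subset)
    then have "card ?S \<le> card ?Q" by (intro card_mono) auto
    also have "\<dots> \<le> c + card C" using S(2) by (meson add_mono card_Un_le le_refl le_trans)
    finally show "card ?S \<le> k" using assms(2) by simp
    show "\<forall>x\<in>?S \<union> T. (r, x) \<in> reach ?S" using * T by auto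
  qed
qed

text \<open>A vertex at the largest distance from \<open>r\<close> is on no shortest path to another
  vertex, so removing it keeps all others reachable.\<close>

lemma exists_removable_vertex:
  assumes "finite U" "r \<in> U" "U \<noteq> {r}" "\<And>x. x \<in> U \<Longrightarrow> (r, x) \<in> (E \<inter> U \<times> U)\<^sup>*"
  shows "\<exists>v p. v \<in> U - {r} \<and> p \<in> U - {v} \<and> (p, v) \<in> E \<and>
    (\<forall>x\<in>U - {v}. (r, x) \<in> (E \<inter> (U - {v}) \<times> (U - {v}))\<^sup>*)"
proof -
  let ?R = "E \<inter> U \<times> U"
  define dist where "dist x = (LEAST i. (r, x) \<in> ?R ^^ i)" for x
  have dist: "(r, x) \<in> ?R ^^ dist x" if "x \<in> U" for x
    unfolding dist_def using assms(4)[OF that] by (metis LeastI rtrancl_imp_relpow)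
  have dist_le: "dist x \<le> i" if "(r, x) \<in> ?R ^^ i" for x i
    unfolding dist_def using that by (rule Least_le)
  have dist_r: "dist r = 0" using dist_le[of r 0] by simp
  have pred: "\<exists>p\<in>U. (p, x) \<in> E \<and> dist p < dist x" if "x \<in> U" "x \<noteq> r" for x
  proof (cases "dist x")
    case 0
    then show ?thesis using dist[OF that(1)] that by simp
  next
    case (Suc i)
    then obtain p where p: "(r, p) \<in> ?R ^^ i" "(p, x) \<in> ?R" using dist[OF \<open>x \<in> U\<close>] by auto
    then show ?thesis using dist_le[OF p(1)] Suc by auto
  qed
  define m where "m = Max (dist ` U)"
  have "m \<in> dist ` U" unfolding m_def using assms by (intro Max_in) auto
  have le: "dist x \<le> m" if "x \<in> U" for x unfolding m_def using assms(1) that by (intro Max_ge) auto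
  obtain z where z: "z \<in> U" "z \<noteq> r" using assms by blast
  then have "dist z > 0" using pred[of z] by auto
  then have "m > 0" using le z by fastforce
  obtain v where v: "v \<in> U" "dist v = m" using \<open>m \<in> dist ` U\<close> by auto
  then have "v \<noteq> r" using dist_r \<open>m > 0\<close> by auto
  obtain p where p: "p \<in> U" "(p, v) \<in> E" "dist p < dist v" using pred[OF v(1) \<open>v \<noteq> r\<close>] by blast
  have "x \<in> U - {v} \<longrightarrow> (r, x) \<in> (E \<inter> (U - {v}) \<times> (U - {v}))\<^sup>*" for x
  proof (induction "dist x" arbitrary: x rule: less_induct)
    case less
    show ?case
    proof (cases "x = r \<or> x \<notin> U - {v}")
      case False
      then obtain q where q: "q \<in> U" "(q, x) \<in> E" "dist q < dist x" using pred by blast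
      then have "q \<noteq> v" using v le[of x] False by auto
      then have "(r, q) \<in> (E \<inter> (U - {v}) \<times> (U - {v}))\<^sup>*" using less q by auto
      moreover have "(q, x) \<in> E \<inter> (U - {v}) \<times> (U - {v})" using q \<open>q \<noteq> v\<close> False by auto
      ultimately show ?thesis by (auto intro: rtrancl_into_rtrancl)
    qed auto
  qed
  then show ?thesis using v p \<open>v \<noteq> r\<close> by (intro exI[of _ v] exI[of _ p]) auto
qed

text \<open>Leaves are removed one by one; each is merged into its parent by one arc and one join.\<close>

lemma der_peel:
  assumes "finite U" "r \<in> U" "U \<subseteq> {..<n} - F" "\<And>x. x \<in> U \<Longrightarrow> (r, x) \<in> (E \<inter> U \<times> U)\<^sup>*"
    and "\<And>v. v \<in> U \<Longrightarrow> der i v (X v) (c v)"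
    and "\<And>u v. u \<in> U \<Longrightarrow> v \<in> U \<Longrightarrow> u \<noteq> v \<Longrightarrow> X u \<inter> X v = {}"
  shows "der (i + 2 * (card U - 1)) r (\<Union>v\<in>U. X v) ((\<Sum>v\<in>U. c v) + (\<Sum>v\<in>U - {r}. cost C F v))"
  using assms
proof (induction "card U" arbitrary: U X c i rule: less_induct)
  case less
  show ?case
  proof (cases "U = {r}")
    case True
    then show ?thesis using less.prems(5)[of r] by simp
  next
    case False
    obtain v p where v: "v \<in> U - {r}" "p \<in> U - {v}" "(p, v) \<in> E"
      "\<forall>x\<in>U - {v}. (r, x) \<in> (E \<inter> (U - {v}) \<times> (U - {v}))\<^sup>*"
      using exists_removable_vertex[OF less.prems(1,2) False less.prems(4)] by blast
    let ?U = "U - {v}"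
    \<comment> \<open>The parent \<open>p\<close> inherits the targets and the cost of the leaf
      \<open>v\<close>, and the price of entering \<open>v\<close> is added. This is why the claim
      admits arbitrary derivations at the vertices of \<open>U\<close>.\<close>
    let ?X = "X(p := X v \<union> X p)"
    let ?c = "c(p := (c v + cost C F v) + c p)"
    have cU: "card U = Suc (card ?U)" using v(1) less.prems(1) by (metis DiffD1 card_Suc_Diff1)
    have pU: "p \<in> ?U" "v \<notin> ?U" "finite ?U" using v less.prems(1) by auto
    have "der (Suc i) p (X v) (c v + cost C F v)"
      using less.prems(5)[of v] v less.prems(3) by (intro der.arc) auto
    moreover have "der (Suc i) p (X p) (c p)" using less.prems(5)[of p] v by (intro der_Suc) auto
    moreover have "X v \<inter> X p = {}" using less.prems(6)[of v p] v by auto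
    ultimately have derp: "der (Suc (Suc i)) p (X v \<union> X p) ((c v + cost C F v) + c p)" by (rule der.join)
    have h1: "der (Suc (Suc i) + 2 * (card ?U - 1)) r (\<Union>v\<in>?U. ?X v) ((\<Sum>v\<in>?U. ?c v) + (\<Sum>v\<in>?U - {r}. cost C F v))"
    proof (rule less.hyps)
      show "card ?U < card U" using cU by simp
      show "r \<in> ?U" "finite ?U" "?U \<subseteq> {..<n} - F" using v less.prems by auto
      show "der (Suc (Suc i)) z (?X z) (?c z)" if "z \<in> ?U" for z
        using that derp less.prems(5)[of z] by (auto intro: der_Suc)
      show "?X x \<inter> ?X y = {}" if "x \<in> ?U" "y \<in> ?U" "x \<noteq> y" for x y
        using that less.prems(6) v by auto
    qed (use v(4) in auto)
    have h2: "Suc (Suc i) + 2 * (card ?U - 1) = i + 2 * (card U - 1)"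
    proof -
      have "card ?U > 0" using pU by (auto simp: card_gt_0_iff)
      then show ?thesis using cU by simp
    qed
    have h3: "(\<Union>v\<in>?U. ?X v) = (\<Union>v\<in>U. X v)"
    proof -
      have "(\<Union>v\<in>?U. ?X v) = ?X p \<union> (\<Union>v\<in>?U - {p}. X v)" using pU by auto
      also have "\<dots> = (\<Union>v\<in>U. X v)" using v by auto
      finally show ?thesis .
    qed
    have h4: "(\<Sum>v\<in>?U. ?c v) + (\<Sum>v\<in>?U - {r}. cost C F v) = (\<Sum>v\<in>U. c v) + (\<Sum>v\<in>U - {r}. cost C F v)"
    proof -
      have "(\<Sum>v\<in>?U. ?c v) = ?c p + (\<Sum>v\<in>?U - {p}. c v)"
        using pU by (simp add: sum.remove[of ?U p])
      also have "\<dots> = c v + cost C F v + (\<Sum>v\<in>?U. c v)" using pU by (simp add: sum.remove[of ?U p c])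
      also have "\<dots> = cost C F v + (\<Sum>v\<in>U. c v)" using v less.prems(1) by (simp add: sum.remove[of U v c])
      finally have "(\<Sum>v\<in>?U. ?c v) = cost C F v + (\<Sum>v\<in>U. c v)" .
      moreover have "(\<Sum>v\<in>U - {r}. cost C F v) = cost C F v + (\<Sum>v\<in>?U - {r}. cost C F v)"
      proof -
        have "U - {r} - {v} = ?U - {r}" by blast
        then show ?thesis using sum.remove[of "U - {r}" v "cost C F"] v(1) less.prems(1) by simp
      qed
      ultimately show ?thesis by simp
    qed
    show ?thesis using h1 unfolding h2 h3 h4 .
  qed
qed

text \<open>At first each vertex derives only itself, if it is a target; peeling then collects
  everything at \<open>r\<close>. The true height is below \<open>2 * n\<close>; the generous
  \<open>n * n\<close> is what two nested loops of length \<open>n\<close> provide.\<close>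

lemma sol_imp_der:
  assumes "sol C F"
  shows "\<exists>c. c + card C \<le> k \<and> der (n * n) r (targets C) c"
proof -
  obtain S where S: "C \<subseteq> S" "S \<subseteq> nonterms - F" "card S \<le> k" "\<forall>x\<in>S \<union> T. (r, x) \<in> reach S"
    using assms by (auto simp: sol_def)
  let ?U = "S \<union> T \<union> {r}"
  have U: "?U \<subseteq> {..<n} - F" using S(2) terms root CF(2) by (auto simp: nonterms_def)
  have finU: "finite ?U" using U by (meson finite_Diff finite_lessThan finite_subset)
  have "der (0 + 2 * (card ?U - 1)) r (\<Union>v\<in>?U. {v} \<inter> targets C) ((\<Sum>v\<in>?U. 0) + (\<Sum>v\<in>?U - {r}. cost C F v))"
  proof (rule der_peel[OF finU _ U])
    show "(r, x) \<in> (E \<inter> ?U \<times> ?U)\<^sup>*" if "x \<in> ?U" for x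
      using that S(4) by (auto simp: reach_def)
    show "der 0 v ({v} \<inter> targets C) 0" if "v \<in> ?U" for v
      using that U der.empty[of v] der.target[of v] by (cases "v \<in> targets C") auto
  qed auto
  moreover have "targets C \<subseteq> ?U" using S(1) by (auto simp: targets_def und_def sources_def)
  then have "(\<Union>v\<in>?U. {v} \<inter> targets C) = targets C" by auto
  moreover have "(\<Sum>v\<in>?U - {r}. cost C F v) = card (S - C)"
  proof -
    have "(\<Sum>v\<in>?U - {r}. cost C F v) = card {v \<in> ?U - {r}. v \<in> avail C F}"
      using finU by (simp add: cost_def sum.If_cases Int_def)
    also have "{v \<in> ?U - {r}. v \<in> avail C F} = S - C"
      using S(2) by (auto simp: avail_def nonterms_def)
    finally show ?thesis .
  qed
  ultimately have der: "der (2 * (card ?U - 1)) r (targets C) (card (S - C))" by simp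
  have "card ?U \<le> n" using card_mono[OF _ U] card_mono[of "{..<n}" "{..<n} - F"] by simp
  then have "2 * (card ?U - 1) \<le> n * n"
  proof -
    have "2 * (n - 1) \<le> n * n" by (cases n) auto
    then show ?thesis using \<open>card ?U \<le> n\<close> by linarith
  qed
  moreover have "card (S - C) + card C \<le> k"
  proof -
    have "finite S" using finU by simp
    then have "card (S - C) = card S - card C" "card C \<le> card S"
      using S(1) by (auto simp: card_Diff_subset finite_subset card_mono)
    then show ?thesis using S(3) by simp
  qed
  ultimately show ?thesis using der_mono der by blast
qed

end

end


section \<open>A structured language and its compilation\<close>

definition run :: "com \<Rightarrow> state \<Rightarrow> nat \<Rightarrow> state \<Rightarrow> bool" where
  "run c s T s' \<longleftrightarrow> (\<exists>t\<le>T. exec c s t s')"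

lemma run_mono: "run c s T s' \<Longrightarrow> T \<le> T' \<Longrightarrow> run c s T' s'"
  by (auto simp: run_def intro: order_trans)

lemma bits_le: "x < 2 ^ L \<Longrightarrow> bits x \<le> L"
  by (rule floorlog_leI) auto

lemma run_Skip: "run Skip s 1 s"
  unfolding run_def using exec.Skip by blast

lemma run_Const: "c < 2 ^ L \<Longrightarrow> run (Const x c) (R, M) (1 + L) (R(x := c), M)"
  unfolding run_def using bits_le[of c L] exec.Const[of x c R M] by (intro exI conjI) auto

lemma run_Add: "R y < 2 ^ L \<Longrightarrow> R z < 2 ^ L \<Longrightarrow>
    run (Add x y z) (R, M) (1 + 2 * L) (R(x := R y + R z), M)"
  unfolding run_def using bits_le[of "R y" L] bits_le[of "R z" L] exec.Add[of x y z R M]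
  by (intro exI conjI) auto

lemma run_Sub: "R y < 2 ^ L \<Longrightarrow> R z < 2 ^ L \<Longrightarrow>
    run (Sub x y z) (R, M) (1 + 2 * L) (R(x := R y - R z), M)"
  unfolding run_def using bits_le[of "R y" L] bits_le[of "R z" L] exec.Sub[of x y z R M]
  by (intro exI conjI) auto

lemma run_Load: "R y < 2 ^ L \<Longrightarrow> M (R y) < 2 ^ L \<Longrightarrow>
    run (Load x y) (R, M) (1 + 2 * L) (R(x := M (R y)), M)"
  unfolding run_def using bits_le[of "R y" L] bits_le[of "M (R y)" L] exec.Load[of x y R M]
  by (intro exI conjI) auto

lemma run_Store: "R x < 2 ^ L \<Longrightarrow> R y < 2 ^ L \<Longrightarrow>
    run (Store x y) (R, M) (1 + 2 * L) (R, M(R x := R y))"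
  unfolding run_def using bits_le[of "R x" L] bits_le[of "R y" L] exec.Store[of x y R M]
  by (intro exI conjI) auto

lemma run_Seq: "run c1 s T1 s1 \<Longrightarrow> run c2 s1 T2 s2 \<Longrightarrow> run (Seq c1 c2) s (T1 + T2) s2"
  unfolding run_def by (meson add_mono exec.Seq)

lemma run_If:
  assumes "R x < 2 ^ L" "R x \<noteq> 0 \<Longrightarrow> run c1 (R, M) T s" "R x = 0 \<Longrightarrow> run c2 (R, M) T s"
  shows "run (If_nz x c1 c2) (R, M) (1 + L + T) s"
proof (cases "R x = 0")
  case True
  then obtain t where "t \<le> T" "exec c2 (R, M) t s" using assms by (auto simp: run_def)
  then show ?thesis unfolding run_def using exec.If_False[of R x c2 M t s c1] True bits_le[OF assms(1)]
    by (intro exI[of _ "1 + bits (R x) + t"]) auto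
next
  case False
  then obtain t where "t \<le> T" "exec c1 (R, M) t s" using assms by (auto simp: run_def)
  then show ?thesis unfolding run_def using exec.If_True[of R x c1 M t s c2] False bits_le[OF assms(1)]
    by (intro exI[of _ "1 + bits (R x) + t"]) auto
qed

lemma run_While_False: "R x = 0 \<Longrightarrow> run (While_nz x c) (R, M) 1 (R, M)"
  unfolding run_def using exec.While_False[of R x c M] by (intro exI[of _ 1]) (auto simp: floorlog_def)

lemma run_While_True:
  assumes "R x \<noteq> 0" "R x < 2 ^ L" "run c (R, M) T1 s1" "run (While_nz x c) s1 T2 s2"
  shows "run (While_nz x c) (R, M) (1 + L + T1 + T2) s2"
proof -
  obtain t1 t2 where "t1 \<le> T1" "exec c (R, M) t1 s1" "t2 \<le> T2" "exec (While_nz x c) s1 t2 s2"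
    using assms by (auto simp: run_def)
  then show ?thesis unfolding run_def
    using exec.While_True[of R x c M t1 s1 t2 s2] assms(1) bits_le[OF assms(2)]
    by (intro exI[of _ "1 + bits (R x) + t1 + t2"]) auto
qed

text \<open>
  Variables are the registers below \<open>64\<close>; higher registers serve as temporaries. Registers \<open>1\<close> to
  \<open>4\<close> are reserved: the range of all sums, the cap on all stored values, the base address of the
  arrays, and the range of the long loops. The input is the array with number \<open>16\<close>; entry \<open>i\<close> of
  array \<open>a < 16\<close> has the address \<open>a + 16 * i\<close> relative to the base.
\<close>

datatype aexp =
    ENum nat
  | EVar nat
  | EIdx nat aexp
  | EAdd aexp aexp
  | ESub aexp aexp
  | EIf aexp aexp aexp
  | ESum nat aexp

fun eval :: "aexp \<Rightarrow> (nat \<Rightarrow> nat) \<Rightarrow> (nat \<Rightarrow> nat \<Rightarrow> nat) \<Rightarrow> nat" where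
  "eval (ENum c) v A = c"
| "eval (EVar x) v A = v x"
| "eval (EIdx a e) v A = A a (eval e v A)"
| "eval (EAdd e1 e2) v A = eval e1 v A + eval e2 v A"
| "eval (ESub e1 e2) v A = eval e1 v A - eval e2 v A"
| "eval (EIf c e1 e2) v A = (if eval c v A \<noteq> 0 then eval e1 v A else eval e2 v A)"
| "eval (ESum x e) v A = (\<Sum>i<v 1. eval e (v(x := i)) A)"

fun wfe :: "aexp \<Rightarrow> bool" where
  "wfe (ENum c) \<longleftrightarrow> True"
| "wfe (EVar x) \<longleftrightarrow> x < 64"
| "wfe (EIdx a e) \<longleftrightarrow> a \<le> 16 \<and> wfe e"
| "wfe (EAdd e1 e2) \<longleftrightarrow> wfe e1 \<and> wfe e2"
| "wfe (ESub e1 e2) \<longleftrightarrow> wfe e1 \<and> wfe e2"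
| "wfe (EIf c e1 e2) \<longleftrightarrow> wfe c \<and> wfe e1 \<and> wfe e2"
| "wfe (ESum x e) \<longleftrightarrow> 4 < x \<and> x < 64 \<and> wfe e"

text \<open>The arrays are interleaved, so that no lengths have to be fixed in advance. As 16 is a
  power of two, four doublings replace a multiplication.\<close>

definition caddr :: "nat \<Rightarrow> nat \<Rightarrow> com" where
  "caddr a r = Seq (Add r r r) (Seq (Add r r r) (Seq (Add r r r) (Seq (Add r r r)
     (Seq (Const (r + 1) a) (Seq (Add r r (r + 1)) (Add r r 3))))))"

text \<open>The result goes to \<open>r\<close>, and temporaries are taken from \<open>r\<close>
  upwards; the index variable of a sum is saved in \<open>r\<close> and restored at the end. A read
  from array 16 first compares the index with the base, because the cells from there on belong to
  the other arrays; it returns 0 for them.\<close>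

fun cexp :: "aexp \<Rightarrow> nat \<Rightarrow> com" where
  "cexp (ENum c) r = Const r c"
| "cexp (EVar x) r = Seq (Const r 0) (Add r x r)"
| "cexp (EIdx a e) r = Seq (cexp e r) (if a < 16 then Seq (caddr a r) (Load r r)
     else Seq (Sub (r + 1) 3 r) (If_nz (r + 1) (Load r r) (Const r 0)))"
| "cexp (EAdd e1 e2) r = Seq (cexp e1 r) (Seq (cexp e2 (r + 1)) (Add r r (r + 1)))"
| "cexp (ESub e1 e2) r = Seq (cexp e1 r) (Seq (cexp e2 (r + 1)) (Sub r r (r + 1)))"
| "cexp (EIf c e1 e2) r = Seq (cexp c r) (If_nz r (cexp e1 r) (cexp e2 r))"
| "cexp (ESum x e) r =
     Seq (Const r 0) (Seq (Add r r x) (Seq (Const (r + 1) 0) (Seq (Const (r + 2) 0)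
     (Seq (Add (r + 2) (r + 2) 1) (Seq (Const x 0) (Seq
       (While_nz (r + 2) (Seq (cexp e (r + 3)) (Seq (Add (r + 1) (r + 1) (r + 3))
         (Seq (Const (r + 3) 1) (Seq (Add x x (r + 3)) (Sub (r + 2) (r + 2) (r + 3)))))))
     (Seq (Const (r + 2) 0) (Seq (Add x r (r + 2)) (Add r (r + 1) (r + 2))))))))))"

abbreviation "sum_loop e x r \<equiv> While_nz (r + 2) (Seq (cexp e (r + 3)) (Seq (Add (r + 1) (r + 1) (r + 3))
  (Seq (Const (r + 3) 1) (Seq (Add x x (r + 3)) (Sub (r + 2) (r + 2) (r + 3))))))"

definition rel :: "(nat \<Rightarrow> nat) \<Rightarrow> (nat \<Rightarrow> nat \<Rightarrow> nat) \<Rightarrow> (nat \<Rightarrow> nat) \<Rightarrow> bool" where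
  "rel R A M \<longleftrightarrow> (\<forall>i. A 16 i = (if i < R 3 then M i else 0)) \<and>
     (\<forall>a<16. \<forall>i. A a i = M (R 3 + a + 16 * i))"

text \<open>\<open>W\<close> bounds the lengths of all stored numbers and also the range of the
  sums, so that running times become polynomials in \<open>W\<close> alone. Temporaries may be
  longer.\<close>

definition bnd :: "nat \<Rightarrow> (nat \<Rightarrow> nat) \<Rightarrow> (nat \<Rightarrow> nat) \<Rightarrow> bool" where
  "bnd W R M \<longleftrightarrow> (\<forall>x<64. R x < 2 ^ W) \<and> (\<forall>i. M i < 2 ^ W) \<and> R 1 \<le> W"

lemma bnd_cong: "bnd W R M \<Longrightarrow> (\<And>x. x < 64 \<Longrightarrow> R' x = R x) \<Longrightarrow> bnd W R' M"
  by (simp add: bnd_def)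

lemma rel_cong: "rel R A M \<Longrightarrow> R' 3 = R 3 \<Longrightarrow> rel R' A M"
  by (simp add: rel_def)

lemma eval_cong: "wfe e \<Longrightarrow> (\<And>x. x < 64 \<Longrightarrow> v x = v' x) \<Longrightarrow> eval e v A = eval e v' A"
proof (induction e arbitrary: v v')
  case (ESum x e)
  have "eval e (v(x := i)) A = eval e (v'(x := i)) A" for i
    by (rule ESum.IH) (use ESum.prems in auto)
  moreover have "v 1 = v' 1" using ESum.prems(2)[of 1] by simp
  ultimately show ?case by simp
next
  case (EIf e1 e2 e3)
  have "eval e1 v A = eval e1 v' A" "eval e2 v A = eval e2 v' A" "eval e3 v A = eval e3 v' A"
    by (rule EIf.IH; use EIf.prems in simp)+
  then show ?case by simp
next
  case (EIdx a e)
  have "eval e v A = eval e v' A" by (rule EIdx.IH) (use EIdx.prems in simp_all)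
  then show ?case by simp
next
  case (EAdd e1 e2)
  have "eval e1 v A = eval e1 v' A" "eval e2 v A = eval e2 v' A"
    by (rule EAdd.IH; use EAdd.prems in simp)+
  then show ?case by simp
next
  case (ESub e1 e2)
  have "eval e1 v A = eval e1 v' A" "eval e2 v A = eval e2 v' A"
    by (rule ESub.IH; use ESub.prems in simp)+
  then show ?case by simp
qed simp_all

lemma poly_nat_mono: "(a :: nat) \<le> b \<Longrightarrow> poly p a \<le> poly p b"
  by (induction p) (auto intro!: add_mono mult_mono)

abbreviation "eval_bounded e q \<equiv> \<forall>v A W. (\<forall>x<64. v x < 2 ^ W) \<longrightarrow> (\<forall>a\<le>16. \<forall>i. A a i < 2 ^ W) \<longrightarrow>
  v 1 \<le> W \<longrightarrow> eval e v A < 2 ^ poly q W"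

text \<open>Intermediate values are not capped. Their lengths still grow only polynomially: a sum
  has at most \<open>W < 2 ^ W\<close> terms, and there are no products.\<close>

lemma eval_bound:
  assumes "wfe e"
  shows "\<exists>q. eval_bounded e q"
  using assms
proof (induction e)
  case (ENum c)
  show ?case by (rule exI[of _ "[:c:]"]) simp
next
  case (EVar x)
  then show ?case by (intro exI[of _ "[:0, 1:]"]) simp
next
  case (EIdx a e)
  then show ?case by (intro exI[of _ "[:0, 1:]"]) simp
next
  case (EAdd e1 e2)
  then obtain q1 q2 where q: "eval_bounded e1 q1" "eval_bounded e2 q2" by auto
  have *: "a + b < (2 :: nat) ^ (m + n + 1)" if "a < 2 ^ m" "b < 2 ^ n" for a b m n :: nat
  proof -
    have "a < 2 ^ (m + n)" "b < 2 ^ (m + n)" using that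
      by (meson le_add1 le_add2 less_le_trans one_le_numeral power_increasing)+
    then show ?thesis by simp
  qed
  show ?case
  proof (rule exI[of _ "q1 + q2 + 1"], intro allI impI)
    fix v :: "nat \<Rightarrow> nat" and A :: "nat \<Rightarrow> nat \<Rightarrow> nat" and W
    assume b: "\<forall>x<64. v x < 2 ^ W" "\<forall>a\<le>16. \<forall>i. A a i < 2 ^ W" "v 1 \<le> W"
    show "eval (EAdd e1 e2) v A < 2 ^ poly (q1 + q2 + 1) W"
      using *[OF q(1)[THEN spec, THEN spec, THEN spec, THEN mp, THEN mp, THEN mp, OF b]
        q(2)[THEN spec, THEN spec, THEN spec, THEN mp, THEN mp, THEN mp, OF b]] by simp
  qed
next
  case (ESub e1 e2)
  then obtain q where q: "eval_bounded e1 q" by auto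
  show ?case by (rule exI[of _ q]) (use q in \<open>auto intro: le_less_trans[OF diff_le_self]\<close>)
next
  case (EIf e1 e2 e3)
  then obtain q1 q2 where q: "eval_bounded e2 q1" "eval_bounded e3 q2" by auto
  have *: "a < (2 :: nat) ^ (m + n)" if "a < 2 ^ m \<or> a < 2 ^ n" for a m n :: nat
    using that by (meson le_add1 le_add2 less_le_trans one_le_numeral power_increasing)
  show ?case
  proof (rule exI[of _ "q1 + q2"], intro allI impI)
    fix v :: "nat \<Rightarrow> nat" and A :: "nat \<Rightarrow> nat \<Rightarrow> nat" and W
    assume b: "\<forall>x<64. v x < 2 ^ W" "\<forall>a\<le>16. \<forall>i. A a i < 2 ^ W" "v 1 \<le> W"
    show "eval (EIf e1 e2 e3) v A < 2 ^ poly (q1 + q2) W"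
      using *[OF disjI1, OF q(1)[THEN spec, THEN spec, THEN spec, THEN mp, THEN mp, THEN mp, OF b], of "poly q2 W"]
        *[OF disjI2, OF q(2)[THEN spec, THEN spec, THEN spec, THEN mp, THEN mp, THEN mp, OF b], of "poly q1 W"] by simp
  qed
next
  case (ESum x e)
  then obtain q where q: "eval_bounded e q" by auto
  show ?case
  proof (rule exI[of _ "[:0, 1:] + q"], intro allI impI)
    fix v :: "nat \<Rightarrow> nat" and A :: "nat \<Rightarrow> nat \<Rightarrow> nat" and W
    assume b: "\<forall>x<64. v x < 2 ^ W" "\<forall>a\<le>16. \<forall>i. A a i < 2 ^ W" "v 1 \<le> W"
    have "eval e (v(x := i)) A < 2 ^ poly q W" if "i < v 1" for i
    proof -
      have "W < 2 ^ W" by simp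
      then have "i < 2 ^ W" using that b by linarith
      then show ?thesis using q[rule_format, of "v(x := i)" W A] b ESum.prems by auto
    qed
    then have "(\<Sum>i<v 1. eval e (v(x := i)) A) \<le> (\<Sum>i<v 1. 2 ^ poly q W)"
      by (intro sum_mono) (auto intro: less_imp_le)
    also have "\<dots> = v 1 * 2 ^ poly q W" by simp
    also have "\<dots> < 2 ^ W * 2 ^ poly q W"
      using b(3) by (intro mult_strict_right_mono) (auto intro: le_less_trans)
    finally show "eval (ESum x e) v A < 2 ^ poly ([:0, 1:] + q) W" by (simp add: power_add)
  qed
qed

lemma rel_bnd: "rel R A M \<Longrightarrow> bnd W R M \<Longrightarrow> a \<le> 16 \<Longrightarrow> A a i < 2 ^ W"
  by (cases "a = 16") (auto simp: rel_def bnd_def)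

lemma eval_bound_state:
  assumes "wfe e"
  obtains q where "\<And>R A M W. bnd W R M \<Longrightarrow> rel R A M \<Longrightarrow> eval e R A < 2 ^ poly q W"
proof -
  obtain q where "eval_bounded e q" using eval_bound[OF assms] by blast
  then show ?thesis using rel_bnd by (intro that[of q]) (auto simp: bnd_def)
qed

lemma pow2_mono_less: "a < 2 ^ m \<Longrightarrow> m \<le> n \<Longrightarrow> a < (2 :: nat) ^ n"
  by (meson less_le_trans one_le_numeral power_increasing)

lemma run_caddr:
  assumes "R r < 2 ^ L" "R 3 < 2 ^ L" "64 \<le> r" "a < 16"
  shows "\<exists>R'. run (caddr a r) (R, M) (100 + 20 * L) (R', M) \<and> R' r = R 3 + a + 16 * R r \<and> (\<forall>x<r. R' x = R x)"
proof -
  \<comment> \<open>Five extra bits suffice, since the largest number is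
    \<open>16 * R r + a + R 3\<close>, which is below \<open>32 * 2 ^ L\<close>.\<close>
  let ?L = "L + 5"
  have p: "2 ^ (L + 5) = 32 * (2 ^ L :: nat)" "1 \<le> (2 ^ L :: nat)" by (simp_all add: power_add)
  have b: "R r < 2 ^ ?L" "2 * R r < 2 ^ ?L" "4 * R r < 2 ^ ?L" "8 * R r < 2 ^ ?L"
    "16 * R r < 2 ^ ?L" "a < 2 ^ ?L" "16 * R r + a < 2 ^ ?L" "R 3 < 2 ^ ?L"
    using assms(1,2,4) p by - (simp only: p(1), linarith)+
  let ?R1 = "R(r := 2 * R r)"
  let ?R2 = "R(r := 4 * R r)"
  let ?R3 = "R(r := 8 * R r)"
  let ?R4 = "R(r := 16 * R r)"
  let ?R5 = "?R4(r + 1 := a)"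
  let ?R6 = "?R5(r := 16 * R r + a)"
  let ?R7 = "?R6(r := 16 * R r + a + R 3)"
  have s1: "run (Add r r r) (R, M) (1 + 2 * ?L) (?R1, M)"
    using run_Add[of R r ?L r r M] b(1) by (simp flip: mult_2)
  have s2: "run (Add r r r) (?R1, M) (1 + 2 * ?L) (?R2, M)"
    using run_Add[of ?R1 r ?L r r M] b by simp
  have s3: "run (Add r r r) (?R2, M) (1 + 2 * ?L) (?R3, M)"
    using run_Add[of ?R2 r ?L r r M] b by simp
  have s4: "run (Add r r r) (?R3, M) (1 + 2 * ?L) (?R4, M)"
    using run_Add[of ?R3 r ?L r r M] b by simp
  have s5: "run (Const (r + 1) a) (?R4, M) (1 + ?L) (?R5, M)"
    by (rule run_Const) (use b in simp)
  have s6: "run (Add r r (r + 1)) (?R5, M) (1 + 2 * ?L) (?R6, M)"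
    using run_Add[of ?R5 r ?L "r + 1" r M] b by simp
  have s7: "run (Add r r 3) (?R6, M) (1 + 2 * ?L) (?R7, M)"
    using run_Add[of ?R6 r ?L 3 r M] b assms(3) by simp
  have "run (caddr a r) (R, M) (100 + 20 * L) (?R7, M)" unfolding caddr_def
    by (rule run_mono[OF run_Seq[OF s1 run_Seq[OF s2 run_Seq[OF s3 run_Seq[OF s4 run_Seq[OF s5 run_Seq[OF s6 s7]]]]]]]) simp
  then show ?thesis by (intro exI[of _ ?R7]) simp
qed

text \<open>The induction is on the countdown register, that is, on the number of passes still to
  come; the accumulator already holds the first \<open>v 1 - m\<close> terms.\<close>

lemma run_sum_loop:
  assumes body: "\<And>R. bnd W R M \<Longrightarrow> rel R A M \<Longrightarrow> \<exists>R'. run (cexp e (r + 3)) (R, M) C (R', M) \<and>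
      R' (r + 3) = eval e R A \<and> (\<forall>y<r + 3. R' y = R y)"
    and val: "\<And>R. bnd W R M \<Longrightarrow> rel R A M \<Longrightarrow> eval e R A < 2 ^ Q"
    and e: "wfe e" "4 < x" "x < 64" "64 \<le> r"
    and base: "bnd W v M" "rel v A M"
  shows "m \<le> v 1 \<Longrightarrow> (\<forall>y<64. y \<noteq> x \<longrightarrow> R y = v y) \<Longrightarrow> R x = v 1 - m \<Longrightarrow> R (r + 2) = m \<Longrightarrow>
    R (r + 1) = (\<Sum>i<v 1 - m. eval e (v(x := i)) A) \<Longrightarrow>
    \<exists>R'. run (sum_loop e x r) (R, M)
       (1 + m * (20 + C + 9 * (W + Q))) (R', M) \<and>
     R' (r + 1) = (\<Sum>i<v 1. eval e (v(x := i)) A) \<and> (\<forall>y\<le>r. y \<noteq> x \<longrightarrow> R' y = R y)"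
proof (induction m arbitrary: R)
  case 0
  then show ?case using run_While_False[of R "r + 2" _ M] by (intro exI[of _ R]) auto
next
  case (Suc m)
  let ?n = "v 1"
  let ?i = "?n - Suc m"
  let ?L = "W + Q + 1"
  have nW: "?n \<le> W" using base by (simp add: bnd_def)
  have small: "y < 2 ^ ?L" if "y \<le> W" for y
    using pow2_mono_less[OF le_less_trans[OF that less_exp], of ?L] by simp
  have R: "bnd W R M" "rel R A M"
  proof -
    have "R y < 2 ^ W" if "y < 64" for y
    proof (cases "y = x")
      case True
      then have "R y \<le> W" using Suc.prems nW by simp
      then show ?thesis by (rule le_less_trans[OF _ less_exp])
    next
      case False
      then show ?thesis using Suc.prems base that by (simp add: bnd_def)
    qed
    then show "bnd W R M" using base Suc.prems e by (simp add: bnd_def)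
    show "rel R A M" by (rule rel_cong[OF base(2)]) (use Suc.prems e in simp)
  qed
  have ev: "eval e R A = eval e (v(x := ?i)) A"
    by (rule eval_cong) (use Suc.prems e in auto)
  obtain R1 where R1: "run (cexp e (r + 3)) (R, M) C (R1, M)" "R1 (r + 3) = eval e R A"
    "\<And>y. y < r + 3 \<Longrightarrow> R1 y = R y" using body[OF R] by blast
  have x: "x \<noteq> r" "x < r" "x \<noteq> r + 1" "x \<noteq> r + 2" "x \<noteq> r + 3" using e by auto
  have evb: "eval e (v(x := i)) A < 2 ^ Q" if "i < ?n" for i
  proof (rule val)
    have "i \<le> W" using that nW by simp
    then have "i < 2 ^ W" by (rule le_less_trans[OF _ less_exp])
    then show "bnd W (v(x := i)) M" using base e by (auto simp: bnd_def)
    show "rel (v(x := i)) A M" by (rule rel_cong[OF base(2)]) (use e in simp)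
  qed
  have "(\<Sum>i<?i. eval e (v(x := i)) A) \<le> (\<Sum>i<?i. 2 ^ Q)"
    using evb by (intro sum_mono) (auto intro: less_imp_le)
  also have "\<dots> \<le> W * 2 ^ Q" using nW by simp
  also have "\<dots> < 2 ^ W * 2 ^ Q" using less_exp[of W] by simp
  finally have acc: "(\<Sum>i<?i. eval e (v(x := i)) A) < 2 ^ (W + Q)" by (simp add: power_add)
  let ?R2 = "R1(r + 1 := R1 (r + 1) + R1 (r + 3))"
  let ?R3 = "?R2(r + 3 := 1)"
  let ?R4 = "?R3(x := R1 x + 1)"
  let ?R5 = "?R4(r + 2 := m)"
  have s2: "run (Add (r + 1) (r + 1) (r + 3)) (R1, M) (1 + 2 * ?L) (?R2, M)"
  proof (rule run_Add)
    have "R1 (r + 1) = R (r + 1)" by (rule R1(3)) simp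
    then show "R1 (r + 1) < 2 ^ ?L" unfolding Suc.prems(5) using pow2_mono_less[OF acc, of ?L] by simp
    show "R1 (r + 3) < 2 ^ ?L" using R1(2) pow2_mono_less[OF val[OF R], of ?L] by simp
  qed
  have s3: "run (Const (r + 3) 1) (?R2, M) (1 + ?L) (?R3, M)"
    by (rule run_Const[OF one_less_power]) simp_all
  have s4: "run (Add x x (r + 3)) (?R3, M) (1 + 2 * ?L) (?R4, M)"
    using run_Add[of ?R3 x ?L "r + 3" x M] x R1(3)[of x] Suc.prems nW small by simp
  have s5: "run (Sub (r + 2) (r + 2) (r + 3)) (?R4, M) (1 + 2 * ?L) (?R5, M)"
    using run_Sub[of ?R4 "r + 2" ?L "r + 3" "r + 2" M] x R1(3)[of "r + 2"] Suc.prems nW small by simp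
  have "\<exists>R'. run (sum_loop e x r) (?R5, M)
       (1 + m * (20 + C + 9 * (W + Q))) (R', M) \<and>
     R' (r + 1) = (\<Sum>i<v 1. eval e (v(x := i)) A) \<and> (\<forall>y\<le>r. y \<noteq> x \<longrightarrow> R' y = ?R5 y)"
  proof (rule Suc.IH)
    have eq: "?n - m = Suc ?i" using Suc.prems by simp
    show "m \<le> ?n" using Suc.prems by simp
    show "\<forall>y<64. y \<noteq> x \<longrightarrow> ?R5 y = v y" using Suc.prems x e R1(3) by auto
    show "?R5 x = ?n - m" using Suc.prems x R1(3)[of x] eq by simp
    show "?R5 (r + 2) = m" by simp
    show "?R5 (r + 1) = (\<Sum>i<?n - m. eval e (v(x := i)) A)"
    proof -
      have "?R5 (r + 1) = R (r + 1) + eval e R A" using x R1(2) R1(3)[of "r + 1"] by simp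
      then show ?thesis unfolding Suc.prems(5) ev eq by simp
    qed
  qed
  then obtain R' where R': "run (sum_loop e x r) (?R5, M)
       (1 + m * (20 + C + 9 * (W + Q))) (R', M)"
     "R' (r + 1) = (\<Sum>i<v 1. eval e (v(x := i)) A)" "\<forall>y\<le>r. y \<noteq> x \<longrightarrow> R' y = ?R5 y" by blast
  have "run (sum_loop e x r) (R, M)
       (1 + Suc m * (20 + C + 9 * (W + Q))) (R', M)"
    by (rule run_mono[OF run_While_True[OF _ _ run_Seq[OF R1(1) run_Seq[OF s2 run_Seq[OF s3 run_Seq[OF s4 s5]]]] R'(1), of ?L]])
      (use Suc.prems small[of "Suc m"] nW in \<open>auto\<close>)
  moreover have "\<forall>y\<le>r. y \<noteq> x \<longrightarrow> R' y = R y" using R'(3) R1(3) by auto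
  ultimately show ?case using R'(2) by blast
qed

text \<open>The induction varies \<open>r\<close>, since subexpressions are evaluated into higher
  registers in order to spare the results already computed.\<close>

lemma run_cexp:
  assumes "wfe e" "64 \<le> r"
  shows "\<exists>p. \<forall>R M A W. bnd W R M \<longrightarrow> rel R A M \<longrightarrow> (\<exists>R'. run (cexp e r) (R, M) (poly p W) (R', M) \<and>
    R' r = eval e R A \<and> (\<forall>x<r. R' x = R x))"
  using assms
proof (induction e arbitrary: r)
  case (ENum c)
  have "run (Const r c) (R, M) (poly [:1 + c:] W) (R(r := c), M)" for R M W
    using run_Const[of c c r R M] by (simp add: less_exp)
  then have "\<exists>R'. run (cexp (ENum c) r) (R, M) (poly [:1 + c:] W) (R', M) \<and>
      R' r = eval (ENum c) R A \<and> (\<forall>x<r. R' x = R x)" for R M A W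
    by (intro exI[of _ "R(r := c)"]) simp
  then show ?case by blast
next
  case (EVar x)
  show ?case
  proof (rule exI[of _ "[:2, 2:] :: nat poly"], intro allI impI)
    fix R M A W assume b: "bnd W R M" "rel R A M"
    have x: "x < r" "R x < 2 ^ W" using EVar b by (auto simp: bnd_def)
    have "run (cexp (EVar x) r) (R, M) ((1 + 0) + (1 + 2 * W)) (R(r := R x), M)"
      using run_Seq[OF run_Const[of 0 0 r R M] run_Add[of "R(r := 0)" x W r r M]] x by simp
    then show "\<exists>R'. run (cexp (EVar x) r) (R, M) (poly [:2, 2:] W) (R', M) \<and>
        R' r = eval (EVar x) R A \<and> (\<forall>x<r. R' x = R x)"
      by (intro exI[of _ "R(r := R x)"]) (auto elim!: run_mono)
  qed
next
  case (EIdx a e)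
  then obtain p where p: "\<And>R M A W. bnd W R M \<Longrightarrow> rel R A M \<Longrightarrow> \<exists>R'. run (cexp e r) (R, M) (poly p W) (R', M) \<and>
    R' r = eval e R A \<and> (\<forall>x<r. R' x = R x)" by fastforce
  obtain q where q: "\<And>R A M W. bnd W R M \<Longrightarrow> rel R A M \<Longrightarrow> eval e R A < 2 ^ poly q W"
    using eval_bound_state EIdx.prems by auto
  let ?p = "p + [:200, 30:] + 30 * q"
  show ?case
  proof (rule exI[of _ ?p], intro allI impI)
    fix R M A W assume b: "bnd W R M" "rel R A M"
    obtain R1 where R1: "run (cexp e r) (R, M) (poly p W) (R1, M)" "R1 r = eval e R A"
      "\<And>x. x < r \<Longrightarrow> R1 x = R x" using p[OF b] by blast
    have b3: "R1 3 = R 3" using R1 EIdx.prems by simp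
    let ?L = "W + poly q W"
    have "R 3 < 2 ^ W" using b(1) by (simp add: bnd_def)
    then have bL: "R1 r < 2 ^ ?L" "R1 3 < 2 ^ ?L"
      using pow2_mono_less[OF q[OF b], of ?L] pow2_mono_less[of "R 3" W ?L] R1(2) b3 by simp_all
    have bM: "M i < 2 ^ (?L + 6)" for i using b by (auto simp: bnd_def intro: pow2_mono_less)
    show "\<exists>R'. run (cexp (EIdx a e) r) (R, M) (poly ?p W) (R', M) \<and>
        R' r = eval (EIdx a e) R A \<and> (\<forall>x<r. R' x = R x)"
    proof (cases "a < 16")
      case True
      obtain R2 where R2: "run (caddr a r) (R1, M) (100 + 20 * ?L) (R2, M)"
        "R2 r = R1 3 + a + 16 * R1 r" "\<And>x. x < r \<Longrightarrow> R2 x = R1 x"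
        using run_caddr[OF bL EIdx.prems(2) True, of M] by blast
      have "R2 r < 2 ^ (?L + 6)"
      proof -
        have "2 ^ (?L + 6) = 64 * (2 ^ ?L :: nat)" "1 \<le> (2 ^ ?L :: nat)" by (simp_all add: power_add)
        then show ?thesis using R2(2) True bL by linarith
      qed
      then have s: "run (Load r r) (R2, M) (1 + 2 * (?L + 6)) (R2(r := M (R2 r)), M)"
        by (intro run_Load bM)
      have "run (cexp (EIdx a e) r) (R, M) (poly ?p W) (R2(r := M (R2 r)), M)"
        using run_Seq[OF R1(1) run_Seq[OF R2(1) s]] True by (auto elim!: run_mono)
      moreover have "M (R2 r) = eval (EIdx a e) R A" using R2(2) R1(2) b(2) True b3 by (simp add: rel_def)
      ultimately show ?thesis using R2(3) R1(3) by (intro exI[of _ "R2(r := M (R2 r))"]) auto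
    next
      case False
      then have a: "a = 16" using EIdx.prems by simp
      let ?R2 = "R1(r + 1 := R1 3 - R1 r)"
      let ?R3 = "?R2(r := if R1 3 - R1 r \<noteq> 0 then M (R1 r) else 0)"
      have s1: "run (Sub (r + 1) 3 r) (R1, M) (1 + 2 * ?L) (?R2, M)" using run_Sub bL by blast
      have s2: "run (If_nz (r + 1) (Load r r) (Const r 0)) (?R2, M) (1 + ?L + (1 + 2 * (?L + 6))) (?R3, M)"
      proof (rule run_If)
        show "?R2 (r + 1) < 2 ^ ?L" using bL by (auto intro: le_less_trans[OF diff_le_self])
        show "run (Load r r) (?R2, M) (1 + 2 * (?L + 6)) (?R3, M)" if "?R2 (r + 1) \<noteq> 0"
          using run_Load[of ?R2 r "?L + 6" M r] bM pow2_mono_less[OF bL(1), of "?L + 6"] that by simp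
        show "run (Const r 0) (?R2, M) (1 + 2 * (?L + 6)) (?R3, M)" if "?R2 (r + 1) = 0"
          using run_Const[of 0 0 r ?R2 M] that by (auto elim: run_mono)
      qed
      have "run (cexp (EIdx a e) r) (R, M) (poly ?p W) (?R3, M)"
        using run_Seq[OF R1(1) run_Seq[OF s1 s2]] a by (auto elim!: run_mono)
      moreover have "?R3 r = eval (EIdx a e) R A" using R1(2) b(2) a b3 by (simp add: rel_def)
      ultimately show ?thesis using R1(3) by (intro exI[of _ ?R3]) auto
    qed
  qed
next
  case (EAdd e1 e2)
  then obtain p1 where p1: "\<And>R M A W. bnd W R M \<Longrightarrow> rel R A M \<Longrightarrow> \<exists>R'. run (cexp e1 r) (R, M) (poly p1 W) (R', M) \<and>
    R' r = eval e1 R A \<and> (\<forall>x<r. R' x = R x)" by fastforce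
  from EAdd obtain p2 where p2: "\<And>R M A W. bnd W R M \<Longrightarrow> rel R A M \<Longrightarrow> \<exists>R'. run (cexp e2 (r + 1)) (R, M) (poly p2 W) (R', M) \<and>
    R' (r + 1) = eval e2 R A \<and> (\<forall>x<r + 1. R' x = R x)" by fastforce
  obtain q1 where q1: "\<And>R A M W. bnd W R M \<Longrightarrow> rel R A M \<Longrightarrow> eval e1 R A < 2 ^ poly q1 W"
    using eval_bound_state EAdd.prems by auto
  obtain q2 where q2: "\<And>R A M W. bnd W R M \<Longrightarrow> rel R A M \<Longrightarrow> eval e2 R A < 2 ^ poly q2 W"
    using eval_bound_state EAdd.prems by auto
  let ?p = "p1 + p2 + 1 + 2 * (q1 + q2)"
  show ?case
  proof (rule exI[of _ ?p], intro allI impI)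
    fix R M A W assume b: "bnd W R M" "rel R A M"
    obtain R1 where R1: "run (cexp e1 r) (R, M) (poly p1 W) (R1, M)" "R1 r = eval e1 R A"
      "\<And>x. x < r \<Longrightarrow> R1 x = R x" using p1[OF b] by blast
    have b1: "bnd W R1 M" by (rule bnd_cong[OF b(1)]) (use R1 EAdd.prems in auto)
    have r1: "rel R1 A M" by (rule rel_cong[OF b(2)]) (use R1 EAdd.prems in auto)
    obtain R2 where R2: "run (cexp e2 (r + 1)) (R1, M) (poly p2 W) (R2, M)" "R2 (r + 1) = eval e2 R1 A"
      "\<And>x. x < r + 1 \<Longrightarrow> R2 x = R1 x" using p2[OF b1 r1] by blast
    have e2: "eval e2 R1 A = eval e2 R A" by (rule eval_cong) (use R1 EAdd.prems in auto)
    have s: "run (Add r r (r + 1)) (R2, M) (1 + 2 * (poly q1 W + poly q2 W)) (R2(r := R2 r + R2 (r + 1)), M)"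
      by (rule run_Add) (use R2 R1 e2 q1[OF b] q2[OF b] in \<open>auto intro: pow2_mono_less\<close>)
    have "run (cexp (EAdd e1 e2) r) (R, M) (poly ?p W) (R2(r := R2 r + R2 (r + 1)), M)"
      using run_Seq[OF R1(1) run_Seq[OF R2(1) s]] by (auto elim!: run_mono)
    then show "\<exists>R'. run (cexp (EAdd e1 e2) r) (R, M) (poly ?p W) (R', M) \<and>
        R' r = eval (EAdd e1 e2) R A \<and> (\<forall>x<r. R' x = R x)"
      using R1(2,3) R2(2,3) e2 by (intro exI[of _ "R2(r := R2 r + R2 (r + 1))"]) simp
  qed
next
  case (ESub e1 e2)
  then obtain p1 where p1: "\<And>R M A W. bnd W R M \<Longrightarrow> rel R A M \<Longrightarrow> \<exists>R'. run (cexp e1 r) (R, M) (poly p1 W) (R', M) \<and>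
    R' r = eval e1 R A \<and> (\<forall>x<r. R' x = R x)" by fastforce
  from ESub obtain p2 where p2: "\<And>R M A W. bnd W R M \<Longrightarrow> rel R A M \<Longrightarrow> \<exists>R'. run (cexp e2 (r + 1)) (R, M) (poly p2 W) (R', M) \<and>
    R' (r + 1) = eval e2 R A \<and> (\<forall>x<r + 1. R' x = R x)" by fastforce
  obtain q1 where q1: "\<And>R A M W. bnd W R M \<Longrightarrow> rel R A M \<Longrightarrow> eval e1 R A < 2 ^ poly q1 W"
    using eval_bound_state ESub.prems by auto
  obtain q2 where q2: "\<And>R A M W. bnd W R M \<Longrightarrow> rel R A M \<Longrightarrow> eval e2 R A < 2 ^ poly q2 W"
    using eval_bound_state ESub.prems by auto
  let ?p = "p1 + p2 + 1 + 2 * (q1 + q2)"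
  show ?case
  proof (rule exI[of _ ?p], intro allI impI)
    fix R M A W assume b: "bnd W R M" "rel R A M"
    obtain R1 where R1: "run (cexp e1 r) (R, M) (poly p1 W) (R1, M)" "R1 r = eval e1 R A"
      "\<And>x. x < r \<Longrightarrow> R1 x = R x" using p1[OF b] by blast
    have b1: "bnd W R1 M" by (rule bnd_cong[OF b(1)]) (use R1 ESub.prems in auto)
    have r1: "rel R1 A M" by (rule rel_cong[OF b(2)]) (use R1 ESub.prems in auto)
    obtain R2 where R2: "run (cexp e2 (r + 1)) (R1, M) (poly p2 W) (R2, M)" "R2 (r + 1) = eval e2 R1 A"
      "\<And>x. x < r + 1 \<Longrightarrow> R2 x = R1 x" using p2[OF b1 r1] by blast
    have e2: "eval e2 R1 A = eval e2 R A" by (rule eval_cong) (use R1 ESub.prems in auto)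
    have s: "run (Sub r r (r + 1)) (R2, M) (1 + 2 * (poly q1 W + poly q2 W)) (R2(r := R2 r - R2 (r + 1)), M)"
      by (rule run_Sub) (use R2 R1 e2 q1[OF b] q2[OF b] in \<open>auto intro: pow2_mono_less\<close>)
    have "run (cexp (ESub e1 e2) r) (R, M) (poly ?p W) (R2(r := R2 r - R2 (r + 1)), M)"
      using run_Seq[OF R1(1) run_Seq[OF R2(1) s]] by (auto elim!: run_mono)
    then show "\<exists>R'. run (cexp (ESub e1 e2) r) (R, M) (poly ?p W) (R', M) \<and>
        R' r = eval (ESub e1 e2) R A \<and> (\<forall>x<r. R' x = R x)"
      using R1(2,3) R2(2,3) e2 by (intro exI[of _ "R2(r := R2 r - R2 (r + 1))"]) simp
  qed
next
  case (EIf e0 e1 e2)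
  then obtain p0 where p0: "\<And>R M A W. bnd W R M \<Longrightarrow> rel R A M \<Longrightarrow> \<exists>R'. run (cexp e0 r) (R, M) (poly p0 W) (R', M) \<and>
    R' r = eval e0 R A \<and> (\<forall>x<r. R' x = R x)" by fastforce
  from EIf obtain p1 where p1: "\<And>R M A W. bnd W R M \<Longrightarrow> rel R A M \<Longrightarrow> \<exists>R'. run (cexp e1 r) (R, M) (poly p1 W) (R', M) \<and>
    R' r = eval e1 R A \<and> (\<forall>x<r. R' x = R x)" by fastforce
  from EIf obtain p2 where p2: "\<And>R M A W. bnd W R M \<Longrightarrow> rel R A M \<Longrightarrow> \<exists>R'. run (cexp e2 r) (R, M) (poly p2 W) (R', M) \<and>
    R' r = eval e2 R A \<and> (\<forall>x<r. R' x = R x)" by fastforce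
  obtain q where q: "\<And>R A M W. bnd W R M \<Longrightarrow> rel R A M \<Longrightarrow> eval e0 R A < 2 ^ poly q W"
    using eval_bound_state EIf.prems by auto
  let ?p = "p0 + 1 + q + (p1 + p2)"
  show ?case
  proof (rule exI[of _ ?p], intro allI impI)
    fix R M A W assume b: "bnd W R M" "rel R A M"
    obtain R1 where R1: "run (cexp e0 r) (R, M) (poly p0 W) (R1, M)" "R1 r = eval e0 R A"
      "\<And>x. x < r \<Longrightarrow> R1 x = R x" using p0[OF b] by blast
    have b1: "bnd W R1 M" by (rule bnd_cong[OF b(1)]) (use R1 EIf.prems in auto)
    have r1: "rel R1 A M" by (rule rel_cong[OF b(2)]) (use R1 EIf.prems in auto)
    have e1: "eval e1 R1 A = eval e1 R A" by (rule eval_cong) (use R1 EIf.prems in auto)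
    have e2: "eval e2 R1 A = eval e2 R A" by (rule eval_cong) (use R1 EIf.prems in auto)
    have "\<exists>R2. (if R1 r \<noteq> 0 then run (cexp e1 r) (R1, M) (poly p1 W + poly p2 W) (R2, M)
          else run (cexp e2 r) (R1, M) (poly p1 W + poly p2 W) (R2, M)) \<and>
        R2 r = eval (EIf e0 e1 e2) R A \<and> (\<forall>x<r. R2 x = R1 x)"
    proof (cases "R1 r = 0")
      case True
      obtain R2 where "run (cexp e2 r) (R1, M) (poly p2 W) (R2, M)" "R2 r = eval e2 R1 A" "\<forall>x<r. R2 x = R1 x"
        using p2[OF b1 r1] by blast
      then show ?thesis using True R1(2) e2 by (intro exI[of _ R2]) (auto elim: run_mono)
    next
      case False
      obtain R2 where "run (cexp e1 r) (R1, M) (poly p1 W) (R2, M)" "R2 r = eval e1 R1 A" "\<forall>x<r. R2 x = R1 x"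
        using p1[OF b1 r1] by blast
      then show ?thesis using False R1(2) e1 by (intro exI[of _ R2]) (auto elim: run_mono)
    qed
    then obtain R2 where R2: "R1 r \<noteq> 0 \<Longrightarrow> run (cexp e1 r) (R1, M) (poly p1 W + poly p2 W) (R2, M)"
       "R1 r = 0 \<Longrightarrow> run (cexp e2 r) (R1, M) (poly p1 W + poly p2 W) (R2, M)"
       "R2 r = eval (EIf e0 e1 e2) R A" "\<forall>x<r. R2 x = R1 x" by (auto split: if_splits)
    have "run (If_nz r (cexp e1 r) (cexp e2 r)) (R1, M) (1 + poly q W + (poly p1 W + poly p2 W)) (R2, M)"
      by (rule run_If) (use q[OF b] R1(2) R2 in auto)
    then have "run (cexp (EIf e0 e1 e2) r) (R, M) (poly ?p W) (R2, M)"
      using run_Seq[OF R1(1)] by (fastforce elim!: run_mono)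
    then show "\<exists>R'. run (cexp (EIf e0 e1 e2) r) (R, M) (poly ?p W) (R', M) \<and>
        R' r = eval (EIf e0 e1 e2) R A \<and> (\<forall>x<r. R' x = R x)"
      using R2(3,4) R1(3) by (intro exI[of _ R2]) auto
  qed
next
  case (ESum x e)
  have "64 \<le> r + 3" "wfe e" using ESum.prems by auto
  from ESum.IH[OF this(2,1)] obtain p where p: "\<And>R M A W. bnd W R M \<Longrightarrow> rel R A M \<Longrightarrow>
    \<exists>R'. run (cexp e (r + 3)) (R, M) (poly p W) (R', M) \<and>
    R' (r + 3) = eval e R A \<and> (\<forall>x<r + 3. R' x = R x)" by blast
  obtain q where q: "\<And>R A M W. bnd W R M \<Longrightarrow> rel R A M \<Longrightarrow> eval e R A < 2 ^ poly q W"
    using eval_bound_state ESum.prems by auto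
  let ?p = "[:20, 20:] + [:0, 1:] * (20 + p + 9 * ([:0, 1:] + q)) + 20 * q"
  show ?case
  proof (rule exI[of _ ?p], intro allI impI)
    fix R M A W assume b: "bnd W R M" "rel R A M"
    let ?L = "W + poly q W"
    have x: "4 < x" "x < 64" "x < r" "x \<noteq> r" "x \<noteq> r + 1" "x \<noteq> r + 2" using ESum.prems by auto
    have Rx: "R x < 2 ^ ?L" and R1: "R 1 < 2 ^ ?L" "R 1 \<le> W"
      using b x pow2_mono_less[of "R x" W ?L] pow2_mono_less[of "R 1" W ?L] by (simp_all add: bnd_def)
    have r: "64 \<le> r" by fact
    let ?R1 = "R(r := 0)"
    let ?R2 = "R(r := R x)"
    let ?R3 = "?R2(r + 1 := 0)"
    let ?R4 = "?R3(r + 2 := 0)"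
    let ?R5 = "?R3(r + 2 := R 1)"
    let ?R6 = "?R5(x := 0)"
    have s1: "run (Const r 0) (R, M) (1 + 0) (?R1, M)" by (rule run_Const) simp
    have s2: "run (Add r r x) (?R1, M) (1 + 2 * ?L) (?R2, M)"
      using run_Add[of ?R1 r ?L x r M] x Rx by simp
    have s3: "run (Const (r + 1) 0) (?R2, M) (1 + 0) (?R3, M)" by (rule run_Const) simp
    have s4: "run (Const (r + 2) 0) (?R3, M) (1 + 0) (?R4, M)" by (rule run_Const) simp
    have s5: "run (Add (r + 2) (r + 2) 1) (?R4, M) (1 + 2 * ?L) (?R5, M)"
      using run_Add[of ?R4 "r + 2" ?L 1 "r + 2" M] R1 r by simp
    have s6: "run (Const x 0) (?R5, M) (1 + 0) (?R6, M)" by (rule run_Const) simp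
    have ex: "\<exists>R'. run (sum_loop e x r) (?R6, M)
       (1 + R 1 * (20 + poly p W + 9 * (W + poly q W))) (R', M) \<and>
     R' (r + 1) = (\<Sum>i<R 1. eval e (R(x := i)) A) \<and> (\<forall>y\<le>r. y \<noteq> x \<longrightarrow> R' y = ?R6 y)"
      by (rule run_sum_loop[where A = A]) (use p q b x r ESum.prems in auto)
    then obtain R7 where R7: "run (sum_loop e x r) (?R6, M)
       (1 + R 1 * (20 + poly p W + 9 * (W + poly q W))) (R7, M)"
       "R7 (r + 1) = eval (ESum x e) R A" "\<And>y. y \<le> r \<Longrightarrow> y \<noteq> x \<Longrightarrow> R7 y = ?R6 y" by auto
    have evb: "eval e (R(x := i)) A < 2 ^ poly q W" if "i < R 1" for i
    proof (rule q)
      have "i \<le> W" using that R1(2) by simp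
      then have "i < 2 ^ W" by (rule le_less_trans[OF _ less_exp])
      then show "bnd W (R(x := i)) M" using b x by (auto simp: bnd_def)
      show "rel (R(x := i)) A M" by (rule rel_cong[OF b(2)]) (use x in simp)
    qed
    have "(\<Sum>i<R 1. eval e (R(x := i)) A) \<le> (\<Sum>i<R 1. 2 ^ poly q W)"
      using evb by (intro sum_mono) (auto intro: less_imp_le)
    also have "\<dots> \<le> W * 2 ^ poly q W" using R1 by simp
    also have "\<dots> < 2 ^ W * 2 ^ poly q W" using less_exp[of W] by simp
    finally have acc: "R7 (r + 1) < 2 ^ ?L" using R7(2) by (simp add: power_add)
    have R7r: "R7 r = R x" using R7(3)[of r] x by simp
    let ?R8 = "R7(r + 2 := 0)"
    let ?R9 = "?R8(x := R x)"
    let ?R10 = "?R9(r := R7 (r + 1))"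
    have s8: "run (Const (r + 2) 0) (R7, M) (1 + 0) (?R8, M)" by (rule run_Const) simp
    have s9: "run (Add x r (r + 2)) (?R8, M) (1 + 2 * ?L) (?R9, M)"
      using run_Add[of ?R8 r ?L "r + 2" x M] R7r Rx by simp
    have s10: "run (Add r (r + 1) (r + 2)) (?R9, M) (1 + 2 * ?L) (?R10, M)"
      using run_Add[of ?R9 "r + 1" ?L "r + 2" r M] x acc by simp
    \<comment> \<open>Naming \<open>K\<close> and the difference \<open>z\<close> turns the
      comparison of the products \<open>R 1 * K\<close> and \<open>W * K\<close> into linear
      arithmetic.\<close>
    define K where "K = 20 + poly p W + 9 * (W + poly q W)"
    have RK: "R 1 * K \<le> W * K" using R1 by (intro mult_le_mono1)
    have pW: "poly ?p W = 20 + 20 * W + W * K + 20 * poly q W" by (simp add: K_def algebra_simps)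
    obtain z where z: "W * K = R 1 * K + z" using RK by (auto simp only: le_iff_add)
    have le: "R 1 * K + 8 * (W + poly q W) + 10 \<le> poly ?p W" unfolding pW z by simp
    have "run (cexp (ESum x e) r) (R, M) (poly ?p W) (?R10, M)"
      unfolding cexp.simps
      by (intro run_mono[OF run_Seq[OF s1 run_Seq[OF s2 run_Seq[OF s3 run_Seq[OF s4 run_Seq[OF s5 run_Seq[OF s6
        run_Seq[OF R7(1)[folded K_def] run_Seq[OF s8 run_Seq[OF s9 s10]]]]]]]]] order_trans[OF _ le]]) simp
    moreover have "?R10 r = eval (ESum x e) R A" using R7(2) by simp
    moreover have "?R10 y = R y" if "y < r" for y
      using that R7(3)[of y] by auto
    ultimately show "\<exists>R'. run (cexp (ESum x e) r) (R, M) (poly ?p W) (R', M) \<and>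
        R' r = eval (ESum x e) R A \<and> (\<forall>x<r. R' x = R x)"
      by (intro exI[of _ ?R10]) blast
  qed
qed

section \<open>Commands, their meaning and their compiled cost\<close>

datatype hcom =
    HSkip
  | HAsg nat aexp
  | HPut nat aexp aexp
  | HSeq hcom hcom
  | HIf aexp hcom hcom
  | HFor nat nat hcom

type_synonym hstate = "(nat \<Rightarrow> nat) \<times> (nat \<Rightarrow> nat \<Rightarrow> nat)"

text \<open>Every stored value is cut off at register 2. Thus every well-formed program preserves
  \<open>bnd\<close>, and the correctness proofs have to show that the cut does not take
  effect.\<close>

fun sem :: "hcom \<Rightarrow> hstate \<Rightarrow> hstate" where
  "sem HSkip s = s"
| "sem (HAsg x e) (v, A) = (v(x := min (eval e v A) (v 2)), A)"
| "sem (HPut a e1 e2) (v, A) = (v, A(a := (A a)(eval e1 v A := min (eval e2 v A) (v 2))))"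
| "sem (HSeq c1 c2) s = sem c2 (sem c1 s)"
| "sem (HIf e c1 c2) (v, A) = (if eval e v A \<noteq> 0 then sem c1 (v, A) else sem c2 (v, A))"
| "sem (HFor x y c) (v, A) = fold (\<lambda>i (v, A). sem c (v(x := i), A)) [0..<v y] (v, A)"

fun wfc :: "hcom \<Rightarrow> bool" where
  "wfc HSkip \<longleftrightarrow> True"
| "wfc (HAsg x e) \<longleftrightarrow> (x = 0 \<or> 4 < x \<and> x < 64) \<and> wfe e"
| "wfc (HPut a e1 e2) \<longleftrightarrow> a < 16 \<and> wfe e1 \<and> wfe e2"
| "wfc (HSeq c1 c2) \<longleftrightarrow> wfc c1 \<and> wfc c2"
| "wfc (HIf e c1 c2) \<longleftrightarrow> wfe e \<and> wfc c1 \<and> wfc c2"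
| "wfc (HFor x y c) \<longleftrightarrow> 4 < x \<and> x < 64 \<and> (y = 1 \<or> y = 4) \<and> wfc c"

text \<open>Loops over register 4 may be exponentially long, while those over register 1 are
  absorbed by the polynomial. Only the nesting counts, as consecutive loops merely add up.\<close>

fun long_depth :: "hcom \<Rightarrow> nat" where
  "long_depth (HSeq c1 c2) = max (long_depth c1) (long_depth c2)"
| "long_depth (HIf e c1 c2) = max (long_depth c1) (long_depth c2)"
| "long_depth (HFor x y c) = (if y = 4 then 1 else 0) + long_depth c"
| "long_depth _ = 0"

text \<open>The cut-off is \<open>e - (e - cap)\<close> in truncated subtraction. A loop keeps its
  counters in \<open>r\<close> and \<open>r + 1\<close> and copies the index into \<open>x\<close>
  before each pass, so that the body may overwrite \<open>x\<close>.\<close>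

fun ccom :: "hcom \<Rightarrow> nat \<Rightarrow> com" where
  "ccom HSkip r = Skip"
| "ccom (HAsg x e) r = Seq (cexp e r) (Seq (Sub (r + 1) r 2) (Seq (Sub r r (r + 1))
     (Seq (Const (r + 1) 0) (Add x r (r + 1)))))"
| "ccom (HPut a e1 e2) r = Seq (cexp e1 r) (Seq (caddr a r) (Seq (cexp e2 (r + 1))
     (Seq (Sub (r + 2) (r + 1) 2) (Seq (Sub (r + 1) (r + 1) (r + 2)) (Store r (r + 1))))))"
| "ccom (HSeq c1 c2) r = Seq (ccom c1 r) (ccom c2 r)"
| "ccom (HIf e c1 c2) r = Seq (cexp e r) (If_nz r (ccom c1 r) (ccom c2 r))"
| "ccom (HFor x y c) r = Seq (Const r 0) (Seq (Add r r y) (Seq (Const (r + 1) 0)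
     (While_nz r (Seq (Const (r + 2) 0) (Seq (Add x (r + 1) (r + 2)) (Seq (ccom c (r + 2))
       (Seq (Const (r + 2) 1) (Seq (Add (r + 1) (r + 1) (r + 2)) (Sub r r (r + 2))))))))))"

abbreviation "for_loop c x r \<equiv> While_nz r (Seq (Const (r + 2) 0) (Seq (Add x (r + 1) (r + 2))
  (Seq (ccom c (r + 2)) (Seq (Const (r + 2) 1) (Seq (Add (r + 1) (r + 1) (r + 2)) (Sub r r (r + 2)))))))"

lemma fold_upt_invariant:
  assumes "P 0 s" "\<And>i s. i < n \<Longrightarrow> P i s \<Longrightarrow> P (Suc i) (f i s)"
  shows "P n (fold f [0..<n] s)"
proof -
  have "m \<le> n \<Longrightarrow> P m (fold f [0..<m] s)" for m
    by (induction m) (use assms in auto)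
  then show ?thesis by simp
qed

lemma sem_preserves:
  "wfc c \<Longrightarrow> x \<in> {1, 2, 3, 4} \<union> {64..} \<Longrightarrow> fst (sem c s) x = fst s x"
proof (induction c arbitrary: s)
  case (HFor z y c)
  obtain v A where s: "s = (v, A)" by (cases s)
  have "fst (fold (\<lambda>i (v, A). sem c (v(z := i), A)) [0..<v y] (v, A)) x = v x"
  proof (rule fold_upt_invariant[where P = "\<lambda>_ s. fst s x = v x"])
    fix i and s' :: hstate assume "fst s' x = v x"
    moreover have "z \<noteq> x" using HFor.prems by auto
    ultimately show "fst (case s' of (v, A) \<Rightarrow> sem c (v(z := i), A)) x = v x"
      using HFor.IH HFor.prems by (auto split: prod.splits)
  qed simp
  then show ?case by (simp add: s)
next
  case (HAsg z e)
  then show ?case by (cases s) auto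
next
  case (HPut a e1 e2)
  then show ?case by (cases s) auto
next
  case (HIf e c1 c2)
  then show ?case by (cases s) auto
qed simp_all

lemma rel_update:
  assumes "rel R A M" "a < 16"
  shows "rel R (A(a := (A a)(i := y))) (M(R 3 + a + 16 * i := y))"
proof -
  have "a' = a \<and> i' = i" if "a' + 16 * i' = a + 16 * i" "a' < 16" for a' i'
    using that assms(2) by presburger
  then show ?thesis using assms unfolding rel_def by fastforce
qed

text \<open>The same \<open>W\<close> bounds the state before and after, so that the costs of
  consecutive commands and of the passes of a loop simply add up.\<close>

definition ccom_ok :: "hcom \<Rightarrow> nat \<Rightarrow> nat poly \<Rightarrow> bool" where
  "ccom_ok c r p \<longleftrightarrow> (\<forall>R M A v W. (\<forall>x<64. R x = v x) \<longrightarrow> bnd W R M \<longrightarrow> rel R A M \<longrightarrow>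
     (\<exists>R' M'. run (ccom c r) (R, M) (poly p W * (v 4 + 1) ^ long_depth c) (R', M') \<and>
       (\<forall>x<64. R' x = fst (sem c (v, A)) x) \<and> rel R' (snd (sem c (v, A))) M' \<and> bnd W R' M' \<and>
       (\<forall>x. 64 \<le> x \<and> x < r \<longrightarrow> R' x = R x)))"

lemma ccom_okD:
  assumes "ccom_ok c r p" "\<And>x. x < 64 \<Longrightarrow> R x = v x" "bnd W R M" "rel R A M"
  obtains R' M' where "run (ccom c r) (R, M) (poly p W * (v 4 + 1) ^ long_depth c) (R', M')"
    "\<And>x. x < 64 \<Longrightarrow> R' x = fst (sem c (v, A)) x" "rel R' (snd (sem c (v, A))) M'" "bnd W R' M'"
    "\<And>x. 64 \<le> x \<Longrightarrow> x < r \<Longrightarrow> R' x = R x"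
  using assms unfolding ccom_ok_def by blast

lemma run_for_loop:
  fixes v :: "nat \<Rightarrow> nat"
  assumes c: "ccom_ok c (r + 2) p" "wfc c" and x: "4 < x" "x < 64" and y: "y = 1 \<or> y = 4" and r: "64 \<le> r"
    and n: "n < 2 ^ W"
  defines "f \<equiv> \<lambda>i (v, A). sem c (v(x := i), A)"
  shows "m \<le> n \<Longrightarrow> (v', A') = fold f [0..<n - m] (v, A) \<Longrightarrow> (\<And>x. x < 64 \<Longrightarrow> R x = v' x) \<Longrightarrow>
    bnd W R M \<Longrightarrow> rel R A' M \<Longrightarrow> R r = m \<Longrightarrow> R (r + 1) = n - m \<Longrightarrow>
    \<exists>R' M'. run (for_loop c x r) (R, M)
       (1 + m * (20 + 10 * W + poly p W * (v 4 + 1) ^ long_depth c)) (R', M') \<and>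
     (\<forall>x<64. R' x = fst (fold f [0..<n] (v, A)) x) \<and> rel R' (snd (fold f [0..<n] (v, A))) M' \<and>
     bnd W R' M' \<and> (\<forall>x. 64 \<le> x \<and> x < r \<longrightarrow> R' x = R x)"
proof (induction m arbitrary: R M v' A')
  case 0
  let ?s = "fold f [0..<n] (v, A)"
  have s: "?s = (v', A')" using 0(2) by simp
  have "run (for_loop c x r) (R, M) 1 (R, M)"
    by (rule run_While_False) (use 0 in simp)
  then show ?case unfolding s using 0(3-5) by (intro exI[of _ R] exI[of _ M]) simp
next
  case (Suc m)
  let ?i = "n - Suc m"
  have eq: "n - m = Suc ?i" using Suc.prems by simp
  \<comment> \<open>No body changes the range of the long loops, so all passes share one time
    bound.\<close>
  have v4: "v' 4 = v 4"
  proof -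
    have "fst (fold f [0..<?i] (v, A)) 4 = v 4"
    proof (rule fold_upt_invariant[where P = "\<lambda>_ s. fst s 4 = v 4"])
      show "fst (f i s) 4 = v 4" if "fst s 4 = v 4" for i s
        using sem_preserves[OF c(2), of 4] that x by (auto simp: f_def split: prod.splits)
    qed simp
    then show ?thesis using Suc.prems(2) by (metis fst_conv)
  qed
  let ?R1 = "R(r + 2 := 0)"
  let ?R2 = "?R1(x := ?i)"
  have i: "?i < 2 ^ W" using n by (rule le_less_trans[rotated]) simp
  have xr: "x \<noteq> r" "x \<noteq> r + 1" "x \<noteq> r + 2" using x r by auto
  have s1: "run (Const (r + 2) 0) (R, M) (1 + 0) (?R1, M)" by (rule run_Const) simp
  have s2: "run (Add x (r + 1) (r + 2)) (?R1, M) (1 + 2 * W) (?R2, M)"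
    using run_Add[of ?R1 "r + 1" W "r + 2" x M] Suc.prems(7) i by simp
  have b2: "bnd W ?R2 M" using Suc.prems(4) i x r by (auto simp: bnd_def)
  have r2: "rel ?R2 A' M" by (rule rel_cong[OF Suc.prems(5)]) (use x r in simp)
  have a2: "?R2 z = (v'(x := ?i)) z" if "z < 64" for z using Suc.prems(3) that r by simp
  obtain R3 M3 where R3: "run (ccom c (r + 2)) (?R2, M) (poly p W * ((v'(x := ?i)) 4 + 1) ^ long_depth c) (R3, M3)"
    "\<And>z. z < 64 \<Longrightarrow> R3 z = fst (sem c (v'(x := ?i), A')) z" "rel R3 (snd (sem c (v'(x := ?i), A'))) M3"
    "bnd W R3 M3" "\<And>z. 64 \<le> z \<Longrightarrow> z < r + 2 \<Longrightarrow> R3 z = ?R2 z"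
    using ccom_okD[OF c(1) a2 b2 r2] by blast
  have v4': "(v'(x := ?i)) 4 = v 4" using v4 x by simp
  have R3r: "R3 r = Suc m" "R3 (r + 1) = ?i"
    using R3(5)[of r] R3(5)[of "r + 1"] r Suc.prems(6,7) xr by auto
  let ?R4 = "R3(r + 2 := 1)"
  let ?R5 = "?R4(r + 1 := Suc ?i)"
  let ?R6 = "?R5(r := m)"
  \<comment> \<open>One bit more than \<open>W\<close>, since for \<open>W = 0\<close> not even the
    constant 1 would fit.\<close>
  have m: "Suc m < 2 ^ (W + 1)" "?i < 2 ^ (W + 1)" "1 < (2 :: nat) ^ (W + 1)"
    using Suc.prems(1) n i by (auto intro: one_less_power)
  have s4: "run (Const (r + 2) 1) (R3, M3) (1 + (W + 1)) (?R4, M3)"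
    by (rule run_Const) (use m in simp)
  have s5: "run (Add (r + 1) (r + 1) (r + 2)) (?R4, M3) (1 + 2 * (W + 1)) (?R5, M3)"
    using run_Add[of ?R4 "r + 1" "W + 1" "r + 2" "r + 1" M3] R3r m by simp
  have s6: "run (Sub r r (r + 2)) (?R5, M3) (1 + 2 * (W + 1)) (?R6, M3)"
    using run_Sub[of ?R5 r "W + 1" "r + 2" r M3] R3r m by simp
  obtain v3 A3 where vA3: "sem c (v'(x := ?i), A') = (v3, A3)" by fastforce
  have step: "(v3, A3) = fold f [0..<n - m] (v, A)"
    unfolding eq using Suc.prems(2)[symmetric] vA3 by (simp add: f_def)
  have b6: "bnd W ?R6 M3" by (rule bnd_cong[OF R3(4)]) (use r in auto)
  have r6: "rel ?R6 A3 M3" by (rule rel_cong) (use R3(3) vA3 r in auto)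
  have a6: "?R6 z = v3 z" if "z < 64" for z using R3(2)[OF that] vA3 that r by simp
  have "\<exists>R' M'. run (for_loop c x r) (?R6, M3)
       (1 + m * (20 + 10 * W + poly p W * (v 4 + 1) ^ long_depth c)) (R', M') \<and>
     (\<forall>x<64. R' x = fst (fold f [0..<n] (v, A)) x) \<and> rel R' (snd (fold f [0..<n] (v, A))) M' \<and>
     bnd W R' M' \<and> (\<forall>x. 64 \<le> x \<and> x < r \<longrightarrow> R' x = ?R6 x)"
    by (rule Suc.IH[OF _ step a6 b6 r6]) (use Suc.prems(1) eq in auto)
  then obtain R' M' where R': "run (for_loop c x r) (?R6, M3)
       (1 + m * (20 + 10 * W + poly p W * (v 4 + 1) ^ long_depth c)) (R', M')"
     "\<forall>x<64. R' x = fst (fold f [0..<n] (v, A)) x" "rel R' (snd (fold f [0..<n] (v, A))) M'"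
     "bnd W R' M'" "\<forall>x. 64 \<le> x \<and> x < r \<longrightarrow> R' x = ?R6 x" by blast
  have "run (for_loop c x r) (R, M)
       (1 + Suc m * (20 + 10 * W + poly p W * (v 4 + 1) ^ long_depth c)) (R', M')"
    by (rule run_mono[OF run_While_True[OF _ _ run_Seq[OF s1 run_Seq[OF s2 run_Seq[OF R3(1)[unfolded v4']
          run_Seq[OF s4 run_Seq[OF s5 s6]]]]] R'(1), of "W + 1"]])
      (use Suc.prems(6) m in auto)
  moreover have "\<forall>z. 64 \<le> z \<and> z < r \<longrightarrow> R' z = R z"
    using R'(5) R3(5) x by auto
  ultimately show ?case using R'(2-4) by blast
qed

lemma run_ccom:
  assumes "wfc c" "64 \<le> r"
  shows "\<exists>p. ccom_ok c r p"
  using assms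
proof (induction c arbitrary: r)
  case HSkip
  have "ccom_ok HSkip r 1"
    unfolding ccom_ok_def using run_Skip by (auto intro!: exI)
  then show ?case by blast
next
  case (HAsg x e)
  obtain p where p: "\<And>R M A W. bnd W R M \<Longrightarrow> rel R A M \<Longrightarrow> \<exists>R'. run (cexp e r) (R, M) (poly p W) (R', M) \<and>
    R' r = eval e R A \<and> (\<forall>x<r. R' x = R x)" using run_cexp[of e r] HAsg by auto
  obtain q where q: "\<And>R A M W. bnd W R M \<Longrightarrow> rel R A M \<Longrightarrow> eval e R A < 2 ^ poly q W"
    using eval_bound_state HAsg.prems by auto
  let ?p = "p + 10 + 10 * ([:0, 1:] + q)"
  have "ccom_ok (HAsg x e) r ?p" unfolding ccom_ok_def
  proof (intro allI impI)
    fix R M A v W assume a: "\<forall>x<64. R x = (v x :: nat)" and b: "bnd W R M" "rel R A M"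
    obtain R1 where R1: "run (cexp e r) (R, M) (poly p W) (R1, M)" "R1 r = eval e R A"
      "\<And>x. x < r \<Longrightarrow> R1 x = R x" using p[OF b] by blast
    have ev: "eval e R A = eval e v A" by (rule eval_cong) (use a HAsg.prems in auto)
    let ?L = "W + poly q W"
    have r: "64 \<le> r" by fact
    have R2: "R1 2 = v 2" "R 2 < 2 ^ W" using R1(3)[of 2] a r b(1) by (auto simp: bnd_def)
    have bL: "R1 r < 2 ^ ?L" "R1 2 < 2 ^ ?L"
      using pow2_mono_less[OF q[OF b], of ?L] pow2_mono_less[OF R2(2), of ?L] R1(2) R2 a by auto
    let ?w = "min (eval e v A) (v 2)"
    let ?R2 = "R1(r + 1 := R1 r - R1 2)"
    let ?R3 = "?R2(r := ?w)"
    let ?R4 = "?R3(r + 1 := 0)"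
    let ?R5 = "?R4(x := ?w)"
    have w: "?w < 2 ^ ?L" "?w < 2 ^ W" using bL R2 a by auto
    have s2: "run (Sub (r + 1) r 2) (R1, M) (1 + 2 * ?L) (?R2, M)" by (rule run_Sub) (use bL in auto)
    have s3: "run (Sub r r (r + 1)) (?R2, M) (1 + 2 * ?L) (?R3, M)"
    proof -
      have "run (Sub r r (r + 1)) (?R2, M) (1 + 2 * ?L) (?R2(r := ?R2 r - ?R2 (r + 1)), M)"
        by (rule run_Sub) (use bL in \<open>auto intro: le_less_trans[OF diff_le_self]\<close>)
      moreover have "?R2 r - ?R2 (r + 1) = ?w" using R1(2) R2(1) ev by (auto simp: min_def)
      ultimately show ?thesis by simp
    qed
    have s4: "run (Const (r + 1) 0) (?R3, M) (1 + 0) (?R4, M)" by (rule run_Const) simp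
    have s5: "run (Add x r (r + 1)) (?R4, M) (1 + 2 * ?L) (?R5, M)"
      using run_Add[of ?R4 r ?L "r + 1" x M] w by simp
    have "run (ccom (HAsg x e) r) (R, M) (poly ?p W * (v 4 + 1) ^ long_depth (HAsg x e)) (?R5, M)"
      unfolding ccom.simps
      by (rule run_mono[OF run_Seq[OF R1(1) run_Seq[OF s2 run_Seq[OF s3 run_Seq[OF s4 s5]]]]]) simp
    moreover have "\<forall>z<64. ?R5 z = fst (sem (HAsg x e) (v, A)) z"
      using R1(3) a r by auto
    moreover have "rel ?R5 (snd (sem (HAsg x e) (v, A))) M"
      by (rule rel_cong[of R]) (use b R1(3) r HAsg.prems in auto)
    moreover have "bnd W ?R5 M"
    proof -
      have "?R5 z < 2 ^ W" if "z < 64" for z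
        using that R1(3)[of z] r b(1) w by (auto simp: bnd_def)
      moreover have "?R5 1 = R 1" using R1(3)[of 1] r HAsg.prems by auto
      ultimately show ?thesis using b(1) by (simp add: bnd_def)
    qed
    moreover have "\<forall>z. 64 \<le> z \<and> z < r \<longrightarrow> ?R5 z = R z" using R1(3) HAsg.prems by auto
    ultimately show "\<exists>R' M'. run (ccom (HAsg x e) r) (R, M) (poly ?p W * (v 4 + 1) ^ long_depth (HAsg x e)) (R', M') \<and>
       (\<forall>z<64. R' z = fst (sem (HAsg x e) (v, A)) z) \<and> rel R' (snd (sem (HAsg x e) (v, A))) M' \<and> bnd W R' M' \<and>
       (\<forall>x. 64 \<le> x \<and> x < r \<longrightarrow> R' x = R x)" by blast
  qed
  then show ?case by blast
next
  case (HPut a e1 e2)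
  have r: "64 \<le> r" "64 \<le> r + 1" using HPut.prems by auto
  obtain p1 where p1: "\<And>R M A W. bnd W R M \<Longrightarrow> rel R A M \<Longrightarrow> \<exists>R'. run (cexp e1 r) (R, M) (poly p1 W) (R', M) \<and>
    R' r = eval e1 R A \<and> (\<forall>x<r. R' x = R x)" using run_cexp[of e1 r] HPut r by auto
  obtain p2 where p2: "\<And>R M A W. bnd W R M \<Longrightarrow> rel R A M \<Longrightarrow> \<exists>R'. run (cexp e2 (r + 1)) (R, M) (poly p2 W) (R', M) \<and>
    R' (r + 1) = eval e2 R A \<and> (\<forall>x<r + 1. R' x = R x)" using run_cexp[of e2 "r + 1"] HPut r by fastforce
  obtain q1 where q1: "\<And>R A M W. bnd W R M \<Longrightarrow> rel R A M \<Longrightarrow> eval e1 R A < 2 ^ poly q1 W"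
    using eval_bound_state HPut.prems by auto
  obtain q2 where q2: "\<And>R A M W. bnd W R M \<Longrightarrow> rel R A M \<Longrightarrow> eval e2 R A < 2 ^ poly q2 W"
    using eval_bound_state HPut.prems by auto
  let ?p = "p1 + p2 + 200 + 30 * ([:0, 1:] + q1 + q2)"
  have "ccom_ok (HPut a e1 e2) r ?p" unfolding ccom_ok_def
  proof (intro allI impI)
    fix R M A v W assume a: "\<forall>x<64. R x = (v x :: nat)" and b: "bnd W R M" "rel R A M"
    obtain R1 where R1: "run (cexp e1 r) (R, M) (poly p1 W) (R1, M)" "R1 r = eval e1 R A"
      "\<And>x. x < r \<Longrightarrow> R1 x = R x" using p1[OF b] by blast
    have ev1: "eval e1 R A = eval e1 v A" by (rule eval_cong) (use a HPut.prems in auto)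
    have ev2: "eval e2 R A = eval e2 v A" by (rule eval_cong) (use a HPut.prems in auto)
    let ?L = "W + poly q1 W + poly q2 W"
    have R3: "R1 3 = R 3" "R 3 < 2 ^ W" using R1(3)[of 3] r b(1) by (auto simp: bnd_def)
    have bL: "R1 r < 2 ^ ?L" "R1 3 < 2 ^ ?L"
      using pow2_mono_less[OF q1[OF b], of ?L] pow2_mono_less[OF R3(2), of ?L] R1(2) R3(1) by auto
    have a16: "a < 16" using HPut.prems by simp
    obtain R2 where R2: "run (caddr a r) (R1, M) (100 + 20 * ?L) (R2, M)"
      "R2 r = R1 3 + a + 16 * R1 r" "\<And>x. x < r \<Longrightarrow> R2 x = R1 x"
      using run_caddr[OF bL r(1) a16, of M] by blast
    have b2: "bnd W R2 M" by (rule bnd_cong[OF b(1)]) (use R1(3) R2(3) r in auto)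
    have r2: "rel R2 A M" by (rule rel_cong[OF b(2)]) (use R1(3) R2(3) r in auto)
    obtain R4 where R4: "run (cexp e2 (r + 1)) (R2, M) (poly p2 W) (R4, M)" "R4 (r + 1) = eval e2 R2 A"
      "\<And>x. x < r + 1 \<Longrightarrow> R4 x = R2 x" using p2[OF b2 r2] by blast
    have ev2': "eval e2 R2 A = eval e2 v A"
      unfolding ev2[symmetric] by (rule eval_cong) (use HPut.prems R1(3) R2(3) r in auto)
    have lt: "R4 x = R x" if "x < r" for x using R4(3) R2(3) R1(3) that by simp
    let ?adr = "R 3 + a + 16 * eval e1 v A"
    let ?w = "min (eval e2 v A) (v 2)"
    have R4r: "R4 r = ?adr" using R4(3)[of r] R2(2) R3 R1(2) ev1 by simp
    have adr: "?adr < 2 ^ (?L + 6)"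
    proof -
      have "2 ^ (?L + 6) = 64 * (2 ^ ?L :: nat)" "1 \<le> (2 ^ ?L :: nat)" by (simp_all add: power_add)
      then show ?thesis using R4r R4(3)[of r] R2(2) a16 bL by linarith
    qed
    have v2: "R4 2 = v 2" "v 2 < 2 ^ W" using lt[of 2] r a b(1) by (auto simp: bnd_def)
    have bL2: "R4 (r + 1) < 2 ^ ?L" "R4 2 < 2 ^ ?L"
      using pow2_mono_less[OF q2[OF b], of ?L] pow2_mono_less[OF v2(2), of ?L] R4(2) ev2' ev2 v2 by auto
    let ?R5 = "R4(r + 2 := R4 (r + 1) - R4 2)"
    let ?R6 = "?R5(r + 1 := ?w)"
    have w: "?w < 2 ^ ?L" "?w < 2 ^ W" using bL2 v2 by auto
    have s5: "run (Sub (r + 2) (r + 1) 2) (R4, M) (1 + 2 * ?L) (?R5, M)" by (rule run_Sub) (use bL2 in auto)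
    have s6: "run (Sub (r + 1) (r + 1) (r + 2)) (?R5, M) (1 + 2 * ?L) (?R6, M)"
    proof -
      have "run (Sub (r + 1) (r + 1) (r + 2)) (?R5, M) (1 + 2 * ?L) (?R5(r + 1 := ?R5 (r + 1) - ?R5 (r + 2)), M)"
        by (rule run_Sub) (use bL2 in \<open>auto intro: le_less_trans[OF diff_le_self]\<close>)
      moreover have "?R5 (r + 1) - ?R5 (r + 2) = ?w" using R4(2) v2(1) ev2' by (auto simp: min_def)
      ultimately show ?thesis by simp
    qed
    let ?M = "M(?adr := ?w)"
    have s7: "run (Store r (r + 1)) (?R6, M) (1 + 2 * (?L + 6)) (?R6, ?M)"
      using run_Store[of ?R6 r "?L + 6" "r + 1" M] R4r adr pow2_mono_less[OF w(1), of "?L + 6"] by simp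
    have "run (ccom (HPut a e1 e2) r) (R, M) (poly ?p W * (v 4 + 1) ^ long_depth (HPut a e1 e2)) (?R6, ?M)"
      unfolding ccom.simps
      by (rule run_mono[OF run_Seq[OF R1(1) run_Seq[OF R2(1) run_Seq[OF R4(1) run_Seq[OF s5 run_Seq[OF s6 s7]]]]]]) simp
    moreover have "\<forall>z<64. ?R6 z = fst (sem (HPut a e1 e2) (v, A)) z"
      using lt a r by auto
    moreover have "rel ?R6 (snd (sem (HPut a e1 e2) (v, A))) ?M"
      by (rule rel_cong[of R]) (use rel_update[OF b(2) a16] lt[of 3] r in auto)
    moreover have "bnd W ?R6 ?M"
      using b(1) w lt r unfolding bnd_def by auto
    moreover have "\<forall>z. 64 \<le> z \<and> z < r \<longrightarrow> ?R6 z = R z" using lt by auto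
    ultimately show "\<exists>R' M'. run (ccom (HPut a e1 e2) r) (R, M) (poly ?p W * (v 4 + 1) ^ long_depth (HPut a e1 e2)) (R', M') \<and>
       (\<forall>z<64. R' z = fst (sem (HPut a e1 e2) (v, A)) z) \<and> rel R' (snd (sem (HPut a e1 e2) (v, A))) M' \<and> bnd W R' M' \<and>
       (\<forall>x. 64 \<le> x \<and> x < r \<longrightarrow> R' x = R x)" by blast
  qed
  then show ?case by blast
next
  case (HSeq c1 c2)
  then obtain p1 p2 where p: "ccom_ok c1 r p1" "ccom_ok c2 r p2" by fastforce
  have wf: "wfc c1" using HSeq.prems by simp
  have "ccom_ok (HSeq c1 c2) r (p1 + p2)" unfolding ccom_ok_def
  proof (intro allI impI)
    fix R M A v W assume a: "\<forall>x<64. R x = (v x :: nat)" and b: "bnd W R M" "rel R A M"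
    have a': "\<And>x. x < 64 \<Longrightarrow> R x = v x" using a by simp
    obtain v1 A1 where s1: "sem c1 (v, A) = (v1, A1)" by fastforce
    obtain R1 M1 where R1: "run (ccom c1 r) (R, M) (poly p1 W * (v 4 + 1) ^ long_depth c1) (R1, M1)"
      "\<And>x. x < 64 \<Longrightarrow> R1 x = v1 x" "rel R1 A1 M1" "bnd W R1 M1" "\<And>x. 64 \<le> x \<Longrightarrow> x < r \<Longrightarrow> R1 x = R x"
      using ccom_okD[OF p(1) a' b] s1 by (metis fst_conv snd_conv)
    obtain R2 M2 where R2: "run (ccom c2 r) (R1, M1) (poly p2 W * (v1 4 + 1) ^ long_depth c2) (R2, M2)"
      "\<And>x. x < 64 \<Longrightarrow> R2 x = fst (sem c2 (v1, A1)) x" "rel R2 (snd (sem c2 (v1, A1))) M2" "bnd W R2 M2"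
      "\<And>x. 64 \<le> x \<Longrightarrow> x < r \<Longrightarrow> R2 x = R1 x"
      using ccom_okD[OF p(2) R1(2,4,3)] by metis
    have v4: "v1 4 = v 4" using sem_preserves[OF wf, of 4 "(v, A)"] s1 by simp
    have "(v 4 + 1) ^ long_depth c1 \<le> (v 4 + 1) ^ max (long_depth c1) (long_depth c2)"
      "(v 4 + 1) ^ long_depth c2 \<le> (v 4 + 1) ^ max (long_depth c1) (long_depth c2)"
      by (intro power_increasing; simp)+
    then have "poly p1 W * (v 4 + 1) ^ long_depth c1 + poly p2 W * (v 4 + 1) ^ long_depth c2
        \<le> poly (p1 + p2) W * (v 4 + 1) ^ long_depth (HSeq c1 c2)"
      unfolding poly_add distrib_right long_depth.simps by (intro add_mono mult_le_mono2)
    then have "run (ccom (HSeq c1 c2) r) (R, M) (poly (p1 + p2) W * (v 4 + 1) ^ long_depth (HSeq c1 c2)) (R2, M2)"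
      unfolding ccom.simps by (rule run_mono[OF run_Seq[OF R1(1) R2(1)[unfolded v4]]])
    then show "\<exists>R' M'. run (ccom (HSeq c1 c2) r) (R, M) (poly (p1 + p2) W * (v 4 + 1) ^ long_depth (HSeq c1 c2)) (R', M') \<and>
       (\<forall>z<64. R' z = fst (sem (HSeq c1 c2) (v, A)) z) \<and> rel R' (snd (sem (HSeq c1 c2) (v, A))) M' \<and> bnd W R' M' \<and>
       (\<forall>x. 64 \<le> x \<and> x < r \<longrightarrow> R' x = R x)"
      using R2(2-5) R1(5) s1 by (intro exI[of _ R2] exI[of _ M2]) auto
  qed
  then show ?case by blast
next
  case (HIf e c1 c2)
  then obtain p1 p2 where p: "ccom_ok c1 r p1" "ccom_ok c2 r p2" by fastforce
  have r: "64 \<le> r" by fact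
  obtain p0 where p0: "\<And>R M A W. bnd W R M \<Longrightarrow> rel R A M \<Longrightarrow> \<exists>R'. run (cexp e r) (R, M) (poly p0 W) (R', M) \<and>
    R' r = eval e R A \<and> (\<forall>x<r. R' x = R x)" using run_cexp[of e r] HIf.prems by auto
  obtain q where q: "\<And>R A M W. bnd W R M \<Longrightarrow> rel R A M \<Longrightarrow> eval e R A < 2 ^ poly q W"
    using eval_bound_state HIf.prems by auto
  let ?p = "p0 + 1 + q + (p1 + p2)"
  have "ccom_ok (HIf e c1 c2) r ?p" unfolding ccom_ok_def
  proof (intro allI impI)
    fix R M A v W assume a: "\<forall>x<64. R x = (v x :: nat)" and b: "bnd W R M" "rel R A M"
    obtain R1 where R1: "run (cexp e r) (R, M) (poly p0 W) (R1, M)" "R1 r = eval e R A"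
      "\<And>x. x < r \<Longrightarrow> R1 x = R x" using p0[OF b] by blast
    have ev: "eval e R A = eval e v A" by (rule eval_cong) (use a HIf.prems in auto)
    have a1: "\<And>x. x < 64 \<Longrightarrow> R1 x = v x" using a R1(3) r by simp
    have b1: "bnd W R1 M" by (rule bnd_cong[OF b(1)]) (use R1(3) r in auto)
    have r1: "rel R1 A M" by (rule rel_cong[OF b(2)]) (use R1(3) r in auto)
    let ?D = "(v 4 + 1) ^ max (long_depth c1) (long_depth c2)"
    have D: "(v 4 + 1) ^ long_depth c1 \<le> ?D" "(v 4 + 1) ^ long_depth c2 \<le> ?D" "1 \<le> ?D"
      by (intro power_increasing; simp)+ simp
    let ?c = "if eval e v A \<noteq> 0 then c1 else c2"
    have "\<exists>R2 M2. run (ccom ?c r) (R1, M) ((poly p1 W + poly p2 W) * ?D) (R2, M2) \<and>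
      (\<forall>x<64. R2 x = fst (sem ?c (v, A)) x) \<and> rel R2 (snd (sem ?c (v, A))) M2 \<and> bnd W R2 M2 \<and>
      (\<forall>x. 64 \<le> x \<and> x < r \<longrightarrow> R2 x = R1 x)"
    proof (cases "eval e v A = 0")
      case True
      obtain R2 M2 where R2: "run (ccom c2 r) (R1, M) (poly p2 W * (v 4 + 1) ^ long_depth c2) (R2, M2)"
      "\<And>x. x < 64 \<Longrightarrow> R2 x = fst (sem c2 (v, A)) x" "rel R2 (snd (sem c2 (v, A))) M2" "bnd W R2 M2"
      "\<And>x. 64 \<le> x \<Longrightarrow> x < r \<Longrightarrow> R2 x = R1 x"
        using ccom_okD[OF p(2) a1 b1 r1] by metis
      have "poly p2 W * (v 4 + 1) ^ long_depth c2 \<le> (poly p1 W + poly p2 W) * ?D"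
        using D by (intro mult_le_mono) auto
      from run_mono[OF R2(1) this] show ?thesis using R2(2-) True by (intro exI[of _ R2] exI[of _ M2]) simp
    next
      case False
      obtain R2 M2 where R2: "run (ccom c1 r) (R1, M) (poly p1 W * (v 4 + 1) ^ long_depth c1) (R2, M2)"
      "\<And>x. x < 64 \<Longrightarrow> R2 x = fst (sem c1 (v, A)) x" "rel R2 (snd (sem c1 (v, A))) M2" "bnd W R2 M2"
      "\<And>x. 64 \<le> x \<Longrightarrow> x < r \<Longrightarrow> R2 x = R1 x"
        using ccom_okD[OF p(1) a1 b1 r1] by metis
      have "poly p1 W * (v 4 + 1) ^ long_depth c1 \<le> (poly p1 W + poly p2 W) * ?D"
        using D by (intro mult_le_mono) auto
      from run_mono[OF R2(1) this] show ?thesis using R2(2-) False by (intro exI[of _ R2] exI[of _ M2]) simp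
    qed
    then obtain R2 M2 where R2: "run (ccom ?c r) (R1, M) ((poly p1 W + poly p2 W) * ?D) (R2, M2)"
      "\<forall>x<64. R2 x = fst (sem ?c (v, A)) x" "rel R2 (snd (sem ?c (v, A))) M2" "bnd W R2 M2"
      "\<forall>x. 64 \<le> x \<and> x < r \<longrightarrow> R2 x = R1 x" by blast
    have s2: "run (If_nz r (ccom c1 r) (ccom c2 r)) (R1, M) (1 + poly q W + (poly p1 W + poly p2 W) * ?D) (R2, M2)"
      by (rule run_If) (use q[OF b] R1(2) R2(1) ev in auto)
    have "poly p0 W + (1 + poly q W) \<le> (poly p0 W + (1 + poly q W)) * ?D"
      using mult_le_mono2[OF D(3), of "poly p0 W + (1 + poly q W)"] by (simp only: mult_1_right)
    then have le: "poly p0 W + (1 + poly q W + (poly p1 W + poly p2 W) * ?D) \<le> poly ?p W * ?D"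
      by (simp add: algebra_simps)
    have "run (ccom (HIf e c1 c2) r) (R, M) (poly ?p W * (v 4 + 1) ^ long_depth (HIf e c1 c2)) (R2, M2)"
      unfolding ccom.simps long_depth.simps by (rule run_mono[OF run_Seq[OF R1(1) s2] le])
    moreover have "sem (HIf e c1 c2) (v, A) = sem ?c (v, A)" by simp
    ultimately show "\<exists>R' M'. run (ccom (HIf e c1 c2) r) (R, M) (poly ?p W * (v 4 + 1) ^ long_depth (HIf e c1 c2)) (R', M') \<and>
       (\<forall>z<64. R' z = fst (sem (HIf e c1 c2) (v, A)) z) \<and> rel R' (snd (sem (HIf e c1 c2) (v, A))) M' \<and> bnd W R' M' \<and>
       (\<forall>x. 64 \<le> x \<and> x < r \<longrightarrow> R' x = R x)"
      using R2(2-5) R1(3) by (intro exI[of _ R2] exI[of _ M2]) simp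
  qed
  then show ?case by blast
next
  case (HFor x y c)
  have wf: "4 < x" "x < 64" "y = 1 \<or> y = 4" "wfc c" "64 \<le> r + 2" and r: "64 \<le> r" using HFor.prems by auto
  obtain p where p: "ccom_ok c (r + 2) p" using HFor.IH wf by blast
  let ?p = "[:20, 20:] + [:1, 1:] * ([:20, 10:] + p)"
  have "ccom_ok (HFor x y c) r ?p" unfolding ccom_ok_def
  proof (intro allI impI)
    fix R M A v W assume a: "\<forall>x<64. R x = (v x :: nat)" and b: "bnd W R M" "rel R A M"
    have y: "y < 64" "v y < 2 ^ W" "R y = v y" "y \<noteq> r" using wf(3) a b(1) r by (auto simp: bnd_def)
    let ?f = "\<lambda>i (v, A). sem c (v(x := i), A)"
    let ?s = "fold ?f [0..<v y] (v, A)"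
    let ?R1 = "R(r := 0)"
    let ?R2 = "R(r := v y)"
    let ?R3 = "?R2(r + 1 := 0)"
    have s1: "run (Const r 0) (R, M) (1 + 0) (?R1, M)" by (rule run_Const) simp
    have s2: "run (Add r r y) (?R1, M) (1 + 2 * W) (?R2, M)"
      using run_Add[of ?R1 r W y r M] y by simp
    have s3: "run (Const (r + 1) 0) (?R2, M) (1 + 0) (?R3, M)" by (rule run_Const) simp
    have b3: "bnd W ?R3 M" by (rule bnd_cong[OF b(1)]) (use r in auto)
    have r3: "rel ?R3 A M" by (rule rel_cong[OF b(2)]) (use r in auto)
    have "\<exists>R' M'. run (for_loop c x r) (?R3, M)
       (1 + v y * (20 + 10 * W + poly p W * (v 4 + 1) ^ long_depth c)) (R', M') \<and>
     (\<forall>x<64. R' x = fst ?s x) \<and> rel R' (snd ?s) M' \<and>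
     bnd W R' M' \<and> (\<forall>x. 64 \<le> x \<and> x < r \<longrightarrow> R' x = ?R3 x)"
      by (rule run_for_loop[OF p wf(4,1,2,3) r y(2) order_refl _ _ b3 r3]) (use a r in auto)
    then obtain R' M' where R': "run (for_loop c x r) (?R3, M)
       (1 + v y * (20 + 10 * W + poly p W * (v 4 + 1) ^ long_depth c)) (R', M')"
     "\<forall>x<64. R' x = fst ?s x" "rel R' (snd ?s) M'" "bnd W R' M'" "\<forall>x. 64 \<le> x \<and> x < r \<longrightarrow> R' x = ?R3 x"
      by blast
    let ?D = "(v 4 + 1) ^ long_depth c"
    let ?E = "(v 4 + 1) ^ long_depth (HFor x y c)"
    have D1: "1 \<le> ?D" "1 \<le> ?E" by simp_all
    have pE: "poly ?p W * z = (20 + 20 * W) * z + (1 + W) * (20 + 10 * W + poly p W) * z" for z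
      by (simp add: algebra_simps)
    have le1: "20 + 10 * W + poly p W * ?D \<le> (20 + 10 * W + poly p W) * ?D"
      using D1(1) mult_le_mono2[OF D1(1), of "20 + 10 * W"] by (simp add: algebra_simps)
    \<comment> \<open>A loop over register 4 uses up the additional factor in \<open>?E\<close>; a
      loop over register 1 makes at most \<open>W\<close> passes.\<close>
    have "v y * ?D \<le> (1 + W) * ?E"
    proof (cases "y = 4")
      case True
      then have "v y * ?D \<le> ?E" by simp
      then show ?thesis by (simp add: trans_le_add1)
    next
      case False
      then have "y = 1" using wf by simp
      then have "v y \<le> 1 + W" using a b(1) by (simp add: bnd_def)
      then have "v y * ?D \<le> (1 + W) * ?D" by (rule mult_le_mono1)
      then show ?thesis using False by simp
    qed
    then have "v y * ?D * (20 + 10 * W + poly p W) \<le> (1 + W) * ?E * (20 + 10 * W + poly p W)"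
      by (rule mult_le_mono1)
    moreover have "v y * (20 + 10 * W + poly p W * ?D) \<le> v y * ((20 + 10 * W + poly p W) * ?D)"
      using le1 by (rule mult_le_mono2)
    ultimately have "v y * (20 + 10 * W + poly p W * ?D) \<le> (1 + W) * (20 + 10 * W + poly p W) * ?E"
      by (simp only: mult.assoc mult.commute mult.left_commute)
    moreover have "5 + 2 * W \<le> (20 + 20 * W) * ?E"
      by (rule order_trans[OF _ mult_le_mono2[OF D1(2)]]) simp
    ultimately have le: "(1 + 0) + ((1 + 2 * W) + ((1 + 0) + (1 + v y * (20 + 10 * W + poly p W * ?D)))) \<le> poly ?p W * ?E"
      unfolding pE by linarith
    have "run (ccom (HFor x y c) r) (R, M) (poly ?p W * ?E) (R', M')"
      unfolding ccom.simps by (rule run_mono[OF run_Seq[OF s1 run_Seq[OF s2 run_Seq[OF s3 R'(1)]]] le])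
    then show "\<exists>R' M'. run (ccom (HFor x y c) r) (R, M) (poly ?p W * ?E) (R', M') \<and>
       (\<forall>z<64. R' z = fst (sem (HFor x y c) (v, A)) z) \<and> rel R' (snd (sem (HFor x y c) (v, A))) M' \<and> bnd W R' M' \<and>
       (\<forall>x. 64 \<le> x \<and> x < r \<longrightarrow> R' x = R x)"
      using R'(2-5) by (intro exI[of _ R'] exI[of _ M']) simp
  qed
  then show ?case by blast
qed

section \<open>Derived expressions\<close>

definition "eLt a b = ESub b a"
definition "eNot e = EIf e (ENum 0) (ENum 1)"
definition "eAnd a b = EIf a (EIf b (ENum 1) (ENum 0)) (ENum 0)"
definition "eOr a b = EIf a (ENum 1) (EIf b (ENum 1) (ENum 0))"
definition "eEq a b = eNot (EAdd (ESub a b) (ESub b a))"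
definition "eEx x e = EIf (ESum x e) (ENum 1) (ENum 0)"
definition "eCnt x e = ESum x (EIf e (ENum 1) (ENum 0))"
definition "eMin a b = EIf (eLt a b) a b"

text \<open>Multiplication by the content of register \<open>1\<close>: variable \<open>63\<close> is a dummy summation index.\<close>

definition "eMulN e = ESum 63 e"
definition "eCell i j = EAdd (eMulN i) j"

primrec mulc :: "nat \<Rightarrow> aexp \<Rightarrow> aexp" where
  "mulc 0 e = ENum 0"
| "mulc (Suc c) e = EAdd e (mulc c e)"

lemmas edefs = eLt_def eNot_def eAnd_def eOr_def eEq_def eEx_def eCnt_def eMin_def eMulN_def eCell_def

text \<open>An over-approximation: indices of sums are kept, and register 1 is included because it
  is the range of every sum. It serves to keep the dummy index of \<open>eMulN\<close> away from the
  first argument of \<open>eCell\<close>.\<close>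

fun evars :: "aexp \<Rightarrow> nat set" where
  "evars (ENum c) = {}"
| "evars (EVar x) = {x}"
| "evars (EIdx a e) = evars e"
| "evars (EAdd e1 e2) = evars e1 \<union> evars e2"
| "evars (ESub e1 e2) = evars e1 \<union> evars e2"
| "evars (EIf e0 e1 e2) = evars e0 \<union> evars e1 \<union> evars e2"
| "evars (ESum x e) = insert 1 (evars e)"

lemma eval_cong_evars: "(\<And>x. x \<in> evars e \<Longrightarrow> v x = v' x) \<Longrightarrow> eval e v A = eval e v' A"
proof (induction e arbitrary: v v')
  case (ESum x e)
  have "eval e (v(x := i)) A = eval e (v'(x := i)) A" for i
    by (rule ESum.IH) (use ESum.prems in auto)
  then show ?case using ESum.prems[of 1] by simp
next
  case (EIf e0 e1 e2)
  have "eval e0 v A = eval e0 v' A" "eval e1 v A = eval e1 v' A" "eval e2 v A = eval e2 v' A"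
    by (rule EIf.IH; use EIf.prems in simp)+
  then show ?case by simp
next
  case (EIdx a e)
  have "eval e v A = eval e v' A" by (rule EIdx.IH) (use EIdx.prems in simp)
  then show ?case by simp
next
  case (EAdd e1 e2)
  have "eval e1 v A = eval e1 v' A" "eval e2 v A = eval e2 v' A"
    by (rule EAdd.IH; use EAdd.prems in simp)+
  then show ?case by simp
next
  case (ESub e1 e2)
  have "eval e1 v A = eval e1 v' A" "eval e2 v A = eval e2 v' A"
    by (rule ESub.IH; use ESub.prems in simp)+
  then show ?case by simp
qed simp_all

lemma eval_derived [simp]:
  "eval (eLt a b) v A = eval b v A - eval a v A"
  "eval (eNot a) v A = of_bool (eval a v A = 0)"
  "eval (eAnd a b) v A = of_bool (eval a v A \<noteq> 0 \<and> eval b v A \<noteq> 0)"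
  "eval (eOr a b) v A = of_bool (eval a v A \<noteq> 0 \<or> eval b v A \<noteq> 0)"
  "eval (eEq a b) v A = of_bool (eval a v A = eval b v A)"
  "eval (eEx x a) v A = of_bool (\<exists>i<v 1. eval a (v(x := i)) A \<noteq> 0)"
  "eval (eMin a b) v A = min (eval a v A) (eval b v A)"
  "eval (mulc c a) v A = c * eval a v A"
  by (induction c) (auto simp: edefs)

lemma eval_eCnt [simp]: "eval (eCnt x a) v A = card {i. i < v 1 \<and> eval a (v(x := i)) A \<noteq> 0}"
proof -
  have "eval (eCnt x a) v A = (\<Sum>i<v 1. of_bool (eval a (v(x := i)) A \<noteq> 0))"
    unfolding eCnt_def eval.simps by (intro sum.cong) auto
  then show ?thesis by (simp add: lessThan_def Int_def)
qed

lemma eval_eCell [simp]: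
  assumes "63 \<notin> evars i"
  shows "eval (eCell i j) v A = v 1 * eval i v A + eval j v A"
proof -
  have "eval i (v(63 := z)) A = eval i v A" for z
    by (rule eval_cong_evars) (use assms in auto)
  then show ?thesis by (simp add: eCell_def eMulN_def)
qed

section \<open>A program logic with frame conditions\<close>

fun asgd :: "hcom \<Rightarrow> nat set" where
  "asgd HSkip = {}"
| "asgd (HAsg x e) = {x}"
| "asgd (HPut a e1 e2) = {}"
| "asgd (HSeq c1 c2) = asgd c1 \<union> asgd c2"
| "asgd (HIf e c1 c2) = asgd c1 \<union> asgd c2"
| "asgd (HFor x y c) = insert x (asgd c)"

fun putd :: "hcom \<Rightarrow> nat set" where
  "putd (HPut a e1 e2) = {a}"
| "putd (HSeq c1 c2) = putd c1 \<union> putd c2"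
| "putd (HIf e c1 c2) = putd c1 \<union> putd c2"
| "putd (HFor x y c) = putd c"
| "putd _ = {}"

lemma sem_frame:
  "(\<forall>x. x \<notin> asgd c \<longrightarrow> fst (sem c s) x = fst s x) \<and> (\<forall>a. a \<notin> putd c \<longrightarrow> snd (sem c s) a = snd s a)"
proof (induction c arbitrary: s)
  case (HFor x y c)
  obtain v A where s: "s = (v, A)" by (cases s)
  let ?P = "\<lambda>s :: hstate. (\<forall>z. z \<notin> insert x (asgd c) \<longrightarrow> fst s z = v z) \<and> (\<forall>a. a \<notin> putd c \<longrightarrow> snd s a = A a)"
  have "?P (fold (\<lambda>i (v, A). sem c (v(x := i), A)) [0..<v y] (v, A))"
  proof (rule fold_upt_invariant[where P = "\<lambda>_. ?P"])
    fix i and s' :: hstate assume "?P s'"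
    then show "?P (case s' of (v, A) \<Rightarrow> sem c (v(x := i), A))"
      using HFor.IH[of "((fst s')(x := i), snd s')"] by (auto split: prod.splits)
  qed simp
  then show ?case by (simp add: s)
next
  case (HAsg z e)
  then show ?case by (cases s) auto
next
  case (HPut a e1 e2)
  then show ?case by (cases s) auto
next
  case (HIf e c1 c2)
  then show ?case by (cases s) auto
qed simp_all

definition wp :: "hcom \<Rightarrow> ((nat \<Rightarrow> nat) \<Rightarrow> (nat \<Rightarrow> nat \<Rightarrow> nat) \<Rightarrow> bool) \<Rightarrow> (nat \<Rightarrow> nat) \<Rightarrow> (nat \<Rightarrow> nat \<Rightarrow> nat) \<Rightarrow> bool" where
  "wp c Q v A \<longleftrightarrow> Q (fst (sem c (v, A))) (snd (sem c (v, A)))"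

lemma wp_simps [simp]:
  "wp HSkip Q v A \<longleftrightarrow> Q v A"
  "wp (HAsg x e) Q v A \<longleftrightarrow> Q (v(x := min (eval e v A) (v 2))) A"
  "wp (HPut a e1 e') Q v A \<longleftrightarrow> Q v (A(a := (A a)(eval e1 v A := min (eval e' v A) (v 2))))"
  "wp (HSeq c1 c2) Q v A \<longleftrightarrow> wp c1 (wp c2 Q) v A"
  "wp (HIf e c1 c2) Q v A \<longleftrightarrow> (if eval e v A \<noteq> 0 then wp c1 Q v A else wp c2 Q v A)"
  by (simp_all add: wp_def)

text \<open>The frame of \<open>c\<close> is handed to the caller, so that a postcondition has to
  mention only what \<open>c\<close> changes.\<close>

lemma wp_conseq:
  assumes "wp c Q' v A"
    and "\<And>v' A'. Q' v' A' \<Longrightarrow> (\<And>x. x \<notin> asgd c \<Longrightarrow> v' x = v x) \<Longrightarrow> (\<And>a. a \<notin> putd c \<Longrightarrow> A' a = A a) \<Longrightarrow> Q v' A'"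
  shows "wp c Q v A"
  unfolding wp_def
  by (rule assms(2)) (use assms(1) sem_frame[of c "(v, A)"] in \<open>auto simp: wp_def\<close>)

lemma wp_for:
  assumes "P 0 v A"
    and "\<And>i v' A'. i < v y \<Longrightarrow> P i v' A' \<Longrightarrow> (\<And>z. z \<notin> insert x (asgd c) \<Longrightarrow> v' z = v z) \<Longrightarrow>
      (\<And>a. a \<notin> putd c \<Longrightarrow> A' a = A a) \<Longrightarrow> wp c (P (Suc i)) (v'(x := i)) A'"
    and "\<And>v' A'. P (v y) v' A' \<Longrightarrow> (\<And>z. z \<notin> insert x (asgd c) \<Longrightarrow> v' z = v z) \<Longrightarrow>
      (\<And>a. a \<notin> putd c \<Longrightarrow> A' a = A a) \<Longrightarrow> Q v' A'"
  shows "wp (HFor x y c) Q v A"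
proof -
  let ?P = "\<lambda>i (s :: hstate). P i (fst s) (snd s) \<and> (\<forall>z. z \<notin> insert x (asgd c) \<longrightarrow> fst s z = v z) \<and>
    (\<forall>a. a \<notin> putd c \<longrightarrow> snd s a = A a)"
  have "?P (v y) (fold (\<lambda>i (v, A). sem c (v(x := i), A)) [0..<v y] (v, A))"
  proof (rule fold_upt_invariant[where P = ?P])
    fix i and s' :: hstate assume i: "i < v y" "?P i s'"
    obtain v' A' where s: "s' = (v', A')" by (cases s')
    have "wp c (P (Suc i)) (v'(x := i)) A'" using assms(2)[of i v' A'] i s by auto
    moreover have "(\<forall>z. z \<notin> asgd c \<longrightarrow> fst (sem c (v'(x := i), A')) z = (v'(x := i)) z)"
      "(\<forall>a. a \<notin> putd c \<longrightarrow> snd (sem c (v'(x := i), A')) a = A' a)"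
      using sem_frame[of c "(v'(x := i), A')"] by simp_all
    ultimately show "?P (Suc i) (case s' of (v, A) \<Rightarrow> sem c (v(x := i), A))"
      using i s by (simp add: wp_def)
  qed (use assms(1) in simp)
  then show ?thesis unfolding wp_def sem.simps using assms(3) by blast
qed

text \<open>\<open>ev\<close> must hold for every \<open>A'\<close> that agrees with
  \<open>A\<close> outside array \<open>a\<close>: an entry may not depend on the array that is
  being filled. This is why reachability alternates between arrays 2 and 3.\<close>

lemma wp_fill:
  assumes x: "x \<noteq> 1" "x \<noteq> 2"
    and ev: "\<And>i v' A'. i < v 1 \<Longrightarrow> v' x = i \<Longrightarrow> (\<And>z. z \<noteq> x \<Longrightarrow> v' z = v z) \<Longrightarrow>
      (\<And>b. b \<noteq> a \<Longrightarrow> A' b = A b) \<Longrightarrow> eval e1 v' A' = ix i \<and> min (eval e' v' A') (v 2) = F i"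
    and inj: "inj_on ix {..<v 1}"
    and post: "\<And>v' A'. (\<And>z. z \<noteq> x \<Longrightarrow> v' z = v z) \<Longrightarrow> (\<And>b. b \<noteq> a \<Longrightarrow> A' b = A b) \<Longrightarrow>
      (\<And>i. i < v 1 \<Longrightarrow> A' a (ix i) = F i) \<Longrightarrow> (\<And>m. m \<notin> ix ` {..<v 1} \<Longrightarrow> A' a m = A a m) \<Longrightarrow> Q v' A'"
  shows "wp (HFor x 1 (HPut a e1 e')) Q v A"
proof (rule wp_for[where P = "\<lambda>i v' A'. (\<forall>j<i. A' a (ix j) = F j) \<and> (\<forall>m. m \<notin> ix ` {..<i} \<longrightarrow> A' a m = A a m)"])
  fix i v' A'
  assume i: "i < v 1" "(\<forall>j<i. A' a (ix j) = F j) \<and> (\<forall>m. m \<notin> ix ` {..<i} \<longrightarrow> A' a m = A a m)"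
    and fr: "\<And>z. z \<notin> insert x (asgd (HPut a e1 e')) \<Longrightarrow> v' z = v z"
      "\<And>b. b \<notin> putd (HPut a e1 e') \<Longrightarrow> A' b = A b"
  have *: "eval e1 (v'(x := i)) A' = ix i \<and> min (eval e' (v'(x := i)) A') (v 2) = F i"
    by (rule ev) (use i fr in auto)
  have v2: "(v'(x := i)) 2 = v 2" using fr(1)[of 2] x by simp
  have ne: "ix j \<noteq> ix i" if "j < i" for j
    using inj_onD[OF inj, of j i] that i(1) by auto
  show "wp (HPut a e1 e') (\<lambda>v' A'. (\<forall>j<Suc i. A' a (ix j) = F j) \<and> (\<forall>m. m \<notin> ix ` {..<Suc i} \<longrightarrow> A' a m = A a m))
    (v'(x := i)) A'"
    unfolding wp_simps v2 using * i(2) ne by (auto simp: less_Suc_eq lessThan_Suc)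
next
  fix v' A'
  assume P: "(\<forall>j<v 1. A' a (ix j) = F j) \<and> (\<forall>m. m \<notin> ix ` {..<v 1} \<longrightarrow> A' a m = A a m)"
    and fr: "\<And>z. z \<notin> insert x (asgd (HPut a e1 e')) \<Longrightarrow> v' z = v z"
      "\<And>b. b \<notin> putd (HPut a e1 e') \<Longrightarrow> A' b = A b"
  show "Q v' A'" by (rule post) (use P fr in auto)
qed simp

lemma grid_eq: "j < n \<Longrightarrow> j' < n \<Longrightarrow> n * i + j = n * i' + j' \<longleftrightarrow> i = i' \<and> j = (j' :: nat)"
proof -
  assume a: "j < n" "j' < n"
  have "(n * i + j) div n = i" "(n * i' + j') div n = i'" "(n * i + j) mod n = j" "(n * i' + j') mod n = j'"
    using a by simp_all
  then show ?thesis by metis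
qed

lemma wp_fill2:
  assumes x: "x \<noteq> 1" "x \<noteq> 2" "y \<noteq> 1" "y \<noteq> 2" "x \<noteq> y" "x \<noteq> 63" "y \<noteq> 63"
    and ev: "\<And>i j v' A'. i < v 1 \<Longrightarrow> j < v 1 \<Longrightarrow> v' x = i \<Longrightarrow> v' y = j \<Longrightarrow>
      (\<And>z. z \<noteq> x \<Longrightarrow> z \<noteq> y \<Longrightarrow> v' z = v z) \<Longrightarrow>
      (\<And>b. b \<noteq> a \<Longrightarrow> A' b = A b) \<Longrightarrow> min (eval e' v' A') (v 2) = F i j"
    and post: "\<And>v' A'. (\<And>z. z \<noteq> x \<Longrightarrow> z \<noteq> y \<Longrightarrow> v' z = v z) \<Longrightarrow> (\<And>b. b \<noteq> a \<Longrightarrow> A' b = A b) \<Longrightarrow>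
      (\<And>i j. i < v 1 \<Longrightarrow> j < v 1 \<Longrightarrow> A' a (v 1 * i + j) = F i j) \<Longrightarrow> Q v' A'"
  shows "wp (HFor x 1 (HFor y 1 (HPut a (eCell (EVar x) (EVar y)) e'))) Q v A"
proof (rule wp_for[where P = "\<lambda>i v' A'. \<forall>i'<i. \<forall>j<v 1. A' a (v 1 * i' + j) = F i' j"])
  fix i v' A'
  let ?c = "HFor y 1 (HPut a (eCell (EVar x) (EVar y)) e')"
  assume i: "i < v 1" "\<forall>i'<i. \<forall>j<v 1. A' a (v 1 * i' + j) = F i' j"
    and fr: "\<And>z. z \<notin> insert x (asgd ?c) \<Longrightarrow> v' z = v z" "\<And>b. b \<notin> putd ?c \<Longrightarrow> A' b = A b"
  let ?v = "v'(x := i)"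
  have v1: "?v 1 = v 1" "?v 2 = v 2" using fr(1) x by auto
  show "wp ?c (\<lambda>v' A'. \<forall>i'<Suc i. \<forall>j<v 1. A' a (v 1 * i' + j) = F i' j) ?v A'"
  proof (rule wp_fill[where ix = "\<lambda>j. v 1 * i + j" and F = "F i"], unfold v1)
    fix j w B
    assume j: "j < v 1" "w y = j" "\<And>z. z \<noteq> y \<Longrightarrow> w z = ?v z" "\<And>b. b \<noteq> a \<Longrightarrow> B b = A' b"
    have "min (eval e' w B) (v 2) = F i j"
      by (rule ev) (use i(1) j fr x in auto)
    moreover have "w 1 = v 1" "w x = i" using j(3) x v1 by auto
    ultimately show "eval (eCell (EVar x) (EVar y)) w B = v 1 * i + j \<and> min (eval e' w B) (v 2) = F i j"
      using x j(2) by simp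
  next
    fix w B
    assume B: "\<And>j. j < v 1 \<Longrightarrow> B a (v 1 * i + j) = F i j"
      "\<And>m. m \<notin> (\<lambda>j. v 1 * i + j) ` {..<v 1} \<Longrightarrow> B a m = A' a m"
    have "B a (v 1 * i' + j) = F i' j" if "i' < Suc i" "j < v 1" for i' j
    proof (cases "i' = i")
      case False
      then have "v 1 * i' + j \<notin> (\<lambda>j. v 1 * i + j) ` {..<v 1}" using that by (auto simp: grid_eq)
      then show ?thesis using B(2) i(2) that False by simp
    qed (use B(1) that in simp)
    then show "\<forall>i'<Suc i. \<forall>j<v 1. B a (v 1 * i' + j) = F i' j" by simp
  qed (use x in \<open>auto simp: inj_on_def\<close>)
next
  fix v' A'
  let ?c = "HFor y 1 (HPut a (eCell (EVar x) (EVar y)) e')"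
  assume "\<forall>i'<v 1. \<forall>j<v 1. A' a (v 1 * i' + j) = F i' j"
    and "\<And>z. z \<notin> insert x (asgd ?c) \<Longrightarrow> v' z = v z" "\<And>b. b \<notin> putd ?c \<Longrightarrow> A' b = A b"
  then show "Q v' A'" by (intro post) auto
qed simp


section \<open>The branching step as a program\<close>

text \<open>
  Variables: \<open>0\<close> the answer, \<open>5\<close> the budget, \<open>6\<close> the root, \<open>7\<close> the height of the stack,
  \<open>8\<close> the number of chosen vertices, \<open>9\<close> whether the current item survives pruning, \<open>10\<close> the
  source to branch on plus one, \<open>11\<close> and \<open>12\<close> the numbers of sets of targets and of disjoint pairs
  of such sets, \<open>13\<close> the number of pairs listed so far.
  Arrays: \<open>0\<close> terminals, \<open>1\<close> arcs, \<open>2\<close> and \<open>3\<close> reachability, \<open>4\<close> sources, \<open>5\<close> domination,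
  \<open>6\<close> the stack, \<open>7\<close> the current item (\<open>1\<close>: forbidden, \<open>2\<close>: chosen), \<open>8\<close> undominated sources,
  \<open>9\<close> high vertices, \<open>10\<close> numbers of high neighbours, \<open>11\<close> masks of single targets,
  \<open>12\<close> and \<open>13\<close> pairs of masks, \<open>14\<close> the Dreyfus--Wagner table.
\<close>

definition "terms_prog = HFor 20 1 (HPut 0 (EVar 20) (EIdx 16 (EAdd (ENum 3) (EVar 20))))"

definition "arcs_prog = HFor 20 1 (HFor 21 1 (HPut 1 (eCell (EVar 20) (EVar 21))
   (EIdx 16 (EAdd (EAdd (ENum 3) (EVar 1)) (eCell (EVar 20) (EVar 21))))))"

definition "refl_prog = HFor 20 1 (HFor 21 1 (HPut 2 (eCell (EVar 20) (EVar 21)) (eEq (EVar 20) (EVar 21))))"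

definition "step_prog =
   HFor 20 1 (HFor 21 1 (HPut 3 (eCell (EVar 20) (EVar 21))
     (eOr (EIdx 2 (eCell (EVar 20) (EVar 21)))
       (eEx 40 (eAnd (EIdx 2 (eCell (EVar 20) (EVar 40)))
         (eAnd (eOr (EIdx 0 (EVar 40)) (eEq (EVar 40) (EVar 6)))
         (eAnd (eOr (EIdx 0 (EVar 21)) (eEq (EVar 21) (EVar 6)))
           (EIdx 1 (eCell (EVar 40) (EVar 21))))))))))"

definition "copy_prog = HFor 20 1 (HFor 21 1
   (HPut 2 (eCell (EVar 20) (EVar 21)) (EIdx 3 (eCell (EVar 20) (EVar 21)))))"

definition "sources_prog = HFor 20 1 (HPut 4 (EVar 20) (eAnd (EIdx 0 (EVar 20))
   (eAnd (eNot (EIdx 2 (eCell (EVar 6) (EVar 20))))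
     (eNot (eEx 40 (eAnd (EIdx 0 (EVar 40)) (eAnd (EIdx 2 (eCell (EVar 40) (EVar 20)))
       (eOr (eNot (EIdx 2 (eCell (EVar 20) (EVar 40)))) (eLt (EVar 40) (EVar 20))))))))))"

definition "dmn_prog = HFor 20 1 (HFor 21 1 (HPut 5 (eCell (EVar 20) (EVar 21))
   (eEx 40 (eAnd (EIdx 0 (EVar 40)) (eAnd (EIdx 1 (eCell (EVar 20) (EVar 40)))
     (EIdx 2 (eCell (EVar 40) (EVar 21))))))))"

definition "first_item_prog = HFor 20 1 (HPut 6 (EVar 20) (ENum 0))"

text \<open>The budget in the input may be exponentially large; cutting it off at \<open>n\<close>
  loses nothing, as a solution has no more vertices than that. Loops over register 1 being the only
  short ones, two nested ones extend reachability to paths of length \<open>n * n\<close>.\<close>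

definition "init_prog =
  HSeq (HAsg 5 (eMin (EIdx 16 (ENum 2)) (EVar 1)))
  (HSeq (HAsg 6 (EIdx 16 (ENum 1)))
  (HSeq terms_prog (HSeq arcs_prog (HSeq refl_prog
  (HSeq (HFor 22 1 (HFor 23 1 (HSeq step_prog copy_prog)))
  (HSeq sources_prog (HSeq dmn_prog (HSeq first_item_prog
  (HSeq (HAsg 7 (ENum 1)) (HAsg 0 (ENum 0)))))))))))"

definition "eAvail x = eAnd (eNot (EIdx 7 x)) (eAnd (eNot (EIdx 0 x)) (eNot (eEq x (EVar 6))))"
definition "eChosen x = eEq (EIdx 7 x) (ENum 2)"
definition "eHn x = eAnd (EIdx 9 x) (EIdx 5 (eCell x (ESub (EVar 10) (ENum 1))))"

text \<open>Register 9 receives the pruning test of \<open>sol_card_low\<close>. The final loop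
  scans for a source with between 1 and \<open>f\<close> high in-neighbours and keeps the last one
  that it finds.\<close>

definition "pop_prog d f =
  HSeq (HAsg 7 (ESub (EVar 7) (ENum 1)))
  (HSeq (HFor 20 1 (HPut 7 (EVar 20) (EIdx 6 (eCell (EVar 7) (EVar 20)))))
  (HSeq (HFor 20 1 (HPut 8 (EVar 20) (eAnd (EIdx 4 (EVar 20))
     (eNot (eEx 40 (eAnd (eChosen (EVar 40)) (EIdx 5 (eCell (EVar 40) (EVar 20)))))))))
  (HSeq (HFor 20 1 (HPut 9 (EVar 20) (eAnd (eAvail (EVar 20)) (eLt (ENum d)
     (eCnt 40 (eAnd (EIdx 8 (EVar 40)) (EIdx 5 (eCell (EVar 20) (EVar 40)))))))))
  (HSeq (HFor 20 1 (HPut 10 (EVar 20)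
     (eCnt 40 (eAnd (EIdx 9 (EVar 40)) (EIdx 5 (eCell (EVar 40) (EVar 20)))))))
  (HSeq (HAsg 8 (eCnt 40 (eChosen (EVar 40))))
  (HSeq (HAsg 9 (eAnd (eNot (eLt (mulc d (ESub (EVar 5) (EVar 8)))
       (eCnt 40 (eAnd (EIdx 8 (EVar 40)) (eNot (EIdx 10 (EVar 40)))))))
     (eNot (eLt (EVar 5) (EVar 8)))))
  (HSeq (HAsg 10 (ENum 0))
    (HFor 20 1 (HIf (eAnd (EIdx 8 (EVar 20)) (eAnd (EIdx 10 (EVar 20))
        (eNot (eLt (ENum f) (EIdx 10 (EVar 20))))))
      (HAsg 10 (EAdd (EVar 20) (ENum 1))) HSkip)))))))))"

text \<open>The first push overwrites the row of the item just popped, whose content survives in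
  array 7.\<close>

definition "push_prog =
  HSeq (HFor 20 1 (HPut 6 (eCell (EVar 7) (EVar 20)) (EIf (eHn (EVar 20)) (ENum 1) (EIdx 7 (EVar 20)))))
  (HSeq (HAsg 7 (EAdd (EVar 7) (ENum 1)))
  (HFor 21 1 (HIf (eHn (EVar 21)) (HSeq
     (HFor 20 1 (HPut 6 (eCell (EVar 7) (EVar 20)) (EIf (eEq (EVar 20) (EVar 21)) (ENum 2) (EIdx 7 (EVar 20)))))
     (HAsg 7 (EAdd (EVar 7) (ENum 1)))) HSkip)))"

context dst
begin

section \<open>Invariants of the search and correctness of one step\<close>

definition "chosen st = {i \<in> {..<n}. st i = (2 :: nat)}"
definition "forbidden st = {i \<in> {..<n}. st i = (1 :: nat)}"
definition "wf_item st \<longleftrightarrow> (\<forall>i<n. st i \<le> (2 :: nat) \<and> (st i \<noteq> 0 \<longrightarrow> i \<in> nonterms))"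

definition "inv_graph cap v A \<longleftrightarrow> v 1 = n \<and> v 2 = cap \<and> v 5 = k \<and> v 6 = r \<and>
   (\<forall>i<n. A 0 i = of_bool (i \<in> T)) \<and> (\<forall>i<n. \<forall>j<n. A 1 (n * i + j) = of_bool ((i, j) \<in> E)) \<and>
   (\<forall>i<n. A 4 i = of_bool (i \<in> sources)) \<and> (\<forall>i<n. \<forall>j<n. A 5 (n * i + j) = of_bool (dmn i j))"

definition "inv_stack \<sigma> v A \<longleftrightarrow> v 7 = length \<sigma> \<and> (\<forall>s<length \<sigma>. \<forall>i<n. A 6 (n * s + i) = (\<sigma> ! s) i)"

definition "inv_item st v A \<longleftrightarrow> (\<forall>i<n. A 7 i = st i) \<and> (\<forall>i<n. A 8 i = of_bool (i \<in> und (chosen st))) \<and>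
   (\<forall>i<n. A 9 i = of_bool (i \<in> high (chosen st) (forbidden st))) \<and> v 8 = card (chosen st)"

lemma nonterms_subset: "nonterms \<subseteq> {..<n}" "sources \<subseteq> {..<n}" "und C \<subseteq> {..<n}" "high C F \<subseteq> {..<n}"
    "hn C F b \<subseteq> {..<n}" "T \<subseteq> {..<n}"
  using terms by (auto simp: nonterms_def sources_def und_def high_def hn_def avail_def)

lemma card_bound: "card {i. i < n \<and> P i} \<le> n"
  using card_mono[of "{..<n}" "{i. i < n \<and> P i}"] by auto

definition "reach_upto m = (\<Union>l\<le>m. (E \<inter> insert r T \<times> insert r T) ^^ l)"

lemma reach_upto_Suc:
  "(i, j) \<in> reach_upto (Suc m) \<longleftrightarrow> (i, j) \<in> reach_upto m \<or>
     (\<exists>z. (i, z) \<in> reach_upto m \<and> (z, j) \<in> E \<inter> insert r T \<times> insert r T)"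
proof
  assume "(i, j) \<in> reach_upto (Suc m)"
  then obtain l where l: "l \<le> Suc m" "(i, j) \<in> (E \<inter> insert r T \<times> insert r T) ^^ l"
    unfolding reach_upto_def by blast
  show "(i, j) \<in> reach_upto m \<or> (\<exists>z. (i, z) \<in> reach_upto m \<and> (z, j) \<in> E \<inter> insert r T \<times> insert r T)"
  proof (cases "l \<le> m")
    case True
    then show ?thesis using l unfolding reach_upto_def by blast
  next
    case False
    then have "l = Suc m" using l by simp
    then obtain z where "(i, z) \<in> (E \<inter> insert r T \<times> insert r T) ^^ m" "(z, j) \<in> E \<inter> insert r T \<times> insert r T"
      using l(2) by (metis relpow_Suc_E)
    then show ?thesis unfolding reach_upto_def by blast
  qed
next
  assume a: "(i, j) \<in> reach_upto m \<or> (\<exists>z. (i, z) \<in> reach_upto m \<and> (z, j) \<in> E \<inter> insert r T \<times> insert r T)"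
  show "(i, j) \<in> reach_upto (Suc m)"
  proof (cases "(i, j) \<in> reach_upto m")
    case True
    then show ?thesis unfolding reach_upto_def by (meson UN_iff atMost_iff le_SucI)
  next
    case False
    then obtain z l where "l \<le> m" "(i, z) \<in> (E \<inter> insert r T \<times> insert r T) ^^ l" "(z, j) \<in> E \<inter> insert r T \<times> insert r T"
      using a unfolding reach_upto_def by blast
    then show ?thesis unfolding reach_upto_def
      by (metis UN_I atMost_iff not_less_eq_eq relpow_Suc_I Suc_le_mono)
  qed
qed

text \<open>The closure is complete after as many steps as there are arcs, of which there are at
  most \<open>n * n\<close>.\<close>

lemma reach_upto_square: "reach_upto (n * n) = RT"
proof -
  let ?R = "E \<inter> insert r T \<times> insert r T"
  have fin: "finite ?R" using finite_basic(1) by blast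
  have "?R \<subseteq> {..<n} \<times> {..<n}" using arcs by blast
  then have "card ?R \<le> n * n" using card_mono[of "{..<n} \<times> {..<n}" ?R] by (simp add: card_cartesian_product)
  then have "(\<Union>l\<in>{l. l \<le> card ?R}. ?R ^^ l) \<subseteq> reach_upto (n * n)"
    unfolding reach_upto_def by (intro UN_mono) auto
  then have "?R\<^sup>* \<subseteq> reach_upto (n * n)" using rtrancl_finite_eq_relpow[OF fin] by simp
  moreover have "reach_upto (n * n) \<subseteq> ?R\<^sup>*" unfolding reach_upto_def using relpow_imp_rtrancl by blast
  ultimately show ?thesis unfolding RT_def by blast
qed


lemma reach_upto_0: "(i, j) \<in> reach_upto 0 \<longleftrightarrow> i = j"
  by (simp add: reach_upto_def)

lemma init_prog_correct:
  assumes v: "v 1 = n" "v 2 = cap" "n \<le> cap"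
    and inp: "A 16 1 = r" "A 16 2 = k0" "k = min k0 n" "\<And>i. i < n \<Longrightarrow> A 16 (3 + i) = of_bool (i \<in> T)"
      "\<And>i j. i < n \<Longrightarrow> j < n \<Longrightarrow> A 16 (3 + n + (n * i + j)) = of_bool ((i, j) \<in> E)"
  shows "wp init_prog (\<lambda>v A. inv_graph cap v A \<and> inv_stack [\<lambda>_. 0] v A \<and> v 0 = 0) v A"
proof -
  have n1: "1 \<le> cap" "r \<le> cap" "0 < n" "k \<le> cap" using root v inp by auto
  have b1: "min (of_bool P) cap = of_bool P" for P using n1 by (cases P) auto
  let ?V = "\<lambda>v :: nat \<Rightarrow> nat. v 1 = n \<and> v 2 = cap \<and> v 5 = k \<and> v 6 = r"
  let ?I = "\<lambda>A :: nat \<Rightarrow> nat \<Rightarrow> nat. (\<forall>i<n. A 16 (3 + i) = of_bool (i \<in> T)) \<and>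
    (\<forall>i<n. \<forall>j<n. A 16 (3 + n + (n * i + j)) = of_bool ((i, j) \<in> E))"
  let ?T = "\<lambda>A :: nat \<Rightarrow> nat \<Rightarrow> nat. \<forall>i<n. A 0 i = of_bool (i \<in> T)"
  let ?E = "\<lambda>A :: nat \<Rightarrow> nat \<Rightarrow> nat. \<forall>i<n. \<forall>j<n. A 1 (n * i + j) = of_bool ((i, j) \<in> E)"
  let ?R = "\<lambda>a m A :: nat \<Rightarrow> nat \<Rightarrow> nat. \<forall>i<n. \<forall>j<n. A a (n * i + j) = of_bool ((i, j) \<in> reach_upto m)"
  let ?B = "\<lambda>A :: nat \<Rightarrow> nat \<Rightarrow> nat. \<forall>i<n. A 4 i = of_bool (i \<in> sources)"
  let ?D = "\<lambda>A :: nat \<Rightarrow> nat \<Rightarrow> nat. \<forall>i<n. \<forall>j<n. A 5 (n * i + j) = of_bool (dmn i j)"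
  have s1: "wp terms_prog (\<lambda>v A. ?V v \<and> ?I A \<and> ?T A) v A" if "?V v" "?I A" for v A
    unfolding terms_prog_def
    by (rule wp_fill[where ix = "\<lambda>i. i" and F = "\<lambda>i. of_bool (i \<in> T)"]) (use that b1 in auto)
  have s2: "wp arcs_prog (\<lambda>v A. ?V v \<and> ?T A \<and> ?E A) v A" if "?V v" "?I A" "?T A" for v A
    unfolding arcs_prog_def
    by (rule wp_fill2[where F = "\<lambda>i j. of_bool ((i, j) \<in> E)"]) (use that b1 in \<open>auto simp: add.assoc\<close>)
  have s3: "wp refl_prog (\<lambda>v A. ?V v \<and> ?T A \<and> ?E A \<and> ?R 2 0 A) v A" if "?V v" "?T A" "?E A" for v A
    unfolding refl_prog_def
    by (rule wp_fill2[where F = "\<lambda>i j. of_bool (i = j)"]) (use that b1 in \<open>auto simp: reach_upto_0\<close>)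
  have s4: "wp step_prog (\<lambda>v A. ?V v \<and> ?T A \<and> ?E A \<and> ?R 3 (Suc m) A) v A"
    if "?V v" "?T A" "?E A" "?R 2 m A" for v A m
    unfolding step_prog_def
  proof (rule wp_fill2[where F = "\<lambda>i j. of_bool ((i, j) \<in> reach_upto (Suc m))"])
    fix i j v' A'
    assume *: "i < v 1" "j < v 1" "v' 20 = i" "v' 21 = j" "\<And>z. z \<noteq> 20 \<Longrightarrow> z \<noteq> 21 \<Longrightarrow> v' z = v z"
      "\<And>b. b \<noteq> 3 \<Longrightarrow> A' b = A b"
    have v': "v' 1 = n" "v' 6 = r" using *(5) that by simp_all
    \<comment> \<open>The program searches intermediate vertices below \<open>n\<close>, which
      covers the terminals and the root.\<close>
    let ?P = "(i, j) \<in> reach_upto m \<or>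
      (\<exists>z<n. (i, z) \<in> reach_upto m \<and> (z \<in> T \<or> z = r) \<and> (j \<in> T \<or> j = r) \<and> (z, j) \<in> E)"
    have "z < n" if "z \<in> T \<or> z = r" for z using that root nonterms_subset(6) by auto
    then have P: "?P \<longleftrightarrow> (i, j) \<in> reach_upto (Suc m)" unfolding reach_upto_Suc by blast
    have "eval (eOr (EIdx 2 (eCell (EVar 20) (EVar 21)))
       (eEx 40 (eAnd (EIdx 2 (eCell (EVar 20) (EVar 40)))
         (eAnd (eOr (EIdx 0 (EVar 40)) (eEq (EVar 40) (EVar 6)))
         (eAnd (eOr (EIdx 0 (EVar 21)) (eEq (EVar 21) (EVar 6)))
           (EIdx 1 (eCell (EVar 40) (EVar 21)))))))) v' A' = of_bool ?P"
      using * v' that by (simp cong: conj_cong)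
    then show "min (eval (eOr (EIdx 2 (eCell (EVar 20) (EVar 21)))
       (eEx 40 (eAnd (EIdx 2 (eCell (EVar 20) (EVar 40)))
         (eAnd (eOr (EIdx 0 (EVar 40)) (eEq (EVar 40) (EVar 6)))
         (eAnd (eOr (EIdx 0 (EVar 21)) (eEq (EVar 21) (EVar 6)))
           (EIdx 1 (eCell (EVar 40) (EVar 21)))))))) v' A') (v 2) = of_bool ((i, j) \<in> reach_upto (Suc m))"
      unfolding P using that b1 by simp
  qed (use that in auto)
  have s5: "wp copy_prog (\<lambda>v A. ?V v \<and> ?T A \<and> ?E A \<and> ?R 2 m A) v A"
    if "?V v" "?T A" "?E A" "?R 3 m A" for v A m
    unfolding copy_prog_def
    by (rule wp_fill2[where F = "\<lambda>i j. of_bool ((i, j) \<in> reach_upto m)"]) (use that b1 in auto)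
  have s6: "wp (HFor 22 1 (HFor 23 1 (HSeq step_prog copy_prog)))
    (\<lambda>v A. ?V v \<and> ?T A \<and> ?E A \<and> ?R 2 (n * n) A) v A" if "?V v" "?T A" "?E A" "?R 2 0 A" for v A
  proof (rule wp_for[where P = "\<lambda>i v A. ?V v \<and> ?T A \<and> ?E A \<and> ?R 2 (n * i) A"])
    fix i v' A' assume i: "?V v' \<and> ?T A' \<and> ?E A' \<and> ?R 2 (n * i) A'"
    show "wp (HFor 23 1 (HSeq step_prog copy_prog)) (\<lambda>v A. ?V v \<and> ?T A \<and> ?E A \<and> ?R 2 (n * Suc i) A) (v'(22 := i)) A'"
    proof (rule wp_for[where P = "\<lambda>j v A. ?V v \<and> ?T A \<and> ?E A \<and> ?R 2 (n * i + j) A"])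
      fix j v2 A2 assume j: "?V v2 \<and> ?T A2 \<and> ?E A2 \<and> ?R 2 (n * i + j) A2"
      show "wp (HSeq step_prog copy_prog) (\<lambda>v A. ?V v \<and> ?T A \<and> ?E A \<and> ?R 2 (n * i + Suc j) A) (v2(23 := j)) A2"
        unfolding wp_simps
        by (rule wp_conseq[OF s4[of _ _ "n * i + j"]]) (use j s5[of _ _ "n * i + Suc j"] in auto)
    qed (use i in \<open>auto simp: add.commute\<close>)
  qed (use that in auto)
  have s7: "wp sources_prog (\<lambda>v A. ?V v \<and> ?T A \<and> ?E A \<and> ?R 2 (n * n) A \<and> ?B A) v A"
    if "?V v" "?T A" "?E A" "?R 2 (n * n) A" for v A
    unfolding sources_prog_def
  proof (rule wp_fill[where ix = "\<lambda>i. i" and F = "\<lambda>i. of_bool (i \<in> sources)"])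
    fix i v' A'
    assume *: "i < v 1" "v' 20 = i" "\<And>z. z \<noteq> 20 \<Longrightarrow> v' z = v z" "\<And>b. b \<noteq> 4 \<Longrightarrow> A' b = A b"
    have v': "v' 1 = n" "v' 6 = r" using *(3) that by simp_all
    have lt: "t < n" if "t \<in> T" for t using nonterms_subset(6) that by auto
    have "(\<forall>t\<in>T. (t, i) \<in> RT \<longrightarrow> (i, t) \<in> RT \<and> i \<le> t) \<longleftrightarrow>
        \<not> (\<exists>t<n. t \<in> T \<and> (t, i) \<in> RT \<and> ((i, t) \<notin> RT \<or> t < i))"
      using lt not_less by blast
    then have P: "i \<in> sources \<longleftrightarrow> i \<in> T \<and> (r, i) \<notin> RT \<and> \<not> (\<exists>t<n. t \<in> T \<and> (t, i) \<in> RT \<and> ((i, t) \<notin> RT \<or> t < i))"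
      unfolding sources_def by simp
    have "eval (eAnd (EIdx 0 (EVar 20))
     (eAnd (eNot (EIdx 2 (eCell (EVar 6) (EVar 20))))
       (eNot (eEx 40 (eAnd (EIdx 0 (EVar 40)) (eAnd (EIdx 2 (eCell (EVar 40) (EVar 20)))
         (eOr (eNot (EIdx 2 (eCell (EVar 20) (EVar 40)))) (eLt (EVar 40) (EVar 20))))))))) v' A' = of_bool (i \<in> sources)"
      unfolding P using * v' that root by (auto simp add: reach_upto_square not_less cong: conj_cong)
    then show "eval (EVar 20) v' A' = i \<and> min (eval (eAnd (EIdx 0 (EVar 20))
     (eAnd (eNot (EIdx 2 (eCell (EVar 6) (EVar 20))))
       (eNot (eEx 40 (eAnd (EIdx 0 (EVar 40)) (eAnd (EIdx 2 (eCell (EVar 40) (EVar 20)))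
         (eOr (eNot (EIdx 2 (eCell (EVar 20) (EVar 40)))) (eLt (EVar 40) (EVar 20))))))))) v' A') (v 2) = of_bool (i \<in> sources)"
      using * that b1 by simp
  qed (use that in auto)
  have s8: "wp dmn_prog (\<lambda>v A. ?V v \<and> ?T A \<and> ?E A \<and> ?B A \<and> ?D A) v A"
    if "?V v" "?T A" "?E A" "?R 2 (n * n) A" "?B A" for v A
    unfolding dmn_prog_def
  proof (rule wp_fill2[where F = "\<lambda>i j. of_bool (dmn i j)"])
    fix i j v' A'
    assume *: "i < v 1" "j < v 1" "v' 20 = i" "v' 21 = j" "\<And>z. z \<noteq> 20 \<Longrightarrow> z \<noteq> 21 \<Longrightarrow> v' z = v z"
      "\<And>b. b \<noteq> 5 \<Longrightarrow> A' b = A b"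
    have v': "v' 1 = n" using *(5) that by simp
    have "dmn i j \<longleftrightarrow> (\<exists>t<n. t \<in> T \<and> (i, t) \<in> E \<and> (t, j) \<in> RT)"
      unfolding dmn_def using nonterms_subset(6) by auto
    then show "min (eval (eEx 40 (eAnd (EIdx 0 (EVar 40)) (eAnd (EIdx 1 (eCell (EVar 20) (EVar 40)))
     (EIdx 2 (eCell (EVar 40) (EVar 21)))))) v' A') (v 2) = of_bool (dmn i j)"
      using * v' that b1 by (simp add: reach_upto_square cong: conj_cong)
  qed (use that in auto)
  have s9: "wp first_item_prog (\<lambda>v A. ?V v \<and> ?T A \<and> ?E A \<and> ?B A \<and> ?D A \<and> (\<forall>i<n. A 6 i = 0)) v A"
    if "?V v" "?T A" "?E A" "?B A" "?D A" for v A
    unfolding first_item_prog_def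
    by (rule wp_fill[where ix = "\<lambda>i. i" and F = "\<lambda>i. 0"]) (use that in auto)
  let ?Q = "\<lambda>v A. inv_graph cap v A \<and> inv_stack [\<lambda>_. 0] v A \<and> v 0 = 0"
  let ?last = "HSeq (HAsg 7 (ENum 1)) (HAsg 0 (ENum 0))"
  \<comment> \<open>The pieces are assembled from the back, so that each goal is the postcondition
    required of the preceding piece.\<close>
  have t9: "wp (HSeq first_item_prog ?last) ?Q v A" if "?V v" "?T A" "?E A" "?B A" "?D A" for v A
    unfolding wp_simps(4)
    by (rule wp_conseq[OF s9]) (use that n1 in \<open>auto simp: inv_graph_def inv_stack_def\<close>)
  have t8: "wp (HSeq dmn_prog (HSeq first_item_prog ?last)) ?Q v A"
    if "?V v" "?T A" "?E A" "?R 2 (n * n) A" "?B A" for v A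
    unfolding wp_simps(4)[of dmn_prog] by (rule wp_conseq[OF s8]) (use that t9 in blast)+
  have t7: "wp (HSeq sources_prog (HSeq dmn_prog (HSeq first_item_prog ?last))) ?Q v A"
    if "?V v" "?T A" "?E A" "?R 2 (n * n) A" for v A
    unfolding wp_simps(4)[of sources_prog] by (rule wp_conseq[OF s7]) (use that t8 in blast)+
  have t6: "wp (HSeq (HFor 22 1 (HFor 23 1 (HSeq step_prog copy_prog)))
      (HSeq sources_prog (HSeq dmn_prog (HSeq first_item_prog ?last)))) ?Q v A"
    if "?V v" "?T A" "?E A" "?R 2 0 A" for v A
    unfolding wp_simps(4)[of "HFor _ _ _"] by (rule wp_conseq[OF s6]) (use that t7 in blast)+
  have t3: "wp (HSeq refl_prog (HSeq (HFor 22 1 (HFor 23 1 (HSeq step_prog copy_prog)))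
      (HSeq sources_prog (HSeq dmn_prog (HSeq first_item_prog ?last))))) ?Q v A"
    if "?V v" "?T A" "?E A" for v A
    unfolding wp_simps(4)[of refl_prog] by (rule wp_conseq[OF s3]) (use that t6 in blast)+
  have t2: "wp (HSeq arcs_prog (HSeq refl_prog (HSeq (HFor 22 1 (HFor 23 1 (HSeq step_prog copy_prog)))
      (HSeq sources_prog (HSeq dmn_prog (HSeq first_item_prog ?last)))))) ?Q v A"
    if "?V v" "?I A" "?T A" for v A
    unfolding wp_simps(4)[of arcs_prog] by (rule wp_conseq[OF s2]) (use that t3 in blast)+
  have t1: "wp (HSeq terms_prog (HSeq arcs_prog (HSeq refl_prog (HSeq (HFor 22 1 (HFor 23 1 (HSeq step_prog copy_prog)))
      (HSeq sources_prog (HSeq dmn_prog (HSeq first_item_prog ?last))))))) ?Q v A"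
    if "?V v" "?I A" for v A
    unfolding wp_simps(4)[of terms_prog] by (rule wp_conseq[OF s1]) (use that t2 in blast)+
  let ?v = "v(5 := k, 6 := r)"
  have "wp init_prog ?Q v A \<longleftrightarrow> wp (HSeq terms_prog (HSeq arcs_prog (HSeq refl_prog (HSeq (HFor 22 1 (HFor 23 1 (HSeq step_prog copy_prog)))
      (HSeq sources_prog (HSeq dmn_prog (HSeq first_item_prog ?last))))))) ?Q ?v A"
    unfolding init_prog_def wp_simps(4)[of "HAsg 5 _"] wp_simps(4)[of "HAsg 6 _"] wp_simps(2)
    using v inp n1 by (simp add: min_def)
  then show ?thesis using t1[of ?v A] v inp by simp
qed

definition "branch_source f C F v \<longleftrightarrow>
  (if v 10 = 0 then \<not> (\<exists>b\<in>und C. hn C F b \<noteq> {} \<and> card (hn C F b) \<le> f)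
   else v 10 - 1 \<in> und C \<and> hn C F (v 10 - 1) \<noteq> {} \<and> card (hn C F (v 10 - 1)) \<le> (f :: nat))"

lemma pop_prog_correct:
  assumes inv: "inv_graph cap v A" "inv_stack (\<sigma> @ [st]) v A" "wf_item st"
    and cap: "n + 1 \<le> cap" "length \<sigma> < cap"
  shows "wp (pop_prog d f) (\<lambda>v A. inv_graph cap v A \<and> inv_stack \<sigma> v A \<and> inv_item st v A \<and>
     (v 9 \<noteq> 0 \<longleftrightarrow> card (low (chosen st) (forbidden st)) \<le> d * (k - card (chosen st)) \<and> card (chosen st) \<le> k) \<and>
     branch_source f (chosen st) (forbidden st) v) v A"
proof -
  let ?C = "chosen st" and ?F = "forbidden st"
  have n1: "1 \<le> cap" "n \<le> cap" "0 < n" using root cap by auto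
  have b1: "min (of_bool P) cap = of_bool P" for P using n1 by (cases P) auto
  have cb: "min (card {i. i < n \<and> P i}) cap = card {i. i < n \<and> P i}" for P
    using card_bound[of P] n1 by simp
  let ?G = "\<lambda>v A. inv_graph cap v A \<and> inv_stack \<sigma> v A"
  let ?c1 = "HFor 20 1 (HPut 7 (EVar 20) (EIdx 6 (eCell (EVar 7) (EVar 20))))"
  let ?c2 = "HFor 20 1 (HPut 8 (EVar 20) (eAnd (EIdx 4 (EVar 20))
     (eNot (eEx 40 (eAnd (eChosen (EVar 40)) (EIdx 5 (eCell (EVar 40) (EVar 20))))))))"
  let ?c3 = "HFor 20 1 (HPut 9 (EVar 20) (eAnd (eAvail (EVar 20)) (eLt (ENum d)
     (eCnt 40 (eAnd (EIdx 8 (EVar 40)) (EIdx 5 (eCell (EVar 20) (EVar 40))))))))"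
  let ?c4 = "HFor 20 1 (HPut 10 (EVar 20)
     (eCnt 40 (eAnd (EIdx 9 (EVar 40)) (EIdx 5 (eCell (EVar 40) (EVar 20))))))"
  let ?c5 = "HAsg 8 (eCnt 40 (eChosen (EVar 40)))"
  let ?c6 = "HAsg 9 (eAnd (eNot (eLt (mulc d (ESub (EVar 5) (EVar 8)))
       (eCnt 40 (eAnd (EIdx 8 (EVar 40)) (eNot (EIdx 10 (EVar 40)))))))
     (eNot (eLt (EVar 5) (EVar 8))))"
  let ?c7 = "HAsg 10 (ENum 0)"
  let ?c8 = "HFor 20 1 (HIf (eAnd (EIdx 8 (EVar 20)) (eAnd (EIdx 10 (EVar 20))
        (eNot (eLt (ENum f) (EIdx 10 (EVar 20))))))
      (HAsg 10 (EAdd (EVar 20) (ENum 1))) HSkip)"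
  let ?S = "\<lambda>A :: nat \<Rightarrow> nat \<Rightarrow> nat. \<forall>i<n. A 7 i = st i"
  let ?U = "\<lambda>A :: nat \<Rightarrow> nat \<Rightarrow> nat. \<forall>i<n. A 8 i = of_bool (i \<in> und ?C)"
  let ?H = "\<lambda>A :: nat \<Rightarrow> nat \<Rightarrow> nat. \<forall>i<n. A 9 i = of_bool (i \<in> high ?C ?F)"
  let ?N = "\<lambda>A :: nat \<Rightarrow> nat \<Rightarrow> nat. \<forall>i<n. A 10 i = card (hn ?C ?F i)"
  have s1: "wp ?c1 (\<lambda>v A. ?G v A \<and> ?S A) v A"
    if "?G v A" "\<forall>i<n. A 6 (n * length \<sigma> + i) = st i" for v A
    by (rule wp_fill[where ix = "\<lambda>i. i" and F = st])
      (use that inv(3) cap in \<open>auto simp: inv_graph_def inv_stack_def wf_item_def intro!: min.absorb1 intro: le_trans\<close>)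
  have s2: "wp ?c2 (\<lambda>v A. ?G v A \<and> ?S A \<and> ?U A) v A" if "?G v A" "?S A" for v A
  proof (rule wp_fill[where ix = "\<lambda>i. i" and F = "\<lambda>i. of_bool (i \<in> und ?C)"])
    fix i v' A'
    assume *: "i < v 1" "v' 20 = i" "\<And>z. z \<noteq> 20 \<Longrightarrow> v' z = v z" "\<And>b. b \<noteq> 8 \<Longrightarrow> A' b = A b"
    have g: "v 1 = n" "v 2 = cap" "\<forall>i<n. A 4 i = of_bool (i \<in> sources)" "\<forall>i<n. \<forall>j<n. A 5 (n * i + j) = of_bool (dmn i j)"
      using that by (auto simp: inv_graph_def)
    have v': "v' 1 = n" using *(3) g by simp
    have P: "i \<in> und ?C \<longleftrightarrow> i \<in> sources \<and> \<not> (\<exists>w<n. st w = 2 \<and> dmn w i)"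
      unfolding und_def chosen_def by auto
    have "eval (eAnd (EIdx 4 (EVar 20))
       (eNot (eEx 40 (eAnd (eChosen (EVar 40)) (EIdx 5 (eCell (EVar 40) (EVar 20))))))) v' A' = of_bool (i \<in> und ?C)"
      unfolding P using * v' g that by (auto simp add: eChosen_def cong: conj_cong)
    then show "eval (EVar 20) v' A' = i \<and> min (eval (eAnd (EIdx 4 (EVar 20))
       (eNot (eEx 40 (eAnd (eChosen (EVar 40)) (EIdx 5 (eCell (EVar 40) (EVar 20))))))) v' A') (v 2) = of_bool (i \<in> und ?C)"
      using * b1 g by simp
  qed (use that in \<open>auto simp: inv_graph_def inv_stack_def\<close>)
  have s3: "wp ?c3 (\<lambda>v A. ?G v A \<and> ?S A \<and> ?U A \<and> ?H A) v A" if "?G v A" "?S A" "?U A" for v A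
  proof (rule wp_fill[where ix = "\<lambda>i. i" and F = "\<lambda>i. of_bool (i \<in> high ?C ?F)"])
    fix i v' A'
    assume *: "i < v 1" "v' 20 = i" "\<And>z. z \<noteq> 20 \<Longrightarrow> v' z = v z" "\<And>b. b \<noteq> 9 \<Longrightarrow> A' b = A b"
    have g: "v 1 = n" "v 2 = cap" "v 6 = r" "\<forall>i<n. A 0 i = of_bool (i \<in> T)" "\<forall>i<n. \<forall>j<n. A 5 (n * i + j) = of_bool (dmn i j)"
      using that by (auto simp: inv_graph_def)
    have v': "v' 1 = n" "v' 6 = r" using *(3) g by simp_all
    have "{b \<in> und ?C. dmn i b} = {b. b < n \<and> b \<in> und ?C \<and> dmn i b}" using nonterms_subset(3) by auto
    moreover have "i \<in> avail ?C ?F \<longleftrightarrow> st i = 0 \<and> i \<notin> T \<and> i \<noteq> r"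
      using *(1) g(1) inv(3) unfolding avail_def chosen_def forbidden_def nonterms_def wf_item_def by fastforce
    ultimately have P: "i \<in> high ?C ?F \<longleftrightarrow> (st i = 0 \<and> i \<notin> T \<and> i \<noteq> r) \<and> d < card {b. b < n \<and> b \<in> und ?C \<and> dmn i b}"
      unfolding high_def by simp
    have "eval (eAnd (eAvail (EVar 20)) (eLt (ENum d)
     (eCnt 40 (eAnd (EIdx 8 (EVar 40)) (EIdx 5 (eCell (EVar 20) (EVar 40))))))) v' A' = of_bool (i \<in> high ?C ?F)"
      unfolding P using * v' g that by (simp add: eAvail_def cong: conj_cong)
    then show "eval (EVar 20) v' A' = i \<and> min (eval (eAnd (eAvail (EVar 20)) (eLt (ENum d)
     (eCnt 40 (eAnd (EIdx 8 (EVar 40)) (EIdx 5 (eCell (EVar 20) (EVar 40))))))) v' A') (v 2) = of_bool (i \<in> high ?C ?F)"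
      using * b1 g by simp
  qed (use that in \<open>auto simp: inv_graph_def inv_stack_def\<close>)
  have s4: "wp ?c4 (\<lambda>v A. ?G v A \<and> ?S A \<and> ?U A \<and> ?H A \<and> ?N A) v A" if "?G v A" "?S A" "?U A" "?H A" for v A
  proof (rule wp_fill[where ix = "\<lambda>i. i" and F = "\<lambda>i. card (hn ?C ?F i)"])
    fix i v' A'
    assume *: "i < v 1" "v' 20 = i" "\<And>z. z \<noteq> 20 \<Longrightarrow> v' z = v z" "\<And>b. b \<noteq> 10 \<Longrightarrow> A' b = A b"
    have g: "v 1 = n" "v 2 = cap" "\<forall>i<n. \<forall>j<n. A 5 (n * i + j) = of_bool (dmn i j)"
      using that by (auto simp: inv_graph_def)
    have v': "v' 1 = n" using *(3) g by simp_all
    have P: "hn ?C ?F i = {w. w < n \<and> w \<in> high ?C ?F \<and> dmn w i}"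
      using nonterms_subset(4) by (auto simp: hn_def)
    have "eval (eCnt 40 (eAnd (EIdx 9 (EVar 40)) (EIdx 5 (eCell (EVar 40) (EVar 20))))) v' A' = card (hn ?C ?F i)"
      unfolding P using * v' g that by (simp cong: conj_cong)
    then show "eval (EVar 20) v' A' = i \<and>
      min (eval (eCnt 40 (eAnd (EIdx 9 (EVar 40)) (EIdx 5 (eCell (EVar 40) (EVar 20))))) v' A') (v 2) = card (hn ?C ?F i)"
      using * g cb P by simp
  qed (use that in \<open>auto simp: inv_graph_def inv_stack_def\<close>)
  let ?P9 = "\<lambda>v :: nat \<Rightarrow> nat. v 9 \<noteq> 0 \<longleftrightarrow> card (low ?C ?F) \<le> d * (k - card ?C) \<and> card ?C \<le> k"
  have s5: "wp (HSeq ?c5 (HSeq ?c6 ?c7)) (\<lambda>v A. ?G v A \<and> ?S A \<and> ?U A \<and> ?H A \<and> ?N A \<and> v 8 = card ?C \<and> ?P9 v \<and> v 10 = 0) v A"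
    if "?G v A" "?S A" "?U A" "?H A" "?N A" for v A
  proof -
    have g: "v 1 = n" "v 2 = cap" "v 5 = k" using that by (auto simp: inv_graph_def)
    have C: "eval (eCnt 40 (eChosen (EVar 40))) v A = card ?C"
      using that g by (simp add: eChosen_def chosen_def cong: conj_cong)
    have mC: "min (card ?C) cap = card ?C" using cb[of "\<lambda>i. st i = 2"] by (simp add: chosen_def)
    let ?v = "v(8 := card ?C)"
    have L: "low ?C ?F = {b. b < n \<and> b \<in> und ?C \<and> card (hn ?C ?F b) = 0}"
      using nonterms_subset(3) by (auto simp: low_def)
    have "eval (eCnt 40 (eAnd (EIdx 8 (EVar 40)) (eNot (EIdx 10 (EVar 40))))) ?v A = card (low ?C ?F)"
      unfolding L using that g by (simp cong: conj_cong)
    then have e6: "min (eval (eAnd (eNot (eLt (mulc d (ESub (EVar 5) (EVar 8)))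
       (eCnt 40 (eAnd (EIdx 8 (EVar 40)) (eNot (EIdx 10 (EVar 40)))))))
     (eNot (eLt (EVar 5) (EVar 8)))) ?v A) (?v 2) = of_bool (card (low ?C ?F) \<le> d * (k - card ?C) \<and> card ?C \<le> k)"
      using g b1 by (simp del: eval_eCnt)
    show ?thesis unfolding wp_simps C g mC e6 using that by (simp add: inv_graph_def inv_stack_def)
  qed
  have s8: "wp ?c8 (\<lambda>v A. ?G v A \<and> ?S A \<and> ?U A \<and> ?H A \<and> v 8 = card ?C \<and> ?P9 v \<and> branch_source f ?C ?F v) v A"
    if "?G v A" "?S A" "?U A" "?H A" "?N A" "v 8 = card ?C" "?P9 v" "v 10 = 0" for v A
  proof -
    let ?e = "eAnd (EIdx 8 (EVar 20)) (eAnd (EIdx 10 (EVar 20)) (eNot (eLt (ENum f) (EIdx 10 (EVar 20)))))"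
    let ?b = "HIf ?e (HAsg 10 (EAdd (EVar 20) (ENum 1))) HSkip"
    define good where "good b \<longleftrightarrow> b \<in> und ?C \<and> hn ?C ?F b \<noteq> {} \<and> card (hn ?C ?F b) \<le> f" for b
    have g: "v 1 = n" "v 2 = cap" using that by (auto simp: inv_graph_def)
    show ?thesis
    proof (rule wp_for[where P = "\<lambda>i v A. if v 10 = 0 then \<not> (\<exists>b<i. good b) else good (v 10 - 1)"])
      fix i v' A'
      assume i: "i < v 1" and P: "if v' 10 = 0 then \<not> (\<exists>b<i. good b) else good (v' 10 - 1)"
        and fr: "\<And>z. z \<notin> insert 20 (asgd ?b) \<Longrightarrow> v' z = v z" "\<And>b. b \<notin> putd ?b \<Longrightarrow> A' b = A b"
      have A: "i < n" "v' 2 = cap" "A' = A" "min (Suc i) cap = Suc i" using i g fr cap by (auto simp: fun_eq_iff)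
      have "(eval ?e (v'(20 := i)) A' \<noteq> 0) \<longleftrightarrow> good i"
        using A that(3,5) by (auto simp: good_def)
      then show "wp ?b (\<lambda>v A. if v 10 = 0 then \<not> (\<exists>b<Suc i. good b) else good (v 10 - 1)) (v'(20 := i)) A'"
        unfolding wp_simps using P A by (auto simp: less_Suc_eq split: if_splits)
    next
      fix v' A'
      assume P: "if v' 10 = 0 then \<not> (\<exists>b<v 1. good b) else good (v' 10 - 1)"
        and fr: "\<And>z. z \<notin> insert 20 (asgd ?b) \<Longrightarrow> v' z = v z" "\<And>b. b \<notin> putd ?b \<Longrightarrow> A' b = A b"
      have A: "A' = A" using fr by (auto simp: fun_eq_iff)
      have "v' z = v z" if "z \<in> {1, 2, 5, 6, 7, 8, 9}" for z using fr(1) that by auto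
      moreover have "branch_source f ?C ?F v'"
      proof -
        have lt: "b < n" if "b \<in> und ?C" for b using nonterms_subset(3) that by blast
        have ex: "(\<exists>b<n. good b) \<longleftrightarrow> (\<exists>b\<in>und ?C. hn ?C ?F b \<noteq> {} \<and> card (hn ?C ?F b) \<le> f)"
          unfolding good_def using lt by blast
        show ?thesis using P unfolding branch_source_def g ex unfolding good_def .
      qed
      ultimately show "?G v' A' \<and> ?S A' \<and> ?U A' \<and> ?H A' \<and> v' 8 = card ?C \<and> ?P9 v' \<and> branch_source f ?C ?F v'"
        unfolding A using that by (simp add: inv_graph_def inv_stack_def)
    qed (use that in simp)
  qed
  let ?Q = "\<lambda>v A. inv_graph cap v A \<and> inv_stack \<sigma> v A \<and> inv_item st v A \<and> ?P9 v \<and> branch_source f ?C ?F v"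
  have t8: "wp ?c8 ?Q v A"
    if "?G v A" "?S A" "?U A" "?H A" "?N A" "v 8 = card ?C" "?P9 v" "v 10 = 0" for v A
    by (rule wp_conseq[OF s8[OF that]]) (simp add: inv_item_def)
  have t5: "wp ?c5 (wp ?c6 (wp ?c7 (wp ?c8 ?Q))) v A" if "?G v A" "?S A" "?U A" "?H A" "?N A" for v A
  proof -
    have "wp (HSeq ?c5 (HSeq ?c6 ?c7)) (wp ?c8 ?Q) v A"
      by (rule wp_conseq[OF s5[OF that]]) (use t8 in blast)
    then show ?thesis unfolding wp_simps(4) .
  qed
  have t4: "wp ?c4 (wp ?c5 (wp ?c6 (wp ?c7 (wp ?c8 ?Q)))) v A" if "?G v A" "?S A" "?U A" "?H A" for v A
    by (rule wp_conseq[OF s4[OF that]]) (use t5 in blast)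
  have t3: "wp ?c3 (wp ?c4 (wp ?c5 (wp ?c6 (wp ?c7 (wp ?c8 ?Q))))) v A" if "?G v A" "?S A" "?U A" for v A
    by (rule wp_conseq[OF s3[OF that]]) (use t4 in blast)
  have t2: "wp ?c2 (wp ?c3 (wp ?c4 (wp ?c5 (wp ?c6 (wp ?c7 (wp ?c8 ?Q)))))) v A" if "?G v A" "?S A" for v A
    by (rule wp_conseq[OF s2[OF that]]) (use t3 in blast)
  have t1: "wp ?c1 (wp ?c2 (wp ?c3 (wp ?c4 (wp ?c5 (wp ?c6 (wp ?c7 (wp ?c8 ?Q))))))) v A"
    if "?G v A" "\<forall>i<n. A 6 (n * length \<sigma> + i) = st i" for v A
    by (rule wp_conseq[OF s1[OF that]]) (use t2 in blast)
  let ?v = "v(7 := length \<sigma>)"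
  have e0: "min (eval (ESub (EVar 7) (ENum 1)) v A) (v 2) = length \<sigma>"
    using inv cap by (simp add: inv_graph_def inv_stack_def)
  have "?G ?v A" "\<forall>i<n. A 6 (n * length \<sigma> + i) = st i"
    using inv by (auto simp: inv_graph_def inv_stack_def nth_append)
  from t1[OF this] show ?thesis unfolding pop_prog_def wp_simps(4) wp_simps(2)[of 7] e0 .
qed

text \<open>The new item gets a row of the grid in array 6 above all rows in use, so that these stay
  intact. The expression \<open>e\<close> must not read array 6, which is being filled.\<close>

lemma push_item:
  assumes inv: "inv_stack \<sigma> v A" "v 1 = n" "v 2 = cap" "length \<sigma> < cap"
    and e: "\<And>i v' A'. i < n \<Longrightarrow> v' 20 = i \<Longrightarrow> (\<And>z. z \<noteq> 20 \<Longrightarrow> v' z = v z) \<Longrightarrow>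
      (\<And>b. b \<noteq> 6 \<Longrightarrow> A' b = A b) \<Longrightarrow> eval e v' A' = g i \<and> g i \<le> cap"
  shows "wp (HSeq (HFor 20 1 (HPut 6 (eCell (EVar 7) (EVar 20)) e)) (HAsg 7 (EAdd (EVar 7) (ENum 1))))
    (inv_stack (\<sigma> @ [g])) v A"
  unfolding wp_simps(4)
proof (rule wp_fill[where ix = "\<lambda>i. n * length \<sigma> + i" and F = g])
  fix i v' A'
  assume *: "i < v 1" "v' 20 = i" "\<And>z. z \<noteq> 20 \<Longrightarrow> v' z = v z" "\<And>b. b \<noteq> 6 \<Longrightarrow> A' b = A b"
  then have "eval e v' A' = g i \<and> g i \<le> cap" using inv by (intro e) auto
  then show "eval (eCell (EVar 7) (EVar 20)) v' A' = n * length \<sigma> + i \<and> min (eval e v' A') (v 2) = g i"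
    using * inv by (simp add: inv_stack_def)
next
  fix v' A'
  assume v': "\<And>z. z \<noteq> 20 \<Longrightarrow> v' z = v z" "\<And>b. b \<noteq> 6 \<Longrightarrow> A' b = A b"
    and A': "\<And>i. i < v 1 \<Longrightarrow> A' 6 (n * length \<sigma> + i) = g i"
      "\<And>m. m \<notin> (\<lambda>i. n * length \<sigma> + i) ` {..<v 1} \<Longrightarrow> A' 6 m = A 6 m"
  have "A' 6 (n * t + i) = ((\<sigma> @ [g]) ! t) i" if "t < Suc (length \<sigma>)" "i < n" for t i
  proof (cases "t = length \<sigma>")
    case True
    then show ?thesis using A'(1)[of i] that inv by simp
  next
    case False
    then have "n * t + i \<notin> (\<lambda>i. n * length \<sigma> + i) ` {..<n}" using that by (auto simp: grid_eq)
    then have "A' 6 (n * t + i) = A 6 (n * t + i)" using A'(2) inv(2) by simp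
    also have "\<dots> = (\<sigma> ! t) i" using inv(1) that False by (simp add: inv_stack_def)
    finally show ?thesis using that False by (simp add: nth_append)
  qed
  then show "wp (HAsg 7 (EAdd (EVar 7) (ENum 1))) (inv_stack (\<sigma> @ [g])) v' A'"
    using v' inv by (simp add: inv_stack_def)
qed (auto simp: inj_on_def)

definition "children st b =
  (\<lambda>i. if i \<in> hn (chosen st) (forbidden st) b then 1 else st i) #
  map (\<lambda>w. st(w := 2)) (filter (\<lambda>w. w \<in> hn (chosen st) (forbidden st) b) [0..<n])"

lemma push_prog_correct:
  assumes inv: "inv_graph cap v A" "inv_stack \<sigma> v A" "inv_item st v A" "wf_item st"
    and b: "v 10 \<noteq> 0" "v 10 - 1 < n" and cap: "2 \<le> cap" "length \<sigma> + n < cap"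
  shows "wp push_prog (\<lambda>v' A'. inv_graph cap v' A' \<and> inv_stack (\<sigma> @ children st (v 10 - 1)) v' A' \<and> v' 0 = v 0) v A"
proof -
  let ?H = "hn (chosen st) (forbidden st) (v 10 - 1)"
  let ?c = "\<lambda>i. if i \<in> ?H then 1 else st i"
  have g: "v 1 = n" "v 2 = cap" "\<forall>i<n. \<forall>j<n. A 5 (n * i + j) = of_bool (dmn i j)"
      "\<forall>i<n. A 9 i = of_bool (i \<in> high (chosen st) (forbidden st))" "\<forall>i<n. A 7 i = st i" "\<forall>i<n. st i \<le> 2"
    using inv by (auto simp: inv_graph_def inv_item_def wf_item_def)
  obtain b' where b': "v 10 = Suc b'" using b(1) by (cases "v 10") auto
  have e: "(eval (eHn (EVar x)) v' A' \<noteq> 0) \<longleftrightarrow> v' x \<in> ?H"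
    if "v' x < n" "v' 10 = v 10" "v' 1 = n" "A' 5 = A 5" "A' 9 = A 9" "x \<noteq> 63" for x v' A'
    using that g b unfolding b' by (auto simp: eHn_def hn_def)
  let ?p1 = "HSeq (HFor 20 1 (HPut 6 (eCell (EVar 7) (EVar 20)) (EIf (eHn (EVar 20)) (ENum 1) (EIdx 7 (EVar 20)))))
    (HAsg 7 (EAdd (EVar 7) (ENum 1)))"
  let ?p2 = "HSeq (HFor 20 1 (HPut 6 (eCell (EVar 7) (EVar 20)) (EIf (eEq (EVar 20) (EVar 21)) (ENum 2) (EIdx 7 (EVar 20)))))
    (HAsg 7 (EAdd (EVar 7) (ENum 1)))"
  let ?p3 = "HIf (eHn (EVar 21)) ?p2 HSkip"
  let ?st = "\<lambda>w. (\<sigma> @ [?c]) @ map (\<lambda>w. st(w := 2)) (filter (\<lambda>w. w \<in> ?H) [0..<w])"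
  have s1: "wp ?p1 (inv_stack (\<sigma> @ [?c])) v A"
  proof (rule push_item[OF inv(2) g(1,2)])
    show "length \<sigma> < cap" using cap by simp
    fix i v' A'
    assume *: "i < n" "v' 20 = i" "\<And>z. z \<noteq> 20 \<Longrightarrow> v' z = v z" "\<And>b. b \<noteq> 6 \<Longrightarrow> A' b = A b"
    have "(eval (eHn (EVar 20)) v' A' \<noteq> 0) \<longleftrightarrow> v' 20 \<in> ?H" by (rule e) (use * g in auto)
    moreover have "st i \<le> cap" using g(6) *(1) cap by (meson le_trans)
    ultimately show "eval (EIf (eHn (EVar 20)) (ENum 1) (EIdx 7 (EVar 20))) v' A' = ?c i \<and> ?c i \<le> cap"
      using * g(5) cap by simp
  qed
  have s2: "wp (HFor 21 1 ?p3) (inv_stack (?st n)) v1 A1"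
    if st: "inv_stack (\<sigma> @ [?c]) v1 A1" and fr1: "\<And>z. z \<notin> {7, 20} \<Longrightarrow> v1 z = v z" "\<And>a. a \<noteq> 6 \<Longrightarrow> A1 a = A a" for v1 A1
  proof (rule wp_for[where P = "\<lambda>w. inv_stack (?st w)"])
    fix w v' A'
    assume w: "w < v1 1" "inv_stack (?st w) v' A'"
      and fr: "\<And>z. z \<notin> insert 21 (asgd ?p3) \<Longrightarrow> v' z = v1 z" "\<And>a. a \<notin> putd ?p3 \<Longrightarrow> A' a = A1 a"
    let ?v = "v'(21 := w)"
    have wn: "w < n" using w fr1 g by simp
    have eq: "?v 10 = v 10" "?v 1 = n" "?v 2 = cap" "A' 5 = A 5" "A' 9 = A 9" "A' 7 = A 7"
      using fr fr1 g by auto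
    have ew: "(eval (eHn (EVar 21)) ?v A' \<noteq> 0) \<longleftrightarrow> ?v 21 \<in> ?H" by (rule e) (use eq wn in auto)
    have stv: "inv_stack (?st w) ?v A'" using w by (simp add: inv_stack_def)
    have len: "length (?st w) < cap"
    proof -
      have "length (filter (\<lambda>w. w \<in> ?H) [0..<w]) \<le> w" using length_filter_le[of _ "[0..<w]"] by simp
      then show ?thesis using wn cap by simp
    qed
    have "wp ?p2 (inv_stack (?st w @ [st(w := 2)])) ?v A'"
    proof (rule push_item[OF stv eq(2,3) len])
      fix i v2 A2
      assume *: "i < n" "v2 20 = i" "\<And>z. z \<noteq> 20 \<Longrightarrow> v2 z = ?v z" "\<And>b. b \<noteq> 6 \<Longrightarrow> A2 b = A' b"
      have "st i \<le> cap" using g(6) *(1) cap by (meson le_trans)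
      then show "eval (EIf (eEq (EVar 20) (EVar 21)) (ENum 2) (EIdx 7 (EVar 20))) v2 A2 = (st(w := 2)) i \<and> (st(w := 2)) i \<le> cap"
        using * eq g(5) cap by simp
    qed
    then show "wp ?p3 (inv_stack (?st (Suc w))) ?v A'"
      using ew stv by (cases "w \<in> ?H") simp_all
  qed (use st fr1 g in auto)
  have "wp push_prog (inv_stack (\<sigma> @ children st (v 10 - 1))) v A"
  proof -
    have "wp ?p1 (wp (HFor 21 1 ?p3) (inv_stack (?st n))) v A"
      by (rule wp_conseq[OF s1]) (use s2 in auto)
    moreover have "?st n = \<sigma> @ children st (v 10 - 1)" by (simp add: children_def)
    ultimately show ?thesis unfolding push_prog_def wp_simps(4) by (simp only:)
  qed
  then show ?thesis
    by (rule wp_conseq) (use inv(1) in \<open>simp add: push_prog_def inv_graph_def\<close>)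
qed

end


section \<open>The dynamic program\<close>

text \<open>Bits are numbered by the rank within the targets, so that the masks are the numbers
  below \<open>2 ^ card Q\<close> and the mask of all targets is
  \<open>2 ^ card Q - 1\<close>.\<close>

definition "rank Q x = card (Q \<inter> {..<x})" for Q :: "nat set"
definition "enc Q X = (\<Sum>x\<in>X. 2 ^ rank Q x :: nat)" for Q :: "nat set"

lemma rank_inj: "finite Q \<Longrightarrow> inj_on (rank Q) Q"
proof (rule linorder_inj_onI')
  fix x y assume *: "finite Q" "x \<in> Q" "y \<in> Q" "x < y"
  then have "Q \<inter> {..<x} \<subset> Q \<inter> {..<y}" by auto
  then have "rank Q x < rank Q y" unfolding rank_def using *(1) by (intro psubset_card_mono) auto
  then show "rank Q x \<noteq> rank Q y" by simp
qed

lemma mask_encode: "finite Q \<Longrightarrow> X \<subseteq> Q \<Longrightarrow> enc Q X = set_encode (rank Q ` X)"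
  unfolding enc_def set_encode_def
  by (subst sum.reindex) (auto intro: inj_on_subset[OF rank_inj])

lemma mask_eq_iff:
  assumes "finite Q" "X \<subseteq> Q" "Y \<subseteq> Q"
  shows "enc Q X = enc Q Y \<longleftrightarrow> X = Y"
proof
  assume "enc Q X = enc Q Y"
  then have "set_encode (rank Q ` X) = set_encode (rank Q ` Y)" using assms mask_encode by simp
  then have "rank Q ` X = rank Q ` Y"
    using assms by (subst (asm) set_encode_eq) (auto intro: finite_subset)
  then show "X = Y" using inj_on_image_eq_iff[OF rank_inj[OF assms(1)] assms(2,3)] by simp
qed simp

lemma mask_Un: "finite X \<Longrightarrow> finite Y \<Longrightarrow> X \<inter> Y = {} \<Longrightarrow> enc Q (X \<union> Y) = enc Q X + enc Q Y"
  unfolding enc_def by (rule sum.union_disjoint)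

lemma mask_full: "finite Q \<Longrightarrow> enc Q Q = 2 ^ card Q - 1"
proof -
  assume fin: "finite Q"
  have "rank Q x < card Q" if "x \<in> Q" for x
    unfolding rank_def using fin that by (intro psubset_card_mono) auto
  then have "rank Q ` Q = {..<card Q}"
    using fin by (intro card_subset_eq) (auto simp: card_image rank_inj)
  then have "enc Q Q = (\<Sum>i<card Q. 2 ^ i)" using fin by (simp add: mask_encode set_encode_def)
  then show ?thesis by (simp add: sum_power2 lessThan_atLeast0)
qed

lemma mask_less: "finite Q \<Longrightarrow> X \<subseteq> Q \<Longrightarrow> enc Q X < 2 ^ card Q"
proof -
  assume *: "finite Q" "X \<subseteq> Q"
  have "enc Q X \<le> enc Q Q" unfolding enc_def using * by (intro sum_mono2) auto
  moreover have "enc Q Q < 2 ^ card Q" using *(1) by (simp add: mask_full)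
  ultimately show ?thesis by simp
qed

definition "eTarget x = eOr (EIdx 8 x) (eChosen x)"

text \<open>Register 11 runs through the powers of 2 and is always the next free bit; register 12
  accumulates the length needed for the long loops.\<close>

definition "mask_prog = HSeq (HAsg 11 (ENum 1)) (HSeq (HAsg 12 (ENum 1))
  (HFor 20 1 (HIf (eTarget (EVar 20))
    (HSeq (HPut 11 (EVar 20) (EVar 11)) (HSeq (HAsg 11 (EAdd (EVar 11) (EVar 11)))
      (HAsg 12 (EAdd (EVar 12) (EAdd (EVar 12) (EVar 12))))))
    (HPut 11 (EVar 20) (ENum 0)))))"

definition "pair_prog =
  HSeq (HPut 12 (EAdd (EVar 13) (EVar 21)) (EAdd (EIdx 12 (EVar 21)) (EIdx 11 (EVar 20))))
  (HSeq (HPut 13 (EAdd (EVar 13) (EVar 21)) (EIdx 13 (EVar 21)))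
  (HSeq (HPut 12 (EAdd (EAdd (EVar 13) (EVar 13)) (EVar 21)) (EIdx 12 (EVar 21)))
    (HPut 13 (EAdd (EAdd (EVar 13) (EVar 13)) (EVar 21)) (EAdd (EIdx 13 (EVar 21)) (EIdx 11 (EVar 20))))))"

text \<open>The machine has no bit operations that could test disjointness, so the disjoint pairs
  are listed: each target triples the list, as it joins neither set, the first or the second. The
  inner loop always has its full length, since register 4 is the only long range, and is guarded by
  the current length of the list.\<close>

definition "pairs_prog = HSeq (HPut 12 (ENum 0) (ENum 0)) (HSeq (HPut 13 (ENum 0) (ENum 0))
  (HSeq (HAsg 13 (ENum 1)) (HFor 20 1 (HIf (eTarget (EVar 20))
    (HSeq (HFor 21 4 (HIf (eLt (EVar 21) (EVar 13)) pair_prog HSkip))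
      (HAsg 13 (EAdd (EVar 13) (EAdd (EVar 13) (EVar 13))))) HSkip))))"

text \<open>\<open>n + 1\<close> plays the role of infinity, because a cost of interest is at most
  \<open>k \<le> n\<close>. Nontargets have mask 0 in array 11 and thus match only the empty
  set.\<close>

definition "table_prog = HFor 21 4 (HFor 20 1 (HPut 14 (eCell (EIdx 12 (EVar 21)) (EVar 20))
  (EIf (eOr (eNot (EIdx 12 (EVar 21))) (eEq (EIdx 12 (EVar 21)) (EIdx 11 (EVar 20))))
    (ENum 0) (EAdd (EVar 1) (ENum 1)))))"

definition "join_prog = HFor 21 4 (HFor 20 1
  (HPut 14 (eCell (EAdd (EIdx 12 (EVar 21)) (EIdx 13 (EVar 21))) (EVar 20))
    (eMin (EIdx 14 (eCell (EAdd (EIdx 12 (EVar 21)) (EIdx 13 (EVar 21))) (EVar 20)))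
      (EAdd (EIdx 14 (eCell (EIdx 12 (EVar 21)) (EVar 20))) (EIdx 14 (eCell (EIdx 13 (EVar 21)) (EVar 20)))))))"

definition "eUsable x = eNot (eEq (EIdx 7 x) (ENum 1))"

text \<open>Only the first components of the pairs are used. Each set of targets occurs among them,
  possibly many times, and repeating a relaxation does no harm.\<close>

definition "arc_prog = HFor 21 4 (HFor 20 1 (HFor 24 1
  (HIf (eAnd (eUsable (EVar 24)) (eAnd (eUsable (EVar 20)) (EIdx 1 (eCell (EVar 24) (EVar 20)))))
    (HPut 14 (eCell (EIdx 12 (EVar 21)) (EVar 24))
      (eMin (EIdx 14 (eCell (EIdx 12 (EVar 21)) (EVar 24)))
        (EAdd (EIdx 14 (eCell (EIdx 12 (EVar 21)) (EVar 20))) (eAvail (EVar 20))))) HSkip)))"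

definition "leaf_prog = HSeq pairs_prog (HSeq table_prog (HSeq
  (HFor 22 1 (HFor 23 1 (HSeq join_prog arc_prog)))
  (HIf (eNot (eLt (ESub (EVar 5) (EVar 8)) (EIdx 14 (eCell (ESub (EVar 11) (ENum 1)) (EVar 6)))))
    (HAsg 0 (ENum 1)) HSkip)))"

context dst
begin

lemma wf_item_sets:
  assumes "wf_item st"
  shows "chosen st \<subseteq> nonterms" "forbidden st \<subseteq> nonterms" "chosen st \<inter> forbidden st = {}"
  using assms by (auto simp: chosen_def forbidden_def wf_item_def)

context
  fixes st :: "nat \<Rightarrow> nat" and cap :: nat
  assumes wf: "wf_item st" and cap: "3 ^ n \<le> cap" "n + 1 \<le> cap"
begin

abbreviation "Cs \<equiv> chosen st"
abbreviation "Fs \<equiv> forbidden st"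
abbreviation "Qs \<equiv> targets (chosen st)"
abbreviation "msk \<equiv> enc (targets (chosen st))"

lemma Qs: "finite Qs" "Qs \<subseteq> {..<n}" "card Qs \<le> n" "Qs \<inter> {..<n} = Qs"
proof -
  show sub: "Qs \<subseteq> {..<n}" using nonterms_subset(3) by (auto simp: targets_def chosen_def)
  then show "finite Qs" using finite_subset by blast
  show "card Qs \<le> n" using card_mono[OF _ sub] by simp
  show "Qs \<inter> {..<n} = Qs" using sub by blast
qed

lemma eval_eTarget:
  "inv_item st v A \<Longrightarrow> v x < n \<Longrightarrow> (eval (eTarget (EVar x)) v A \<noteq> 0) \<longleftrightarrow> v x \<in> Qs"
  by (auto simp: eTarget_def eChosen_def inv_item_def targets_def chosen_def)

lemma rank_Suc: "i \<in> Qs \<Longrightarrow> card (Qs \<inter> {..<Suc i}) = Suc (rank Qs i)"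
proof -
  assume "i \<in> Qs"
  then have "Qs \<inter> {..<Suc i} = insert i (Qs \<inter> {..<i})" by auto
  then show ?thesis using Qs(1) by (simp add: rank_def)
qed

lemma rank_Suc': "i \<notin> Qs \<Longrightarrow> Qs \<inter> {..<Suc i} = Qs \<inter> {..<i}"
  by (auto simp: less_Suc_eq)

lemma pow_le_cap: "X \<subseteq> Qs \<Longrightarrow> 2 ^ card X \<le> cap" "X \<subseteq> Qs \<Longrightarrow> 3 ^ card X \<le> cap"
proof -
  assume X: "X \<subseteq> Qs"
  then have c: "card X \<le> n" using card_mono[OF Qs(1) X] Qs(3) by simp
  then have "(3 :: nat) ^ card X \<le> 3 ^ n" by (intro power_increasing) auto
  then show 3: "3 ^ card X \<le> cap" using cap(1) by (rule le_trans)
  have "(2 :: nat) ^ card X \<le> 3 ^ card X" by (intro power_mono) auto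
  then show "2 ^ card X \<le> cap" using 3 by (rule le_trans)
qed

definition "inv_mask A \<longleftrightarrow> (\<forall>i<n. A 11 i = (if i \<in> Qs then 2 ^ rank Qs i else (0 :: nat)))"
  for A :: "nat \<Rightarrow> nat \<Rightarrow> nat"

lemma mask_prog_correct:
  assumes inv: "inv_item st v A" "v 1 = n" "v 2 = cap"
  shows "wp mask_prog (\<lambda>v A. inv_mask A \<and> v 11 = 2 ^ card Qs \<and> v 12 = 3 ^ card Qs) v A"
proof -
  have c1: "min 1 cap = 1" using cap by simp
  let ?v = "v(11 := 1, 12 := 1)"
  let ?b = "HIf (eTarget (EVar 20))
    (HSeq (HPut 11 (EVar 20) (EVar 11)) (HSeq (HAsg 11 (EAdd (EVar 11) (EVar 11)))
      (HAsg 12 (EAdd (EVar 12) (EAdd (EVar 12) (EVar 12))))))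
    (HPut 11 (EVar 20) (ENum 0))"
  have "wp (HFor 20 1 ?b) (\<lambda>v A. inv_mask A \<and> v 11 = 2 ^ card Qs \<and> v 12 = 3 ^ card Qs) ?v A"
  proof (rule wp_for[where P = "\<lambda>i v A. (\<forall>j<i. A 11 j = (if j \<in> Qs then 2 ^ rank Qs j else 0)) \<and>
      v 11 = 2 ^ card (Qs \<inter> {..<i}) \<and> v 12 = 3 ^ card (Qs \<inter> {..<i})"])
    fix i v' A'
    assume i: "i < ?v 1" and P: "(\<forall>j<i. A' 11 j = (if j \<in> Qs then 2 ^ rank Qs j else 0)) \<and>
      v' 11 = 2 ^ card (Qs \<inter> {..<i}) \<and> v' 12 = 3 ^ card (Qs \<inter> {..<i})"
      and fr: "\<And>z. z \<notin> insert 20 (asgd ?b) \<Longrightarrow> v' z = ?v z" "\<And>a. a \<notin> putd ?b \<Longrightarrow> A' a = A a"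
    let ?w = "v'(20 := i)"
    have w: "?w 2 = cap" "i < n" using fr(1) inv i by auto
    have "inv_item st ?w A'" using inv(1) fr by (simp add: inv_item_def)
    then have t: "(eval (eTarget (EVar 20)) ?w A' \<noteq> 0) \<longleftrightarrow> i \<in> Qs" using eval_eTarget[of ?w A' 20] w by simp
    show "wp ?b (\<lambda>v A. (\<forall>j<Suc i. A 11 j = (if j \<in> Qs then 2 ^ rank Qs j else 0)) \<and>
      v 11 = 2 ^ card (Qs \<inter> {..<Suc i}) \<and> v 12 = 3 ^ card (Qs \<inter> {..<Suc i})) ?w A'"
    proof (cases "i \<in> Qs")
      case True
      have "2 * 2 ^ rank Qs i \<le> cap" "3 * 3 ^ rank Qs i \<le> cap" "2 ^ rank Qs i \<le> cap"
        using pow_le_cap[of "Qs \<inter> {..<Suc i}"] pow_le_cap[of "Qs \<inter> {..<i}"] rank_Suc[OF True]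
        by (auto simp: rank_def)
      then show ?thesis using True t P w rank_Suc[OF True]
        by (simp add: less_Suc_eq min.absorb1 flip: rank_def)
    next
      case False
      then show ?thesis using t P w rank_Suc'[OF False] by (simp add: less_Suc_eq)
    qed
  next
    fix v' and A' :: "nat \<Rightarrow> nat \<Rightarrow> nat"
    assume "(\<forall>j<?v 1. A' 11 j = (if j \<in> Qs then 2 ^ rank Qs j else 0)) \<and>
      v' 11 = 2 ^ card (Qs \<inter> {..<?v 1}) \<and> v' 12 = 3 ^ card (Qs \<inter> {..<?v 1})"
    then show "inv_mask A' \<and> v' 11 = 2 ^ card Qs \<and> v' 12 = 3 ^ card Qs"
      using inv Qs(4) by (simp add: inv_mask_def)
  qed simp
  then show ?thesis unfolding mask_prog_def wp_simps(4) wp_simps(2)[of 11] wp_simps(2)[of 12]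
    using inv c1 by simp
qed

definition "pairs i = {(msk Y, msk Z) | Y Z. Y \<subseteq> Qs \<inter> {..<i} \<and> Z \<subseteq> Qs \<inter> {..<i} \<and> Y \<inter> Z = {}}"

definition "inv_pairs i m A \<longleftrightarrow> m = 3 ^ card (Qs \<inter> {..<i}) \<and> (\<lambda>t. (A 12 t, A 13 t)) ` {..<m} = pairs i"
  for A :: "nat \<Rightarrow> nat \<Rightarrow> nat"

lemma msk_insert: "i \<in> Qs \<Longrightarrow> Y \<subseteq> Qs \<inter> {..<i} \<Longrightarrow> msk (insert i Y) = msk Y + 2 ^ rank Qs i"
proof -
  assume *: "i \<in> Qs" "Y \<subseteq> Qs \<inter> {..<i}"
  then have "finite Y" "i \<notin> Y" using Qs(1) by (auto intro: finite_subset)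
  then show ?thesis by (simp add: enc_def)
qed

lemma pairs_Suc:
  assumes i: "i \<in> Qs"
  shows "pairs (Suc i) = pairs i \<union> (\<lambda>(a, b). (a + 2 ^ rank Qs i, b)) ` pairs i \<union> (\<lambda>(a, b). (a, b + 2 ^ rank Qs i)) ` pairs i"
    (is "?L = ?R")
proof
  have S: "Qs \<inter> {..<Suc i} = insert i (Qs \<inter> {..<i})" using i by auto
  show "?L \<subseteq> ?R"
  proof
    fix p assume "p \<in> ?L"
    then obtain Y Z where p: "p = (msk Y, msk Z)" "Y \<subseteq> insert i (Qs \<inter> {..<i})" "Z \<subseteq> insert i (Qs \<inter> {..<i})" "Y \<inter> Z = {}"
      unfolding pairs_def S by blast
    let ?Y = "Y - {i}" and ?Z = "Z - {i}"
    have YZ: "?Y \<subseteq> Qs \<inter> {..<i}" "?Z \<subseteq> Qs \<inter> {..<i}" "?Y \<inter> ?Z = {}" using p by auto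
    then have mem: "(msk ?Y, msk ?Z) \<in> pairs i" unfolding pairs_def by blast
    consider "i \<in> Y" "i \<notin> Z" | "i \<notin> Y" "i \<in> Z" | "i \<notin> Y" "i \<notin> Z" using p(4) by blast
    then show "p \<in> ?R"
    proof cases
      case 1
      then have "p = (msk ?Y + 2 ^ rank Qs i, msk ?Z)"
        using msk_insert[OF i YZ(1)] p(1) by (simp add: insert_absorb)
      then show ?thesis using mem by force
    next
      case 2
      then have "p = (msk ?Y, msk ?Z + 2 ^ rank Qs i)"
        using msk_insert[OF i YZ(2)] p(1) by (simp add: insert_absorb)
      then show ?thesis using mem by force
    next
      case 3
      then show ?thesis using mem p(1) by simp
    qed
  qed
  show "?R \<subseteq> ?L"
  proof
    fix p assume "p \<in> ?R"
    then obtain Y Z where YZ: "Y \<subseteq> Qs \<inter> {..<i}" "Z \<subseteq> Qs \<inter> {..<i}" "Y \<inter> Z = {}"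
      and p: "p = (msk Y, msk Z) \<or> p = (msk Y + 2 ^ rank Qs i, msk Z) \<or> p = (msk Y, msk Z + 2 ^ rank Qs i)"
      unfolding pairs_def by auto
    have "p = (msk Y, msk Z) \<or> p = (msk (insert i Y), msk Z) \<or> p = (msk Y, msk (insert i Z))"
      using p msk_insert[OF i YZ(1)] msk_insert[OF i YZ(2)] by simp
    moreover have "i \<notin> Y" "i \<notin> Z" using YZ by auto
    then have "insert i Y \<inter> Z = {}" "Y \<inter> insert i Z = {}" using YZ by auto
    ultimately show "p \<in> ?L" unfolding pairs_def S using YZ by blast
  qed
qed

lemma image_thirds:
  fixes g :: "nat \<Rightarrow> 'x"
  shows "g ` {..<m + (m + m)} = g ` {..<m} \<union> (\<lambda>t. g (m + t)) ` {..<m} \<union> (\<lambda>t. g (m + m + t)) ` {..<m}"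
proof -
  have "{..<m + (m + m)} = {..<m} \<union> (\<lambda>t. m + t) ` {..<m} \<union> (\<lambda>t. m + m + t) ` {..<m}"
  proof (intro set_eqI iffI)
    fix x assume x: "x \<in> {..<m + (m + m)}"
    consider "x < m" | "m \<le> x" "x < m + m" | "m + m \<le> x" by linarith
    then show "x \<in> {..<m} \<union> (\<lambda>t. m + t) ` {..<m} \<union> (\<lambda>t. m + m + t) ` {..<m}"
    proof cases
      case 2
      then have "x = m + (x - m)" "x - m < m" by auto
      then show ?thesis by blast
    next
      case 3
      then have "x = m + m + (x - (m + m))" "x - (m + m) < m" using x by auto
      then show ?thesis by blast
    qed simp
  qed auto
  then show ?thesis by (simp add: image_Un image_image)
qed

lemma pairs_prog_correct:
  assumes inv: "inv_item st v A" "v 1 = n" "v 2 = cap" "v 4 = 3 ^ card Qs" "inv_mask A"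
  shows "wp pairs_prog (\<lambda>v A. (\<lambda>t. (A 12 t, A 13 t)) ` {..<v 4} = pairs n) v A"
proof -
  have c1: "min 1 cap = 1" using cap by simp
  let ?v = "v(13 := 1)" and ?A = "A(12 := (A 12)(0 := 0), 13 := (A 13)(0 := 0))"
  let ?in = "HIf (eLt (EVar 21) (EVar 13)) pair_prog HSkip"
  let ?b = "HIf (eTarget (EVar 20)) (HSeq (HFor 21 4 ?in) (HAsg 13 (EAdd (EVar 13) (EAdd (EVar 13) (EVar 13))))) HSkip"
  have asgd: "asgd pair_prog = {}" "putd pair_prog = {12, 13}" by (simp_all add: pair_prog_def insert_commute)
  have inner: "wp (HFor 21 4 ?in) (\<lambda>_ A2. (\<lambda>t. (A2 12 t, A2 13 t)) ` {..<m + (m + m)} = pairs (Suc i)) w A1"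
    if i: "i \<in> Qs" "i < n" and w: "w 20 = i" "w 13 = m" "w 4 = 3 ^ card Qs" "w 2 = cap"
      and A1: "inv_mask A1" "inv_pairs i m A1" for i m w A1
  proof -
    have m: "m = 3 ^ rank Qs i" "(\<lambda>t. (A1 12 t, A1 13 t)) ` {..<m} = pairs i"
      using A1 by (auto simp: inv_pairs_def rank_def)
    \<comment> \<open>The long loop is tuned to the final list and therefore covers the current
      one.\<close>
    have "m \<le> 3 ^ card Qs" unfolding m(1) rank_def
      using Qs(1) by (intro power_increasing card_mono) auto
    then have mw: "m \<le> w 4" using w by simp
    have bit: "A1 11 i = 2 ^ rank Qs i" using A1 i by (simp add: inv_mask_def)
    have bd: "A1 12 t + 2 ^ rank Qs i \<le> cap" "A1 13 t + 2 ^ rank Qs i \<le> cap" if "t < m" for t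
    proof -
      have "(A1 12 t, A1 13 t) \<in> pairs i" unfolding m(2)[symmetric] using that by blast
      then obtain Y Z where YZ: "A1 12 t = msk Y" "A1 13 t = msk Z" "Y \<subseteq> Qs \<inter> {..<i}" "Z \<subseteq> Qs \<inter> {..<i}"
        unfolding pairs_def by auto
      have "msk (insert i Y) < 2 ^ card Qs" "msk (insert i Z) < 2 ^ card Qs"
        by (rule mask_less; use YZ i Qs(1) in auto)+
      then show "A1 12 t + 2 ^ rank Qs i \<le> cap" "A1 13 t + 2 ^ rank Qs i \<le> cap"
        using pow_le_cap(1)[OF order_refl] msk_insert[OF i(1) YZ(3)] msk_insert[OF i(1) YZ(4)] YZ by auto
    qed
    \<comment> \<open>The first \<open>m\<close> entries are read but never changed, so that the
      other two thirds can be written entry by entry.\<close>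
    let ?P = "\<lambda>s (w :: nat \<Rightarrow> nat) (B :: nat \<Rightarrow> nat \<Rightarrow> nat). (\<forall>t<m. B 12 t = A1 12 t \<and> B 13 t = A1 13 t) \<and>
      (\<forall>t. t < s \<and> t < m \<longrightarrow> B 12 (m + t) = A1 12 t + 2 ^ rank Qs i \<and> B 13 (m + t) = A1 13 t \<and>
        B 12 (m + m + t) = A1 12 t \<and> B 13 (m + m + t) = A1 13 t + 2 ^ rank Qs i)"
    show ?thesis
    proof (rule wp_for[where P = ?P])
      fix s w' B
      assume s: "s < w 4" and P: "?P s w' B"
        and fr: "\<And>z. z \<notin> insert 21 (asgd ?in) \<Longrightarrow> w' z = w z" "\<And>a. a \<notin> putd ?in \<Longrightarrow> B a = A1 a"
      have w': "w' 20 = i" "w' 13 = m" "w' 2 = cap" "B 11 i = 2 ^ rank Qs i"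
        using fr w bit by (auto simp: asgd)
      show "wp ?in (?P (Suc s)) (w'(21 := s)) B"
      proof (cases "s < m")
        case True
        have B: "B 12 s = A1 12 s" "B 13 s = A1 13 s" using P True by auto
        have mins: "min (A1 12 s + 2 ^ rank Qs i) cap = A1 12 s + 2 ^ rank Qs i" "min (A1 13 s) cap = A1 13 s"
          "min (A1 12 s) cap = A1 12 s" "min (A1 13 s + 2 ^ rank Qs i) cap = A1 13 s + 2 ^ rank Qs i"
          using bd[OF True] by auto
        let ?B = "B(12 := (B 12)(m + s := A1 12 s + 2 ^ rank Qs i, m + m + s := A1 12 s),
          13 := (B 13)(m + s := A1 13 s, m + m + s := A1 13 s + 2 ^ rank Qs i))"
        have "?P (Suc s) w' ?B" using P True by (auto simp: less_Suc_eq)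
        moreover have "wp pair_prog (?P (Suc s)) (w'(21 := s)) B \<longleftrightarrow> ?P (Suc s) w' ?B"
          unfolding pair_prog_def wp_simps using w' B mins True by (simp add: fun_upd_twist)
        ultimately show ?thesis using w' True by simp
      next
        case False
        then show ?thesis using w' P by (auto simp: less_Suc_eq)
      qed
    next
      fix w' B
      assume P: "?P (w 4) w' B"
      have "(\<lambda>t. (B 12 t, B 13 t)) ` {..<m} = pairs i"
        using P m(2) by (metis (mono_tags, lifting) image_cong lessThan_iff)
      moreover have "(\<lambda>t. (B 12 (m + t), B 13 (m + t))) ` {..<m} = (\<lambda>(a, b). (a + 2 ^ rank Qs i, b)) ` pairs i"
        unfolding m(2)[symmetric] image_image using P mw by (intro image_cong) auto
      moreover have "(\<lambda>t. (B 12 (m + m + t), B 13 (m + m + t))) ` {..<m} = (\<lambda>(a, b). (a, b + 2 ^ rank Qs i)) ` pairs i"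
        unfolding m(2)[symmetric] image_image using P mw by (intro image_cong) auto
      ultimately show "(\<lambda>t. (B 12 t, B 13 t)) ` {..<m + (m + m)} = pairs (Suc i)"
        unfolding image_thirds pairs_Suc[OF i(1)] by simp
    qed simp
  qed
  have "wp (HFor 20 1 ?b) (\<lambda>v A. (\<lambda>t. (A 12 t, A 13 t)) ` {..<v 4} = pairs n) ?v ?A"
  proof (rule wp_for[where P = "\<lambda>i v A. inv_pairs i (v 13) A"])
    show "inv_pairs 0 (?v 13) ?A" by (auto simp: inv_pairs_def pairs_def enc_def)
  next
    fix i v' A'
    assume i: "i < ?v 1" and P: "inv_pairs i (v' 13) A'"
      and fr: "\<And>z. z \<notin> insert 20 (asgd ?b) \<Longrightarrow> v' z = ?v z" "\<And>a. a \<notin> putd ?b \<Longrightarrow> A' a = ?A a"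
    let ?w = "v'(20 := i)"
    have w: "?w 2 = cap" "i < n" "?w 4 = 3 ^ card Qs" using fr(1) inv i by (auto simp: asgd)
    have "inv_item st ?w A'" using inv(1) fr by (simp add: inv_item_def asgd)
    then have t: "(eval (eTarget (EVar 20)) ?w A' \<noteq> 0) \<longleftrightarrow> i \<in> Qs" using eval_eTarget[of ?w A' 20] w by simp
    show "wp ?b (\<lambda>v A. inv_pairs (Suc i) (v 13) A) ?w A'"
    proof (cases "i \<in> Qs")
      case True
      let ?m = "v' 13"
      have mask': "inv_mask A'" using inv(5) fr by (simp add: inv_mask_def asgd)
      have m3: "?m = 3 ^ rank Qs i" using P by (simp add: inv_pairs_def rank_def)
      have le: "?m + (?m + ?m) \<le> cap"
        using pow_le_cap(2)[of "Qs \<inter> {..<Suc i}"] rank_Suc[OF True] m3 by simp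
      have "wp (HFor 21 4 ?in) (wp (HAsg 13 (EAdd (EVar 13) (EAdd (EVar 13) (EVar 13)))) (\<lambda>v A. inv_pairs (Suc i) (v 13) A)) ?w A'"
        by (rule wp_conseq[OF inner[OF True w(2) _ _ w(3,1) mask', of ?m]])
          (use P le w m3 rank_Suc[OF True] in \<open>auto simp: inv_pairs_def asgd\<close>)
      then show ?thesis using t True by simp
    next
      case False
      have "pairs (Suc i) = pairs i" by (simp only: pairs_def rank_Suc'[OF False])
      note eq = this
      have "inv_pairs (Suc i) (v' 13) A'"
        using P unfolding inv_pairs_def rank_Suc'[OF False] eq .
      then show ?thesis using False t by simp
    qed
  next
    fix v' A'
    assume P: "inv_pairs (?v 1) (v' 13) A'" and fr: "\<And>z. z \<notin> insert 20 (asgd ?b) \<Longrightarrow> v' z = ?v z"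
    have n: "?v 1 = n" using inv by simp
    have "v' 4 = 3 ^ card Qs" using fr inv by (simp add: asgd)
    then have "v' 13 = v' 4" using P Qs(4) unfolding inv_pairs_def n by simp
    then show "(\<lambda>t. (A' 12 t, A' 13 t)) ` {..<v' 4} = pairs n"
      using P unfolding inv_pairs_def n by metis
  qed
  then show ?thesis unfolding pairs_prog_def wp_simps(4) wp_simps(2)[of 13] wp_simps(3)[of 12] wp_simps(3)[of 13]
    using inv c1 by simp
qed

definition "good_pairs m A \<longleftrightarrow> (\<lambda>t. (A 12 t, A 13 t)) ` {..<m} = pairs n"
  for A :: "nat \<Rightarrow> nat \<Rightarrow> nat"

lemma good_pairs_mem:
  assumes "good_pairs m A" "t < m"
  obtains Y Z where "Y \<subseteq> Qs" "Z \<subseteq> Qs" "Y \<inter> Z = {}" "A 12 t = msk Y" "A 13 t = msk Z"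
proof -
  have "(A 12 t, A 13 t) \<in> pairs n" using assms unfolding good_pairs_def by blast
  then have "\<exists>Y Z. (A 12 t, A 13 t) = (msk Y, msk Z) \<and> Y \<subseteq> Qs \<inter> {..<n} \<and> Z \<subseteq> Qs \<inter> {..<n} \<and> Y \<inter> Z = {}"
    by (simp add: pairs_def)
  then obtain Y Z where "(A 12 t, A 13 t) = (msk Y, msk Z)" "Y \<subseteq> Qs \<inter> {..<n}" "Z \<subseteq> Qs \<inter> {..<n}" "Y \<inter> Z = {}"
    by (elim exE conjE)
  then show ?thesis using that[of Y Z] by simp
qed

lemma good_pairs_ex:
  assumes "good_pairs m A" "Y \<subseteq> Qs" "Z \<subseteq> Qs" "Y \<inter> Z = {}"
  obtains t where "t < m" "A 12 t = msk Y" "A 13 t = msk Z"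
proof -
  have "(msk Y, msk Z) \<in> pairs n" using assms(2-4) Qs(4) unfolding pairs_def by auto
  then have "(msk Y, msk Z) \<in> (\<lambda>t. (A 12 t, A 13 t)) ` {..<m}" using assms(1) by (simp add: good_pairs_def)
  then show ?thesis using that by auto
qed

lemma table_prog_correct:
  assumes v: "v 1 = n" "v 2 = cap" "v 4 = m" and A: "inv_mask A" "good_pairs m A"
  shows "wp table_prog (\<lambda>_ A. \<forall>X\<subseteq>Qs. \<forall>w<n. A 14 (n * msk X + w) =
    (if X = {} \<or> w \<in> Qs \<and> X = {w} then 0 else n + 1)) v A"
proof -
  let ?val = "\<lambda>x w. if x = 0 \<or> x = A 11 w then 0 else n + 1"
  let ?e = "EIf (eOr (eNot (EIdx 12 (EVar 21))) (eEq (EIdx 12 (EVar 21)) (EIdx 11 (EVar 20))))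
    (ENum 0) (EAdd (EVar 1) (ENum 1))"
  let ?c = "HFor 20 1 (HPut 14 (eCell (EIdx 12 (EVar 21)) (EVar 20)) ?e)"
  have val: "?val (msk X) w = (if X = {} \<or> w \<in> Qs \<and> X = {w} then 0 else n + 1)" if "X \<subseteq> Qs" "w < n" for X w
  proof -
    have 0: "msk {} = 0" by (simp add: enc_def)
    then have "msk X = 0 \<longleftrightarrow> X = {}" using mask_eq_iff[OF Qs(1) that(1), of "{}"] by simp
    moreover have "msk X = A 11 w \<longleftrightarrow> X = {w}" if "w \<in> Qs"
    proof -
      have "A 11 w = msk {w}" using A(1) that \<open>w < n\<close> by (simp add: inv_mask_def enc_def)
      then show ?thesis using mask_eq_iff[OF Qs(1) \<open>X \<subseteq> Qs\<close>, of "{w}"] that by simp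
    qed
    moreover have "A 11 w = 0" if "w \<notin> Qs" using A(1) that \<open>w < n\<close> by (simp add: inv_mask_def)
    ultimately show ?thesis by (cases "w \<in> Qs") auto
  qed
  show ?thesis unfolding table_prog_def
  proof (rule wp_for[where P = "\<lambda>t v B. \<forall>t'<t. \<forall>w<n. B 14 (n * A 12 t' + w) = ?val (A 12 t') w"])
    fix t v' B
    assume t: "t < v 4" and P: "\<forall>t'<t. \<forall>w<n. B 14 (n * A 12 t' + w) = ?val (A 12 t') w"
      and fr: "\<And>z. z \<notin> insert 21 (asgd ?c) \<Longrightarrow> v' z = v z" "\<And>a. a \<notin> putd ?c \<Longrightarrow> B a = A a"
    let ?v = "v'(21 := t)"
    have v1: "?v 1 = n" "?v 2 = cap" "?v 21 = t" using fr v by auto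
    have B: "B 12 = A 12" "B 11 = A 11" using fr by auto
    show "wp ?c (\<lambda>v B. \<forall>t'<Suc t. \<forall>w<n. B 14 (n * A 12 t' + w) = ?val (A 12 t') w) ?v B"
    proof (rule wp_fill[where ix = "\<lambda>w. n * A 12 t + w" and F = "?val (A 12 t)"], unfold v1)
      fix w u D
      assume *: "w < n" "u 20 = w" "\<And>z. z \<noteq> 20 \<Longrightarrow> u z = ?v z" "\<And>a. a \<noteq> 14 \<Longrightarrow> D a = B a"
      have "u 1 = n" "u 21 = t" "D 12 = A 12" "D 11 = A 11" using * v1 B by auto
      then show "eval (eCell (EIdx 12 (EVar 21)) (EVar 20)) u D = n * A 12 t + w \<and>
          min (eval ?e u D) cap = ?val (A 12 t) w" using *(2) cap by simp
    next
      fix u D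
      assume D: "\<And>w. w < n \<Longrightarrow> D 14 (n * A 12 t + w) = ?val (A 12 t) w"
        "\<And>x. x \<notin> (\<lambda>w. n * A 12 t + w) ` {..<n} \<Longrightarrow> D 14 x = B 14 x"
      have "D 14 (n * A 12 t' + w) = ?val (A 12 t') w" if "t' < Suc t" "w < n" for t' w
      proof (cases "A 12 t' = A 12 t")
        case True
        then show ?thesis using D(1)[OF that(2)] by simp
      next
        case False
        then have "n * A 12 t' + w \<notin> (\<lambda>w. n * A 12 t + w) ` {..<n}" using that by (auto simp: grid_eq)
        moreover have "t' < t" using that False by (auto simp: less_Suc_eq)
        ultimately show ?thesis using D(2) P that by simp
      qed
      then show "\<forall>t'<Suc t. \<forall>w<n. D 14 (n * A 12 t' + w) = ?val (A 12 t') w" by blast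
    qed (auto simp: inj_on_def)
  next
    fix v' and B :: "nat \<Rightarrow> nat \<Rightarrow> nat"
    assume P: "\<forall>t'<v 4. \<forall>w<n. B 14 (n * A 12 t' + w) = ?val (A 12 t') w"
    show "\<forall>X\<subseteq>Qs. \<forall>w<n. B 14 (n * msk X + w) = (if X = {} \<or> w \<in> Qs \<and> X = {w} then 0 else n + 1)"
    proof (intro allI impI)
      fix X w assume X: "X \<subseteq> Qs" "w < n"
      obtain t where t: "t < m" "A 12 t = msk X" using good_pairs_ex[OF A(2) X(1), of "{}"] by auto
      have "B 14 (n * A 12 t + w) = ?val (A 12 t) w" using P t(1) X(2) v(3) by blast
      then show "B 14 (n * msk X + w) = (if X = {} \<or> w \<in> Qs \<and> X = {w} then 0 else n + 1)"
        unfolding t(2) val[OF X] .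
    qed
  qed simp
qed

section \<open>Soundness and completeness of the Dreyfus--Wagner table\<close>

lemmas CF = wf_item_sets[OF wf]

text \<open>Entries up to \<open>n\<close> are justified by derivations, and \<open>n + 1\<close>
  stands for infinity. Nothing is claimed about costs at forbidden vertices, where no derivation
  starts.\<close>

definition "table_ok B \<longleftrightarrow> (\<forall>X\<subseteq>Qs. \<forall>w<n. B (n * msk X + w) \<le> n + 1 \<and>
  (w \<notin> Fs \<longrightarrow> B (n * msk X + w) \<le> n \<longrightarrow> (\<exists>i. der Cs Fs i w X (B (n * msk X + w)))))"
  for B :: "nat \<Rightarrow> nat"

definition "table_le B' B \<longleftrightarrow> (\<forall>X\<subseteq>Qs. \<forall>w<n. B' (n * msk X + w) \<le> B (n * msk X + w))"
  for B' B :: "nat \<Rightarrow> nat"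

definition "table_complete i B \<longleftrightarrow> (\<forall>X w c. der Cs Fs i w X c \<longrightarrow> B (n * msk X + w) \<le> c)"
  for B :: "nat \<Rightarrow> nat"

lemma table_okD:
  "table_ok B \<Longrightarrow> X \<subseteq> Qs \<Longrightarrow> w < n \<Longrightarrow> w \<notin> Fs \<Longrightarrow> B (n * msk X + w) \<le> n \<Longrightarrow>
    \<exists>i. der Cs Fs i w X (B (n * msk X + w))"
  by (simp add: table_ok_def)

lemma table_leD: "table_le B' B \<Longrightarrow> X \<subseteq> Qs \<Longrightarrow> w < n \<Longrightarrow> B' (n * msk X + w) \<le> B (n * msk X + w)"
  by (simp add: table_le_def)

lemma table_le_refl [simp]: "table_le B B"
  by (simp add: table_le_def)

lemma table_le_trans: "table_le B1 B2 \<Longrightarrow> table_le B2 B3 \<Longrightarrow> table_le B1 B3"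
  unfolding table_le_def by (meson le_trans)

text \<open>Masks are injective, so that lowering a cell affects a single pair of a set and a
  vertex. The lowered entry is justified by its old derivation or by that of
  \<open>c\<close>.\<close>

lemma table_relax:
  assumes "table_ok B" "X \<subseteq> Qs" "w < n" "w \<notin> Fs \<Longrightarrow> c \<le> n \<Longrightarrow> \<exists>i. der Cs Fs i w X c"
  defines "B' \<equiv> B(n * msk X + w := min (B (n * msk X + w)) c)"
  shows "table_ok B'" "table_le B' B" "B' (n * msk X + w) \<le> c"
proof -
  have B': "B' (n * msk X' + w') = (if X' = X \<and> w' = w then min (B (n * msk X + w)) c else B (n * msk X' + w'))"
    if "X' \<subseteq> Qs" "w' < n" for X' w'
    using grid_eq[of w' n w "msk X'" "msk X"] mask_eq_iff[OF Qs(1) that(1) assms(2)] that assms(3)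
    by (auto simp: B'_def)
  show "table_le B' B" unfolding table_le_def using B' by auto
  show "B' (n * msk X + w) \<le> c" by (simp add: B'_def)
  show "table_ok B'" unfolding table_ok_def
  proof (intro allI impI conjI)
    fix X' w' assume X': "X' \<subseteq> Qs" "w' < n"
    have old: "B (n * msk X' + w') \<le> n + 1"
      "w' \<notin> Fs \<Longrightarrow> B (n * msk X' + w') \<le> n \<Longrightarrow> \<exists>i. der Cs Fs i w' X' (B (n * msk X' + w'))"
      using assms(1) X' unfolding table_ok_def by blast+
    show "B' (n * msk X' + w') \<le> n + 1" unfolding B'[OF X'] using old(1) by auto
    assume "w' \<notin> Fs" "B' (n * msk X' + w') \<le> n"
    then show "\<exists>i. der Cs Fs i w' X' (B' (n * msk X' + w'))"
      unfolding B'[OF X'] using old(2) assms(4) by (auto simp: min_def split: if_splits)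
  qed
qed

text \<open>The table is updated in place, so later passes may read entries that have been lowered
  already. Hence only inequalities are maintained: the table stays sound and decreases, and what
  pass \<open>i\<close> has achieved survives any further decrease.\<close>

lemma wp_for_relax:
  assumes I: "table_ok (A 14)"
    and step: "\<And>i v' A'. i < v y \<Longrightarrow> table_ok (A' 14) \<Longrightarrow> table_le (A' 14) (A 14) \<Longrightarrow>
      (\<And>z. z \<notin> insert x (asgd c) \<Longrightarrow> v' z = v z) \<Longrightarrow> (\<And>a. a \<notin> putd c \<Longrightarrow> A' a = A a) \<Longrightarrow>
      wp c (\<lambda>_ A''. table_ok (A'' 14) \<and> table_le (A'' 14) (A' 14) \<and> G i (A'' 14)) (v'(x := i)) A'"
    and stable: "\<And>i B B'. i < v y \<Longrightarrow> G i B \<Longrightarrow> table_le B' B \<Longrightarrow> G i B'"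
  shows "wp (HFor x y c) (\<lambda>_ A'. table_ok (A' 14) \<and> table_le (A' 14) (A 14) \<and> (\<forall>i<v y. G i (A' 14))) v A"
proof (rule wp_for[where P = "\<lambda>i v' A'. table_ok (A' 14) \<and> table_le (A' 14) (A 14) \<and> (\<forall>j<i. G j (A' 14))"])
  fix i v' A'
  assume i: "i < v y" and P: "table_ok (A' 14) \<and> table_le (A' 14) (A 14) \<and> (\<forall>j<i. G j (A' 14))"
    and fr: "\<And>z. z \<notin> insert x (asgd c) \<Longrightarrow> v' z = v z" "\<And>a. a \<notin> putd c \<Longrightarrow> A' a = A a"
  have "wp c (\<lambda>_ A''. table_ok (A'' 14) \<and> table_le (A'' 14) (A' 14) \<and> G i (A'' 14)) (v'(x := i)) A'"
    using step[OF i _ _ fr] P by blast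
  then show "wp c (\<lambda>v' A''. table_ok (A'' 14) \<and> table_le (A'' 14) (A 14) \<and> (\<forall>j<Suc i. G j (A'' 14))) (v'(x := i)) A'"
  proof (rule wp_conseq)
    fix v2 A2 assume Q: "table_ok (A2 14) \<and> table_le (A2 14) (A' 14) \<and> G i (A2 14)"
    have "G j (A2 14)" if "j < Suc i" for j
    proof (cases "j = i")
      case False
      then have "j < i" using that by simp
      then have "j < v y" "G j (A' 14)" using P i by simp_all
      then show ?thesis using stable[of j "A' 14" "A2 14"] Q by blast
    qed (use Q in simp)
    then show "table_ok (A2 14) \<and> table_le (A2 14) (A 14) \<and> (\<forall>j<Suc i. G j (A2 14))"
      using P Q table_le_trans by blast
  qed
qed (use I in auto)

lemma join_prog_correct:
  assumes v: "v 1 = n" "v 2 = cap" "v 4 = m" and A: "good_pairs m A" "table_ok (A 14)"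
  shows "wp join_prog (\<lambda>_ A'. table_ok (A' 14) \<and> table_le (A' 14) (A 14) \<and>
    (\<forall>Y Z w. Y \<subseteq> Qs \<longrightarrow> Z \<subseteq> Qs \<longrightarrow> Y \<inter> Z = {} \<longrightarrow> w < n \<longrightarrow>
      A' 14 (n * msk (Y \<union> Z) + w) \<le> A 14 (n * msk Y + w) + A 14 (n * msk Z + w))) v A"
proof -
  let ?put = "HPut 14 (eCell (EAdd (EIdx 12 (EVar 21)) (EIdx 13 (EVar 21))) (EVar 20))
    (eMin (EIdx 14 (eCell (EAdd (EIdx 12 (EVar 21)) (EIdx 13 (EVar 21))) (EVar 20)))
      (EAdd (EIdx 14 (eCell (EIdx 12 (EVar 21)) (EVar 20))) (EIdx 14 (eCell (EIdx 13 (EVar 21)) (EVar 20)))))"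
  define G where "G t w B \<longleftrightarrow> B (n * (A 12 t + A 13 t) + w) \<le> A 14 (n * A 12 t + w) + A 14 (n * A 13 t + w)"
    for t w and B :: "nat \<Rightarrow> nat"
  have stable: "G t w B'" if t: "t < m" and "w < n" and G: "G t w B" "table_le B' B" for t w B B'
  proof -
    obtain Y Z where YZ: "Y \<subseteq> Qs" "Z \<subseteq> Qs" "Y \<inter> Z = {}" "A 12 t = msk Y" "A 13 t = msk Z"
      using good_pairs_mem[OF A(1) t] .
    have "A 12 t + A 13 t = msk (Y \<union> Z)"
      using YZ Qs(1) by (simp add: mask_Un finite_subset)
    then have "B' (n * (A 12 t + A 13 t) + w) \<le> B (n * (A 12 t + A 13 t) + w)"
      using G(2) YZ \<open>w < n\<close> by (simp add: table_le_def)
    then show ?thesis using G(1) by (simp add: G_def)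
  qed
  have inner: "wp (HFor 20 1 ?put) (\<lambda>_ A''. table_ok (A'' 14) \<and> table_le (A'' 14) (A' 14) \<and>
      (\<forall>w<v' 1. G t w (A'' 14))) v' A'"
    if t: "t < m" and A': "table_ok (A' 14)" "table_le (A' 14) (A 14)" "A' 12 = A 12" "A' 13 = A 13"
      and v': "v' 1 = n" "v' 2 = cap" "v' 21 = t" for t v' A'
  proof (rule wp_for_relax[where A = A', OF A'(1)])
    fix w u B
    assume w: "w < v' 1" and B: "table_ok (B 14)" "table_le (B 14) (A' 14)"
      and fr: "\<And>z. z \<notin> insert 20 (asgd ?put) \<Longrightarrow> u z = v' z" "\<And>a. a \<notin> putd ?put \<Longrightarrow> B a = A' a"
    let ?u = "u(20 := w)"
    obtain Y Z where YZ: "Y \<subseteq> Qs" "Z \<subseteq> Qs" "Y \<inter> Z = {}" "A 12 t = msk Y" "A 13 t = msk Z"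
      using good_pairs_mem[OF A(1) t] .
    have sum: "msk Y + msk Z = msk (Y \<union> Z)" using YZ Qs(1) by (simp add: mask_Un finite_subset)
    have u: "?u 1 = n" "?u 2 = cap" "?u 21 = t" "?u 20 = w" "B 12 t = msk Y" "B 13 t = msk Z" "w < n"
      using fr v' A' YZ w by auto
    let ?c = "B 14 (n * msk Y + w) + B 14 (n * msk Z + w)"
    let ?B = "(B 14)(n * msk (Y \<union> Z) + w := min (B 14 (n * msk (Y \<union> Z) + w)) ?c)"
    \<comment> \<open>A sum of at most \<open>n\<close> forces both summands to be proper entries
      rather than infinity; the maximum of the heights makes the two derivations fit
      together.\<close>
    have der: "\<exists>i. der Cs Fs i w (Y \<union> Z) ?c" if hF: "w \<notin> Fs" and hc: "?c \<le> n"
    proof -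
      have "B 14 (n * msk Y + w) \<le> n" "B 14 (n * msk Z + w) \<le> n" using hc by simp_all
      then obtain i j where "der Cs Fs i w Y (B 14 (n * msk Y + w))" "der Cs Fs j w Z (B 14 (n * msk Z + w))"
        using table_okD[OF B(1) YZ(1) u(7) hF] table_okD[OF B(1) YZ(2) u(7) hF] by blast
      then have "der Cs Fs (max i j) w Y (B 14 (n * msk Y + w))" "der Cs Fs (max i j) w Z (B 14 (n * msk Z + w))"
        using der_mono[OF CF] by (meson max.cobounded1 max.cobounded2)+
      then show ?thesis using der.join[OF CF] YZ(3) by blast
    qed
    have YZQ: "Y \<union> Z \<subseteq> Qs" using YZ by simp
    note r = table_relax[OF B(1) YZQ u(7) der]
    have "B 14 (n * msk (Y \<union> Z) + w) \<le> n + 1" using B(1) YZQ u(7) unfolding table_ok_def by blast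
    then have capm: "min (min (B 14 (n * msk (Y \<union> Z) + w)) ?c) cap = min (B 14 (n * msk (Y \<union> Z) + w)) ?c"
      using cap by simp
    have "B 14 (n * msk Y + w) \<le> A 14 (n * msk Y + w)" "B 14 (n * msk Z + w) \<le> A 14 (n * msk Z + w)"
      using table_le_trans[OF B(2) A'(2)] YZ u(7) unfolding table_le_def by blast+
    then have G: "G t w ?B" using r(3) unfolding G_def YZ sum by linarith
    have "wp ?put (\<lambda>_ A''. table_ok (A'' 14) \<and> table_le (A'' 14) (B 14) \<and> G t w (A'' 14)) ?u B \<longleftrightarrow>
        table_ok ?B \<and> table_le ?B (B 14) \<and> G t w ?B"
      unfolding wp_simps using u capm sum by (simp del: fun_upd_apply add: fun_upd_same fun_upd_other)
    then show "wp ?put (\<lambda>_ A''. table_ok (A'' 14) \<and> table_le (A'' 14) (B 14) \<and> G t w (A'' 14)) ?u B"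
      using r G by blast
  next
    fix w B B' assume "w < v' 1" "G t w B" "table_le B' B"
    then show "G t w B'" using stable[OF t] v' by simp
  qed
  have "wp join_prog (\<lambda>_ A'. table_ok (A' 14) \<and> table_le (A' 14) (A 14) \<and> (\<forall>t<v 4. \<forall>w<n. G t w (A' 14))) v A"
    unfolding join_prog_def
  proof (rule wp_for_relax[where A = A, OF A(2)])
    fix t v' A'
    assume t: "t < v 4" and A': "table_ok (A' 14)" "table_le (A' 14) (A 14)"
      and fr: "\<And>z. z \<notin> insert 21 (asgd (HFor 20 1 ?put)) \<Longrightarrow> v' z = v z"
        "\<And>a. a \<notin> putd (HFor 20 1 ?put) \<Longrightarrow> A' a = A a"
    let ?v = "v'(21 := t)"
    have "?v 1 = n" "?v 2 = cap" "?v 21 = t" "A' 12 = A 12" "A' 13 = A 13" using fr v by auto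
    then show "wp (HFor 20 1 ?put) (\<lambda>_ A''. table_ok (A'' 14) \<and> table_le (A'' 14) (A' 14) \<and> (\<forall>w<n. G t w (A'' 14))) ?v A'"
      using inner[of t A' ?v] t A' v by simp
  next
    fix t B B' assume "t < v 4" "\<forall>w<n. G t w B" "table_le B' B"
    then show "\<forall>w<n. G t w B'" using stable v by blast
  qed
  then show ?thesis
  proof (rule wp_conseq)
    fix v' A' assume Q: "table_ok (A' 14) \<and> table_le (A' 14) (A 14) \<and> (\<forall>t<v 4. \<forall>w<n. G t w (A' 14))"
    have "A' 14 (n * msk (Y \<union> Z) + w) \<le> A 14 (n * msk Y + w) + A 14 (n * msk Z + w)"
      if YZ: "Y \<subseteq> Qs" "Z \<subseteq> Qs" "Y \<inter> Z = {}" "w < n" for Y Z w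
    proof -
      obtain t where t: "t < m" "A 12 t = msk Y" "A 13 t = msk Z" using good_pairs_ex[OF A(1) YZ(1-3)] .
      have "msk Y + msk Z = msk (Y \<union> Z)" using YZ Qs(1) by (simp add: mask_Un finite_subset)
      moreover have "G t w (A' 14)" using Q t v YZ by simp
      ultimately show ?thesis using t by (simp add: G_def)
    qed
    then show "table_ok (A' 14) \<and> table_le (A' 14) (A 14) \<and> (\<forall>Y Z w. Y \<subseteq> Qs \<longrightarrow> Z \<subseteq> Qs \<longrightarrow> Y \<inter> Z = {} \<longrightarrow> w < n \<longrightarrow>
      A' 14 (n * msk (Y \<union> Z) + w) \<le> A 14 (n * msk Y + w) + A 14 (n * msk Z + w))" using Q by blast
  qed
qed

definition "item_base v A \<longleftrightarrow> v 1 = n \<and> v 2 = cap \<and> v 6 = r \<and> (\<forall>i<n. A 7 i = st i) \<and>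
  (\<forall>i<n. A 0 i = of_bool (i \<in> T)) \<and> (\<forall>i<n. \<forall>j<n. A 1 (n * i + j) = of_bool ((i, j) \<in> E))"
  for A :: "nat \<Rightarrow> nat \<Rightarrow> nat"

lemma arc_prog_correct:
  assumes v: "item_base v A" "v 4 = m" and A: "good_pairs m A" "table_ok (A 14)"
  shows "wp arc_prog (\<lambda>_ A'. table_ok (A' 14) \<and> table_le (A' 14) (A 14) \<and>
    (\<forall>X u w. X \<subseteq> Qs \<longrightarrow> u < n \<longrightarrow> w < n \<longrightarrow> u \<notin> Fs \<longrightarrow> w \<notin> Fs \<longrightarrow> (u, w) \<in> E \<longrightarrow>
      A' 14 (n * msk X + u) \<le> A 14 (n * msk X + w) + cost Cs Fs w)) v A"
proof -
  let ?g = "eAnd (eUsable (EVar 24)) (eAnd (eUsable (EVar 20)) (EIdx 1 (eCell (EVar 24) (EVar 20))))"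
  let ?if = "HIf ?g (HPut 14 (eCell (EIdx 12 (EVar 21)) (EVar 24))
      (eMin (EIdx 14 (eCell (EIdx 12 (EVar 21)) (EVar 24)))
        (EAdd (EIdx 14 (eCell (EIdx 12 (EVar 21)) (EVar 20))) (eAvail (EVar 20))))) HSkip"
  define G where "G t w u B \<longleftrightarrow> (u \<notin> Fs \<longrightarrow> w \<notin> Fs \<longrightarrow> (u, w) \<in> E \<longrightarrow>
      B (n * A 12 t + u) \<le> A 14 (n * A 12 t + w) + cost Cs Fs w)"
    for t w u and B :: "nat \<Rightarrow> nat"
  have stable: "G t w u B'" if t: "t < m" and "u < n" and G: "G t w u B" "table_le B' B" for t w u B B'
  proof -
    obtain Y where Y: "Y \<subseteq> Qs" "A 12 t = msk Y" using good_pairs_mem[OF A(1) t] by metis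
    then have "B' (n * A 12 t + u) \<le> B (n * A 12 t + u)" using G(2) \<open>u < n\<close> by (simp add: table_le_def)
    then show ?thesis using G(1) by (auto simp: G_def)
  qed
  have inner: "wp (HFor 24 1 ?if) (\<lambda>_ A''. table_ok (A'' 14) \<and> table_le (A'' 14) (A' 14) \<and>
      (\<forall>u<v' 1. G t w u (A'' 14))) v' A'"
    if t: "t < m" and w: "w < n" and A': "table_ok (A' 14)" "table_le (A' 14) (A 14)" "\<And>a. a \<noteq> 14 \<Longrightarrow> A' a = A a"
      and v': "\<And>z. z \<notin> {20, 21, 24} \<Longrightarrow> v' z = v z" "v' 21 = t" "v' 20 = w" for t w v' A'
  proof (rule wp_for_relax[where A = A', OF A'(1)])
    fix x u B
    assume x: "x < v' 1" and B: "table_ok (B 14)" "table_le (B 14) (A' 14)"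
      and fr: "\<And>z. z \<notin> insert 24 (asgd ?if) \<Longrightarrow> u z = v' z" "\<And>a. a \<notin> putd ?if \<Longrightarrow> B a = A' a"
    let ?u = "u(24 := x)"
    obtain X where X: "X \<subseteq> Qs" "A 12 t = msk X" using good_pairs_mem[OF A(1) t] by metis
    have B12: "B 12 t = msk X" "B 7 = A 7" "B 0 = A 0" "B 1 = A 1" using fr A' X by auto
    have u: "?u 1 = n" "?u 2 = cap" "?u 6 = r" "?u 21 = t" "?u 20 = w" "?u 24 = x" "x < n"
      using fr v' v(1) x by (auto simp: item_base_def)
    have F: "st i = 1 \<longleftrightarrow> i \<in> Fs" if "i < n" for i using that by (simp add: forbidden_def)
    have A7: "A 7 x = st x" "A 7 w = st w" "A 0 w = of_bool (w \<in> T)" "A 1 (n * x + w) = of_bool ((x, w) \<in> E)"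
      using v(1) u(7) w by (auto simp: item_base_def)
    have g: "(eval ?g ?u B \<noteq> 0) \<longleftrightarrow> x \<notin> Fs \<and> w \<notin> Fs \<and> (x, w) \<in> E"
      using u B12 A7 F[OF w] F[OF u(7)] by (simp add: eUsable_def)
    have av: "w \<in> avail Cs Fs \<longleftrightarrow> st w = 0 \<and> w \<notin> T \<and> w \<noteq> r"
      using w wf unfolding avail_def chosen_def forbidden_def nonterms_def wf_item_def by fastforce
    have c: "eval (eAvail (EVar 20)) ?u B = cost Cs Fs w"
      using u B12 A7 by (simp add: eAvail_def cost_def av)
    show "wp ?if (\<lambda>_ A''. table_ok (A'' 14) \<and> table_le (A'' 14) (B 14) \<and> G t w x (A'' 14)) ?u B"
    proof (cases "x \<notin> Fs \<and> w \<notin> Fs \<and> (x, w) \<in> E")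
      case True
      let ?c = "B 14 (n * msk X + w) + cost Cs Fs w"
      let ?B = "(B 14)(n * msk X + x := min (B 14 (n * msk X + x)) ?c)"
      have der: "\<exists>i. der Cs Fs i x X ?c" if hc: "?c \<le> n"
      proof -
        have "B 14 (n * msk X + w) \<le> n" "w \<notin> Fs" using hc True by simp_all
        then obtain i where "der Cs Fs i w X (B 14 (n * msk X + w))"
          using table_okD[OF B(1) X(1) w] by blast
        then show ?thesis using der.arc[OF CF, of i w X _ x] True u(7) by blast
      qed
      note r = table_relax[OF B(1) X(1) u(7) der]
      have "B 14 (n * msk X + x) \<le> n + 1" using B(1) X(1) u(7) unfolding table_ok_def by blast
      then have capm: "min (min (B 14 (n * msk X + x)) ?c) cap = min (B 14 (n * msk X + x)) ?c"
        using cap by simp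
      have "B 14 (n * msk X + w) \<le> A 14 (n * msk X + w)"
        using table_le_trans[OF B(2) A'(2)] X w unfolding table_le_def by blast
      then have G: "G t w x ?B" using r(3) unfolding G_def X(2) by linarith
      have "wp ?if (\<lambda>_ A''. table_ok (A'' 14) \<and> table_le (A'' 14) (B 14) \<and> G t w x (A'' 14)) ?u B \<longleftrightarrow>
          table_ok ?B \<and> table_le ?B (B 14) \<and> G t w x ?B"
        unfolding wp_simps using g True u B12 capm c
        by (simp del: fun_upd_apply add: fun_upd_same fun_upd_other)
      then show ?thesis using r G by blast
    next
      case False
      then have "G t w x (B 14)" by (auto simp: G_def)
      then show ?thesis unfolding wp_simps using g False B by simp
    qed
  next
    fix u B B' assume "u < v' 1" "G t w u B" "table_le B' B"
    then show "G t w u B'" using stable[OF t] v' v(1) by (simp add: item_base_def)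
  qed
  have v1: "v 1 = n" using v by (simp add: item_base_def)
  have middle: "wp (HFor 20 1 (HFor 24 1 ?if)) (\<lambda>_ A''. table_ok (A'' 14) \<and> table_le (A'' 14) (A' 14) \<and>
      (\<forall>w<v' 1. \<forall>u<n. G t w u (A'' 14))) v' A'"
    if t: "t < m" and A': "table_ok (A' 14)" "table_le (A' 14) (A 14)" "\<And>a. a \<noteq> 14 \<Longrightarrow> A' a = A a"
      and v': "\<And>z. z \<notin> {20, 21, 24} \<Longrightarrow> v' z = v z" "v' 21 = t" for t v' A'
  proof (rule wp_for_relax[where A = A', OF A'(1)])
    fix w u B
    assume w: "w < v' 1" and B: "table_ok (B 14)" "table_le (B 14) (A' 14)"
      and fr: "\<And>z. z \<notin> insert 20 (asgd (HFor 24 1 ?if)) \<Longrightarrow> u z = v' z"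
        "\<And>a. a \<notin> putd (HFor 24 1 ?if) \<Longrightarrow> B a = A' a"
    let ?u = "u(20 := w)"
    have wn: "w < n" using w v' v1 by simp
    have "?u z = v z" if "z \<notin> {20, 21, 24}" for z using that fr v' by auto
    moreover have "?u 21 = t" "?u 20 = w" using fr v' by auto
    moreover have "B a = A a" if "a \<noteq> 14" for a using that fr A' by auto
    ultimately have "wp (HFor 24 1 ?if) (\<lambda>_ A''. table_ok (A'' 14) \<and> table_le (A'' 14) (B 14) \<and>
      (\<forall>u<?u 1. G t w u (A'' 14))) ?u B"
      by (intro inner[of t w B ?u] t wn B(1) table_le_trans[OF B(2) A'(2)])
    moreover have "?u 1 = n" using fr v' v1 by simp
    ultimately show "wp (HFor 24 1 ?if) (\<lambda>_ A''. table_ok (A'' 14) \<and> table_le (A'' 14) (B 14) \<and>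
      (\<forall>u<n. G t w u (A'' 14))) ?u B" by simp
  next
    fix w B B' assume "w < v' 1" "\<forall>u<n. G t w u B" "table_le B' B"
    then show "\<forall>u<n. G t w u B'" using stable[OF t] by blast
  qed
  have "wp arc_prog (\<lambda>_ A'. table_ok (A' 14) \<and> table_le (A' 14) (A 14) \<and> (\<forall>t<v 4. \<forall>w<n. \<forall>u<n. G t w u (A' 14))) v A"
    unfolding arc_prog_def
  proof (rule wp_for_relax[where A = A, OF A(2)])
    fix t v' A'
    assume t: "t < v 4" and A': "table_ok (A' 14)" "table_le (A' 14) (A 14)"
      and fr: "\<And>z. z \<notin> insert 21 (asgd (HFor 20 1 (HFor 24 1 ?if))) \<Longrightarrow> v' z = v z"
        "\<And>a. a \<notin> putd (HFor 20 1 (HFor 24 1 ?if)) \<Longrightarrow> A' a = A a"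
    let ?v = "v'(21 := t)"
    have "wp (HFor 20 1 (HFor 24 1 ?if)) (\<lambda>_ A''. table_ok (A'' 14) \<and> table_le (A'' 14) (A' 14) \<and>
      (\<forall>w<?v 1. \<forall>u<n. G t w u (A'' 14))) ?v A'"
      by (rule middle) (use t A' fr v in auto)
    moreover have "?v 1 = n" using fr v1 by simp
    ultimately show "wp (HFor 20 1 (HFor 24 1 ?if)) (\<lambda>_ A''. table_ok (A'' 14) \<and> table_le (A'' 14) (A' 14) \<and>
      (\<forall>w<n. \<forall>u<n. G t w u (A'' 14))) ?v A'" by simp
  next
    fix t B B' assume "t < v 4" "\<forall>w<n. \<forall>u<n. G t w u B" "table_le B' B"
    then show "\<forall>w<n. \<forall>u<n. G t w u B'" using stable v by blast
  qed
  then show ?thesis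
  proof (rule wp_conseq)
    fix v' A' assume Q: "table_ok (A' 14) \<and> table_le (A' 14) (A 14) \<and> (\<forall>t<v 4. \<forall>w<n. \<forall>u<n. G t w u (A' 14))"
    have "A' 14 (n * msk X + u) \<le> A 14 (n * msk X + w) + cost Cs Fs w"
      if X: "X \<subseteq> Qs" and uw: "u < n" "w < n" "u \<notin> Fs" "w \<notin> Fs" "(u, w) \<in> E" for X u w
    proof -
      obtain t where t: "t < m" "A 12 t = msk X" using good_pairs_ex[OF A(1) X, of "{}"] by auto
      then have "G t w u (A' 14)" using Q v uw by simp
      then show ?thesis using t uw by (simp add: G_def)
    qed
    then show "table_ok (A' 14) \<and> table_le (A' 14) (A 14) \<and>
    (\<forall>X u w. X \<subseteq> Qs \<longrightarrow> u < n \<longrightarrow> w < n \<longrightarrow> u \<notin> Fs \<longrightarrow> w \<notin> Fs \<longrightarrow> (u, w) \<in> E \<longrightarrow>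
      A' 14 (n * msk X + u) \<le> A 14 (n * msk X + w) + cost Cs Fs w)" using Q by blast
  qed
qed

text \<open>One round of joins and arcs matches one level of height: the last rule of a derivation
  of height \<open>Suc i\<close> acts on entries that are complete for height
  \<open>i\<close>.\<close>

lemma round_correct:
  assumes v: "item_base v A" "v 4 = m" and A: "good_pairs m A" "table_ok (A 14)" "table_complete i (A 14)"
  shows "wp (HSeq join_prog arc_prog) (\<lambda>_ A'. table_ok (A' 14) \<and> table_complete (Suc i) (A' 14)) v A"
  unfolding wp_simps(4)
proof (rule wp_conseq[OF join_prog_correct[of v m A]])
  show "v 1 = n" "v 2 = cap" "v 4 = m" using v by (simp_all add: item_base_def)
  show "good_pairs m A" "table_ok (A 14)" by fact+
  fix v1 A1
  assume J: "table_ok (A1 14) \<and> table_le (A1 14) (A 14) \<and>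
    (\<forall>Y Z w. Y \<subseteq> Qs \<longrightarrow> Z \<subseteq> Qs \<longrightarrow> Y \<inter> Z = {} \<longrightarrow> w < n \<longrightarrow>
      A1 14 (n * msk (Y \<union> Z) + w) \<le> A 14 (n * msk Y + w) + A 14 (n * msk Z + w))"
    and fr: "\<And>x. x \<notin> asgd join_prog \<Longrightarrow> v1 x = v x" "\<And>a. a \<notin> putd join_prog \<Longrightarrow> A1 a = A a"
  have "v1 x = v x" if "x \<notin> {20, 21}" for x using fr(1) that by (simp add: join_prog_def)
  moreover have A1: "A1 a = A a" if "a \<noteq> 14" for a using fr(2) that by (simp add: join_prog_def)
  ultimately have b: "item_base v1 A1" "v1 4 = m" "good_pairs m A1"
    using v A(1) by (simp_all add: item_base_def good_pairs_def)
  show "wp arc_prog (\<lambda>_ A'. table_ok (A' 14) \<and> table_complete (Suc i) (A' 14)) v1 A1"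
  proof (rule wp_conseq[OF arc_prog_correct[of v1 A1 m]])
    show "item_base v1 A1" "v1 4 = m" "good_pairs m A1" by fact+
    show "table_ok (A1 14)" using J by simp
    fix v2 and A2 :: "nat \<Rightarrow> nat \<Rightarrow> nat"
    assume R: "table_ok (A2 14) \<and> table_le (A2 14) (A1 14) \<and>
    (\<forall>X u w. X \<subseteq> Qs \<longrightarrow> u < n \<longrightarrow> w < n \<longrightarrow> u \<notin> Fs \<longrightarrow> w \<notin> Fs \<longrightarrow> (u, w) \<in> E \<longrightarrow>
      A2 14 (n * msk X + u) \<le> A1 14 (n * msk X + w) + cost Cs Fs w)"
    have use: "w < n" "w \<notin> Fs" "X \<subseteq> Qs" if "der Cs Fs j w X c" for j w X c
      using der_usable[OF CF that] by auto
    have le: "A1 14 (n * msk X + w) \<le> c" "A2 14 (n * msk X + w) \<le> c" if "der Cs Fs i w X c" for w X c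
    proof -
      have "A 14 (n * msk X + w) \<le> c" using A(3) that by (simp add: table_complete_def)
      moreover have "A1 14 (n * msk X + w) \<le> A 14 (n * msk X + w)" "A2 14 (n * msk X + w) \<le> A1 14 (n * msk X + w)"
        using table_leD[OF J[THEN conjunct2, THEN conjunct1] use(3,1)[OF that]]
          table_leD[OF R[THEN conjunct2, THEN conjunct1] use(3,1)[OF that]] by auto
      ultimately show "A1 14 (n * msk X + w) \<le> c" "A2 14 (n * msk X + w) \<le> c" by linarith+
    qed
    have "A2 14 (n * msk X + w) \<le> c" if d: "der Cs Fs (Suc i) w X c" for w X c
      using d
    proof (cases rule: der.cases[OF CF d, case_names empty target arc join])
      case (empty v j)
      then show ?thesis using le(2)[OF der.empty[OF CF, of w i]] by simp
    next
      case (target v j)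
      then show ?thesis using le(2)[OF der.target[OF CF, of w i]] by simp
    next
      case (arc j u Y c' v)
      then have d: "der Cs Fs i u X c'" by simp
      have "A2 14 (n * msk X + w) \<le> A1 14 (n * msk X + u) + cost Cs Fs u"
        using R arc use[OF d] by auto
      then show ?thesis using le(1)[OF d] arc by simp
    next
      case (join j v Y c1 Z c2)
      then have d: "der Cs Fs i w Y c1" "der Cs Fs i w Z c2" by simp_all
      have "A2 14 (n * msk X + w) \<le> A1 14 (n * msk X + w)"
        by (rule table_leD[OF R[THEN conjunct2, THEN conjunct1] use(3,1)[OF \<open>der Cs Fs (Suc i) w X c\<close>]])
      also have "\<dots> \<le> A 14 (n * msk Y + w) + A 14 (n * msk Z + w)"
        using J join use[OF d(1)] use[OF d(2)] by simp
      also have "\<dots> \<le> c1 + c2" using A(3) d unfolding table_complete_def by (intro add_mono) blast+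
      finally show ?thesis using join by simp
    qed
    then show "table_ok (A2 14) \<and> table_complete (Suc i) (A2 14)" using R by (simp add: table_complete_def)
  qed
qed

lemma asgd_leaf: "asgd pairs_prog = {13, 20, 21}" "putd pairs_prog = {12, 13}"
  "asgd table_prog = {20, 21}" "putd table_prog = {14}"
  "asgd join_prog = {20, 21}" "putd join_prog = {14}"
  "asgd arc_prog = {20, 21, 24}" "putd arc_prog = {14}"
  by (auto simp: pairs_prog_def pair_prog_def table_prog_def join_prog_def arc_prog_def)

lemma leaf_prog_correct:
  assumes inv: "inv_graph cap v A" "inv_item st v A" "inv_mask A"
    and v: "v 4 = 3 ^ card Qs" "v 11 = 2 ^ card Qs" and k: "card Cs \<le> k" "k \<le> n"
  shows "wp leaf_prog (\<lambda>v' _. v' 0 = (if sol Cs Fs then 1 else v 0)) v A"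
proof -
  have base: "item_base v A" using inv by (simp add: item_base_def inv_graph_def inv_item_def)
  have v12: "v 1 = n" "v 2 = cap" "v 5 = k" "v 6 = r" "v 8 = card Cs" using inv by (auto simp: inv_graph_def inv_item_def)
  let ?fr = "\<lambda>v' A'. (\<forall>x. x \<notin> {13, 20, 21, 22, 23, 24} \<longrightarrow> v' x = v x) \<and> (\<forall>a. a \<notin> {12, 13, 14} \<longrightarrow> A' a = A a)"
  let ?m = "3 ^ card Qs"
  let ?S = "HIf (eNot (eLt (ESub (EVar 5) (EVar 8)) (EIdx 14 (eCell (ESub (EVar 11) (ENum 1)) (EVar 6)))))
    (HAsg 0 (ENum 1)) HSkip"
  let ?R = "HFor 22 1 (HFor 23 1 (HSeq join_prog arc_prog))"
  let ?Q = "\<lambda>v' _. v' 0 = (if sol Cs Fs then 1 else v 0)"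
  have frb: "item_base v' A' \<and> v' 4 = ?m" if "?fr v' A'" for v' A'
    using that base v(1) by (simp add: item_base_def)
  have fin: "wp ?S ?Q v' A'"
    if fr: "?fr v' A'" and ok: "table_ok (A' 14)" "table_complete (n * n) (A' 14)" for v' A'
  proof -
    have rF: "r < n" "r \<notin> Fs" using root CF(2) by (auto simp: nonterms_def)
    have v': "v' 0 = v 0" "v' 1 = n" "v' 2 = cap" "v' 5 = k" "v' 6 = r" "v' 8 = card Cs" "v' 11 - 1 = msk Qs"
      using fr v v12 Qs(1) by (simp_all add: mask_full)
    \<comment> \<open>An entry within the remaining budget is at most \<open>n\<close>, hence proper
      and backed by a derivation. Conversely, height \<open>n * n\<close> suffices for every
      solution.\<close>
    have "A' 14 (n * msk Qs + r) \<le> k - card Cs \<longleftrightarrow> sol Cs Fs"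
    proof
      assume *: "A' 14 (n * msk Qs + r) \<le> k - card Cs"
      then have "A' 14 (n * msk Qs + r) \<le> n" using k by simp
      then obtain i where "der Cs Fs i r Qs (A' 14 (n * msk Qs + r))"
        using ok(1) rF unfolding table_ok_def by blast
      then show "sol Cs Fs" using * k by (intro der_imp_sol[OF CF]) auto
    next
      assume "sol Cs Fs"
      then obtain c where "c + card Cs \<le> k" "der Cs Fs (n * n) r Qs c" using sol_imp_der[OF CF] by blast
      then show "A' 14 (n * msk Qs + r) \<le> k - card Cs" using ok(2) unfolding table_complete_def by fastforce
    qed
    then show ?thesis using v' cap by simp
  qed
  have rounds: "wp ?R (\<lambda>v' A'. table_ok (A' 14) \<and> table_complete (n * n) (A' 14)) v' A'"
    if fr: "?fr v' A'" and gp: "good_pairs ?m A'" and ok: "table_ok (A' 14)" "table_complete 0 (A' 14)" for v' A'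
  proof (rule wp_for[where P = "\<lambda>i _ B. table_ok (B 14) \<and> table_complete (n * i) (B 14)"])
    fix i v2 A2
    assume P: "table_ok (A2 14) \<and> table_complete (n * i) (A2 14)"
      and fr2: "\<And>z. z \<notin> insert 22 (asgd (HFor 23 1 (HSeq join_prog arc_prog))) \<Longrightarrow> v2 z = v' z"
        "\<And>a. a \<notin> putd (HFor 23 1 (HSeq join_prog arc_prog)) \<Longrightarrow> A2 a = A' a"
    show "wp (HFor 23 1 (HSeq join_prog arc_prog)) (\<lambda>_ B. table_ok (B 14) \<and> table_complete (n * Suc i) (B 14)) (v2(22 := i)) A2"
    proof (rule wp_for[where P = "\<lambda>j _ B. table_ok (B 14) \<and> table_complete (n * i + j) (B 14)"])
      fix j v3 A3
      assume P3: "table_ok (A3 14) \<and> table_complete (n * i + j) (A3 14)"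
        and fr3: "\<And>z. z \<notin> insert 23 (asgd (HSeq join_prog arc_prog)) \<Longrightarrow> v3 z = (v2(22 := i)) z"
          "\<And>a. a \<notin> putd (HSeq join_prog arc_prog) \<Longrightarrow> A3 a = A2 a"
      have f: "(v3(23 := j)) x = v x" if "x \<notin> {13, 20, 21, 22, 23, 24}" for x
        using that fr fr2(1)[of x] fr3(1)[of x] by (simp add: asgd_leaf)
      have g: "A3 a = A' a" if "a \<noteq> 14" for a using that fr2(2)[of a] fr3(2)[of a] by (simp add: asgd_leaf)
      have "item_base (v3(23 := j)) A3 \<and> (v3(23 := j)) 4 = ?m" by (rule frb) (use f g fr in auto)
      moreover have "good_pairs ?m A3" using gp g by (simp add: good_pairs_def)
      ultimately show "wp (HSeq join_prog arc_prog) (\<lambda>_ B. table_ok (B 14) \<and> table_complete (n * i + Suc j) (B 14)) (v3(23 := j)) A3"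
        using round_correct[of "v3(23 := j)" A3 ?m "n * i + j"] P3 by simp
    next
      fix v3 A3
      assume "table_ok (A3 14) \<and> table_complete (n * i + (v2(22 := i)) 1) (A3 14)"
      moreover have "(v2(22 := i)) 1 = n" using fr fr2(1)[of 1] v12 by (simp add: asgd_leaf)
      ultimately show "table_ok (A3 14) \<and> table_complete (n * Suc i) (A3 14)" by (simp add: add.commute)
    qed (use P in simp)
  next
    fix v2 A2
    assume "table_ok (A2 14) \<and> table_complete (n * v' 1) (A2 14)"
    moreover have "v' 1 = n" using fr v12 by simp
    ultimately show "table_ok (A2 14) \<and> table_complete (n * n) (A2 14)" by simp
  qed (use ok in simp)
  have t3: "wp ?R (wp ?S ?Q) v' A'"
    if fr: "?fr v' A'" and gp: "good_pairs ?m A'" and ok: "table_ok (A' 14)" "table_complete 0 (A' 14)" for v' A'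
  proof (rule wp_conseq[OF rounds[OF that]])
    fix v2 A2
    assume ok2: "table_ok (A2 14) \<and> table_complete (n * n) (A2 14)"
      and fr2: "\<And>x. x \<notin> asgd ?R \<Longrightarrow> v2 x = v' x" "\<And>a. a \<notin> putd ?R \<Longrightarrow> A2 a = A' a"
    have "?fr v2 A2" using fr fr2 by (simp add: asgd_leaf)
    then show "wp ?S ?Q v2 A2" using ok2 by (intro fin) simp_all
  qed
  have t2: "wp table_prog (wp ?R (wp ?S ?Q)) v' A'" if fr: "?fr v' A'" and gp: "good_pairs ?m A'" for v' A'
  proof (rule wp_conseq[OF table_prog_correct[where m = ?m]])
    show "v' 1 = n" "v' 2 = cap" "v' 4 = ?m" using fr v12 v by simp_all
    show "inv_mask A'" using inv(3) fr by (simp add: inv_mask_def)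
    show "good_pairs ?m A'" by fact
    fix v2 A2
    assume tab: "\<forall>X\<subseteq>Qs. \<forall>w<n. A2 14 (n * msk X + w) = (if X = {} \<or> w \<in> Qs \<and> X = {w} then 0 else n + 1)"
      and fr2: "\<And>x. x \<notin> asgd table_prog \<Longrightarrow> v2 x = v' x" "\<And>a. a \<notin> putd table_prog \<Longrightarrow> A2 a = A' a"
    have "?fr v2 A2" using fr fr2 by (simp add: asgd_leaf)
    moreover have "good_pairs ?m A2" using gp fr2 by (simp add: good_pairs_def asgd_leaf)
    moreover have "table_ok (A2 14)" unfolding table_ok_def
    proof (intro allI impI conjI)
      fix X w assume Xw: "X \<subseteq> Qs" "w < n"
      then have e: "A2 14 (n * msk X + w) = (if X = {} \<or> w \<in> Qs \<and> X = {w} then 0 else n + 1)" using tab by blast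
      then show "A2 14 (n * msk X + w) \<le> n + 1" by simp
      assume "w \<notin> Fs" "A2 14 (n * msk X + w) \<le> n"
      then show "\<exists>i. der Cs Fs i w X (A2 14 (n * msk X + w))"
        using e Xw der.empty[OF CF, of w 0] der.target[OF CF, of w 0] by (auto split: if_splits)
    qed
    moreover have "table_complete 0 (A2 14)" unfolding table_complete_def
    proof (intro allI impI)
      fix X w c assume d: "der Cs Fs 0 w X c"
      have "w < n" "X \<subseteq> Qs" using der_usable[OF CF d] by auto
      moreover have "X = {} \<or> w \<in> Qs \<and> X = {w}"
        by (rule der.cases[OF CF d]) auto
      ultimately show "A2 14 (n * msk X + w) \<le> c" using tab by auto
    qed
    ultimately show "wp ?R (wp ?S ?Q) v2 A2" by (intro t3)
  qed
  have "wp pairs_prog (wp table_prog (wp ?R (wp ?S ?Q))) v A"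
  proof (rule wp_conseq[OF pairs_prog_correct[OF inv(2) v12(1,2) v(1) inv(3)]])
    fix v2 A2
    assume "(\<lambda>t. (A2 12 t, A2 13 t)) ` {..<v2 4} = pairs n"
      and fr: "\<And>x. x \<notin> asgd pairs_prog \<Longrightarrow> v2 x = v x" "\<And>a. a \<notin> putd pairs_prog \<Longrightarrow> A2 a = A a"
    then show "wp table_prog (wp ?R (wp ?S ?Q)) v2 A2"
      using v by (intro t2) (simp_all add: good_pairs_def asgd_leaf)
  qed
  then show ?thesis unfolding leaf_prog_def wp_simps(4) .
qed

end

end


section \<open>The potential\<close>

text \<open>For \<open>x = 2 / (d + 2)\<close> one has \<open>1 / (1 - x) = 1 + 2 / d\<close>, whose
  \<open>d\<close>-th power is at most \<open>exp 2 \<le> 9\<close>; this is the surplus of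
  \<open>3 ^ (d + 2)\<close> over \<open>3 ^ d\<close>. With \<open>c = d * 2 ^ d\<close> the
  condition on \<open>c\<close> becomes \<open>d * (d + 2) * 2 ^ d \<le> 6 * 3 ^ d\<close>.\<close>

lemma exists_branching_parameter:
  fixes d :: nat
  shows "\<exists>x c :: real. 0 < x \<and> x < 1 \<and> 1 \<le> c \<and> real (d * 2 ^ d) \<le> c \<and>
    3 * c \<le> 3 ^ (d + 2) * x \<and> 3 ^ d \<le> 3 ^ (d + 2) * (1 - x) ^ d"
proof (cases "d = 0")
  case True
  \<comment> \<open>Here \<open>2 / (d + 2)\<close> would be 1 and \<open>d * 2 ^ d\<close> would be
    0, so other values are needed.\<close>
  then show ?thesis by (intro exI[of _ "1/2"] exI[of _ 1]) simp
next
  case False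
  then have d: "1 \<le> d" by simp
  \<comment> \<open>From \<open>d = 4\<close> on, the left-hand side grows by a factor of at most 3
    per step, just as the right-hand side does; the smaller cases are checked.\<close>
  have key: "d * (d + 2) * 2 ^ d \<le> 6 * 3 ^ d"
  proof (cases "d < 4")
    case True
    then have "d = 1 \<or> d = 2 \<or> d = 3" using d by auto
    then show ?thesis by auto
  next
    case False
    then have "4 \<le> d" by simp
    then show ?thesis
    proof (induction d rule: dec_induct)
      case (step m)
      have "6 + 2 * m \<le> 4 * m" using step.hyps by simp
      also have "4 * m \<le> m * m" using step.hyps by (intro mult_le_mono1)
      finally have "2 * ((m + 1) * (m + 3)) \<le> 3 * (m * (m + 2))" using step.hyps by (simp add: algebra_simps)
      then have "2 * ((m + 1) * (m + 3)) * 2 ^ m \<le> 3 * (m * (m + 2)) * 2 ^ m" by (rule mult_le_mono1)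
      also have "\<dots> = 3 * (m * (m + 2) * 2 ^ m)" by (simp only: mult.assoc)
      also have "\<dots> \<le> 3 * (6 * 3 ^ m)" by (rule mult_le_mono2[OF step.IH])
      finally show ?case by (simp add: algebra_simps)
    qed simp
  qed
  define x where "x = 2 / real (d + 2)"
  have x: "0 < x" "x < 1" using d by (auto simp: x_def)
  have "1 \<le> d * 2 ^ d" using d by simp
  then have 1: "1 \<le> real (d * 2 ^ d)" by linarith
  have "real (d * (d + 2) * 2 ^ d) \<le> real (6 * 3 ^ d)" using key by (simp only: of_nat_le_iff)
  then have "3 * real (d * 2 ^ d) * real (d + 2) \<le> 3 ^ (d + 2) * 2" by (simp add: algebra_simps power_add)
  then have 2: "3 * real (d * 2 ^ d) \<le> 3 ^ (d + 2) * x" unfolding x_def by (simp add: field_simps)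
  have "(1 + 2 / real d) ^ d \<le> exp 2" by (rule exp_ge_one_plus_x_over_n_power_n) (use d in auto)
  also have "exp 2 = exp 1 * exp (1 :: real)" by (simp flip: exp_add)
  also have "\<dots> \<le> 3 * 3" using exp_le by (intro mult_mono) auto
  finally have 9: "(1 + 2 / real d) ^ d \<le> 9" by simp
  have e: "0 < real d" using d by simp
  have "1 - x = real d / (real d + 2)" "1 + 2 / real d = (real d + 2) / real d"
    using e by (simp_all add: x_def field_simps)
  then have "(1 - x) * (1 + 2 / real d) = 1" using e by simp
  then have "1 = (1 - x) ^ d * (1 + 2 / real d) ^ d" by (simp flip: power_mult_distrib)
  also have "\<dots> \<le> (1 - x) ^ d * 9" using x 9 by (intro mult_left_mono) auto
  finally have "3 ^ d * 1 \<le> 3 ^ d * ((1 - x) ^ d * 9 :: real)" by (intro mult_left_mono) auto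
  then have 3: "3 ^ d \<le> 3 ^ (d + 2) * (1 - x) ^ d" by (simp add: power_add algebra_simps)
  show ?thesis using x 1 2 3 by (intro exI[of _ x] exI[of _ "real (d * 2 ^ d)"]) simp
qed

context dst
begin

abbreviation "lows st \<equiv> card (low (chosen st) (forbidden st))"

definition "pass st \<longleftrightarrow> lows st \<le> d * (k - card (chosen st)) \<and> card (chosen st) \<le> k"
definition "work st = (if pass st then 3 ^ (card (chosen st) + lows st) + 1 else 1 :: nat)"
text \<open>Each branching raises the number of chosen vertices plus low components, and an item
  that passes has at most \<open>(d + 1) * k\<close> of them. So this bounds the remaining depth of
  the search.\<close>

definition "levels st = (d + 1) * k + 1 - (card (chosen st) + lows st)"

context
  fixes h :: nat and x c :: real
  assumes x: "0 < x" "x < 1" and c: "1 \<le> c" "real (d * 2 ^ d) \<le> c"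
    and choose: "3 * c \<le> 3 ^ h * x" and forbid: "3 ^ d \<le> 3 ^ h * (1 - x) ^ d"
begin

definition "weight st = (x / c) ^ card (chosen st) * (1 - x) ^ lows st"
text \<open>The scaled weight \<open>3 ^ (h * k) * weight st\<close> bounds the cost of a leaf and
  does not grow in total when branching; the factor \<open>levels st\<close> pays for the inner
  nodes. Of the factor \<open>n + 2\<close>, two units pay for the work on the item itself and
  \<open>n\<close> for the summands 1 of its at most \<open>n + 1\<close> children, the last of
  which is covered by the item's own summand.\<close>

definition "pot st = 1 + (real n + 2) * (3 ^ (h * k) * weight st * real (levels st))"

lemma weight_pos: "0 < weight st"
  using x c by (simp add: weight_def)

lemma pot_ge_1: "1 \<le> pot st"
  using weight_pos[of st] by (simp add: pot_def)

text \<open>The budget is split: each chosen vertex pays for itself by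
  \<open>3 ^ h * (x / c) \<ge> 3\<close>, and each of the \<open>k - card (chosen st)\<close>
  remaining units offers \<open>3 ^ h\<close> for \<open>d\<close> low components at the price
  \<open>3 / (1 - x)\<close> each.\<close>

lemma weight_ge:
  assumes "pass st"
  shows "3 ^ (card (chosen st) + lows st) \<le> 3 ^ (h * k) * weight st"
proof -
  let ?j = "card (chosen st)" and ?l = "lows st"
  have l: "?l \<le> d * (k - ?j)" and j: "?j \<le> k" using assms by (auto simp: pass_def)
  have "3 \<le> 3 ^ h * (x / c)" using choose c by (simp add: field_simps)
  then have "3 ^ ?j \<le> (3 ^ h * (x / c)) ^ ?j" by (intro power_mono) auto
  then have 1: "3 ^ ?j \<le> 3 ^ (h * ?j) * (x / c) ^ ?j" by (simp only: power_mult power_mult_distrib)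
  have q: "1 \<le> 3 / (1 - x)" using x by (simp add: field_simps)
  have "(3 / (1 - x)) ^ ?l \<le> (3 / (1 - x)) ^ (d * (k - ?j))" by (rule power_increasing[OF l q])
  also have "\<dots> = ((3 / (1 - x)) ^ d) ^ (k - ?j)" by (simp add: power_mult)
  also have "\<dots> \<le> (3 ^ h) ^ (k - ?j)"
    using forbid x by (intro power_mono) (auto simp: power_divide field_simps)
  finally have 2: "3 ^ ?l \<le> 3 ^ (h * (k - ?j)) * (1 - x) ^ ?l"
    using x by (simp add: power_divide field_simps power_mult)
  have "3 ^ (?j + ?l) \<le> (3 ^ (h * ?j) * (x / c) ^ ?j) * (3 ^ (h * (k - ?j)) * (1 - x) ^ ?l)"
    unfolding power_add using 1 2 x c by (intro mult_mono mult_nonneg_nonneg zero_le_power) auto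
  also have "\<dots> = 3 ^ (h * ?j + h * (k - ?j)) * weight st" by (simp add: weight_def power_add algebra_simps)
  also have "h * ?j + h * (k - ?j) = h * k" using j by (simp flip: distrib_left)
  finally show ?thesis .
qed

lemma levels_pos: "pass st \<Longrightarrow> 1 \<le> levels st"
proof -
  assume "pass st"
  then have *: "lows st \<le> d * (k - card (chosen st))" "card (chosen st) \<le> k" by (auto simp: pass_def)
  moreover have "d * (k - card (chosen st)) \<le> d * k" by (intro mult_le_mono2) simp
  ultimately have "card (chosen st) + lows st \<le> k + d * k" by linarith
  then show ?thesis by (simp add: levels_def)
qed

lemma pot_ge_work: "real (work st) \<le> pot st"
proof (cases "pass st")
  case True
  have 1: "(3 :: real) ^ (card (chosen st) + lows st) \<le> 3 ^ (h * k) * weight st" by (rule weight_ge[OF True])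
  have 2: "3 ^ (h * k) * weight st * 1 \<le> 3 ^ (h * k) * weight st * real (levels st)"
    using levels_pos[OF True] weight_pos[of st] by (intro mult_left_mono) auto
  have "1 * (3 ^ (h * k) * weight st * real (levels st)) \<le> (real n + 2) * (3 ^ (h * k) * weight st * real (levels st))"
    using weight_pos[of st] by (intro mult_right_mono) auto
  moreover have "real (work st) = 3 ^ (card (chosen st) + lows st) + 1" using True by (simp add: work_def)
  ultimately show ?thesis using 1 2 unfolding pot_def by linarith
qed (simp add: work_def pot_ge_1)

lemma wf_item_high:
  assumes "wf_item st" "w \<in> high (chosen st) (forbidden st)"
  shows "w < n" "st w = 0" "w \<in> nonterms" "w \<notin> chosen st"
proof -
  have *: "w \<in> nonterms" "w \<notin> chosen st" "w \<notin> forbidden st" using assms by (auto simp: high_def avail_def)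
  then show "w < n" "w \<in> nonterms" "w \<notin> chosen st" by (auto simp: nonterms_def)
  then have "st w \<le> 2" "st w \<noteq> 1" "st w \<noteq> 2" using assms(1) * by (auto simp: wf_item_def chosen_def forbidden_def)
  then show "st w = 0" by linarith
qed

lemma choose_item:
  assumes "wf_item st" "w \<in> high (chosen st) (forbidden st)"
  shows "chosen (st(w := 2)) = insert w (chosen st)" "forbidden (st(w := 2)) = forbidden st" "wf_item (st(w := 2))"
  using wf_item_high[OF assms] assms(1) by (auto simp: chosen_def forbidden_def wf_item_def)

lemma forbid_item:
  fixes b
  assumes "wf_item st"
  defines "st' \<equiv> \<lambda>i. if i \<in> hn (chosen st) (forbidden st) b then 1 else st i"
  shows "chosen st' = chosen st" "forbidden st' = forbidden st \<union> hn (chosen st) (forbidden st) b" "wf_item st'"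
proof -
  have H: "w < n \<and> st w = 0 \<and> w \<in> nonterms" if "w \<in> hn (chosen st) (forbidden st) b" for w
    using that wf_item_high[OF assms(1), of w] by (auto simp: hn_def)
  have gen: "chosen (\<lambda>i. if i \<in> X then 1 else st i) = chosen st"
    "forbidden (\<lambda>i. if i \<in> X then 1 else st i) = forbidden st \<union> X"
    "wf_item (\<lambda>i. if i \<in> X then 1 else st i)"
    if "\<forall>w\<in>X. w < n \<and> st w = 0 \<and> w \<in> nonterms" for X
    using that assms(1) by (auto simp: chosen_def forbidden_def wf_item_def)
  have "\<forall>w\<in>hn (chosen st) (forbidden st) b. w < n \<and> st w = 0 \<and> w \<in> nonterms" using H by blast
  note gen = gen[OF this]
  show "chosen st' = chosen st" "forbidden st' = forbidden st \<union> hn (chosen st) (forbidden st) b" "wf_item st'"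
    unfolding st'_def by (fact gen)+
qed

lemma children_wf: "wf_item st \<Longrightarrow> st' \<in> set (children st b) \<Longrightarrow> wf_item st'"
  using choose_item(3) forbid_item(3) by (auto simp: children_def hn_def)

lemma children_sol:
  assumes "wf_item st"
  shows "sol (chosen st) (forbidden st) \<longleftrightarrow> (\<exists>st'\<in>set (children st b). sol (chosen st') (forbidden st'))"
proof -
  let ?H = "hn (chosen st) (forbidden st) b"
  have H: "w < n" "w \<in> high (chosen st) (forbidden st)" if "w \<in> ?H" for w
    using that wf_item_high[OF assms, of w] by (auto simp: hn_def)
  have "(\<exists>st'\<in>set (children st b). sol (chosen st') (forbidden st')) \<longleftrightarrow>
      sol (chosen st) (forbidden st \<union> ?H) \<or> (\<exists>w\<in>?H. sol (chosen (st(w := 2))) (forbidden (st(w := 2))))"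
    using H by (auto simp: children_def forbid_item[OF assms])
  also have "(\<exists>w\<in>?H. sol (chosen (st(w := 2))) (forbidden (st(w := 2)))) \<longleftrightarrow>
      (\<exists>w\<in>?H. sol (insert w (chosen st)) (forbidden st))"
    using H choose_item[OF assms] by (intro bex_cong) auto
  finally show ?thesis using sol_branch[of "chosen st" "forbidden st" ?H] by simp
qed

text \<open>The forbidding child keeps at most the fraction \<open>1 - x\<close> of the weight and
  each of the at most \<open>c\<close> choosing children \<open>x / c\<close>, which makes 1 in
  total. All children have a level less, and this frees \<open>n + 2\<close> times the scaled weight
  for the work and the additive constants.\<close>

lemma pot_children:
  assumes wf: "wf_item st" and pass: "pass st" and b: "b \<in> und (chosen st)"
    and H: "hn (chosen st) (forbidden st) b \<noteq> {}" "card (hn (chosen st) (forbidden st) b) \<le> d * 2 ^ d"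
  shows "real (work st) + sum_list (map pot (children st b)) \<le> pot st"
proof -
  let ?H = "hn (chosen st) (forbidden st) b"
  let ?st1 = "\<lambda>i. if i \<in> ?H then 1 else st i"
  let ?K = "3 ^ (h * k) :: real"
  let ?L = "levels st"
  have finC: "finite (chosen st)" by (simp add: chosen_def)
  have Hn: "?H \<subseteq> {..<n}" by (rule nonterms_subset)
  have L1: "1 \<le> ?L" by (rule levels_pos[OF pass])
  have x1: "0 \<le> 1 - x" "1 - x \<le> 1" "0 \<le> x / c" using x c by auto
  have w1: "weight ?st1 \<le> weight st * (1 - x)" and l1: "levels ?st1 \<le> ?L - 1"
  proof -
    have l: "Suc (lows st) \<le> lows ?st1"
      using card_low_forbid[OF b H(1)] by (simp add: forbid_item[OF wf])
    have "(1 - x) ^ lows ?st1 \<le> (1 - x) ^ Suc (lows st)" by (rule power_decreasing[OF l x1(1,2)])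
    then have "(x / c) ^ card (chosen st) * (1 - x) ^ lows ?st1 \<le> (x / c) ^ card (chosen st) * (1 - x) ^ Suc (lows st)"
      using x1(3) by (intro mult_left_mono) auto
    then show "weight ?st1 \<le> weight st * (1 - x)" by (simp add: weight_def forbid_item[OF wf] algebra_simps)
    show "levels ?st1 \<le> ?L - 1" using l by (simp add: levels_def forbid_item[OF wf])
  qed
  have w2: "weight (st(w := 2)) \<le> weight st * (x / c)" and l2: "levels (st(w := 2)) \<le> ?L - 1" if "w \<in> ?H" for w
  proof -
    have hw: "w \<in> high (chosen st) (forbidden st)" using that by (simp add: hn_def)
    note ch = choose_item[OF wf hw]
    have j: "card (chosen (st(w := 2))) = Suc (card (chosen st))"
      unfolding ch(1) using finC wf_item_high(4)[OF wf hw] by simp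
    have l: "lows st \<le> lows (st(w := 2))" unfolding ch by (rule card_low_choose[OF hw])
    have "(1 - x) ^ lows (st(w := 2)) \<le> (1 - x) ^ lows st" by (rule power_decreasing[OF l x1(1,2)])
    then have "(x / c) ^ Suc (card (chosen st)) * (1 - x) ^ lows (st(w := 2)) \<le>
        (x / c) ^ Suc (card (chosen st)) * (1 - x) ^ lows st"
      using x1(3) by (intro mult_left_mono zero_le_power)
    then show "weight (st(w := 2)) \<le> weight st * (x / c)" unfolding weight_def j by (simp add: algebra_simps)
    show "levels (st(w := 2)) \<le> ?L - 1" using l j by (simp add: levels_def)
  qed
  have pot_le: "pot s \<le> 1 + (real n + 2) * (?K * weight st * y * real (?L - 1))"
    if "weight s \<le> weight st * y" "levels s \<le> ?L - 1" "0 \<le> y" for s y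
  proof -
    have "weight s * real (levels s) \<le> weight st * y * real (?L - 1)"
      using that weight_pos[of s] by (intro mult_mono) (auto simp: less_imp_le)
    then have "?K * (weight s * real (levels s)) \<le> ?K * (weight st * y * real (?L - 1))"
      by (intro mult_left_mono) auto
    then have "(real n + 2) * (?K * (weight s * real (levels s))) \<le> (real n + 2) * (?K * (weight st * y * real (?L - 1)))"
      by (intro mult_left_mono) auto
    then show ?thesis unfolding pot_def by (simp only: mult.assoc add_le_cancel_left)
  qed
  have filter: "set (filter (\<lambda>w. w \<in> ?H) [0..<n]) = ?H" "distinct (filter (\<lambda>w. w \<in> ?H) [0..<n])"
    using Hn by auto
  have "sum_list (map pot (map (\<lambda>w. st(w := 2)) (filter (\<lambda>w. w \<in> ?H) [0..<n]))) = (\<Sum>w\<in>?H. pot (st(w := 2)))"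
    using sum_list_distinct_conv_sum_set[OF filter(2), of "\<lambda>w. pot (st(w := 2))"] filter(1)
    by (simp add: comp_def)
  also have "\<dots> \<le> (\<Sum>w\<in>?H. 1 + (real n + 2) * (?K * weight st * (x / c) * real (?L - 1)))"
    using w2 l2 x1 by (intro sum_mono pot_le) auto
  also have "\<dots> = real (card ?H) + real (card ?H) * ((real n + 2) * (?K * weight st * (x / c) * real (?L - 1)))"
    by (simp add: algebra_simps)
  also have "\<dots> \<le> real n + c * ((real n + 2) * (?K * weight st * (x / c) * real (?L - 1)))"
  proof (intro add_mono mult_right_mono)
    have "card ?H \<le> n" using card_mono[OF _ Hn] by simp
    then show "real (card ?H) \<le> real n" by simp
    have "real (card ?H) \<le> real (d * 2 ^ d)" using H(2) by (simp only: of_nat_le_iff)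
    then show "real (card ?H) \<le> c" using c(2) by linarith
  qed (use x1 weight_pos[of st] in \<open>auto intro!: mult_nonneg_nonneg simp del: times_divide_eq_right\<close>)
  also have "\<dots> = real n + (real n + 2) * (?K * weight st * x * real (?L - 1))"
    using c(1) by (simp add: field_simps)
  finally have s2: "sum_list (map pot (map (\<lambda>w. st(w := 2)) (filter (\<lambda>w. w \<in> ?H) [0..<n])))
    \<le> real n + (real n + 2) * (?K * weight st * x * real (?L - 1))" .
  have s1: "pot ?st1 \<le> 1 + (real n + 2) * (?K * weight st * (1 - x) * real (?L - 1))"
    by (rule pot_le[OF w1 l1 x1(1)])
  define y where "y = ?K * weight st"
  have "sum_list (map pot (children st b)) \<le> (1 + real n) + (real n + 2) * (y * real (?L - 1))"
    using s1 s2 unfolding children_def y_def by (simp add: algebra_simps)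
  also have "real (?L - 1) = real ?L - 1" using L1 by simp
  finally have s: "sum_list (map pot (children st b)) \<le> (1 + real n) + (real n + 2) * (y * (real ?L - 1))" .
  have "3 ^ (card (chosen st) + lows st) \<le> y" unfolding y_def by (rule weight_ge[OF pass])
  moreover have "(1 :: real) \<le> 3 ^ (card (chosen st) + lows st)" by simp
  moreover have work: "real (work st) = 3 ^ (card (chosen st) + lows st) + 1" using pass by (simp add: work_def)
  ultimately have y: "1 \<le> y" "real (work st) \<le> 2 * y"
    using work by linarith+
  \<comment> \<open>As the scaled weight is at least 1, the additive constants of the children are
    dominated by multiples of it.\<close>
  have "real n * 1 \<le> real n * y" using y(1) by (intro mult_left_mono) auto
  then show ?thesis using s y(2) unfolding pot_def y_def[symmetric] by (simp add: algebra_simps)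
qed

end

end


section \<open>The search\<close>

text \<open>Compiled code determines only the variables and may leave anything in its temporaries;
  \<open>cong\<close> says that \<open>Q\<close> ignores these.\<close>

lemma run_wp:
  assumes c: "wfc c" "ccom_ok c 64 p" and b: "bnd W R M" "rel R A M" and wp: "wp c Q R A"
    and cong: "\<And>v v' A. (\<And>x. x < 64 \<Longrightarrow> v' x = v x) \<Longrightarrow> Q v A \<Longrightarrow> Q v' A"
  obtains R' M' A' where "run (ccom c 64) (R, M) (poly p W * (R 4 + 1) ^ long_depth c) (R', M')"
    "Q R' A'" "bnd W R' M'" "rel R' A' M'" "R' 4 = R 4"
proof -
  obtain R' M' where R': "run (ccom c 64) (R, M) (poly p W * (R 4 + 1) ^ long_depth c) (R', M')"
    "\<And>x. x < 64 \<Longrightarrow> R' x = fst (sem c (R, A)) x" "rel R' (snd (sem c (R, A))) M'" "bnd W R' M'"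
    using ccom_okD[OF c(2) refl b] by metis
  have "Q R' (snd (sem c (R, A)))"
    by (rule cong[of R' "fst (sem c (R, A))"]) (use R'(2) wp in \<open>auto simp: wp_def\<close>)
  moreover have "R' 4 = R 4" using R'(2)[of 4] sem_preserves[OF c(1), of 4 "(R, A)"] by simp
  ultimately show ?thesis using that R' by blast
qed

text \<open>Register 4 is reserved in the structured language, so the range of the long loops is
  copied from register 12 by two raw instructions once \<open>mask_prog\<close> has computed
  it.\<close>

definition "body_prog d = Seq (ccom (pop_prog d (d * 2 ^ d)) 64) (If_nz 9 (If_nz 10 (ccom push_prog 64)
  (Seq (ccom mask_prog 64) (Seq (Seq (Const 64 0) (Add 4 12 64)) (ccom leaf_prog 64)))) Skip)"

lemma wfe_mulc [simp]: "wfe (mulc d e) \<longleftrightarrow> d = 0 \<or> wfe e"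
  by (induction d) auto

lemmas prog_defs = pop_prog_def push_prog_def mask_prog_def leaf_prog_def pairs_prog_def pair_prog_def
  table_prog_def join_prog_def arc_prog_def eAvail_def eChosen_def eHn_def eTarget_def eUsable_def

lemma wfc_progs: "wfc (pop_prog d f)" "wfc push_prog" "wfc mask_prog" "wfc leaf_prog"
  by (simp_all add: prog_defs edefs)

lemma wfc_init_prog: "wfc init_prog"
  by (simp add: init_prog_def terms_prog_def arcs_prog_def refl_prog_def step_prog_def copy_prog_def
    sources_prog_def dmn_prog_def first_item_prog_def edefs)

lemma long_depth_progs: "long_depth (pop_prog d f) = 0" "long_depth push_prog = 0" "long_depth mask_prog = 0"
    "long_depth leaf_prog = 1"
  by (simp_all add: prog_defs)

lemma long_depth_init_prog: "long_depth init_prog = 0"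
  by (simp add: init_prog_def terms_prog_def arcs_prog_def refl_prog_def step_prog_def copy_prog_def
    sources_prog_def dmn_prog_def first_item_prog_def)

lemma asgd_main: "asgd mask_prog = {11, 12, 20}" "putd mask_prog = {11}"
  "asgd leaf_prog = {0, 13, 20, 21, 22, 23, 24}" "putd leaf_prog = {12, 13, 14}"
  "0 \<notin> asgd (pop_prog d f)"
  by (auto simp: prog_defs)

context dst
begin

lemma inv_cong:
  fixes v v' :: "nat \<Rightarrow> nat" and A :: "nat \<Rightarrow> nat \<Rightarrow> nat"
  assumes "\<And>x. x < 64 \<Longrightarrow> v' x = v x"
  shows "inv_graph cap v A \<Longrightarrow> inv_graph cap v' A" "inv_stack \<sigma> v A \<Longrightarrow> inv_stack \<sigma> v' A"
    "inv_item st v A \<Longrightarrow> inv_item st v' A" "branch_source f C F v \<Longrightarrow> branch_source f C F v'"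
  using assms by (simp_all add: inv_graph_def inv_stack_def inv_item_def branch_source_def split: if_splits)

text \<open>By the excluded minor, no source to branch on means no high vertex; then every
  undominated source is low, and the pruning bound limits the number of targets.\<close>

lemma branch_source_0:
  assumes "branch_source (d * 2 ^ d) C F v" "v 10 = 0" "\<not> clique_minor (d + 2) {..<n} (E \<union> E\<inverse>)"
  shows "und C = low C F"
proof -
  have "\<not> (\<exists>b\<in>und C. hn C F b \<noteq> {} \<and> card (hn C F b) \<le> d * 2 ^ d)"
    using assms(1,2) by (simp add: branch_source_def)
  then have "high C F = {}" using few_high_neighbours[OF assms(3), of C F] by blast
  then show ?thesis by (simp add: low_def hn_def)
qed

lemma card_targets_leaf:
  assumes "wf_item st" "und (chosen st) = low (chosen st) (forbidden st)"
  shows "card (targets (chosen st)) = card (chosen st) + card (low (chosen st) (forbidden st))"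
proof -
  have "und (chosen st) \<inter> chosen st = {}"
    using wf_item_sets(1)[OF assms(1)] by (auto simp: und_def sources_def nonterms_def)
  then show ?thesis unfolding targets_def assms(2)[symmetric]
    by (subst card_Un_disjoint) (auto simp: chosen_def)
qed

context
  fixes h :: nat and x c :: real
  assumes x: "0 < x" "x < 1" and c: "1 \<le> c" "real (d * 2 ^ d) \<le> c"
    and choose: "3 * c \<le> 3 ^ h * x" and forbid: "3 ^ d \<le> 3 ^ h * (1 - x) ^ d"
begin

lemmas pot_facts = pot_ge_1[OF x c choose forbid] pot_ge_work[OF x c choose forbid]
  pot_children[OF x c choose forbid]

abbreviation "soluble st \<equiv> sol (chosen st) (forbidden st)"
abbreviation "pots \<sigma> \<equiv> sum_list (map (pot h x c) \<sigma>)"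

text \<open>Bounds the height of the stack by the potential, which keeps the register that holds
  this height below the cap.\<close>

lemma pots_ge_length: "real (length \<sigma>) \<le> pots \<sigma>"
  by (induction \<sigma>) (use pot_facts(1) in \<open>auto intro: add_mono\<close>)

context
  fixes pp pu pm pl :: "nat poly" and cap :: nat
  assumes ok: "ccom_ok (pop_prog d (d * 2 ^ d)) 64 pp" "ccom_ok push_prog 64 pu" "ccom_ok mask_prog 64 pm"
      "ccom_ok leaf_prog 64 pl"
    and cap: "3 ^ n \<le> cap" "n + 1 \<le> cap" "2 \<le> cap" and kn: "k \<le> n"
    and free: "\<not> clique_minor (d + 2) {..<n} (E \<union> E\<inverse>)"
begin

abbreviation "step_poly \<equiv> pp + pu + pm + pl + [:10, 10:]"

text \<open>A pruned item or a leaf gives up its whole potential, which covers its work; a branching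
  item hands the rest down to its children.\<close>

lemma body_correct:
  assumes b: "bnd W R M" "rel R A M" and inv: "inv_graph cap R A" "inv_stack (\<sigma> @ [st]) R A"
    and wf: "wf_item st" and len: "length \<sigma> + n < cap"
  shows "\<exists>R' M' A' \<sigma>'. run (body_prog d) (R, M) (poly step_poly W * work st) (R', M') \<and>
    bnd W R' M' \<and> rel R' A' M' \<and> inv_graph cap R' A' \<and> inv_stack (\<sigma> @ \<sigma>') R' A' \<and> (\<forall>s\<in>set \<sigma>'. wf_item s) \<and>
    (R' 0 \<noteq> 0 \<or> (\<exists>s\<in>set \<sigma>'. soluble s) \<longleftrightarrow> R 0 \<noteq> 0 \<or> soluble st) \<and>
    real (work st) + pots \<sigma>' \<le> pot h x c st"
proof -
  let ?C = "chosen st" and ?F = "forbidden st"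
  let ?Q1 = "\<lambda>v A. inv_graph cap v A \<and> inv_stack \<sigma> v A \<and> inv_item st v A \<and>
     (v 9 \<noteq> 0 \<longleftrightarrow> card (low ?C ?F) \<le> d * (k - card ?C) \<and> card ?C \<le> k) \<and>
     branch_source (d * 2 ^ d) ?C ?F v \<and> v 0 = R 0"
  have "wp (pop_prog d (d * 2 ^ d)) ?Q1 R A"
    by (rule wp_conseq[OF pop_prog_correct[OF inv wf]]) (use cap len asgd_main(5) in auto)
  then obtain R1 M1 A1 where R1: "run (ccom (pop_prog d (d * 2 ^ d)) 64) (R, M)
      (poly pp W * (R 4 + 1) ^ long_depth (pop_prog d (d * 2 ^ d))) (R1, M1)"
    "?Q1 R1 A1" "bnd W R1 M1" "rel R1 A1 M1"
  proof (rule run_wp[OF wfc_progs(1) ok(1) b])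
    fix v v' :: "nat \<Rightarrow> nat" and A :: "nat \<Rightarrow> nat \<Rightarrow> nat"
    assume "\<And>x. x < 64 \<Longrightarrow> v' x = v x" "?Q1 v A"
    then show "?Q1 v' A" using inv_cong[of v' v] by simp
  qed blast
  have r1: "run (ccom (pop_prog d (d * 2 ^ d)) 64) (R, M) (poly pp W) (R1, M1)"
    using R1(1) by (simp add: long_depth_progs)
  have pass: "pass st \<longleftrightarrow> R1 9 \<noteq> 0" using R1(2) by (simp add: pass_def)
  have R9: "R1 9 < 2 ^ W" "R1 10 < 2 ^ W" "R1 12 < 2 ^ W" using R1(3) by (auto simp: bnd_def)
  consider (prune) "R1 9 = 0" | (branch) "R1 9 \<noteq> 0" "R1 10 \<noteq> 0" | (leaf) "R1 9 \<noteq> 0" "R1 10 = 0" by blast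
  then show ?thesis
  proof cases
    case prune
    let ?p = "ccom push_prog 64"
    have "run (If_nz 9 (If_nz 10 ?p (Seq (ccom mask_prog 64) (Seq (Seq (Const 64 0) (Add 4 12 64)) (ccom leaf_prog 64)))) Skip)
        (R1, M1) (1 + W + 1) (R1, M1)"
      by (rule run_If) (use prune R9 run_Skip in auto)
    from run_Seq[OF r1 this] have "run (body_prog d) (R, M) (poly pp W + (1 + W + 1)) (R1, M1)"
      unfolding body_prog_def .
    moreover have "work st = 1" using prune pass by (simp add: work_def)
    ultimately have "run (body_prog d) (R, M) (poly step_poly W * work st) (R1, M1)"
      by (auto elim!: run_mono)
    moreover have "\<not> soluble st" using sol_card_low[of ?C ?F] pass prune by (auto simp: pass_def)
    moreover have "real (work st) \<le> pot h x c st" by (rule pot_facts(2))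
    ultimately show ?thesis using R1 by (intro exI[of _ R1] exI[of _ M1] exI[of _ A1] exI[of _ "[]"]) simp
  next
    case branch
    let ?b = "R1 10 - 1"
    have bs: "?b \<in> und ?C" "hn ?C ?F ?b \<noteq> {}" "card (hn ?C ?F ?b) \<le> d * 2 ^ d"
      using R1(2) branch by (auto simp: branch_source_def)
    have bn: "?b < n" using bs(1) nonterms_subset(3) by blast
    let ?Q2 = "\<lambda>v' A'. inv_graph cap v' A' \<and> inv_stack (\<sigma> @ children st ?b) v' A' \<and> v' 0 = R1 0"
    have "wp push_prog ?Q2 R1 A1"
      by (rule push_prog_correct) (use R1(2) wf branch bn cap len in auto)
    then obtain R2 M2 A2 where R2: "run (ccom push_prog 64) (R1, M1) (poly pu W * (R1 4 + 1) ^ long_depth push_prog) (R2, M2)"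
      "?Q2 R2 A2" "bnd W R2 M2" "rel R2 A2 M2"
    proof (rule run_wp[OF wfc_progs(2) ok(2) R1(3,4)])
      fix v v' :: "nat \<Rightarrow> nat" and A :: "nat \<Rightarrow> nat \<Rightarrow> nat"
      assume "\<And>x. x < 64 \<Longrightarrow> v' x = v x" "?Q2 v A"
      then show "?Q2 v' A" using inv_cong[of v' v] by simp
    qed blast
    have r2: "run (ccom push_prog 64) (R1, M1) (poly pu W) (R2, M2)" using R2(1) by (simp add: long_depth_progs)
    let ?l = "Seq (ccom mask_prog 64) (Seq (Seq (Const 64 0) (Add 4 12 64)) (ccom leaf_prog 64))"
    have "run (If_nz 9 (If_nz 10 (ccom push_prog 64) ?l) Skip) (R1, M1) (1 + W + (1 + W + poly pu W)) (R2, M2)"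
      by (intro run_If) (use branch R9 r2 in auto)
    from run_Seq[OF r1 this] have "run (body_prog d) (R, M) (poly pp W + (1 + W + (1 + W + poly pu W))) (R2, M2)"
      unfolding body_prog_def .
    moreover have le: "poly step_poly W * 1 \<le> poly step_poly W * work st" by (intro mult_le_mono2) (simp add: work_def)
    have "poly pp W + (1 + W + (1 + W + poly pu W)) \<le> poly step_poly W * work st"
      by (rule order_trans[OF _ le]) simp
    ultimately have run: "run (body_prog d) (R, M) (poly step_poly W * work st) (R2, M2)" by (rule run_mono)
    have "pass st" using branch pass by simp
    then have "real (work st) + pots (children st ?b) \<le> pot h x c st" by (rule pot_facts(3)[OF wf _ bs])
    then show ?thesis using run R1(2) R2 children_wf[OF x c choose forbid wf] children_sol[OF x c choose forbid wf, of ?b]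
      by (intro exI[of _ R2] exI[of _ M2] exI[of _ A2] exI[of _ "children st ?b"]) auto
  next
    case leaf
    have ul: "und ?C = low ?C ?F" by (rule branch_source_0[of ?C ?F R1, OF _ leaf(2) free]) (use R1(2) in blast)
    let ?q = "card (targets ?C)"
    \<comment> \<open>At a leaf every target is chosen or low, so that the length
      \<open>3 ^ ?q\<close> of the long loops is the work of the item up to 1.\<close>
    have q: "?q = card ?C + card (low ?C ?F)" by (rule card_targets_leaf[OF wf ul])
    let ?Q2 = "\<lambda>v A. inv_graph cap v A \<and> inv_stack \<sigma> v A \<and> inv_item st v A \<and> inv_mask st A \<and>
      v 11 = 2 ^ ?q \<and> v 12 = 3 ^ ?q \<and> v 0 = R1 0"
    have v12: "R1 1 = n" "R1 2 = cap" using R1(2) by (auto simp: inv_graph_def)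
    have "wp mask_prog ?Q2 R1 A1"
    proof (rule wp_conseq[OF mask_prog_correct[OF wf cap(1,2) _ v12]])
      show "inv_item st R1 A1" using R1(2) by simp
      fix v' A'
      assume "inv_mask st A' \<and> v' 11 = 2 ^ ?q \<and> v' 12 = 3 ^ ?q"
        and "\<And>x. x \<notin> asgd mask_prog \<Longrightarrow> v' x = R1 x" "\<And>a. a \<notin> putd mask_prog \<Longrightarrow> A' a = A1 a"
      then show "?Q2 v' A'" using R1(2) by (simp add: asgd_main inv_graph_def inv_stack_def inv_item_def)
    qed
    then obtain R2 M2 A2 where R2: "run (ccom mask_prog 64) (R1, M1) (poly pm W * (R1 4 + 1) ^ long_depth mask_prog) (R2, M2)"
      "?Q2 R2 A2" "bnd W R2 M2" "rel R2 A2 M2"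
    proof (rule run_wp[OF wfc_progs(3) ok(3) R1(3,4)])
      fix v v' :: "nat \<Rightarrow> nat" and A :: "nat \<Rightarrow> nat \<Rightarrow> nat"
      assume "\<And>x. x < 64 \<Longrightarrow> v' x = v x" "?Q2 v A"
      then show "?Q2 v' A" using inv_cong[of v' v] by simp
    qed blast
    have r2: "run (ccom mask_prog 64) (R1, M1) (poly pm W) (R2, M2)" using R2(1) by (simp add: long_depth_progs)
    let ?R3 = "R2(64 := 0, 4 := R2 12)"
    have R12: "R2 12 < 2 ^ W" using R2(3) by (simp add: bnd_def)
    have "run (Const 64 0) (R2, M2) (1 + 0) (R2(64 := 0), M2)" by (rule run_Const) simp
    moreover have "run (Add 4 12 64) (R2(64 := 0), M2) (1 + 2 * W) (?R3, M2)"
      using run_Add[of "R2(64 := 0)" 12 W 64 4 M2] R12 by simp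
    ultimately have r3: "run (Seq (Const 64 0) (Add 4 12 64)) (R2, M2) (1 + 0 + (1 + 2 * W)) (?R3, M2)" by (rule run_Seq)
    have b3: "bnd W ?R3 M2" using R2(3) R12 by (auto simp: bnd_def)
    have rel3: "rel ?R3 A2 M2" by (rule rel_cong[OF R2(4)]) simp
    have inv3: "inv_graph cap ?R3 A2" "inv_stack \<sigma> ?R3 A2" "inv_item st ?R3 A2" "?R3 4 = 3 ^ ?q" "?R3 11 = 2 ^ ?q" "?R3 0 = R 0"
      using R2(2) R1(2) by (simp_all add: inv_graph_def inv_stack_def inv_item_def)
    have Ck: "card ?C \<le> k" using leaf pass by (simp add: pass_def)
    let ?Q4 = "\<lambda>v A. inv_graph cap v A \<and> inv_stack \<sigma> v A \<and> v 0 = (if soluble st then 1 else R 0)"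
    have "wp leaf_prog ?Q4 ?R3 A2"
    proof (rule wp_conseq[OF leaf_prog_correct[OF wf cap(1,2) inv3(1,3) _ inv3(4,5) Ck kn]])
      show "inv_mask st A2" using R2(2) by simp
      fix v' A'
      assume "v' 0 = (if soluble st then 1 else ?R3 0)"
        and fr: "\<And>x. x \<notin> asgd leaf_prog \<Longrightarrow> v' x = ?R3 x" "\<And>a. a \<notin> putd leaf_prog \<Longrightarrow> A' a = A2 a"
      moreover have "inv_graph cap v' A'" using inv3(1) fr by (simp add: asgd_main inv_graph_def)
      moreover have "inv_stack \<sigma> v' A'" using inv3(2) fr by (simp add: asgd_main inv_stack_def)
      ultimately show "?Q4 v' A'" using inv3(6) by simp
    qed
    then obtain R4 M4 A4 where R4: "run (ccom leaf_prog 64) (?R3, M2) (poly pl W * (?R3 4 + 1) ^ long_depth leaf_prog) (R4, M4)"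
      "?Q4 R4 A4" "bnd W R4 M4" "rel R4 A4 M4"
    proof (rule run_wp[OF wfc_progs(4) ok(4) b3 rel3])
      fix v v' :: "nat \<Rightarrow> nat" and A :: "nat \<Rightarrow> nat \<Rightarrow> nat"
      assume "\<And>x. x < 64 \<Longrightarrow> v' x = v x" "?Q4 v A"
      then show "?Q4 v' A" using inv_cong[of v' v] by simp
    qed blast
    have w: "work st = 3 ^ ?q + 1" using leaf pass by (simp add: work_def q)
    have r4: "run (ccom leaf_prog 64) (?R3, M2) (poly pl W * work st) (R4, M4)"
      using R4(1) inv3(4) unfolding long_depth_progs w by simp
    let ?l = "Seq (ccom mask_prog 64) (Seq (Seq (Const 64 0) (Add 4 12 64)) (ccom leaf_prog 64))"
    have "run ?l (R1, M1) (poly pm W + ((1 + 0 + (1 + 2 * W)) + poly pl W * work st)) (R4, M4)"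
      by (rule run_Seq[OF r2 run_Seq[OF r3 r4]])
    then have "run (If_nz 9 (If_nz 10 (ccom push_prog 64) ?l) Skip) (R1, M1)
        (1 + W + (1 + W + (poly pm W + ((1 + 0 + (1 + 2 * W)) + poly pl W * work st)))) (R4, M4)"
      by (intro run_If) (use leaf R9 in auto)
    from run_Seq[OF r1 this] have r5: "run (body_prog d) (R, M)
        (poly pp W + (1 + W + (1 + W + (poly pm W + ((1 + 0 + (1 + 2 * W)) + poly pl W * work st))))) (R4, M4)"
      unfolding body_prog_def .
    have le: "(poly pp W + poly pm W + 10 + 10 * W) * 1 \<le> (poly pp W + poly pm W + 10 + 10 * W) * work st"
      by (intro mult_le_mono2) (simp add: w)
    have "poly pp W + (1 + W + (1 + W + (poly pm W + ((1 + 0 + (1 + 2 * W)) + z)))) \<le>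
        (poly pp W + poly pm W + 10 + 10 * W) * work st + z" for z
      by (rule order_trans[OF _ add_right_mono[OF le]]) simp
    then have "poly pp W + (1 + W + (1 + W + (poly pm W + ((1 + 0 + (1 + 2 * W)) + poly pl W * work st))))
        \<le> (poly pp W + poly pm W + 10 + 10 * W) * work st + poly pl W * work st" .
    also have "\<dots> \<le> poly step_poly W * work st" by (simp add: algebra_simps)
    finally have run: "run (body_prog d) (R, M) (poly step_poly W * work st) (R4, M4)" by (rule run_mono[OF r5])
    have "real (work st) \<le> pot h x c st" by (rule pot_facts(2))
    then show ?thesis using run R4 by (intro exI[of _ R4] exI[of _ M4] exI[of _ A4] exI[of _ "[]"]) simp
  qed
qed

text \<open>Induction on an integer bound of the potential, as every pass lowers the potential by
  \<open>work st \<ge> 1\<close>. For the same reason a cap above the initial potential plus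
  \<open>n\<close> always leaves room for the next pushes.\<close>

lemma loop_correct:
  "pots \<sigma> \<le> real m \<Longrightarrow> pots \<sigma> + real n < real cap \<Longrightarrow> bnd W R M \<Longrightarrow> rel R A M \<Longrightarrow> inv_graph cap R A \<Longrightarrow>
   inv_stack \<sigma> R A \<Longrightarrow> (\<forall>s\<in>set \<sigma>. wf_item s) \<Longrightarrow>
   \<exists>R' M' t. run (While_nz 7 (body_prog d)) (R, M) t (R', M') \<and>
     real t \<le> 1 + real (poly step_poly W + W + 1) * pots \<sigma> \<and> (R' 0 \<noteq> 0 \<longleftrightarrow> R 0 \<noteq> 0 \<or> (\<exists>s\<in>set \<sigma>. soluble s))"
proof (induction m arbitrary: \<sigma> R M A)
  case 0
  have "real (length \<sigma>) \<le> 0" using pots_ge_length[of \<sigma>] 0(1) by linarith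
  then have "\<sigma> = []" by simp
  then have "R 7 = 0" using 0(6) by (simp add: inv_stack_def)
  then show ?case using run_While_False[of R 7 "body_prog d" M] \<open>\<sigma> = []\<close>
    by (intro exI[of _ R] exI[of _ M] exI[of _ 1]) simp
next
  case (Suc m)
  show ?case
  proof (cases \<sigma> rule: rev_exhaust)
    case Nil
    then have "R 7 = 0" using Suc.prems(6) by (simp add: inv_stack_def)
    then show ?thesis using run_While_False[of R 7 "body_prog d" M] Nil
      by (intro exI[of _ R] exI[of _ M] exI[of _ 1]) simp
  next
    case (snoc \<sigma>0 st)
    have R7: "R 7 \<noteq> 0" using Suc.prems(6) snoc by (simp add: inv_stack_def)
    have R7': "R 7 < 2 ^ W" using Suc.prems(3) by (simp add: bnd_def)
    have "real (length \<sigma>) + real n < real cap" using pots_ge_length[of \<sigma>] Suc.prems(2) by linarith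
    then have len: "length \<sigma>0 + n < cap" using snoc by simp
    have wf: "wf_item st" using Suc.prems(7) snoc by simp
    obtain R1 M1 A1 \<sigma>1 where s: "run (body_prog d) (R, M) (poly step_poly W * work st) (R1, M1)"
      "bnd W R1 M1" "rel R1 A1 M1" "inv_graph cap R1 A1" "inv_stack (\<sigma>0 @ \<sigma>1) R1 A1" "\<forall>s\<in>set \<sigma>1. wf_item s"
      "R1 0 \<noteq> 0 \<or> (\<exists>s\<in>set \<sigma>1. soluble s) \<longleftrightarrow> R 0 \<noteq> 0 \<or> soluble st" "real (work st) + pots \<sigma>1 \<le> pot h x c st"
      using body_correct[OF Suc.prems(3,4,5) _ wf len] Suc.prems(6) snoc by blast
    have pots: "pots (\<sigma>0 @ \<sigma>1) + real (work st) \<le> pots \<sigma>" using s(8) snoc by simp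
    have w1: "1 \<le> work st" by (simp add: work_def)
    have "pots (\<sigma>0 @ \<sigma>1) \<le> real m" "pots (\<sigma>0 @ \<sigma>1) + real n < real cap"
      using pots w1 Suc.prems(1,2) by linarith+
    moreover have "\<forall>s\<in>set (\<sigma>0 @ \<sigma>1). wf_item s" using Suc.prems(7) snoc s(6) by auto
    ultimately obtain R2 M2 t where IH: "run (While_nz 7 (body_prog d)) (R1, M1) t (R2, M2)"
      "real t \<le> 1 + real (poly step_poly W + W + 1) * pots (\<sigma>0 @ \<sigma>1)"
      "R2 0 \<noteq> 0 \<longleftrightarrow> R1 0 \<noteq> 0 \<or> (\<exists>s\<in>set (\<sigma>0 @ \<sigma>1). soluble s)"
      using Suc.IH[OF _ _ s(2-5)] by blast
    let ?K = "poly step_poly W + W + 1"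
    let ?t = "1 + W + poly step_poly W * work st + t"
    have "run (While_nz 7 (body_prog d)) (R, M) ?t (R2, M2)" by (rule run_While_True[OF R7 R7' s(1) IH(1)])
    moreover have "real ?t \<le> 1 + real ?K * pots \<sigma>"
    proof -
      have "(1 + W) * 1 \<le> (1 + W) * work st" using w1 by (intro mult_le_mono2)
      then have "1 + W + poly step_poly W * work st \<le> ?K * work st" by (simp add: algebra_simps)
      then have "real (1 + W + poly step_poly W * work st) \<le> real ?K * real (work st)"
        by (simp only: of_nat_mult[symmetric] of_nat_le_iff)
      then have "real ?t \<le> real ?K * real (work st) + (1 + real ?K * pots (\<sigma>0 @ \<sigma>1))" using IH(2) by linarith
      also have "\<dots> = 1 + real ?K * (pots (\<sigma>0 @ \<sigma>1) + real (work st))" by (simp only: algebra_simps)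
      also have "\<dots> \<le> 1 + real ?K * pots \<sigma>" using pots by (intro add_left_mono mult_left_mono) auto
      finally show ?thesis .
    qed
    moreover have "R2 0 \<noteq> 0 \<longleftrightarrow> R 0 \<noteq> 0 \<or> (\<exists>s\<in>set \<sigma>. soluble s)" using IH(3) s(7) snoc by auto
    ultimately show ?thesis by blast
  qed
qed

end

end
end

text \<open>Register 5 still holds 0, so the first instruction loads \<open>n\<close> from address
  0. The cap is built by doublings in raw instructions, because assignments of the structured
  language would be cut off at the initial value 0 of register 2.\<close>

definition "setup_prog c = Seq (Load 1 5)
  (Seq (cexp (EAdd (EAdd (ENum 3) (EVar 1)) (eCell (EVar 1) (ENum 0))) 64)
  (Seq (Const 65 0) (Seq (Add 3 64 65)
  (Seq (cexp (mulc c (EAdd (EVar 1) (ENum 1))) 64)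
  (Seq (Const 2 1) (While_nz 64 (Seq (Add 2 2 2) (Seq (Const 65 1) (Sub 64 64 65)))))))))"

lemma run_power_loop:
  "R 64 = m \<Longrightarrow> R 2 = 2 ^ j \<Longrightarrow> j + m < W \<Longrightarrow>
   \<exists>R'. run (While_nz 64 (Seq (Add 2 2 2) (Seq (Const 65 1) (Sub 64 64 65)))) (R, M) (1 + m * (10 + 10 * W)) (R', M) \<and>
     R' 2 = 2 ^ (j + m) \<and> (\<forall>x<64. x \<noteq> 2 \<longrightarrow> R' x = R x)"
proof (induction m arbitrary: R j)
  case 0
  then show ?case using run_While_False[of R 64 _ M] by (intro exI[of _ R]) simp
next
  case (Suc m)
  let ?R1 = "R(2 := 2 ^ Suc j)" let ?R2 = "?R1(65 := 1)" let ?R3 = "?R2(64 := m)"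
  have mW: "Suc m < 2 ^ W" using Suc.prems(3) less_exp[of W] by linarith
  have one: "1 < (2 :: nat) ^ W" using Suc.prems(3) by (intro one_less_power) auto
  have s1: "run (Add 2 2 2) (R, M) (1 + 2 * W) (?R1, M)"
    using run_Add[of R 2 W 2 2 M] Suc.prems by (simp add: power_strict_increasing mult_2)
  have s2: "run (Const 65 1) (?R1, M) (1 + W) (?R2, M)" by (rule run_Const[OF one])
  have s3: "run (Sub 64 64 65) (?R2, M) (1 + 2 * W) (?R3, M)"
    using run_Sub[of ?R2 64 W 65 64 M] mW one Suc.prems(1) by simp
  have "\<exists>R'. run (While_nz 64 (Seq (Add 2 2 2) (Seq (Const 65 1) (Sub 64 64 65)))) (?R3, M) (1 + m * (10 + 10 * W)) (R', M) \<and>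
    R' 2 = 2 ^ (Suc j + m) \<and> (\<forall>x<64. x \<noteq> 2 \<longrightarrow> R' x = ?R3 x)"
    by (rule Suc.IH) (use Suc.prems(3) in auto)
  then obtain R' where R': "run (While_nz 64 (Seq (Add 2 2 2) (Seq (Const 65 1) (Sub 64 64 65)))) (?R3, M) (1 + m * (10 + 10 * W)) (R', M)"
    "R' 2 = 2 ^ (Suc j + m)" "\<forall>x<64. x \<noteq> 2 \<longrightarrow> R' x = ?R3 x" by blast
  have "run (While_nz 64 (Seq (Add 2 2 2) (Seq (Const 65 1) (Sub 64 64 65)))) (R, M) (1 + Suc m * (10 + 10 * W)) (R', M)"
    by (rule run_mono[OF run_While_True[OF _ _ run_Seq[OF s1 run_Seq[OF s2 s3]] R'(1), of W]])
      (use Suc.prems(1) mW in auto)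
  then show ?case using R'(2,3) by (intro exI[of _ R']) simp
qed

text \<open>The arrays are merely a view of the memory, so any contents will do.\<close>

lemma rel_exists: "\<exists>A. rel R A M"
  by (rule exI[of _ "\<lambda>a i. if a = 16 then (if i < R 3 then M i else 0) else M (R 3 + a + 16 * i)"]) (simp add: rel_def)

lemma run_setup_prog:
  "\<exists>p. \<forall>W n M. M 0 = n \<longrightarrow> n \<le> W \<longrightarrow> (\<forall>i. M i < 2 ^ W) \<longrightarrow> 3 + n + n * n < 2 ^ W \<longrightarrow> c * (n + 1) < W \<longrightarrow>
     (\<exists>R. run (setup_prog c) (\<lambda>_. 0, M) (poly p W) (R, M) \<and> R 1 = n \<and> R 2 = 2 ^ (c * (n + 1)) \<and>
       R 3 = 3 + n + n * n \<and> R 4 = 0 \<and> bnd W R M)"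
proof -
  let ?e1 = "EAdd (EAdd (ENum 3) (EVar 1)) (eCell (EVar 1) (ENum 0))" and ?e2 = "mulc c (EAdd (EVar 1) (ENum 1))"
  have wf: "wfe ?e1" "wfe ?e2" by (simp_all add: edefs)
  obtain p1 where p1: "\<And>R M A W. bnd W R M \<Longrightarrow> rel R A M \<Longrightarrow> \<exists>R'. run (cexp ?e1 64) (R, M) (poly p1 W) (R', M) \<and>
    R' 64 = eval ?e1 R A \<and> (\<forall>x<64. R' x = R x)" using run_cexp[OF wf(1) order_refl] by blast
  obtain p2 where p2: "\<And>R M A W. bnd W R M \<Longrightarrow> rel R A M \<Longrightarrow> \<exists>R'. run (cexp ?e2 64) (R, M) (poly p2 W) (R', M) \<and>
    R' 64 = eval ?e2 R A \<and> (\<forall>x<64. R' x = R x)" using run_cexp[OF wf(2) order_refl] by blast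
  let ?p = "p1 + p2 + [:10, 10:] + [:0, 1:] * [:10, 10:]"
  show ?thesis
  proof (rule exI[of _ ?p], intro allI impI)
    fix W n and M :: "nat \<Rightarrow> nat"
    assume M: "M 0 = n" "n \<le> W" "\<forall>i. M i < 2 ^ W" "3 + n + n * n < 2 ^ W" "c * (n + 1) < W"
    have nW: "n < 2 ^ W" using M(4) by linarith
    let ?R0 = "(\<lambda>_. 0 :: nat)" let ?R1 = "?R0(1 := n)"
    have s1: "run (Load 1 5) (?R0, M) (1 + 2 * W) (?R1, M)"
      using run_Load[of ?R0 5 W M 1] M nW by simp
    have b1: "bnd W ?R1 M" using M nW by (auto simp: bnd_def)
    obtain A1 where r1: "rel ?R1 A1 M" using rel_exists by blast
    obtain R2 where R2: "run (cexp ?e1 64) (?R1, M) (poly p1 W) (R2, M)" "R2 64 = eval ?e1 ?R1 A1"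
      "\<And>x. x < 64 \<Longrightarrow> R2 x = ?R1 x" using p1[OF b1 r1] by blast
    have R264: "R2 64 = 3 + n + n * n" using R2(2) by simp
    let ?R3 = "R2(65 := 0)" let ?R4 = "?R3(3 := 3 + n + n * n)"
    have s3: "run (Const 65 0) (R2, M) (1 + 0) (?R3, M)" by (rule run_Const) simp
    have s4: "run (Add 3 64 65) (?R3, M) (1 + 2 * W) (?R4, M)"
      using run_Add[of ?R3 64 W 65 3 M] R264 M(4) by simp
    have R4: "?R4 x = (if x = 3 then 3 + n + n * n else if x = 1 then n else 0)" if "x < 64" for x
      using R2(3)[OF that] that by simp
    have b4: "bnd W ?R4 M" unfolding bnd_def
    proof (intro conjI allI impI)
      show "?R4 x < 2 ^ W" if "x < 64" for x unfolding R4[OF that] using M nW by simp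
      show "?R4 1 \<le> W" by (subst R4) (use M in simp_all)
      show "M i < 2 ^ W" for i using M by simp
    qed
    obtain A4 where r4: "rel ?R4 A4 M" using rel_exists by blast
    obtain R5 where R5: "run (cexp ?e2 64) (?R4, M) (poly p2 W) (R5, M)" "R5 64 = eval ?e2 ?R4 A4"
      "\<And>x. x < 64 \<Longrightarrow> R5 x = ?R4 x" using p2[OF b4 r4] by blast
    have R564: "R5 64 = c * (n + 1)" using R5(2) R4[of 1] by simp
    let ?R6 = "R5(2 := 1)"
    have one: "1 < (2 :: nat) ^ W" using M(5) by (intro one_less_power) auto
    have s6: "run (Const 2 1) (R5, M) (1 + W) (?R6, M)" by (rule run_Const[OF one])
    obtain R7 where R7: "run (While_nz 64 (Seq (Add 2 2 2) (Seq (Const 65 1) (Sub 64 64 65)))) (?R6, M)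
        (1 + c * (n + 1) * (10 + 10 * W)) (R7, M)" "R7 2 = 2 ^ (0 + c * (n + 1))" "\<forall>x<64. x \<noteq> 2 \<longrightarrow> R7 x = ?R6 x"
      using run_power_loop[of ?R6 "c * (n + 1)" 0 W M] R564 M(5) by auto
    have le: "c * (n + 1) * (10 + 10 * W) \<le> W * (10 + 10 * W)" using M(5) by (intro mult_le_mono1) simp
    have pW: "poly ?p W = poly p1 W + poly p2 W + (10 + 10 * W) + W * (10 + 10 * W)" by (simp add: algebra_simps)
    obtain z where z: "W * (10 + 10 * W) = c * (n + 1) * (10 + 10 * W) + z" using le by (auto simp only: le_iff_add)
    have "run (setup_prog c) (?R0, M) (poly ?p W) (R7, M)" unfolding setup_prog_def pW z
      by (rule run_mono[OF run_Seq[OF s1 run_Seq[OF R2(1) run_Seq[OF s3 run_Seq[OF s4 run_Seq[OF R5(1) run_Seq[OF s6 R7(1)]]]]]]]) simp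
    moreover have v: "R7 x = (if x = 2 then 2 ^ (c * (n + 1)) else ?R4 x)" if "x < 64" for x
      using R7(2,3) R5(3)[OF that] that by simp
    moreover have "bnd W R7 M"
    proof -
      have "(2 :: nat) ^ (c * (n + 1)) < 2 ^ W" using M(5) by (intro power_strict_increasing) auto
      note pow = this
      show ?thesis unfolding bnd_def
      proof (intro conjI allI impI)
        show "R7 x < 2 ^ W" if "x < 64" for x unfolding v[OF that] R4[OF that] using M nW pow by simp
        have "R7 1 = ?R4 1" using v[of 1] by simp
        then show "R7 1 \<le> W" using R4[of 1] M by simp
        show "M i < 2 ^ W" for i using M by simp
      qed
    qed
    ultimately show "\<exists>R. run (setup_prog c) (?R0, M) (poly ?p W) (R, M) \<and> R 1 = n \<and> R 2 = 2 ^ (c * (n + 1)) \<and>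
       R 3 = 3 + n + n * n \<and> R 4 = 0 \<and> bnd W R M"
      using R4[of 1] R4[of 4] by (intro exI[of _ R7]) simp
  qed
qed


section \<open>The main theorem\<close>

lemma reachable_rtrancl:
  "u \<in> verts G \<Longrightarrow> arcs_ends G \<subseteq> verts G \<times> verts G \<Longrightarrow> (reachable G u v \<longleftrightarrow> (u, v) \<in> (arcs_ends G)\<^sup>*)"
proof -
  assume u: "u \<in> verts G" and sub: "arcs_ends G \<subseteq> verts G \<times> verts G"
  show "reachable G u v \<longleftrightarrow> (u, v) \<in> (arcs_ends G)\<^sup>*"
  proof
    assume "reachable G u v"
    then show "(u, v) \<in> (arcs_ends G)\<^sup>*"
      unfolding reachable_def by (induction rule: rtrancl_on.induct) (auto intro: rtrancl_into_rtrancl)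
  next
    assume "(u, v) \<in> (arcs_ends G)\<^sup>*"
    then show "reachable G u v" unfolding reachable_def
      by (induction rule: rtrancl_induct) (use u sub in \<open>auto intro: rtrancl_on.intros\<close>)
  qed
qed

lemma arcs_ends_induce_with_proj [simp]: "arcs_ends (with_proj G \<restriction> U) = parcs G \<inter> U \<times> U"
  by (auto simp: arcs_ends_conv)

lemma parcs_mk_symmetric_ends: "parcs (mk_symmetric G) = arcs_ends G \<union> (arcs_ends G)\<inverse>"
  by (auto simp: parcs_mk_symmetric arcs_ends_conv)

lemma clique_minor_imp_minor_of:
  assumes "clique_minor h (pverts G) (parcs G \<union> (parcs G)\<inverse>)"
  shows "minor_of (with_proj (complete_graph h)) (with_proj (mk_symmetric (with_proj G)))"
proof -
  let ?E = "parcs G \<union> (parcs G)\<inverse>"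
  let ?G = "with_proj (mk_symmetric (with_proj G))"
  have E: "arcs_ends ?G = ?E" unfolding with_proj_simps(3) parcs_mk_symmetric_ends ..
  obtain X where "\<forall>i<h. X i \<subseteq> pverts G \<and> conn ?E (X i)"
    "\<forall>i<h. \<forall>j<h. i \<noteq> j \<longrightarrow> X i \<inter> X j = {} \<and> (\<exists>u\<in>X i. \<exists>v\<in>X j. (u, v) \<in> ?E)"
    using assms unfolding clique_minor_def by blast
  note X = this[rule_format]
  have "connected (?G \<restriction> X i)" if "i < h" for i
  proof -
    let ?K = "?G \<restriction> X i"
    \<comment> \<open>\<open>connected\<close> symmetrises the induced graph once more, which
      changes nothing here.\<close>
    have ends: "arcs_ends (with_proj (mk_symmetric ?K)) = ?E \<inter> X i \<times> X i"
      unfolding with_proj_simps(3) arcs_ends_induce_with_proj parcs_mk_symmetric_ends by blast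
    have "reachable (with_proj (mk_symmetric ?K)) u v" if "u \<in> X i" "v \<in> X i" for u v
      using X(1)[OF \<open>i < h\<close>] that ends
      by (subst reachable_rtrancl) (auto simp: conn_def)
    moreover have "X i \<noteq> {}" using X(1)[OF that] by (simp add: conn_def)
    ultimately show ?thesis by (auto simp: connected_def strongly_connected_def)
  qed
  then show ?thesis unfolding minor_of_def
    by (intro exI[of _ X]) (use X E in \<open>auto simp: complete_graph_def\<close>)
qed

lemma length_concat_grid: "length (concat (map (\<lambda>i. map (g i) [0..<n]) [0..<m])) = n * m"
  by (induction m) auto

lemma nth_concat_grid:
  "i < m \<Longrightarrow> j < n \<Longrightarrow> concat (map (\<lambda>i. map (g i) [0..<n]) [0..<m]) ! (n * i + j) = g i j"
proof (induction m)
  case (Suc m)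
  show ?case
  proof (cases "i = m")
    case True
    then show ?thesis using Suc.prems by (simp add: nth_append length_concat_grid)
  next
    case False
    then have "i < m" using Suc.prems by simp
    then have "n * i + j < n * m"
      using Suc.prems(2) mult_le_mono2[of "Suc i" m n] by simp
    then show ?thesis using Suc.IH[OF \<open>i < m\<close> Suc.prems(2)] by (simp add: nth_append length_concat_grid)
  qed
qed simp

section \<open>Encoded instances and their solutions\<close>

context
  fixes I :: "nat dst_instance" and n :: nat
  assumes wf: "dst_wf I" and verts: "pverts (dgraph I) = {0..<n}"
begin

abbreviation "rt \<equiv> root I"
abbreviation "tm \<equiv> terminals I"
abbreviation "ar \<equiv> parcs (dgraph I)"

lemma instance_facts: "rt < n" "tm \<subseteq> {..<n} - {rt}" "ar \<subseteq> {..<n} \<times> {..<n}"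
proof -
  have w: "pair_fin_digraph (dgraph I)" using wf by (simp add: dst_wf_def)
  then interpret pair_fin_digraph "dgraph I" .
  show "rt < n" "tm \<subseteq> {..<n} - {rt}" using wf verts by (auto simp: dst_wf_def)
  show "ar \<subseteq> {..<n} \<times> {..<n}" using in_arcsD1 in_arcsD2 verts by fastforce
qed

lemma dst_instance: "dst n rt tm ar"
  using instance_facts by unfold_locales

lemma encode_nth:
  defines "xs \<equiv> dst_encode I"
  shows "length xs = 3 + n + n * n" "xs ! 0 = n" "xs ! 1 = rt" "xs ! 2 = budget I"
    "\<And>i. i < n \<Longrightarrow> xs ! (3 + i) = of_bool (i \<in> tm)"
    "\<And>i j. i < n \<Longrightarrow> j < n \<Longrightarrow> xs ! (3 + n + (n * i + j)) = of_bool ((i, j) \<in> ar)"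
proof -
  let ?M = "concat (map (\<lambda>u. map (\<lambda>v. of_bool ((u, v) \<in> ar)) [0..<n]) [0..<n]) :: nat list"
  have xs: "xs = [n, rt, budget I] @ map (\<lambda>v. of_bool (v \<in> tm)) [0..<n] @ ?M"
    unfolding xs_def dst_encode_def Let_def verts by simp
  show "length xs = 3 + n + n * n" unfolding xs by (simp add: length_concat_grid)
  show "xs ! 0 = n" "xs ! 1 = rt" "xs ! 2 = budget I" unfolding xs by simp_all
  show "xs ! (3 + i) = of_bool (i \<in> tm)" if "i < n" for i
    using that unfolding xs by (simp add: nth_append)
  show "xs ! (3 + n + (n * i + j)) = of_bool ((i, j) \<in> ar)" if "i < n" "j < n" for i j
  proof -
    have "xs ! (3 + n + (n * i + j)) = ?M ! (n * i + j)" unfolding xs by (simp add: nth_append)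
    then show ?thesis using nth_concat_grid[OF that, of "\<lambda>u v. of_bool ((u, v) \<in> ar)"] by simp
  qed
qed

text \<open>Two gaps are closed: \<open>sol\<close> wants every vertex of the solution reachable, so
  the others are dropped; and it caps the budget at \<open>n\<close>, which loses nothing because
  there are only \<open>n\<close> vertices.\<close>

lemma dst_yes_sol: "dst_yes I \<longleftrightarrow> dst.sol n rt tm ar (min (budget I) n) {} {}"
proof -
  interpret dst n rt tm ar "min (budget I) n" 0 by (rule dst_instance)
  interpret D: pair_fin_digraph "dgraph I" using wf by (simp add: dst_wf_def)
  have V: "pverts (dgraph I) - (tm \<union> {rt}) = nonterms"
    unfolding verts by (auto simp: nonterms_def)
  have path: "(\<exists>p. pre_digraph.apath (with_proj (dgraph I) \<restriction> (S \<union> tm \<union> {rt})) rt p t) \<longleftrightarrow> (rt, t) \<in> reach S" for S t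
  proof -
    let ?G = "with_proj (dgraph I) \<restriction> (S \<union> tm \<union> {rt})"
    interpret G: wf_digraph ?G
      by unfold_locales (auto simp: induce_subgraph_def)
    have "(\<exists>p. pre_digraph.apath ?G rt p t) \<longleftrightarrow> reachable ?G rt t"
      using G.reachable_apath by simp
    also have "\<dots> \<longleftrightarrow> (rt, t) \<in> reach S"
      by (subst reachable_rtrancl) (auto simp: reach_def)
    finally show ?thesis .
  qed
  show ?thesis
  proof
    assume "dst_yes I"
    then obtain S where S: "S \<subseteq> nonterms" "card S \<le> budget I" "\<forall>t\<in>tm. (rt, t) \<in> reach S"
      unfolding dst_yes_def path V by blast
    let ?S = "{y \<in> S. (rt, y) \<in> reach S}"
    have *: "(rt, y) \<in> reach ?S" if "(rt, y) \<in> reach S" for y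
      using that unfolding reach_def[of S]
    proof (induction rule: rtrancl_induct)
      case (step y z)
      have "(rt, y) \<in> reach S" "(rt, z) \<in> reach S"
        using step.hyps unfolding reach_def by (auto intro: rtrancl_into_rtrancl)
      then have "(y, z) \<in> ar \<inter> (?S \<union> tm \<union> {rt}) \<times> (?S \<union> tm \<union> {rt})" using step.hyps by auto
      then show ?case using step.IH unfolding reach_def by (rule rtrancl_into_rtrancl[rotated])
    qed (simp add: reach_def)
    have "finite S" using S(1) finite_basic(2) finite_subset by blast
    then have "card ?S \<le> card S" by (intro card_mono) auto
    moreover have "card ?S \<le> n" using card_mono[of "{..<n}" ?S] S(1) nonterms_subset(1) by auto
    ultimately have "card ?S \<le> min (budget I) n" using S(2) by simp
    moreover have "\<forall>y\<in>?S \<union> tm. (rt, y) \<in> reach ?S" using * S(3) by blast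
    moreover have "?S \<subseteq> nonterms - {}" using S(1) by auto
    ultimately show "sol {} {}" unfolding sol_def by (intro exI[of _ ?S]) blast
  next
    assume "sol {} {}"
    then obtain S where "S \<subseteq> nonterms" "card S \<le> min (budget I) n" "\<forall>t\<in>S \<union> tm. (rt, t) \<in> reach S"
      unfolding sol_def by blast
    then show "dst_yes I" unfolding dst_yes_def path V by (intro exI[of _ S]) auto
  qed
qed

end

lemma word_size_ge:
  "length xs \<le> word_size xs" "x \<in> set xs \<Longrightarrow> x < 2 ^ word_size xs"
proof -
  show "length xs \<le> word_size xs" unfolding word_size_def by (induction xs) auto
  assume "x \<in> set xs"
  then have "1 + bits x \<le> word_size xs" unfolding word_size_def by (intro member_le_sum_list) auto
  then have "bits x \<le> word_size xs" by simp
  then show "x < 2 ^ word_size xs" by (rule floorlog_leD) simp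
qed

text \<open>\<open>c\<close> is chosen such that \<open>2 ^ (c * (n + 1))\<close> exceeds the
  initial potential plus \<open>n\<close>: the part \<open>2 * h\<close> covers
  \<open>3 ^ (h * n) \<le> 4 ^ (h * n)\<close>, a part \<open>d + 2\<close> covers the polynomial
  factor, and the rest the constants in the exponent.\<close>

definition "dst_prog h = (let d = h - 2; c = 2 * h + d + 5 in
  Seq (setup_prog c) (Seq (ccom init_prog 64) (While_nz 7 (body_prog d))))"

lemma dst_prog_correct:
  assumes h: "2 \<le> h"
  shows "\<exists>p. \<forall>I. dst_input I \<longrightarrow> excludes_minor (with_proj (dgraph I)) (with_proj (complete_graph h)) \<longrightarrow>
    (\<exists>R M t. exec (dst_prog h) (init_state (dst_encode I)) t (R, M) \<and> (R 0 \<noteq> 0 \<longleftrightarrow> dst_yes I) \<and>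
      real t \<le> 3 ^ (h * min (budget I) (card (pverts (dgraph I)))) * real (poly p (dst_size I)))"
proof -
  define d where "d = h - 2"
  define c where "c = 2 * h + d + 5"
  have hd: "d + 2 = h" using h by (simp add: d_def)
  obtain x a :: real where xa: "0 < x" "x < 1" "1 \<le> a" "real (d * 2 ^ d) \<le> a"
    "3 * a \<le> 3 ^ h * x" "3 ^ d \<le> 3 ^ h * (1 - x) ^ d"
    using exists_branching_parameter[of d] unfolding hd by blast
  obtain ps where ps: "\<And>W n M. M 0 = n \<Longrightarrow> n \<le> W \<Longrightarrow> (\<forall>i. M i < 2 ^ W) \<Longrightarrow> 3 + n + n * n < 2 ^ W \<Longrightarrow> c * (n + 1) < W \<Longrightarrow>
     (\<exists>R. run (setup_prog c) (\<lambda>_. 0, M) (poly ps W) (R, M) \<and> R 1 = n \<and> R 2 = 2 ^ (c * (n + 1)) \<and>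
       R 3 = 3 + n + n * n \<and> R 4 = 0 \<and> bnd W R M)" using run_setup_prog[of c] by blast
  obtain pinit where pinit: "ccom_ok init_prog 64 pinit" using run_ccom[OF wfc_init_prog order_refl] by blast
  obtain pp where pp: "ccom_ok (pop_prog d (d * 2 ^ d)) 64 pp" using run_ccom[OF wfc_progs(1) order_refl] by blast
  obtain pu where pu: "ccom_ok push_prog 64 pu" using run_ccom[OF wfc_progs(2) order_refl] by blast
  obtain pm where pm: "ccom_ok mask_prog 64 pm" using run_ccom[OF wfc_progs(3) order_refl] by blast
  obtain pl where pl: "ccom_ok leaf_prog 64 pl" using run_ccom[OF wfc_progs(4) order_refl] by blast
  let ?sp = "pp + pu + pm + pl + [:10, 10:]"
  \<comment> \<open>\<open>?w\<close> bounds \<open>W\<close> linearly in the input size, and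
    \<open>?N\<close> bounds the initial potential up to the factor
    \<open>3 ^ (h * k)\<close>.\<close>
  let ?w = "[:c + 1, c + 1:] :: nat poly"
  let ?N = "1 + [:2, 1:] * [:1, d + 1:] :: nat poly"
  let ?p = "pcompose ps ?w + pcompose pinit ?w + 1 + (pcompose ?sp ?w + ?w + 1) * ?N"
  show ?thesis
  proof (rule exI[of _ ?p], intro allI impI)
    fix I assume inp: "dst_input I" and ex: "excludes_minor (with_proj (dgraph I)) (with_proj (complete_graph h))"
    obtain n where n: "pverts (dgraph I) = {0..<n}" and wf: "dst_wf I" using inp by (auto simp: dst_input_def)
    have cn: "card (pverts (dgraph I)) = n" using n by simp
    let ?k = "min (budget I) n"
    interpret dst n "root I" "terminals I" "parcs (dgraph I)" ?k d by (rule dst_instance[OF wf n])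
    let ?xs = "dst_encode I"
    note enc = encode_nth[OF wf n]
    let ?M = "\<lambda>a. if a < length ?xs then ?xs ! a else 0"
    let ?s = "dst_size I"
    have s: "3 + n + n * n \<le> ?s" using word_size_ge(1)[of ?xs] enc(1) by (simp add: dst_size_def)
    \<comment> \<open>The summand \<open>c * (n + 1)\<close> makes room for the cap, the input size
      for the numbers in the input.\<close>
    define W where "W = c * (n + 1) + ?s + 1"
    have sW: "?s \<le> W" by (simp add: W_def)
    have Mb: "?M i < 2 ^ W" for i
    proof (cases "i < length ?xs")
      case True
      then have "?xs ! i < 2 ^ ?s" unfolding dst_size_def by (intro word_size_ge(2)) simp
      then show ?thesis using True pow2_mono_less[OF _ sW] by simp
    qed simp
    have "3 + n + n * n < 2 ^ W" using s sW less_exp[of W] by linarith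
    moreover have "n \<le> W" "c * (n + 1) < W" using s sW by (auto simp: W_def)
    moreover have "?M 0 = n" using enc(1,2) by simp
    ultimately obtain R1 where R1: "run (setup_prog c) (\<lambda>_. 0, ?M) (poly ps W) (R1, ?M)" "R1 1 = n"
      "R1 2 = 2 ^ (c * (n + 1))" "R1 3 = 3 + n + n * n" "R1 4 = 0" "bnd W R1 ?M"
      using ps[of ?M n W] Mb by blast
    let ?cap = "2 ^ (c * (n + 1)) :: nat"
    obtain A1 where A1: "rel R1 A1 ?M" using rel_exists by blast
    have in16: "A1 16 i = ?xs ! i" if "i < 3 + n + n * n" for i
      using A1 that R1(4) enc(1) by (simp add: rel_def)
    have "n < 2 ^ n" by (rule less_exp)
    have pow_le: "(2 :: nat) ^ a \<le> ?cap" if "a \<le> c * (n + 1)" for a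
      using that by (intro power_increasing) auto
    have "3 ^ n \<le> (4 :: nat) ^ n" by (intro power_mono) auto
    also have "\<dots> = 2 ^ (2 * n)" by (simp add: power_mult)
    also have "\<dots> \<le> ?cap" by (intro pow_le mult_le_mono) (simp_all add: c_def)
    finally have cap3: "3 ^ n \<le> ?cap" .
    have "n + 1 \<le> 2 ^ n" using less_exp[of n] by linarith
    also have "\<dots> \<le> ?cap" using mult_le_mono[of 1 c n "n + 1"] by (intro pow_le) (simp add: c_def)
    finally have capn: "n + 1 \<le> ?cap" .
    have cap2: "2 \<le> ?cap" using pow_le[of 1] by (simp add: c_def)
    let ?Q = "\<lambda>v A. inv_graph ?cap v A \<and> inv_stack [\<lambda>_. 0] v A \<and> v 0 = 0"
    have "wp init_prog ?Q R1 A1"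
    proof (rule init_prog_correct[where ?k0.0 = "budget I"])
      have "2 < 3 + n + n * n" "1 < 3 + n + n * n" by auto
      then show "A1 16 1 = root I" "A1 16 2 = budget I" using in16 enc(3,4) by auto
      show "A1 16 (3 + i) = of_bool (i \<in> terminals I)" if "i < n" for i
        using in16[of "3 + i"] enc(5)[OF that] that by simp
      show "A1 16 (3 + n + (n * i + j)) = of_bool ((i, j) \<in> parcs (dgraph I))" if "i < n" "j < n" for i j
      proof -
        have "n * i + j < n * n" using that mult_le_mono2[of "Suc i" n n] by simp
        then show ?thesis using in16[of "3 + n + (n * i + j)"] enc(6)[OF that] by simp
      qed
    qed (use R1 capn in simp_all)
    then obtain R2 M2 A2 where R2: "run (ccom init_prog 64) (R1, ?M) (poly pinit W * (R1 4 + 1) ^ long_depth init_prog) (R2, M2)"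
      "?Q R2 A2" "bnd W R2 M2" "rel R2 A2 M2"
    proof (rule run_wp[OF wfc_init_prog pinit R1(6) A1])
      fix v v' :: "nat \<Rightarrow> nat" and A :: "nat \<Rightarrow> nat \<Rightarrow> nat"
      assume "\<And>x. x < 64 \<Longrightarrow> v' x = v x" "?Q v A"
      then show "?Q v' A" using inv_cong[of v' v] by simp
    qed blast
    have r2: "run (ccom init_prog 64) (R1, ?M) (poly pinit W) (R2, M2)"
      using R2(1) by (simp add: long_depth_init_prog)
    have free: "\<not> clique_minor (d + 2) {..<n} (parcs (dgraph I) \<union> (parcs (dgraph I))\<inverse>)"
      using ex clique_minor_imp_minor_of[of h "dgraph I"] unfolding hd excludes_minor_def n atLeast0LessThan by blast
    let ?st = "\<lambda>_ :: nat. 0 :: nat"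
    have st0: "chosen ?st = {}" "forbidden ?st = {}" "wf_item ?st"
      by (auto simp: chosen_def forbidden_def wf_item_def)
    define P where "P = pot h x a ?st"
    have P: "P \<le> 3 ^ (h * ?k) * real (poly ?N n)"
    proof -
      have "(1 - x) ^ lows ?st \<le> 1" using xa by (intro power_le_one) auto
      then have w: "weight x a ?st \<le> 1" "0 \<le> weight x a ?st"
        using xa by (auto simp: weight_def[OF xa] st0)
      have "levels ?st \<le> (d + 1) * ?k + 1" by (simp add: levels_def)
      also have "\<dots> \<le> (d + 1) * n + 1" by (intro add_mono mult_le_mono) auto
      finally have l: "real (levels ?st) \<le> real ((d + 1) * n + 1)" by (simp only: of_nat_le_iff)
      have "3 ^ (h * ?k) * weight x a ?st * real (levels ?st) \<le> 3 ^ (h * ?k) * 1 * real ((d + 1) * n + 1)"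
        using w l by (intro mult_mono) auto
      then have "(real n + 2) * (3 ^ (h * ?k) * weight x a ?st * real (levels ?st)) \<le>
          (real n + 2) * (3 ^ (h * ?k) * 1 * real ((d + 1) * n + 1))" by (intro mult_left_mono) auto
      moreover have "(1 :: real) \<le> 3 ^ (h * ?k)" by simp
      ultimately have "P \<le> 3 ^ (h * ?k) + (real n + 2) * (3 ^ (h * ?k) * 1 * real ((d + 1) * n + 1))"
        unfolding P_def pot_def[OF xa] by linarith
      also have "\<dots> = 3 ^ (h * ?k) * real (poly ?N n)" by (simp add: algebra_simps)
      finally show ?thesis .
    qed
    have capP: "P + real n < real ?cap"
    proof -
      have "(3 :: nat) ^ (h * ?k) \<le> 4 ^ (h * n)"
        by (rule order_trans[OF power_mono power_increasing]) auto
      also have "\<dots> = 2 ^ (2 * (h * n))" by (simp add: power_mult)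
      finally have 1: "(3 :: nat) ^ (h * ?k) \<le> 2 ^ (2 * (h * n))" .
      have "n + 2 \<le> 2 ^ (n + 1)" using less_exp[of "n + 1"] by linarith
      moreover have "1 + (d + 1) * n \<le> 2 ^ ((d + 1) * n)" using less_exp[of "(d + 1) * n"] by linarith
      ultimately have 2: "(n + 2) * (1 + (d + 1) * n) \<le> 2 ^ (n + 1) * 2 ^ ((d + 1) * n)" by (rule mult_le_mono)
      have "poly ?N n = 1 + (n + 2) * (1 + (d + 1) * n)" by (simp add: algebra_simps)
      also have "\<dots> \<le> 2 ^ (n + 1) * 2 ^ ((d + 1) * n) + 2 ^ (n + 1) * 2 ^ ((d + 1) * n)"
        using 2 by (intro add_mono) auto
      also have "\<dots> = 2 ^ (n + 2 + (d + 1) * n)" by (simp add: power_add)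
      finally have "3 ^ (h * ?k) * poly ?N n \<le> 2 ^ (2 * (h * n)) * 2 ^ (n + 2 + (d + 1) * n)"
        using 1 by (intro mult_le_mono)
      also have "\<dots> = 2 ^ (2 * (h * n) + (n + 2 + (d + 1) * n))" by (simp only: power_add)
      finally have 3: "3 ^ (h * ?k) * poly ?N n \<le> 2 ^ (2 * (h * n) + (n + 2 + (d + 1) * n))" .
      have "(2 :: nat) ^ n \<le> 2 ^ (2 * (h * n) + (n + 2 + (d + 1) * n))" by (intro power_increasing) auto
      then have "3 ^ (h * ?k) * poly ?N n + n < 2 ^ Suc (2 * (h * n) + (n + 2 + (d + 1) * n))"
        using 3 less_exp[of n] unfolding power_Suc by linarith
      also have "\<dots> \<le> ?cap" by (rule pow_le) (simp add: c_def algebra_simps)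
      finally have "3 ^ (h * ?k) * poly ?N n + n < ?cap" .
      then have "real (3 ^ (h * ?k) * poly ?N n + n) < real ?cap" by (simp only: of_nat_less_iff)
      then have "3 ^ (h * ?k) * real (poly ?N n) + real n < real ?cap"
        by (simp only: of_nat_add of_nat_mult of_nat_power of_nat_numeral)
      then show ?thesis using P by linarith
    qed
    obtain m where m: "P \<le> real m" using real_arch_simple by blast
    have "\<exists>R' M' t. run (While_nz 7 (body_prog d)) (R2, M2) t (R', M') \<and>
      real t \<le> 1 + real (poly ?sp W + W + 1) * sum_list (map (pot h x a) [?st]) \<and>
      (R' 0 \<noteq> 0 \<longleftrightarrow> R2 0 \<noteq> 0 \<or> (\<exists>s\<in>set [?st]. sol (chosen s) (forbidden s)))"
      by (rule loop_correct[OF xa pp pu pm pl cap3 capn cap2 _ free, of _ m W R2 M2 A2])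
        (use m capP R2 st0 in \<open>simp_all add: P_def\<close>)
    then obtain R3 M3 t where R3: "run (While_nz 7 (body_prog d)) (R2, M2) t (R3, M3)"
      "real t \<le> 1 + real (poly ?sp W + W + 1) * P" "R3 0 \<noteq> 0 \<longleftrightarrow> sol {} {}"
      using R2(2) by (auto simp: P_def st0)
    have "run (dst_prog h) (init_state ?xs) (poly ps W + (poly pinit W + t)) (R3, M3)"
      using run_Seq[OF R1(1) run_Seq[OF r2 R3(1)]]
      unfolding dst_prog_def Let_def d_def[symmetric] c_def[symmetric] init_state_def .
    then obtain t' where t': "t' \<le> poly ps W + (poly pinit W + t)" "exec (dst_prog h) (init_state ?xs) t' (R3, M3)"
      unfolding run_def by blast
    have Ww: "W \<le> poly ?w ?s"
    proof -
      have "c * (n + 1) \<le> c * (?s + 1)" using s by (intro mult_le_mono2) simp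
      then show ?thesis by (simp add: W_def algebra_simps)
    qed
    have mono: "poly q W \<le> poly (pcompose q ?w) ?s" for q
      unfolding poly_pcompose by (rule poly_nat_mono[OF Ww])
    let ?K = "3 ^ (h * ?k) :: real"
    let ?a = "poly (pcompose ps ?w) ?s" and ?b = "poly (pcompose pinit ?w) ?s"
      and ?e = "poly (pcompose ?sp ?w) ?s + poly ?w ?s + 1"
    have "real t' \<le> real (poly ps W) + (real (poly pinit W) + real t)"
      using t'(1) by (metis of_nat_add of_nat_le_iff)
    also have "\<dots> \<le> real ?a + (real ?b + (1 + real ?e * (?K * real (poly ?N ?s))))"
    proof -
      have "n \<le> ?s" using s by linarith
      then have "real (poly ?N n) \<le> real (poly ?N ?s)" by (simp only: of_nat_le_iff poly_nat_mono)
      then have "P \<le> ?K * real (poly ?N ?s)" by (intro order_trans[OF P] mult_left_mono) simp_all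
      moreover have "poly ?sp W + W + 1 \<le> ?e" using mono[of ?sp] Ww by linarith
      then have "real (poly ?sp W + W + 1) \<le> real ?e" by (simp only: of_nat_le_iff)
      moreover have "0 \<le> P" using pot_ge_1[OF xa, of ?st] by (simp add: P_def)
      ultimately have "real (poly ?sp W + W + 1) * P \<le> real ?e * (?K * real (poly ?N ?s))"
        by (intro mult_mono) auto
      moreover have "real (poly ps W) \<le> real ?a" "real (poly pinit W) \<le> real ?b"
        using mono by (simp_all only: of_nat_le_iff)
      ultimately show ?thesis using R3(2) by linarith
    qed
    also have "\<dots> \<le> ?K * real (poly ?p ?s)"
    proof -
      have "(1 :: real) \<le> ?K" by simp
      then have "1 * (real ?a + real ?b + 1) \<le> ?K * (real ?a + real ?b + 1)" by (intro mult_right_mono) auto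
      moreover have "real (poly ?p ?s) = real ?a + real ?b + 1 + real ?e * real (poly ?N ?s)"
        by (simp only: poly_add poly_mult poly_1 of_nat_add of_nat_mult of_nat_1)
      ultimately show ?thesis by (simp only: algebra_simps)
    qed
    finally have "real t' \<le> ?K * real (poly ?p ?s)" .
    moreover have "R3 0 \<noteq> 0 \<longleftrightarrow> dst_yes I" using R3(3) dst_yes_sol[OF wf n] by simp
    ultimately show "\<exists>R M t. exec (dst_prog h) (init_state ?xs) t (R, M) \<and> (R 0 \<noteq> 0 \<longleftrightarrow> dst_yes I) \<and>
      real t \<le> 3 ^ (h * min (budget I) (card (pverts (dgraph I)))) * real (poly ?p ?s)"
      unfolding cn using t'(2) by blast
  qed
qed

text \<open>The root alone is a model of \<open>K_1\<close>, and \<open>K_0\<close> needs no branch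
  set at all.\<close>

lemma excludes_small_clique:
  assumes "h < 2" "dst_input I"
  shows "\<not> excludes_minor (with_proj (dgraph I)) (with_proj (complete_graph h))"
proof -
  have "root I \<in> pverts (dgraph I)" using assms(2) by (auto simp: dst_input_def dst_wf_def)
  moreover have "h = 0 \<or> h = 1" using assms(1) by auto
  ultimately have "clique_minor h (pverts (dgraph I)) (parcs (dgraph I) \<union> (parcs (dgraph I))\<inverse>)"
    unfolding clique_minor_def by (intro exI[of _ "\<lambda>_. {root I}"]) auto
  then show ?thesis using clique_minor_imp_minor_of unfolding excludes_minor_def by blast
qed

theorem theorem1:
  fixes h :: nat
  shows "\<exists>(P :: com) (g :: nat \<Rightarrow> real).
           g \<in> o(\<lambda>x. real x) \<and>
           solves_dst P {I. excludes_minor (with_proj (dgraph I)) (with_proj (complete_graph h))}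
             (\<lambda>k. 3 powr (real (h * k) + g (h * k)))"
proof (cases "2 \<le> h")
  case True
  obtain p where p: "\<And>I. dst_input I \<Longrightarrow> excludes_minor (with_proj (dgraph I)) (with_proj (complete_graph h)) \<Longrightarrow>
    (\<exists>R M t. exec (dst_prog h) (init_state (dst_encode I)) t (R, M) \<and> (R 0 \<noteq> 0 \<longleftrightarrow> dst_yes I) \<and>
      real t \<le> 3 ^ (h * min (budget I) (card (pverts (dgraph I)))) * real (poly p (dst_size I)))"
    using dst_prog_correct[OF True] by blast
  have "solves_dst (dst_prog h) {I. excludes_minor (with_proj (dgraph I)) (with_proj (complete_graph h))}
      (\<lambda>k. 3 powr (real (h * k) + 0))"
    unfolding solves_dst_def
  proof (intro exI[of _ p] ballI impI)
    fix I assume "I \<in> {I. excludes_minor (with_proj (dgraph I)) (with_proj (complete_graph h))}" "dst_input I"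
    then obtain R M t where t: "exec (dst_prog h) (init_state (dst_encode I)) t (R, M)" "R 0 \<noteq> 0 \<longleftrightarrow> dst_yes I"
      "real t \<le> 3 ^ (h * min (budget I) (card (pverts (dgraph I)))) * real (poly p (dst_size I))"
      using p by blast
    have "(3 :: real) ^ (h * min (budget I) (card (pverts (dgraph I)))) \<le> 3 ^ (h * budget I)"
      by (intro power_increasing) auto
    also have "\<dots> = 3 powr (real (h * budget I) + 0)" by (subst powr_realpow[symmetric]) auto
    finally have "3 ^ (h * min (budget I) (card (pverts (dgraph I)))) * real (poly p (dst_size I))
        \<le> 3 powr (real (h * budget I) + 0) * real (poly p (dst_size I))" by (intro mult_right_mono) auto
    then have "real t \<le> 3 powr (real (h * budget I) + 0) * real (poly p (dst_size I))" using t(3) by linarith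
    then show "\<exists>t. real t \<le> 3 powr (real (h * budget I) + 0) * real (poly p (dst_size I)) \<and>
        (if dst_yes I then accepts_in (dst_prog h) (dst_encode I) t else rejects_in (dst_prog h) (dst_encode I) t)"
      using t(1,2) by (intro exI[of _ t]) (auto simp: accepts_in_def rejects_in_def)
  qed
  then show ?thesis by (intro exI[of _ "dst_prog h"] exI[of _ "\<lambda>_. 0"]) simp
next
  \<comment> \<open>For \<open>h < 2\<close> the class contains no input, so that any program solves
    the problem on it.\<close>
  case False
  then have "solves_dst Skip {I. excludes_minor (with_proj (dgraph I)) (with_proj (complete_graph h))}
      (\<lambda>k. 3 powr (real (h * k) + 0))"
    unfolding solves_dst_def using excludes_small_clique by auto
  then show ?thesis by (intro exI[of _ Skip] exI[of _ "\<lambda>_. 0"]) simp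
qed

end
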